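(* Let $s\in(0,1)$, $n>2s$, and let $\Omega\subset\mathbb{R}^n$ be an open bounded set with continuous boundary. Let $f:\Omega\times\mathbb{R}\to\mathbb{R}$ satisfy conditions (F1)–(F5) below. Then for every eigenvalue $\lambda_k$ of $(-\Delta)^s$ with homogeneous Dirichlet boundary data there is a left neighborhood $\mathcal O_k$ of $\lambda_k$ such that for every $\lambda\in\mathcal O_k$ the problem $$(-\Delta)^su-\lambda u=f(x,u)\text{ in }\Omega,\qquad u=0\text{ in }\mathbb{R}^n\setminus\Omega$$ admits at least three non-trivial weak solutions belonging to $H^s(\mathbb{R}^n)$.
   Context: Here (up to normalization) $-(-\Delta)^su(x)=\int_{\mathbb{R}^n}\frac{u(x+y)+u(x-y)-2u(x)}{|y|^{n+2s}}dy$. Let $X_0$ be the space of measurable $g:\mathbb{R}^n\to\mathbb{R}$ with $g=0$ a.e. in $\mathbb{R}^n\setminus\Omega$, $g|_\Omega\in L^2(\Omega)$ and $\int_{\mathbb{R}^n\times\mathbb{R}^n}\frac{|g(x)-g(y)|^2}{|x-y|^{n+2s}}dx\,dy<\infty$, with inner product $\langle u,v\rangle_{X_0}=\int_{\mathbb{R}^n\times\mathbb{R}^n}\frac{(u(x)-u(y))(v(x)-v(y))}{|x-y|^{n+2s}}dx\,dy$. A weak solution is $u\in X_0$ with $\langle u,\varphi\rangle_{X_0}-\lambda\int_\Omega u\varphi=\int_\Omega f(x,u)\varphi$ for all $\varphi\in X_0$. Eigenvalues of $(-\Delta)^s$ with homogeneous Dirichlet data: numbers $\lambda$ such that some $u\in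 X_0\setminus\{0\}$ satisfies $\langle u,\varphi\rangle_{X_0}=\lambda\int_\Omega u\varphi$ for all $\varphi\in X_0$. Conditions on $f$, with $F(x,t)=\int_0^tf(x,\tau)d\tau$: (F1) $f$ is Carathéodory; (F2) there are $a_1,a_2>0$, $q\in(2,2^* )$, $2^*=2n/(n-2s)$, with $|f(x,t)|\le a_1+a_2|t|^{q-1}$ for a.e. $x$, all $t$; (F3) there are $a_3,a_4>0$ with $F(x,t)\ge a_3|t|^q-a_4$; (F4) $\lim_{|t|\to0}f(x,t)/|t|=0$ uniformly in $x\in\Omega$; (F5) $0<qF(x,t)\le tf(x,t)$ for a.e. $x$ and all $t\ne0$, same $q$ as in (F2). *)

theory Defs
  imports "HOL-Analysis.Analysis"
begin

text \<open>Open bounded set with continuous boundary: near every boundary point, after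
  choosing a "vertical" unit direction e, the set is the strict epigraph of a continuous
  function defined on the hyperplane orthogonal to e.\<close>
definition continuous_boundary_domain :: "'a::euclidean_space set \<Rightarrow> bool" where
  "continuous_boundary_domain \<Omega> \<longleftrightarrow> open \<Omega> \<and> bounded \<Omega> \<and>
     (\<forall>p\<in>frontier \<Omega>. \<exists>r>0. \<exists>e::'a. \<exists>\<phi>::'a \<Rightarrow> real.
        norm e = 1 \<and> continuous_on {y. y \<bullet> e = 0} \<phi> \<and>
        \<Omega> \<inter> ball p r = {x \<in> ball p r. x \<bullet> e > \<phi> (x - (x \<bullet> e) *\<^sub>R e)})"

definition gagliardo_energy :: "real \<Rightarrow> ('a::euclidean_space \<Rightarrow> real) \<Rightarrow> ennreal" where
  "gagliardo_energy s g =
     (\<integral>\<^sup>+ z. ennreal ((g (fst z) - g (snd z))\<^sup>2 / norm (fst z - snd z) powr (real DIM('a) + 2 * s))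
        \<partial>(lebesgue \<Otimes>\<^sub>M lebesgue))"

definition X0 :: "'a::euclidean_space set \<Rightarrow> real \<Rightarrow> ('a \<Rightarrow> real) set" where
  "X0 \<Omega> s = {g. g \<in> borel_measurable lebesgue \<and>
                 (AE x in lebesgue. x \<notin> \<Omega> \<longrightarrow> g x = 0) \<and>
                 set_integrable lebesgue \<Omega> (\<lambda>x. (g x)\<^sup>2) \<and>
                 gagliardo_energy s g < \<infinity>}"

definition Hs :: "real \<Rightarrow> ('a::euclidean_space \<Rightarrow> real) set" where
  "Hs s = {g. g \<in> borel_measurable lebesgue \<and>
              integrable lebesgue (\<lambda>x. (g x)\<^sup>2) \<and>
              gagliardo_energy s g < \<infinity>}"

definition X0_inner :: "real \<Rightarrow> ('a::euclidean_space \<Rightarrow> real) \<Rightarrow> ('a \<Rightarrow> real) \<Rightarrow> real" where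
  "X0_inner s u v =
     (\<integral>z. (u (fst z) - u (snd z)) * (v (fst z) - v (snd z)) / norm (fst z - snd z) powr (real DIM('a) + 2 * s)
        \<partial>(lebesgue \<Otimes>\<^sub>M lebesgue))"

definition frac_dirichlet_eigenvalue :: "'a::euclidean_space set \<Rightarrow> real \<Rightarrow> real \<Rightarrow> bool" where
  "frac_dirichlet_eigenvalue \<Omega> s lam \<longleftrightarrow>
     (\<exists>u\<in>X0 \<Omega> s. \<not> (AE x in lebesgue. u x = 0) \<and>
        (\<forall>\<phi>\<in>X0 \<Omega> s. X0_inner s u \<phi> = lam * (\<integral>x\<in>\<Omega>. u x * \<phi> x \<partial>lebesgue)))"

definition weak_solution ::
  "'a::euclidean_space set \<Rightarrow> real \<Rightarrow> real \<Rightarrow> ('a \<Rightarrow> real \<Rightarrow> real) \<Rightarrow> ('a \<Rightarrow> real) \<Rightarrow> bool" where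
  "weak_solution \<Omega> s lam f u \<longleftrightarrow> u \<in> X0 \<Omega> s \<and>
     (\<forall>\<phi>\<in>X0 \<Omega> s. X0_inner s u \<phi> - lam * (\<integral>x\<in>\<Omega>. u x * \<phi> x \<partial>lebesgue)
                    = (\<integral>x\<in>\<Omega>. f x (u x) * \<phi> x \<partial>lebesgue))"

definition prim :: "('a \<Rightarrow> real \<Rightarrow> real) \<Rightarrow> 'a \<Rightarrow> real \<Rightarrow> real" where
  "prim f x t = (LBINT \<tau>=0..t. f x \<tau>)"

definition crit_exp :: "nat \<Rightarrow> real \<Rightarrow> real" where
  "crit_exp n s = 2 * real n / (real n - 2 * s)"

end

theory Submission
  imports Defs "HOL-Homology.Homology" "HOL-Library.Function_Algebras"
begin

text \<open>An eigenbasis for the compact embedding of \<open>X0\<close> into \<open>L\<^sup>2\<close> identifies \<open>X0\<close>, up to null functions,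
  with the space of square-summable sequences, the \<open>L\<^sup>2\<close> product becoming the diagonal operator
  \<open>diag \<mu>\<close>. Weak solutions are the critical points of
  \<open>I u = (\<parallel>u\<parallel>\<^sup>2 - \<nu> * (diag \<mu> u \<bullet> u)) / 2 - \<Phi> u\<close>, where \<open>\<Phi>\<close> has a compact gradient, and the eigenvalues
  are the numbers \<open>1 / \<mu> k\<close>. Let \<open>A1\<close>, \<open>A2\<close>, \<open>A3\<close> be the coordinates whose eigenvalue is smaller than, equal
  to, and larger than a given one. For \<open>\<nu>\<close> slightly below it, \<open>I\<close> is at most a small \<open>b\<close> on the span of
  \<open>A1 \<union> A2\<close>, while the critical points of \<open>I\<close> restricted to the coordinates \<open>A1 \<union> A3\<close> have no level in
  \<open>(0, b]\<close>. This is the situation of the \<open>\<nabla>\<close>-theorem of Marino and Saccon: a descent that never annihilates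
  the \<open>A2\<close> component yields two critical points with levels in \<open>(0, b]\<close>. A linking between a small sphere in \<open>A3\<close>
  and the span of \<open>A1 \<union> A2\<close> with one more coordinate yields a third one at a higher level.

  Two shortcuts avoid heavier theory. The deformations are finite iterations of small steps along a continuous
  pseudo-gradient instead of flows. The subcritical Sobolev inequality follows from a pointwise bound of
  \<open>\<bar>u x\<bar>\<close> by the energy of \<open>u\<close> seen from \<open>x\<close>, which improves an \<open>L\<^sup>p\<close> bound to one
  with exponent \<open>2 + 2 * s * p / n\<close>; the fixed point of this map is the critical exponent.\<close>

section \<open>Deformation by discrete steps along a pseudo-gradient\<close>

text \<open>The low range of levels has to yield two critical points, so a single one must not be
  able to absorb the topology. Suppose \<open>u1\<close> were the only critical point with level in
  \<open>(0, b]\<close>. Each point of the span of \<open>A1 \<union> A2\<close> then either sinks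
  below the level attained on a small sphere in \<open>A2 \<union> A3\<close>, or is trapped near
  \<open>u1\<close>, where the \<open>A2\<close>-direction cannot be opposite to that of
  \<open>u1\<close>. A topological argument on the finite-dimensional span produces a point that
  ends on the sphere with any prescribed \<open>A2\<close>-direction, in particular the opposite
  one. This is why the \<open>A2\<close>-component must survive the descent: its direction is what
  is being tracked. Closeness of \<open>\<nu>\<close> to the eigenvalue enters because
  \<open>b\<close> is proportional to their distance, while the lowest positive level of the
  restricted functional and the linking level stay away from 0. As \<open>f\<close> is only
  continuous in its second argument, the gradient is uniformly continuous on bounded sets but
  carries no Lipschitz bound. Steps of a fixed small length suit exactly this regularity.\<close>

locale descent =
  fixes I :: "'h::real_inner \<Rightarrow> real" and G :: "'h \<Rightarrow> 'h" and P :: "'h \<Rightarrow> 'h"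
  assumes deriv: "\<And>u v. ((\<lambda>t. I (u + t *\<^sub>R v)) has_real_derivative (G u \<bullet> v)) (at 0)"
    and unif: "\<And>R. uniformly_continuous_on (cball 0 R) G"
    and P_linear: "bounded_linear P"
    and P_idem: "\<And>x. P (P x) = P x"
    and P_sym: "\<And>x y. P x \<bullet> y = x \<bullet> P y"
begin

lemma mean_value:
  obtains \<xi> where "0 < \<xi>" "\<xi> < 1" "I (u + v) - I u = G (u + \<xi> *\<^sub>R v) \<bullet> v"
proof -
  have d: "((\<lambda>t. I (u + t *\<^sub>R v)) has_real_derivative (G (u + t *\<^sub>R v) \<bullet> v)) (at t)" for t
  proof -
    have "((\<lambda>s. I ((u + t *\<^sub>R v) + s *\<^sub>R v)) has_real_derivative (G (u + t *\<^sub>R v) \<bullet> v)) (at 0)"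
      by (rule deriv)
    then have "((\<lambda>s. I (u + (s + t) *\<^sub>R v)) has_real_derivative (G (u + t *\<^sub>R v) \<bullet> v)) (at 0)"
      by (simp add: algebra_simps)
    then show ?thesis
      using DERIV_shift[of "\<lambda>t. I (u + t *\<^sub>R v)" _ 0 t] by simp
  qed
  obtain z where "0 < z" "z < 1" "I (u + 1 *\<^sub>R v) - I (u + 0 *\<^sub>R v) = (1 - 0) * (G (u + z *\<^sub>R v) \<bullet> v)"
    using MVT2[of 0 1 "\<lambda>t. I (u + t *\<^sub>R v)" "\<lambda>t. G (u + t *\<^sub>R v) \<bullet> v"] d by auto
  with that show ?thesis by simp
qed

lemma continuous_gradient: "continuous_on UNIV G"
proof (rule continuous_at_imp_continuous_on, rule ballI)
  fix u :: 'h
  have "continuous_on (ball 0 (norm u + 1)) G"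
    by (rule continuous_on_subset[OF uniformly_continuous_imp_continuous[OF unif[of "norm u + 1"]]]) auto
  then show "isCont G u"
    by (subst (asm) continuous_on_eq_continuous_at) auto
qed

text \<open>Only directional derivatives are assumed, so continuity comes from a gradient bound near
  \<open>u\<close> and the mean value formula.\<close>

lemma continuous_functional: "continuous_on UNIV I"
proof (rule continuous_at_imp_continuous_on, rule ballI, unfold continuous_at_eps_delta, intro allI impI)
  fix u and e :: real assume e: "0 < e"
  have "isCont G u" using continuous_gradient by (simp add: continuous_on_eq_continuous_at)
  then obtain d where d: "d > 0" "\<And>x. dist x u < d \<Longrightarrow> dist (G x) (G u) < 1"
    unfolding continuous_at_eps_delta using zero_less_one by blast
  define m where "m = min d (e / (norm (G u) + 1))"
  have M: "norm (G u) + 1 > 0" by (simp add: add_nonneg_pos)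
  have "m > 0" using d e M by (simp add: m_def)
  moreover have "dist (I x) (I u) < e" if "dist x u < m" for x
  proof (cases "x = u")
    case False
    obtain z where z: "0 < z" "z < 1" "I (u + (x - u)) - I u = G (u + z *\<^sub>R (x - u)) \<bullet> (x - u)"
      by (rule mean_value)
    have "dist (u + z *\<^sub>R (x - u)) u = z * norm (x - u)" using z by (simp add: dist_norm)
    also have "\<dots> \<le> norm (x - u)" using z by (simp add: mult_left_le_one_le)
    also have "\<dots> < d" using that by (simp add: m_def dist_norm)
    finally have "norm (G (u + z *\<^sub>R (x - u)) - G u) < 1" using d(2) by (simp add: dist_norm)
    then have n: "norm (G (u + z *\<^sub>R (x - u))) < norm (G u) + 1"
      using norm_triangle_ineq2[of "G (u + z *\<^sub>R (x - u))" "G u"] by linarith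
    have "\<bar>I x - I u\<bar> \<le> norm (G (u + z *\<^sub>R (x - u))) * norm (x - u)"
      using z(3) Cauchy_Schwarz_ineq2 by (metis add_diff_cancel_left' add.commute diff_add_cancel)
    also have "\<dots> < (norm (G u) + 1) * norm (x - u)" using n False by (intro mult_strict_right_mono) auto
    also have "\<dots> < e" using that M by (simp add: m_def dist_norm field_simps)
    finally show ?thesis by (simp add: dist_real_def)
  qed (use e in simp)
  ultimately show "\<exists>d>0. \<forall>x. dist x u < d \<longrightarrow> dist (I x) (I u) < e" by blast
qed

interpretation P: bounded_linear P by (rule P_linear)

lemma norm_P_le: "norm (P x) \<le> norm x"
proof -
  have "norm (P x) * norm (P x) = x \<bullet> P x"
    using P_sym[of "x" "P x"] P_idem by (metis P_sym norm_eq_sqrt_inner real_sqrt_mult_self inner_ge_zero abs_of_nonneg)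
  also have "\<dots> \<le> norm x * norm (P x)" by (rule norm_cauchy_schwarz)
  finally show ?thesis by (metis mult_right_le_imp_le norm_ge_zero order_le_less)
qed

lemma P_orthogonal: "(x - P x) \<bullet> P y = 0"
  by (simp add: inner_diff_left P_sym P_idem)

text \<open>Where \<open>P u\<close> is small the field has no \<open>P\<close>-component, so that
  descending along it never leaves the set where \<open>P u \<noteq> 0\<close>.\<close>
definition field :: "real \<Rightarrow> 'h \<Rightarrow> 'h"
  where "field \<gamma> u = (G u - P (G u)) + max 0 (min 1 (norm (P u) / \<gamma> - 1)) *\<^sub>R P (G u)"

text \<open>The two parts of the gradient are orthogonal and the damping factor \<open>c\<close>
  lies in [0, 1], so \<open>c * c \<le> c\<close>. Hence \<open>field\<close> is a descent direction
  with rate at least its squared norm, as an undamped gradient would be.\<close>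

lemma inner_field_ge: "(norm (field \<gamma> u))\<^sup>2 \<le> G u \<bullet> field \<gamma> u"
proof -
  define c where "c = max 0 (min 1 (norm (P u) / \<gamma> - 1))"
  have c: "0 \<le> c" "c \<le> 1" by (auto simp: c_def)
  define x y where "x = G u - P (G u)" and "y = P (G u)"
  have o: "x \<bullet> y = 0" "y \<bullet> x = 0" using P_orthogonal by (auto simp: x_def y_def inner_commute)
  have W: "field \<gamma> u = x + c *\<^sub>R y" and G: "G u = x + y" by (auto simp: field_def c_def x_def y_def)
  have "(norm (field \<gamma> u))\<^sup>2 = x \<bullet> x + c * c * (y \<bullet> y)"
    using o by (simp add: W power2_norm_eq_inner inner_add_left inner_add_right)
  also have "\<dots> \<le> x \<bullet> x + c * (y \<bullet> y)"
    using c by (simp add: mult_left_le_one_le mult_right_mono)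
  also have "\<dots> = G u \<bullet> field \<gamma> u"
    using o by (simp add: W G inner_add_left inner_add_right)
  finally show ?thesis .
qed

text \<open>Damping touches only the \<open>P\<close>-part. Where \<open>P u\<close> is small, the
  bound \<open>nabla\<close> of \<open>deformation\<close> therefore still controls the field from
  below.\<close>

lemma norm_field_ge: "norm (G u - P (G u)) \<le> norm (field \<gamma> u)"
proof (rule power2_le_imp_le)
  define c x y where "c = max 0 (min 1 (norm (P u) / \<gamma> - 1))" and "x = G u - P (G u)" and "y = P (G u)"
  have o: "x \<bullet> y = 0" "y \<bullet> x = 0" using P_orthogonal by (auto simp: x_def y_def inner_commute)
  have W: "field \<gamma> u = x + c *\<^sub>R y" by (auto simp: field_def c_def x_def y_def)
  have "(norm (field \<gamma> u))\<^sup>2 = x \<bullet> x + c * c * (y \<bullet> y)"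
    using o by (simp add: W power2_norm_eq_inner inner_add_left inner_add_right)
  then show "(norm (G u - P (G u)))\<^sup>2 \<le> (norm (field \<gamma> u))\<^sup>2"
    by (simp add: x_def[symmetric] power2_norm_eq_inner)
qed simp

lemma continuous_field: "0 < \<gamma> \<Longrightarrow> continuous_on UNIV (field \<gamma>)"
  unfolding field_def
  by (intro continuous_intros continuous_gradient P.continuous_on continuous_on_compose2[OF P.continuous_on[OF continuous_on_id]]) auto

lemma P_field: "\<lbrakk>norm (P u) \<le> \<gamma>; 0 < \<gamma>\<rbrakk> \<Longrightarrow> P (field \<gamma> u) = 0"
proof -
  assume "norm (P u) \<le> \<gamma>" "0 < \<gamma>"
  then have "norm (P u) / \<gamma> - 1 \<le> 0" by simp
  then show ?thesis by (simp add: field_def P.diff P.add P.scaleR P_idem)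
qed

text \<open>Let \<open>S\<close> be one step along the normalised field, switched off below
  \<open>a'\<close> and near \<open>u1\<close>; \<open>h1\<close> is \<open>N\<close> steps and
  \<open>h2\<close> is \<open>N + N\<close> steps. Above \<open>a\<close> and away from
  \<open>u1\<close> each step lowers \<open>I\<close> by a fixed amount, so \<open>N\<close> steps
  either end below \<open>a\<close> or visit a neighbourhood of \<open>u1\<close>. A point that
  visits it and is later at distance \<open>r0\<close> has paid for the way out and lies below all
  values taken near \<open>u1\<close>. It cannot return, and the second batch of steps brings it
  below \<open>a\<close>.\<close>

theorem deformation:
  fixes u1 :: 'h
  assumes a: "a' < a" and \<gamma>: "0 < \<gamma>" and r0: "0 < r0" and \<sigma>0: "0 < \<sigma>0"
    and nabla: "\<And>u. \<lbrakk>a' \<le> I u; I u \<le> b; norm (P u) \<le> 2 * \<gamma>\<rbrakk> \<Longrightarrow> \<sigma>0 \<le> norm (G u - P (G u))"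
    and noncrit: "\<And>r. 0 < r \<Longrightarrow> \<exists>\<sigma>>0. \<forall>u. a' \<le> I u \<and> I u \<le> b \<and> r \<le> norm (u - u1) \<longrightarrow> \<sigma> \<le> norm (G u)"
  obtains h1 h2 where "continuous_on UNIV h1" "continuous_on UNIV h2"
    "\<And>u. I u \<le> a' \<Longrightarrow> h1 u = u" "\<And>u. I u \<le> a' \<Longrightarrow> h2 u = u"
    "\<And>u. P u \<noteq> 0 \<Longrightarrow> P (h1 u) \<noteq> 0"
    "\<And>u. \<lbrakk>norm u \<le> R0; I u \<le> b\<rbrakk> \<Longrightarrow> norm (h1 u - u1) < r0 \<or> I (h2 u) \<le> a"
    "\<And>u. \<lbrakk>norm u \<le> R0; I u \<le> b\<rbrakk> \<Longrightarrow> I (h2 u) \<le> I (h1 u)"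
proof -
  let ?W = "field \<gamma>"
  \<comment> \<open>Beyond \<open>2 * \<gamma>\<close> the field is the full gradient; up to there
    \<open>nabla\<close> gives the bound.\<close>
  have Wlow: "\<exists>\<sigma>>0. \<forall>u. a' \<le> I u \<and> I u \<le> b \<and> r \<le> norm (u - u1) \<longrightarrow> \<sigma> \<le> norm (?W u)" if "0 < r" for r
  proof -
    obtain \<sigma> where \<sigma>: "\<sigma> > 0" "\<And>u. a' \<le> I u \<Longrightarrow> I u \<le> b \<Longrightarrow> r \<le> norm (u - u1) \<Longrightarrow> \<sigma> \<le> norm (G u)"
      using noncrit[OF \<open>0 < r\<close>] by blast
    have "min \<sigma> \<sigma>0 \<le> norm (?W u)" if u: "a' \<le> I u" "I u \<le> b" "r \<le> norm (u - u1)" for u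
    proof (cases "norm (P u) \<le> 2 * \<gamma>")
      case True
      have "norm (G u - P (G u)) \<le> norm (?W u)" by (rule norm_field_ge)
      with nabla[OF u(1,2) True] show ?thesis by linarith
    next
      case False
      then have "norm (P u) / \<gamma> > 2" using \<gamma> by (simp add: field_simps)
      then have "?W u = G u" by (simp add: field_def)
      with \<sigma>(2)[OF u] show ?thesis by simp
    qed
    then show ?thesis using \<sigma>(1) \<sigma>0 by (intro exI[of _ "min \<sigma> \<sigma>0"]) auto
  qed
  obtain \<sigma> where \<sigma>: "\<sigma> > 0" "\<And>u. \<lbrakk>a' \<le> I u; I u \<le> b; r0 / 2 \<le> norm (u - u1)\<rbrakk> \<Longrightarrow> \<sigma> \<le> norm (?W u)"
    using Wlow[of "r0 / 2"] r0 by auto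
  \<comment> \<open>The way from radius \<open>r0 / 2 + \<tau>\<close> out to \<open>r0\<close>
    costs at least \<open>\<sigma> / 2 * (3 * r0 / 8) = 3 * \<epsilon>\<close>, more than the
    oscillation \<open>2 * \<epsilon>\<close> of \<open>I\<close> near \<open>u1\<close>.\<close>
  define c \<epsilon> where "c = I u1" and "\<epsilon> = \<sigma> * r0 / 16"
  have \<epsilon>: "\<epsilon> > 0" using \<sigma> r0 by (simp add: \<epsilon>_def)
  have "isCont I u1" using continuous_functional by (simp add: continuous_on_eq_continuous_at)
  then obtain \<rho>0 where \<rho>0: "\<rho>0 > 0" "\<And>x. dist x u1 < \<rho>0 \<Longrightarrow> dist (I x) c < \<epsilon>"
    unfolding continuous_at_eps_delta c_def using \<epsilon> by blast
  define \<rho> where "\<rho> = min \<rho>0 (r0 / 2)"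
  have \<rho>: "\<rho> > 0" "\<rho> \<le> r0 / 2" "\<And>x. norm (x - u1) < \<rho> \<Longrightarrow> \<bar>I x - c\<bar> < \<epsilon>"
    using \<rho>0 r0 by (auto simp: \<rho>_def dist_norm)
  obtain \<sigma>'' where \<sigma>'': "\<sigma>'' > 0" "\<And>u. \<lbrakk>a' \<le> I u; I u \<le> b; \<rho> / 2 \<le> norm (u - u1)\<rbrakk> \<Longrightarrow> \<sigma>'' \<le> norm (?W u)"
    using Wlow[of "\<rho> / 2"] \<rho> by auto
  \<comment> \<open>Normalisation by \<open>1 + norm (?W u)\<close> leaves the decrease rate
    \<open>w\<^sup>2 / (1 + w)\<close>, which increases with \<open>w\<close>; half of it is given
    up to the variation of the gradient along a step.\<close>
  define \<kappa> where "\<kappa> = \<sigma>''\<^sup>2 / (1 + \<sigma>'') / 2"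
  have \<kappa>: "\<kappa> > 0" using \<sigma>'' by (simp add: \<kappa>_def)
  define T where "T = \<bar>b - a'\<bar> / \<kappa> + 1"
  have T: "T > 0" using \<kappa> by (simp add: T_def add_nonneg_pos)
  \<comment> \<open>Steps have length at most \<open>\<tau>\<close> and
    \<open>N * \<tau> \<le> T + 1\<close>, so \<open>N + N\<close> of them starting within
    \<open>R0\<close> stay within \<open>R1\<close>.\<close>
  define R1 where "R1 = \<bar>R0\<bar> + 2 * (T + 1)"
  obtain \<delta> where \<delta>: "\<delta> > 0" "\<And>x y. \<lbrakk>norm x \<le> R1 + 1; norm y \<le> R1 + 1; norm (x - y) < \<delta>\<rbrakk> \<Longrightarrow> norm (G x - G y) < \<sigma>'' / 2"
    using unif[of "R1 + 1", unfolded uniformly_continuous_on_def] \<sigma>''(1)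
    by (metis dist_norm half_gt_zero mem_cball_0)
  \<comment> \<open>The bounds keep the gradient within \<open>\<sigma>'' / 2\<close> along a step,
    leave the slack \<open>r0 / 8\<close> in the escape estimate, and make a step shorter than
    \<open>\<gamma>\<close>, so that it cannot reach \<open>P u = 0\<close> from outside the damped
    zone.\<close>
  define \<tau> where "\<tau> = min (\<delta> / 2) (min (r0 / 8) (min (\<gamma> / 2) 1))"
  have \<tau>: "\<tau> > 0" "\<tau> < \<delta>" "\<tau> \<le> r0 / 8" "\<tau> < \<gamma>" "\<tau> \<le> 1"
    using \<delta> r0 \<gamma> by (auto simp: \<tau>_def min_def)
  define N where "N = nat \<lceil>T / \<tau>\<rceil>"
  have N1: "T \<le> N * \<tau>" 
  proof -
    have "T / \<tau> \<le> real N" unfolding N_def by linarith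
    then show ?thesis using \<tau> by (simp add: field_simps)
  qed
  have N2: "N * \<tau> \<le> T + 1"
  proof -
    have "0 \<le> T / \<tau>" using T \<tau> by simp
    then have "real N \<le> T / \<tau> + 1" unfolding N_def by linarith
    then have "real N * \<tau> \<le> (T / \<tau> + 1) * \<tau>" using \<tau> by (intro mult_right_mono) auto
    also have "\<dots> \<le> T + 1" using \<tau> by (simp add: field_simps)
    finally show ?thesis .
  qed
  \<comment> \<open>First factor: 0 below level \<open>a'\<close>, 1 above \<open>a\<close>. Second
    factor: 0 within \<open>\<rho> / 2\<close> of \<open>u1\<close>, 1 beyond \<open>\<rho>\<close>.
    The denominator normalises the field.\<close>
  define m where "m u = max 0 (min 1 ((I u - a') / (a - a'))) * max 0 (min 1 (2 * norm (u - u1) / \<rho> - 1)) / (1 + norm (?W u))" for u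
  define V where "V u = m u *\<^sub>R ?W u" for u
  define S where "S u = u - \<tau> *\<^sub>R V u" for u
  have pos1: "1 + norm x > 0" for x :: 'h by (simp add: add_pos_nonneg)
  have m01: "0 \<le> m u" "m u \<le> 1 / (1 + norm (?W u))" for u
  proof -
    show "0 \<le> m u" using pos1[of "?W u"] by (simp add: m_def)
    have "max 0 (min 1 ((I u - a') / (a - a'))) * max 0 (min 1 (2 * norm (u - u1) / \<rho> - 1)) \<le> 1 * 1"
      by (intro mult_mono) auto
    then show "m u \<le> 1 / (1 + norm (?W u))" unfolding m_def using pos1[of "?W u"]
      by (intro divide_right_mono) auto
  qed
  have V1: "norm (V u) \<le> 1" for u
  proof -
    have "norm (V u) = m u * norm (?W u)" using m01 by (simp add: V_def)
    also have "\<dots> \<le> 1 / (1 + norm (?W u)) * norm (?W u)" using m01 by (intro mult_right_mono) auto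
    also have "\<dots> \<le> 1" using pos1[of "?W u"] by (simp add: field_simps)
    finally show ?thesis .
  qed
  have contS: "continuous_on UNIV S"
    unfolding S_def V_def m_def using a \<rho> 
    by (intro continuous_intros continuous_functional continuous_field \<gamma>) (auto simp: add_nonneg_eq_0_iff)
  have s4: "S u = u" if "I u \<le> a'" for u
  proof -
    have "(I u - a') / (a - a') \<le> 0" using that a by (simp add: divide_nonpos_pos)
    then have "m u = 0" by (simp add: m_def)
    then show ?thesis by (simp add: S_def V_def)
  qed
  have s5: "norm (S u - u) \<le> \<tau>" for u
    using V1[of u] \<tau> by (simp add: S_def mult_left_le)
  have s6: "P (S u) \<noteq> 0" if "P u \<noteq> 0" for u
  proof (cases "norm (P u) \<le> \<gamma>")
    case True
    then have "P (S u) = P u" using P_field[OF True \<gamma>] by (simp add: S_def V_def P.diff P.scaleR)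
    with that show ?thesis by simp
  next
    case False
    have "norm (P (S u - u)) \<le> \<tau>" using norm_P_le s5 order_trans by blast
    then show ?thesis using False \<tau> by (auto simp: P.diff)
  qed
  \<comment> \<open>Where \<open>V u\<close> is nonzero the field has norm at least
    \<open>\<sigma>''\<close>, so the gradient changes along the step by at most half of that norm,
    and half of the first-order decrease survives.\<close>
  have key: "I (S u) \<le> I u - (\<tau> / 2) * (norm (V u) * norm (?W u))" if u: "norm u \<le> R1" "I u \<le> b" for u
  proof (cases "V u = 0")
    case True then show ?thesis by (simp add: S_def)
  next
    case False
    then have "m u \<noteq> 0" by (auto simp: V_def)
    then have "max 0 (min 1 ((I u - a') / (a - a'))) \<noteq> 0" "max 0 (min 1 (2 * norm (u - u1) / \<rho> - 1)) \<noteq> 0"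
      by (auto simp: m_def)
    then have "(I u - a') / (a - a') > 0" "2 * norm (u - u1) / \<rho> - 1 > 0" by linarith+
    then have "a' \<le> I u" "\<rho> / 2 \<le> norm (u - u1)" using a \<rho> by (auto simp: field_simps zero_less_divide_iff)
    then have W: "\<sigma>'' \<le> norm (?W u)" using \<sigma>''(2) u by auto
    obtain z where z: "0 < z" "z < 1" "I (u + - \<tau> *\<^sub>R V u) - I u = G (u + z *\<^sub>R (- \<tau> *\<^sub>R V u)) \<bullet> (- \<tau> *\<^sub>R V u)"
      by (rule mean_value)
    let ?y = "u + z *\<^sub>R (- \<tau> *\<^sub>R V u)"
    have "norm (?y - u) = z * (\<tau> * norm (V u))" using z \<tau> by simp
    also have "\<dots> \<le> 1 * (\<tau> * 1)" using z \<tau> V1 by (intro mult_mono) auto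
    finally have d: "norm (?y - u) \<le> \<tau>" by simp
    have "norm ?y \<le> R1 + 1" using norm_triangle_ineq[of u "?y - u"] d u \<tau> by simp
    then have "norm (G ?y - G u) < \<sigma>'' / 2" using \<delta>(2)[of ?y u] d \<tau> u by force
    then have "norm (G ?y - G u) * norm (V u) \<le> norm (?W u) / 2 * norm (V u)"
      using W by (intro mult_right_mono) auto
    then have e: "- (norm (?W u) / 2 * norm (V u)) \<le> (G ?y - G u) \<bullet> V u"
      using Cauchy_Schwarz_ineq2[of "G ?y - G u" "V u"] by linarith
    have "norm (V u) * norm (?W u) = m u * (norm (?W u))\<^sup>2" using m01 by (simp add: V_def power2_eq_square)
    also have "\<dots> \<le> m u * (G u \<bullet> ?W u)" using m01 inner_field_ge by (intro mult_left_mono) auto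
    also have "\<dots> = G u \<bullet> V u" by (simp add: V_def)
    finally have "norm (V u) * norm (?W u) / 2 \<le> G ?y \<bullet> V u" using e by (simp add: inner_diff_left algebra_simps)
    then have "\<tau> * (norm (V u) * norm (?W u) / 2) \<le> \<tau> * (G ?y \<bullet> V u)" using \<tau> by (intro mult_left_mono) auto
    then show ?thesis using z(3) by (simp add: S_def algebra_simps)
  qed
  have s1: "I (S u) \<le> I u" if u: "norm u \<le> R1" "I u \<le> b" for u
    using key[OF u] \<tau> by (smt (verit) mult_nonneg_nonneg norm_ge_zero half_gt_zero)
  have s2: "I (S u) \<le> I u - \<sigma> / 2 * norm (S u - u)" if u: "norm u \<le> R1" "I u \<le> b" "r0 / 2 \<le> norm (u - u1)" for u
  proof (cases "I u \<le> a'")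
    case True then show ?thesis using s4 by simp
  next
    case False
    then have "\<sigma> \<le> norm (?W u)" using \<sigma> u by auto
    then have "(\<tau> / 2) * (norm (V u) * \<sigma>) \<le> (\<tau> / 2) * (norm (V u) * norm (?W u))"
      using \<tau> by (intro mult_left_mono) auto
    moreover have "norm (S u - u) = \<tau> * norm (V u)" using \<tau> by (simp add: S_def)
    ultimately show ?thesis using key[OF u(1,2)] by (simp add: algebra_simps)
  qed
  have s3: "I (S u) \<le> I u - \<tau> * \<kappa>" if u: "norm u \<le> R1" "I u \<le> b" "\<rho> \<le> norm (u - u1)" "a \<le> I u" for u
  proof -
    have "(I u - a') / (a - a') \<ge> 1" "2 * norm (u - u1) / \<rho> - 1 \<ge> 1"
      using u a \<rho> by (auto simp: field_simps)
    then have m: "m u = 1 / (1 + norm (?W u))" by (simp add: m_def)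
    have W: "\<sigma>'' \<le> norm (?W u)" using \<sigma>''(2) u a \<rho> by auto
    define w where "w = norm (?W u)"
    have "\<sigma>''\<^sup>2 / (1 + \<sigma>'') \<le> w\<^sup>2 / (1 + w)"
    proof -
      have "\<sigma>''\<^sup>2 * (1 + w) \<le> w\<^sup>2 * (1 + \<sigma>'')"
      proof -
        have "\<sigma>'' * \<sigma>'' \<le> w * w" "(\<sigma>'' * w) * \<sigma>'' \<le> (\<sigma>'' * w) * w" using W \<sigma>'' by (auto simp: w_def[symmetric] intro!: mult_mono mult_left_mono)
        then show ?thesis by (simp add: power2_eq_square algebra_simps)
      qed
      then show ?thesis using W \<sigma>''(1) by (simp add: w_def[symmetric] frac_le_eq divide_le_eq pos_le_divide_eq field_simps)
    qed
    also have "\<dots> = norm (V u) * norm (?W u)"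
      using pos1[of "?W u"] by (simp add: V_def m w_def power2_eq_square)
    finally have "\<tau> / 2 * (\<sigma>''\<^sup>2 / (1 + \<sigma>'')) \<le> \<tau> / 2 * (norm (V u) * norm (?W u))"
      using \<tau> by (intro mult_left_mono) auto
    also have "\<tau> / 2 * (\<sigma>''\<^sup>2 / (1 + \<sigma>'')) = \<tau> * \<kappa>" unfolding \<kappa>_def by simp
    finally show ?thesis using key[OF u(1,2)] by linarith
  qed
  have it: "norm ((S ^^ j) u) \<le> norm u + j * \<tau> \<and> I ((S ^^ j) u) \<le> I u \<and> I ((S ^^ j) u) \<le> b
      \<and> (\<forall>i\<le>j. I ((S ^^ j) u) \<le> I ((S ^^ i) u))"
    if "norm u + real k * \<tau> \<le> R1" "I u \<le> b" "j \<le> k" for u j k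
    using that(3)
  proof (induction j)
    case 0 then show ?case using that by simp
  next
    case (Suc j)
    then have IH: "norm ((S ^^ j) u) \<le> norm u + j * \<tau>" "I ((S ^^ j) u) \<le> I u" "I ((S ^^ j) u) \<le> b"
      "\<forall>i\<le>j. I ((S ^^ j) u) \<le> I ((S ^^ i) u)" by auto
    have "real j * \<tau> \<le> real k * \<tau>" using Suc.prems \<tau> by (intro mult_right_mono) auto
    then have R: "norm ((S ^^ j) u) \<le> R1" using IH(1) that(1) by linarith
    have d: "I ((S ^^ Suc j) u) \<le> I ((S ^^ j) u)" using s1[OF R IH(3)] by simp
    have "norm ((S ^^ Suc j) u) \<le> norm ((S ^^ j) u) + \<tau>"
      using s5[of "(S ^^ j) u"] norm_triangle_sub[of "S ((S ^^ j) u)" "(S ^^ j) u"] by simp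
    then have "norm ((S ^^ Suc j) u) \<le> norm u + Suc j * \<tau>" using IH(1) by (simp add: algebra_simps)
    moreover have "\<forall>i\<le>Suc j. I ((S ^^ Suc j) u) \<le> I ((S ^^ i) u)"
      using d IH(4) by (metis le_Suc_eq order_refl order_trans)
    moreover have "I ((S ^^ Suc j) u) \<le> I u" "I ((S ^^ Suc j) u) \<le> b" using d IH by linarith+
    ultimately show ?case by blast
  qed
  have inR: "norm ((S ^^ j) u) \<le> R1" if "norm u + real k * \<tau> \<le> R1" "I u \<le> b" "j \<le> k" for u j k
  proof -
    have "real j * \<tau> \<le> real k * \<tau>" using that \<tau> by (intro mult_right_mono) auto
    then show ?thesis using it[OF that] that by linarith
  qed
  \<comment> \<open>Without a visit to the \<open>\<rho>\<close>-ball each of the \<open>N\<close>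
    steps would cost \<open>\<tau> * \<kappa>\<close>, in total more than
    \<open>b - a'\<close>.\<close>
  have A: "(\<exists>j\<le>N. norm ((S ^^ j) u - u1) < \<rho>) \<or> I ((S ^^ N) u) < a"
    if u: "norm u + real N * \<tau> \<le> R1" "I u \<le> b" for u
  proof (rule ccontr)
    assume "\<not> ?thesis"
    then have nv: "\<And>j. j \<le> N \<Longrightarrow> \<rho> \<le> norm ((S ^^ j) u - u1)" and big: "a \<le> I ((S ^^ N) u)" by force+
    have big': "a \<le> I ((S ^^ j) u)" if "j \<le> N" for j using it[OF u order_refl] big that by (meson order_trans)
    have "I ((S ^^ j) u) \<le> b - j * (\<tau> * \<kappa>)" if "j \<le> N" for j
      using that
    proof (induction j)
      case (Suc j)
      then have "I (S ((S ^^ j) u)) \<le> I ((S ^^ j) u) - \<tau> * \<kappa>"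
        using it[OF u, of j] inR[OF u, of j] nv[of j] big'[of j] by (intro s3) auto
      with Suc show ?case by (simp add: algebra_simps)
    qed (use u in simp)
    then have "I ((S ^^ N) u) \<le> b - (N * \<tau>) * \<kappa>" by (simp add: algebra_simps)
    also have "\<dots> \<le> b - T * \<kappa>" using N1 \<kappa> by simp
    also have "T * \<kappa> = \<bar>b - a'\<bar> + \<kappa>" using \<kappa> by (simp add: T_def field_simps)
    finally show False using big a \<kappa> by linarith
  qed
  have B: "norm ((S ^^ k) u - u1) < r0 \<or> I ((S ^^ k) u) \<le> c - \<epsilon>"
    if u: "norm u + real k * \<tau> \<le> R1" "I u \<le> b" and v: "norm ((S ^^ j) u - u1) < \<rho>" "j \<le> k" for u j k
  proof -
    have "I ((S ^^ i) u) \<le> c + \<epsilon> - \<sigma> / 2 * max 0 (norm ((S ^^ i) u - u1) - r0 / 2 - \<tau>)" if "j \<le> i" "i \<le> k" for i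
      using that
    proof (induction i rule: dec_induct)
      case base
      have "norm ((S ^^ j) u - u1) - r0 / 2 - \<tau> \<le> 0" using v \<rho> \<tau> by linarith
      moreover have "I ((S ^^ j) u) \<le> c + \<epsilon>" using \<rho>(3)[OF v(1)] by linarith
      ultimately show ?case by (simp add: max_def)
    next
      case (step i)
      let ?x = "(S ^^ i) u"
      have x: "norm ?x \<le> R1" "I ?x \<le> b" using inR[OF u, of i] it[OF u, of i] step by auto
      have IH: "I ?x \<le> c + \<epsilon> - \<sigma> / 2 * max 0 (norm (?x - u1) - r0 / 2 - \<tau>)" using step by simp
      have tri: "norm (S ?x - u1) \<le> norm (?x - u1) + norm (S ?x - ?x)"
        using norm_triangle_ineq[of "?x - u1" "S ?x - ?x"] by simp
      show ?case
      proof (cases "r0 / 2 \<le> norm (?x - u1)")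
        case True
        have "I (S ?x) \<le> I ?x - \<sigma> / 2 * norm (S ?x - ?x)" by (rule s2[OF x True])
        also have "\<dots> \<le> c + \<epsilon> - \<sigma> / 2 * (max 0 (norm (?x - u1) - r0 / 2 - \<tau>) + norm (S ?x - ?x))"
          using IH by (simp add: algebra_simps)
        also have "\<dots> \<le> c + \<epsilon> - \<sigma> / 2 * max 0 (norm (S ?x - u1) - r0 / 2 - \<tau>)"
          using \<sigma>(1) tri by (intro diff_left_mono mult_left_mono) auto
        finally show ?thesis by simp
      next
        case False
        then have "norm (S ?x - u1) - r0 / 2 - \<tau> \<le> 0" using tri s5[of ?x] by linarith
        then have z: "max 0 (norm (S ?x - u1) - r0 / 2 - \<tau>) = 0" by simp
        have "0 \<le> \<sigma> / 2 * max 0 (norm (?x - u1) - r0 / 2 - \<tau>)" using \<sigma> by simp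
        then have "I (S ?x) \<le> c + \<epsilon>" using s1[OF x] IH by linarith
        then show ?thesis using z by simp
      qed
    qed
    from this[of k] v have *: "I ((S ^^ k) u) \<le> c + \<epsilon> - \<sigma> / 2 * max 0 (norm ((S ^^ k) u - u1) - r0 / 2 - \<tau>)" by simp
    show ?thesis
    proof (cases "norm ((S ^^ k) u - u1) < r0")
      case False
      then have "3 * r0 / 8 \<le> max 0 (norm ((S ^^ k) u - u1) - r0 / 2 - \<tau>)" using \<tau>(3) by linarith
      then have "\<sigma> / 2 * (3 * r0 / 8) \<le> \<sigma> / 2 * max 0 (norm ((S ^^ k) u - u1) - r0 / 2 - \<tau>)"
        using \<sigma> by (intro mult_left_mono) auto
      moreover have "\<sigma> / 2 * (3 * r0 / 8) = 3 * \<epsilon>" by (simp add: \<epsilon>_def)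
      ultimately show ?thesis using * \<epsilon> by linarith
    qed simp
  qed
  have contIt: "continuous_on UNIV (S ^^ j)" for j
  proof (induction j)
    case (Suc j)
    then show ?case using continuous_on_compose2[OF contS Suc] by (simp add: o_def)
  qed (simp add: id_def)
  have fix4: "(S ^^ j) u = u" if "I u \<le> a'" for u j
    using that by (induction j) (auto simp: s4)
  have P6: "P ((S ^^ j) u) \<noteq> 0" if "P u \<noteq> 0" for u j
    using that by (induction j) (auto simp: s6)
  have final: "(norm ((S ^^ N) u - u1) < r0 \<or> I ((S ^^ (N + N)) u) \<le> a) \<and> I ((S ^^ (N + N)) u) \<le> I ((S ^^ N) u)"
    if u: "norm u \<le> R0" "I u \<le> b" for u
  proof -
    have R: "norm u + real (N + N) * \<tau> \<le> R1" using u N2 by (simp add: R1_def algebra_simps)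
    have "0 \<le> real N * \<tau>" using \<tau> by simp
    then have R': "norm u + real N * \<tau> \<le> R1" using R by (simp add: algebra_simps)
    have mono: "I ((S ^^ (N + N)) u) \<le> I ((S ^^ N) u)" using it[OF R u(2) order_refl] by simp
    show ?thesis
    proof (cases "norm ((S ^^ N) u - u1) < r0 \<or> I ((S ^^ N) u) < a")
      case True then show ?thesis using mono by auto
    next
      case False
      then obtain j where "j \<le> N" "norm ((S ^^ j) u - u1) < \<rho>" using A[OF R' u(2)] by auto
      then have low: "I ((S ^^ N) u) \<le> c - \<epsilon>" using B[OF R' u(2)] False by blast
      let ?v = "(S ^^ N) u"
      have v: "norm ?v + real N * \<tau> \<le> R1" "I ?v \<le> b"
        using it[OF R' u(2) order_refl] R by (auto simp: algebra_simps)
      \<comment> \<open>All values within \<open>\<rho>\<close> of \<open>u1\<close> exceed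
        \<open>c - \<epsilon>\<close>, so the lowered orbit never comes back.\<close>
      have "\<not> norm ((S ^^ j) ?v - u1) < \<rho>" if "j \<le> N" for j
        using \<rho>(3)[of "(S ^^ j) ?v"] it[OF v that] low by linarith
      then have "I ((S ^^ N) ?v) < a" using A[OF v] by blast
      then show ?thesis using mono by (simp add: funpow_add)
    qed
  qed
  show ?thesis
    by (rule that[of "S ^^ N" "S ^^ (N + N)"]) (use contIt fix4 P6 final in auto)
qed

end

section \<open>Maps that are the identity near infinity\<close>

text \<open>If \<open>g\<close> had no zero, \<open>sgn (g y)\<close> on the concentric spheres of
  radius \<open>t * R\<close> would deform the identity of the unit sphere, at \<open>t = 1\<close>,
  into a constant, at \<open>t = 0\<close>, against the non-contractibility of
  \<open>nsphere m\<close>.\<close>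

lemma zero_of_identity_near_infinity:
  fixes b :: "nat \<Rightarrow> 'h::real_inner" and g :: "'h \<Rightarrow> 'h" and m :: nat
  defines "Y \<equiv> span (b ` {..m})"
  assumes orth: "\<And>i j. \<lbrakk>i \<le> m; j \<le> m\<rbrakk> \<Longrightarrow> b i \<bullet> b j = (if i = j then 1 else 0)"
    and cont: "continuous_on Y g" and maps: "g ` Y \<subseteq> Y"
    and ident: "\<And>y. \<lbrakk>y \<in> Y; R \<le> norm y\<rbrakk> \<Longrightarrow> g y = y" and R: "0 < R"
  shows "\<exists>y\<in>Y. g y = 0"
proof (rule ccontr)
  assume neg: "\<not> ?thesis"
  \<comment> \<open>Coordinate sequences vanishing beyond \<open>m\<close> are the carrier of
    \<open>nsphere m\<close>; the \<open>m + 1\<close> vectors \<open>b 0\<close>, ...,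
    \<open>b m\<close> span a space whose unit sphere has dimension \<open>m\<close>.\<close>
  define S :: "(nat \<Rightarrow> real) set" where "S = {x. (\<Sum>i\<le>m. x i ^ 2) = 1 \<and> (\<forall>i>m. x i = 0)}"
  define L where "L x = (\<Sum>i\<le>m. x i *\<^sub>R b i)" for x
  define \<kappa> where "\<kappa> y = (\<lambda>i. if i \<le> m then y \<bullet> b i else 0)" for y
  have LY: "L x \<in> Y" for x unfolding L_def Y_def by (intro span_sum span_scale span_base) auto
  have Lb: "L x \<bullet> b j = x j" if "j \<le> m" for x j
  proof -
    have "L x \<bullet> b j = (\<Sum>i\<le>m. if i = j then x i else 0)"
      unfolding L_def inner_sum_left using that orth by (intro sum.cong) auto
    then show ?thesis using that by simp
  qed
  have LL: "L x \<bullet> L x = (\<Sum>i\<le>m. (x i)\<^sup>2)" for x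
    by (subst (2) L_def) (simp add: inner_sum_right Lb power2_eq_square)
  have repr: "L (\<kappa> y) = y" if "y \<in> Y" for y
  proof -
    have "y \<in> range L"
    proof -
      have "subspace (range L)"
      proof (rule subspaceI)
        show "0 \<in> range L" using image_iff[of 0 L UNIV] by (auto simp: L_def intro!: exI[of _ "\<lambda>_. 0"])
        show "x + y \<in> range L" if "x \<in> range L" "y \<in> range L" for x y
          using that by (auto simp: L_def image_iff scaleR_add_left[symmetric] sum.distrib[symmetric] intro: exI[of _ "\<lambda>i. _ i + _ i"])
        show "c *\<^sub>R x \<in> range L" if "x \<in> range L" for c x
          using that by (auto simp: L_def image_iff scaleR_sum_right intro: exI[of _ "\<lambda>i. _ * _ i"])
      qed
      moreover have "b ` {..m} \<subseteq> range L"
      proof clarify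
        fix i assume i: "i \<le> m"
        have "L (\<lambda>j. if j = i then 1 else 0) = (\<Sum>j\<le>m. if j = i then b j else 0)"
          unfolding L_def by (intro sum.cong) auto
        then have "L (\<lambda>j. if j = i then 1 else 0) = b i" using i by simp
        then show "b i \<in> range L" by (metis rangeI)
      qed
      ultimately show ?thesis using that span_minimal Y_def by blast
    qed
    then obtain x where "y = L x" by auto
    moreover have "L (\<kappa> (L x)) = L x" by (subst L_def, subst (2) L_def) (simp add: \<kappa>_def Lb)
    ultimately show ?thesis by simp
  qed
  have contL: "continuous_on A L" for A
    unfolding L_def by (intro continuous_intros continuous_on_subset[OF continuous_on_product_coordinates]) auto
  have cont\<kappa>: "continuous_on A \<kappa>" for A
  proof (rule continuous_on_coordinatewise_then_product)
    show "continuous_on A (\<lambda>y. \<kappa> y i)" for i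
      unfolding \<kappa>_def by (cases "i \<le> m") (auto intro!: continuous_intros)
  qed
  define h where "h = (\<lambda>(t::real, x). \<kappa> (sgn (g (L (\<lambda>i. t * R * x i)))))"
  have contM: "continuous_on A (\<lambda>z::real \<times> (nat \<Rightarrow> real). L (\<lambda>i. fst z * R * snd z i))" for A
    unfolding L_def
    by (intro continuous_intros continuous_on_compose2[OF continuous_on_product_coordinates]) auto
  have conth: "continuous_on ({0..1} \<times> S) h"
    unfolding h_def case_prod_beta
  proof (rule continuous_on_compose2[OF cont\<kappa>[of UNIV]])
    show "continuous_on ({0..1} \<times> S) (\<lambda>x. sgn (g (L (\<lambda>i. fst x * R * snd x i))))"
      by (intro continuous_on_sgn continuous_on_compose2[OF cont contM]) (use LY neg in auto)
  qed auto
  have hS: "h z \<in> S" for z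
  proof -
    obtain t x where z: "z = (t, x)" by (cases z)
    let ?w = "g (L (\<lambda>i. t * R * x i))"
    have w: "?w \<in> Y" "?w \<noteq> 0" using LY maps neg by auto
    then have sY: "sgn ?w \<in> Y" unfolding Y_def sgn_div_norm by (intro span_scale)
    have "(\<Sum>i\<le>m. (\<kappa> (sgn ?w) i)\<^sup>2) = L (\<kappa> (sgn ?w)) \<bullet> L (\<kappa> (sgn ?w))" by (simp add: LL)
    also have "\<dots> = (norm (sgn ?w))\<^sup>2" by (simp add: repr[OF sY] power2_norm_eq_inner)
    also have "\<dots> = 1" using w by (simp add: norm_sgn)
    finally show ?thesis by (simp add: S_def h_def z \<kappa>_def)
  qed
  have h1: "h (1, x) = x" if x: "x \<in> S" for x
  proof -
    have Rx: "L (\<lambda>i. 1 * R * x i) = R *\<^sub>R L x" by (simp add: L_def scaleR_sum_right)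
    have n: "norm (L x) = 1" using x LL[of x] by (simp add: S_def norm_eq_sqrt_inner)
    then have "g (R *\<^sub>R L x) = R *\<^sub>R L x"
      using ident[of "R *\<^sub>R L x"] LY[of "\<lambda>i. 1 * R * x i"] R unfolding Rx by simp
    then have "h (1, x) = \<kappa> (L x)" using n R by (simp add: h_def Rx[simplified] sgn_div_norm)
    also have "\<dots> = x" using x by (auto simp: \<kappa>_def Lb S_def fun_eq_iff)
    finally show ?thesis .
  qed
  have h0: "h (0, x) = h (0, y)" for x y by (simp add: h_def)
  have "homotopic_with_canon (\<lambda>x. True) S S (\<lambda>x. h (0, \<lambda>_. 0)) id"
  proof (subst homotopic_with, simp, intro exI[of _ h] conjI)
    show "continuous_map (prod_topology (top_of_set {0..1}) (top_of_set S)) (top_of_set S) h"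
      using conth hS by (simp add: continuous_map_in_subtopology flip: subtopology_Times)
  qed (use h0 h1 in auto)
  then have "contractible S" unfolding contractible_def using homotopic_with_symD by blast
  moreover have "nsphere m = top_of_set S" by (simp add: nsphere S_def euclidean_product_topology)
  ultimately show False using non_contractible_space_nsphere[of m] by (simp add: contractible_space_top_of_set)
qed

text \<open>Translation by \<open>p\<close> turns a preimage of \<open>p\<close> into a zero, and
  \<open>f (y + p) - p\<close> is again the identity far out.\<close>

lemma identity_near_infinity_onto:
  fixes b :: "nat \<Rightarrow> 'h::real_inner" and f :: "'h \<Rightarrow> 'h" and m :: nat
  defines "Y \<equiv> span (b ` {..m})"
  assumes orth: "\<And>i j. \<lbrakk>i \<le> m; j \<le> m\<rbrakk> \<Longrightarrow> b i \<bullet> b j = (if i = j then 1 else 0)"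
    and cont: "continuous_on Y f" and maps: "f ` Y \<subseteq> Y"
    and ident: "\<And>y. \<lbrakk>y \<in> Y; R \<le> norm y\<rbrakk> \<Longrightarrow> f y = y" and p: "p \<in> Y"
  obtains y where "y \<in> Y" "f y = p"
proof -
  have add: "y + p \<in> Y" if "y \<in> Y" for y using that p unfolding Y_def by (rule span_add)
  have "\<exists>y\<in>Y. f (y + p) - p = 0"
    unfolding Y_def
  proof (rule zero_of_identity_near_infinity[OF orth, where R = "\<bar>R\<bar> + norm p + 1"], unfold Y_def[symmetric])
    show "continuous_on Y (\<lambda>y. f (y + p) - p)"
      using add by (intro continuous_intros continuous_on_compose2[OF cont]) auto
    show "(\<lambda>y. f (y + p) - p) ` Y \<subseteq> Y"
      using add maps p by (auto simp: Y_def intro!: span_diff)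
    show "f (y + p) - p = y" if "y \<in> Y" "\<bar>R\<bar> + norm p + 1 \<le> norm y" for y
    proof -
      have "R \<le> norm (y + p)" using norm_triangle_ineq2[of y "- p"] that by simp
      then show ?thesis using ident[OF add[OF that(1)]] by simp
    qed
  qed (auto simp: add_nonneg_pos)
  then show ?thesis using that add by force
qed

section \<open>The space of square-summable sequences\<close>

typedef ell2 = "{x :: nat \<Rightarrow> real. summable (\<lambda>i. (x i)\<^sup>2)}"
  morphisms coord Abs_ell2
  by (rule exI[of _ "\<lambda>_. 0"]) simp

setup_lifting type_definition_ell2

lemma summable_coord: "summable (\<lambda>i. (coord x i)\<^sup>2)"
  using coord[of x] by simp

lemma ell2_eqI: "(\<And>i. coord x i = coord y i) \<Longrightarrow> x = y"
  by (auto simp: coord_inject[symmetric])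

lemma summable_square_mult:
  fixes x y :: "nat \<Rightarrow> real"
  assumes "summable (\<lambda>i. (x i)\<^sup>2)" "summable (\<lambda>i. (y i)\<^sup>2)"
  shows "summable (\<lambda>i. x i * y i)"
proof (rule summable_comparison_test'[of "\<lambda>i. (x i)\<^sup>2 + (y i)\<^sup>2" 0])
  show "norm (x n * y n) \<le> (x n)\<^sup>2 + (y n)\<^sup>2" for n
  proof -
    have "0 \<le> \<bar>x n\<bar> * \<bar>y n\<bar>" "2 * (\<bar>x n\<bar> * \<bar>y n\<bar>) \<le> (x n)\<^sup>2 + (y n)\<^sup>2"
      using sum_squares_bound[of "\<bar>x n\<bar>" "\<bar>y n\<bar>"] by (auto simp: mult.assoc)
    then have "\<bar>x n\<bar> * \<bar>y n\<bar> \<le> (x n)\<^sup>2 + (y n)\<^sup>2" by linarith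
    then show ?thesis by (simp add: abs_mult)
  qed
qed (intro summable_add assms)

lemma summable_square_add:
  fixes x y :: "nat \<Rightarrow> real"
  assumes "summable (\<lambda>i. (x i)\<^sup>2)" "summable (\<lambda>i. (y i)\<^sup>2)"
  shows "summable (\<lambda>i. (x i + y i)\<^sup>2)"
proof -
  have "summable (\<lambda>i. (x i)\<^sup>2 + (y i)\<^sup>2 + 2 * (x i * y i))"
    by (intro summable_add summable_mult summable_square_mult assms)
  then show ?thesis by (simp add: power2_sum mult.assoc)
qed

instantiation ell2 :: real_vector
begin
lift_definition zero_ell2 :: ell2 is "\<lambda>_. 0" by simp
lift_definition plus_ell2 :: "ell2 \<Rightarrow> ell2 \<Rightarrow> ell2" is "\<lambda>x y i. x i + y i" by (rule summable_square_add)
lift_definition uminus_ell2 :: "ell2 \<Rightarrow> ell2" is "\<lambda>x i. - x i" by simp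
lift_definition minus_ell2 :: "ell2 \<Rightarrow> ell2 \<Rightarrow> ell2" is "\<lambda>x y i. x i - y i"
proof -
  fix x y :: "nat \<Rightarrow> real" assume "summable (\<lambda>i. (x i)\<^sup>2)" "summable (\<lambda>i. (y i)\<^sup>2)"
  then show "summable (\<lambda>i. (x i - y i)\<^sup>2)" using summable_square_add[of x "\<lambda>i. - y i"] by simp
qed
lift_definition scaleR_ell2 :: "real \<Rightarrow> ell2 \<Rightarrow> ell2" is "\<lambda>c x i. c * x i"
  by (simp add: power_mult_distrib summable_mult)
instance
  by standard (transfer; auto simp: algebra_simps)+
end

lemmas coord_simps [simp] = zero_ell2.rep_eq plus_ell2.rep_eq uminus_ell2.rep_eq minus_ell2.rep_eq scaleR_ell2.rep_eq

instantiation ell2 :: real_inner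
begin
definition inner_ell2 :: "ell2 \<Rightarrow> ell2 \<Rightarrow> real" where "inner_ell2 x y = (suminf (\<lambda>i. coord x i * coord y i))"
definition norm_ell2 :: "ell2 \<Rightarrow> real" where "norm_ell2 x = sqrt (inner x x)"
definition dist_ell2 :: "ell2 \<Rightarrow> ell2 \<Rightarrow> real" where "dist_ell2 x y = norm (x - y)"
definition sgn_ell2 :: "ell2 \<Rightarrow> ell2" where "sgn_ell2 x = x /\<^sub>R norm x"
definition uniformity_ell2 :: "(ell2 \<times> ell2) filter" where
  "uniformity_ell2 = (INF e\<in>{0<..}. principal {(x, y). dist x y < e})"
definition open_ell2 :: "ell2 set \<Rightarrow> bool" where
  "open_ell2 U \<longleftrightarrow> (\<forall>x\<in>U. eventually (\<lambda>(x', y). x' = x \<longrightarrow> y \<in> U) uniformity)"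
instance
proof
  fix x y z :: ell2 and r :: real
  have s: "summable (\<lambda>i. coord u i * coord v i)" for u v
    by (intro summable_square_mult summable_coord)
  show "inner x y = inner y x" by (simp add: inner_ell2_def mult.commute)
  show "inner (x + y) z = inner x z + inner y z"
    by (simp add: inner_ell2_def distrib_right suminf_add s)
  show "inner (r *\<^sub>R x) y = r * inner x y"
    using suminf_mult[OF s[of x y], of r] by (simp add: inner_ell2_def mult.assoc)
  show "0 \<le> inner x x" unfolding inner_ell2_def by (intro suminf_nonneg s) simp
  show "(inner x x = 0) = (x = 0)"
  proof
    assume "inner x x = 0"
    then have "\<forall>i. coord x i * coord x i = 0"
      using suminf_eq_zero_iff[OF s[of x x]] by (simp add: inner_ell2_def)
    then show "x = 0" by (intro ell2_eqI) simp
  qed (simp add: inner_ell2_def)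
qed (auto simp: norm_ell2_def dist_ell2_def sgn_ell2_def uniformity_ell2_def open_ell2_def)
end

lemma inner_sums: "(\<lambda>i. coord x i * coord y i) sums (x \<bullet> y)"
  unfolding inner_ell2_def by (intro summable_sums summable_square_mult summable_coord)

lemma norm_sq_sums: "(\<lambda>i. (coord x i)\<^sup>2) sums (norm x)\<^sup>2"
proof -
  have "(coord x i)\<^sup>2 = coord x i * coord x i" for i by (simp add: power2_eq_square)
  then show ?thesis using inner_sums[of x x] by (simp only: power2_norm_eq_inner)
qed

lemma sum_coord_sq_le: "finite A \<Longrightarrow> (\<Sum>i\<in>A. (coord x i)\<^sup>2) \<le> (norm x)\<^sup>2"
  using sum_le_suminf[OF summable_coord, of A x] norm_sq_sums[of x] by (simp add: sums_iff)

lemma abs_coord_le: "\<bar>coord x i\<bar> \<le> norm x"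
  using sum_coord_sq_le[of "{i}" x] abs_le_square_iff[of "coord x i" "norm x"] by simp

text \<open>Completeness of the sequence space is used in this form: uniformly bounded partial sums
  define an element.\<close>

lemma ell2_exI:
  assumes "\<And>n. (\<Sum>i<n. (x i)\<^sup>2) \<le> B\<^sup>2" "0 \<le> B"
  shows "\<exists>z. coord z = x \<and> norm z \<le> B"
proof -
  have s: "summable (\<lambda>i. (x i)\<^sup>2)"
    by (rule bounded_imp_summable[of _ "B\<^sup>2"]) (use assms(1)[of "Suc _"] in \<open>auto simp: lessThan_Suc_atMost\<close>)
  then have z: "coord (Abs_ell2 x) = x" by (simp add: Abs_ell2_inverse)
  have "(norm (Abs_ell2 x))\<^sup>2 = (suminf (\<lambda>i. (x i)\<^sup>2))" using norm_sq_sums[of "Abs_ell2 x"] by (simp add: sums_iff z)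
  also have "\<dots> \<le> B\<^sup>2" by (intro suminf_le_const s assms)
  finally have "norm (Abs_ell2 x) \<le> B" using assms(2) by (rule power2_le_imp_le)
  with z show ?thesis by blast
qed

section \<open>Unit vectors, diagonal operators and coordinate projections\<close>

lift_definition unit :: "nat \<Rightarrow> ell2" is "\<lambda>i j. if j = i then 1 else 0"
proof -
  show "summable (\<lambda>j. (if j = i then 1 else 0 :: real)\<^sup>2)" for i
    by (rule summable_finite[of "{i}"]) auto
qed

lemma coord_unit: "coord (unit i) j = (if j = i then 1 else 0)"
  by (simp add: unit.rep_eq)

lemma inner_unit [simp]: "x \<bullet> unit i = coord x i" "unit i \<bullet> x = coord x i"
proof -
  have "(\<lambda>j. coord x j * coord (unit i) j) sums (\<Sum>j\<in>{i}. coord x j * coord (unit i) j)"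
    by (rule sums_finite) (auto simp: coord_unit)
  then show "x \<bullet> unit i = coord x i" using inner_sums[of x "unit i"] sums_unique2 by (fastforce simp: coord_unit)
  then show "unit i \<bullet> x = coord x i" by (simp add: inner_commute)
qed

lemma coord_sum [simp]: "coord (\<Sum>i\<in>A. f i) j = (\<Sum>i\<in>A. coord (f i) j)"
  by (induction A rule: infinite_finite_induct) auto

text \<open>Junk value: \<open>diag m = 0\<close> for an unbounded multiplier \<open>m\<close>.\<close>
lift_definition diag :: "(nat \<Rightarrow> real) \<Rightarrow> ell2 \<Rightarrow> ell2" is
  "\<lambda>m x i. if bounded (range m) then m i * x i else 0"
proof -
  fix m x :: "nat \<Rightarrow> real" assume x: "summable (\<lambda>i. (x i)\<^sup>2)"
  show "summable (\<lambda>i. (if bounded (range m) then m i * x i else 0)\<^sup>2)"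
  proof (cases "bounded (range m)")
    case True
    then obtain B where B: "\<And>i. \<bar>m i\<bar> \<le> B" by (auto simp: bounded_iff)
    have "summable (\<lambda>i. (m i * x i)\<^sup>2)"
    proof (rule summable_comparison_test'[of "\<lambda>i. B\<^sup>2 * (x i)\<^sup>2" 0])
      show "norm ((m n * x n)\<^sup>2) \<le> B\<^sup>2 * (x n)\<^sup>2" for n
        using B[of n] by (auto simp: power_mult_distrib intro!: mult_right_mono) (meson abs_le_square_iff abs_ge_self order_trans)
    qed (intro summable_mult x)
    then show ?thesis using True by simp
  qed simp
qed

lemma coord_diag: "bounded (range m) \<Longrightarrow> coord (diag m x) i = m i * coord x i"
  by (simp add: diag.rep_eq)

lemma diag_sym: "bounded (range m) \<Longrightarrow> diag m x \<bullet> y = x \<bullet> diag m y"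
  using inner_sums[of "diag m x" y] inner_sums[of x "diag m y"] sums_unique2
  by (fastforce simp: coord_diag mult_ac)

lemma norm_diag_le:
  assumes "\<And>i. \<bar>m i\<bar> \<le> B" shows "norm (diag m x) \<le> B * norm x"
proof (rule power2_le_imp_le)
  have b: "bounded (range m)" using assms by (auto simp: bounded_iff)
  have "(m i * coord x i)\<^sup>2 \<le> B\<^sup>2 * (coord x i)\<^sup>2" for i
    using assms[of i] by (auto simp: power_mult_distrib intro!: mult_right_mono) (meson abs_le_square_iff abs_ge_self order_trans)
  then have "(norm (diag m x))\<^sup>2 \<le> B\<^sup>2 * (norm x)\<^sup>2"
    using sums_le[OF _ norm_sq_sums sums_mult[OF norm_sq_sums]] by (simp add: coord_diag[OF b])
  then show "(norm (diag m x))\<^sup>2 \<le> (B * norm x)\<^sup>2" by (simp add: power_mult_distrib)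
qed (use assms[of 0] in auto)

lemma diag_bounded_linear: "bounded_linear (diag m)"
proof (cases "bounded (range m)")
  case True
  then obtain B where B: "\<And>i. \<bar>m i\<bar> \<le> B" by (auto simp: bounded_iff)
  show ?thesis
    by (rule bounded_linear_intro[of _ B])
      (use True norm_diag_le[OF B] in \<open>auto intro!: ell2_eqI simp: coord_diag algebra_simps\<close>)
next
  case False
  then have "diag m = (\<lambda>_. 0)" by (auto intro!: ell2_eqI simp: diag.rep_eq)
  then show ?thesis by simp
qed

definition restr :: "nat set \<Rightarrow> ell2 \<Rightarrow> ell2" where "restr A = diag (indicator A)"

lemma bounded_indicator [simp]: "bounded (range (indicator A :: nat \<Rightarrow> real))"
  by (auto simp: bounded_iff indicator_def intro!: exI[of _ 1])

lemma coord_restr [simp]: "coord (restr A x) i = (if i \<in> A then coord x i else 0)"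
  by (simp add: restr_def coord_diag)

lemma restr_bounded_linear: "bounded_linear (restr A)"
  unfolding restr_def by (rule diag_bounded_linear)

lemmas restr_linear [simp] =
  bounded_linear.linear[OF restr_bounded_linear, THEN linear_add]
  bounded_linear.linear[OF restr_bounded_linear, THEN linear_diff]
  bounded_linear.linear[OF restr_bounded_linear, THEN linear_0]
  bounded_linear.linear[OF restr_bounded_linear, THEN linear_cmul]
  bounded_linear.linear[OF restr_bounded_linear, THEN linear_neg]

lemma restr_sym: "restr A x \<bullet> y = x \<bullet> restr A y"
  unfolding restr_def by (rule diag_sym) simp

lemma restr_restr [simp]: "restr A (restr B x) = restr (A \<inter> B) x"
  by (rule ell2_eqI) simp

lemma restr_UNIV [simp]: "restr UNIV x = x" and restr_empty [simp]: "restr {} x = 0"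
  by (auto intro: ell2_eqI)

lemma norm_restr_le: "norm (restr A x) \<le> norm x"
  using norm_diag_le[of "indicator A" 1 x] by (simp add: restr_def indicator_def)

lemma restr_add_disjoint: "A \<inter> B = {} \<Longrightarrow> restr (A \<union> B) x = restr A x + restr B x"
  by (rule ell2_eqI) auto

lemma restr_Compl: "restr (- A) x = x - restr A x"
  by (rule ell2_eqI) auto

lemma inner_restr_disjoint: "A \<inter> B = {} \<Longrightarrow> restr A x \<bullet> restr B y = 0"
  by (simp add: restr_sym)

lemma norm_sq_add_disjoint:
  "A \<inter> B = {} \<Longrightarrow> (norm (restr A x + restr B y))\<^sup>2 = (norm (restr A x))\<^sup>2 + (norm (restr B y))\<^sup>2"
  by (simp add: power2_norm_eq_inner inner_add_left inner_add_right inner_restr_disjoint inner_commute)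

lemma restr_finite: "finite A \<Longrightarrow> restr A x = (\<Sum>i\<in>A. coord x i *\<^sub>R unit i)"
  by (rule ell2_eqI) (auto simp: coord_unit if_distrib cong: if_cong)

lemma restr_in_span: "finite A \<Longrightarrow> A \<subseteq> B \<Longrightarrow> restr A x \<in> span (unit ` B)"
  by (auto simp: restr_finite intro!: span_sum span_scale intro: span_base)

lemma restr_eq_span: "x \<in> span (unit ` A) \<Longrightarrow> restr A x = x"
proof (induction rule: span_induct_alt)
  case (step c x y)
  then show ?case by (auto intro!: ell2_eqI simp: coord_unit)
qed simp

text \<open>Weak convergence in the Hilbert space: for bounded sequences it is the same as
  coordinatewise convergence.\<close>

definition weakly :: "(nat \<Rightarrow> ell2) \<Rightarrow> ell2 \<Rightarrow> bool" where
  "weakly x l \<longleftrightarrow> bounded (range x) \<and> (\<forall>i. (\<lambda>n. coord (x n) i) \<longlonglongrightarrow> coord l i)"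

lemma weakly_subseq: "weakly x l \<Longrightarrow> strict_mono r \<Longrightarrow> weakly (x \<circ> r) l"
  unfolding weakly_def using LIMSEQ_subseq_LIMSEQ[of "\<lambda>n. coord (x n) _" _ r]
  by (auto simp: o_def intro: bounded_subset)

lemma coord_tendsto: "(x \<longlongrightarrow> l) F \<Longrightarrow> ((\<lambda>n. coord (x n) i) \<longlongrightarrow> coord l i) F"
  using tendsto_inner[of x l F "\<lambda>_. unit i" "unit i"] by simp

lemma tendsto_imp_weakly: "x \<longlonglongrightarrow> l \<Longrightarrow> weakly x l"
  unfolding weakly_def using coord_tendsto convergent_imp_bounded by blast

lemma weakly_add_null: 
  assumes "weakly x l" "(\<lambda>n. y n - x n) \<longlonglongrightarrow> 0" shows "weakly y l"
proof -
  have "weakly (\<lambda>n. y n - x n) 0" using assms(2) by (rule tendsto_imp_weakly)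
  then have a: "bounded (range (\<lambda>n. y n - x n))" "\<And>i. (\<lambda>n. coord (y n - x n) i) \<longlonglongrightarrow> 0"
    by (auto simp: weakly_def)
  have "bounded (range (\<lambda>n. (y n - x n) + x n))"
    using a(1) assms(1) by (intro bounded_plus_comp) (auto simp: weakly_def)
  moreover have "(\<lambda>n. coord (y n) i) \<longlonglongrightarrow> coord l i" for i
  proof -
    have "(\<lambda>n. coord (y n - x n) i + coord (x n) i) \<longlonglongrightarrow> 0 + coord l i"
      using assms(1) by (intro tendsto_add a(2)) (simp add: weakly_def)
    then show ?thesis by simp
  qed
  ultimately show ?thesis by (simp add: weakly_def)
qed

text \<open>The coordinates of a bounded sequence live in a countable power of
  \<open>{-B..B}\<close>, which is compact and metrisable. The bound on finite sums of squares
  survives the limit, so the coordinatewise limit is square-summable.\<close>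

lemma weakly_compact:
  fixes x :: "nat \<Rightarrow> ell2"
  assumes "bounded (range x)"
  obtains r l where "strict_mono r" "weakly (x \<circ> r) l"
proof -
  obtain B where B: "\<And>n. norm (x n) \<le> B" "0 \<le> B" using assms by (metis bounded_iff norm_ge_zero order_trans rangeI)
  have c: "compact (PiE UNIV (\<lambda>_::nat. {-B..B}))"
    using compactin_PiE[of "\<lambda>_. euclidean" UNIV "\<lambda>_. {-B..B}"] by (simp add: euclidean_product_topology)
  have m: "coord (x n) \<in> PiE UNIV (\<lambda>_::nat. {-B..B})" for n
    using B(1)[of n] abs_coord_le[of "x n"] by (auto simp: abs_le_iff) (smt (verit))+
  obtain l r where r: "strict_mono r" "((\<lambda>n. coord (x n)) \<circ> r) \<longlonglongrightarrow> l"
    using spec[OF compact_imp_seq_compact[OF c, unfolded seq_compact_def], of "\<lambda>n. coord (x n)"] m by auto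
  have lim: "(\<lambda>n. coord ((x \<circ> r) n) i) \<longlonglongrightarrow> l i" for i
    using continuous_on_tendsto_compose[OF continuous_on_product_coordinates[of i] r(2)]
    by (simp add: o_def)
  have "(\<Sum>i<n. (l i)\<^sup>2) \<le> B\<^sup>2" for n
  proof (rule LIMSEQ_le_const2)
    show "(\<lambda>k. \<Sum>i<n. (coord ((x \<circ> r) k) i)\<^sup>2) \<longlonglongrightarrow> (\<Sum>i<n. (l i)\<^sup>2)" by (intro tendsto_intros lim)
    have "(\<Sum>i<n. (coord ((x \<circ> r) k) i)\<^sup>2) \<le> B\<^sup>2" for k
      using sum_coord_sq_le[of "{..<n}" "(x \<circ> r) k"] B(1)[of "r k"] power_mono[of "norm (x (r k))" B 2] by simp
    then show "\<exists>N. \<forall>k\<ge>N. (\<Sum>i<n. (coord ((x \<circ> r) k) i)\<^sup>2) \<le> B\<^sup>2" by blast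
  qed
  then obtain z where "coord z = l" using ell2_exI[of l B] B(2) by auto
  then have "weakly (x \<circ> r) z" using lim assms by (auto simp: weakly_def intro: bounded_subset)
  with r(1) that show ?thesis by blast
qed

lemma weakly_restr_tendsto:
  assumes "weakly x l" "finite A" shows "(\<lambda>n. restr A (x n)) \<longlonglongrightarrow> restr A l"
  using assms unfolding weakly_def by (auto simp: restr_finite intro!: tendsto_intros)

text \<open>A diagonal operator with null multipliers is compact: beyond \<open>N\<close> the
  multipliers are small, uniformly over the bounded sequence, and the first \<open>N\<close>
  coordinates converge.\<close>

lemma weakly_diag_tendsto:
  assumes w: "weakly x l" and m: "m \<longlonglongrightarrow> 0" shows "(\<lambda>n. diag m (x n)) \<longlonglongrightarrow> diag m l"
proof (rule LIMSEQ_I)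
  fix e :: real assume e: "0 < e"
  obtain B where B: "\<And>n. norm (x n) \<le> B" "0 < B" using w unfolding weakly_def bounded_pos by auto
  define C where "C = B + norm l"
  have "norm (x n - l) \<le> C" for n using B(1)[of n] norm_triangle_ineq4[of "x n" l] by (simp add: C_def)
  moreover have "C > 0" using B by (simp add: C_def add_pos_nonneg)
  ultimately have C: "C > 0" "\<And>n. norm (x n - l) \<le> C" by auto
  have bm: "bounded (range m)" using m convergent_imp_bounded by blast
  then obtain D where D: "\<And>i. \<bar>m i\<bar> \<le> D" "D > 0" by (auto simp: bounded_pos)
  obtain N where N: "\<And>i. i \<ge> N \<Longrightarrow> \<bar>m i\<bar> < e / (2 * C)"
    using LIMSEQ_D[OF m, of "e / (2 * C)"] e C by auto
  have "(\<lambda>n. restr {..<N} (x n)) \<longlonglongrightarrow> restr {..<N} l" by (rule weakly_restr_tendsto[OF w]) simp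
  then obtain n0 where n0: "\<And>n. n \<ge> n0 \<Longrightarrow> norm (restr {..<N} (x n) - restr {..<N} l) < e / (2 * D)"
    using LIMSEQ_D[of _ _ "e / (2 * D)"] e D by (metis divide_pos_pos mult_pos_pos zero_less_numeral)
  have "norm (diag m (x n) - diag m l) < e" if n: "n \<ge> n0" for n
  proof -
    let ?y = "x n - l"
    define m' where "m' i = (if i < N then 0 else m i)" for i
    have b': "\<bar>m' i\<bar> \<le> e / (2 * C)" for i using N[of i] e C by (auto simp: m'_def not_less) 
    then have bm': "bounded (range m')" by (auto simp: bounded_iff)
    have "diag m (x n) - diag m l = diag m (restr {..<N} ?y) + diag m' ?y"
      by (rule ell2_eqI) (auto simp: coord_diag[OF bm] coord_diag[OF bm'] m'_def algebra_simps)
    also have "norm \<dots> \<le> D * norm (restr {..<N} ?y) + e / (2 * C) * norm ?y"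
      by (intro order_trans[OF norm_triangle_ineq] add_mono norm_diag_le D b')
    also have "\<dots> \<le> D * norm (restr {..<N} ?y) + e / (2 * C) * C"
      using C D e by (intro add_mono mult_left_mono) auto
    also have "\<dots> < D * (e / (2 * D)) + e / (2 * C) * C" using n0[OF n] D by (intro add_strict_right_mono mult_strict_left_mono) auto
    also have "\<dots> = e" using C D by simp
    finally show ?thesis .
  qed
  then show "\<exists>no. \<forall>n\<ge>no. norm (diag m (x n) - diag m l) < e" by blast
qed

lemma restr_lessThan_tendsto: "(\<lambda>n. restr {..<n} x) \<longlonglongrightarrow> x"
proof -
  have "(norm (restr {..<n} x - x))\<^sup>2 = (norm x)\<^sup>2 - (\<Sum>i<n. (coord x i)\<^sup>2)" for n
  proof -
    have "(norm (x - restr {..<n} x))\<^sup>2 = (norm x)\<^sup>2 - (norm (restr {..<n} x))\<^sup>2"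
      using norm_sq_add_disjoint[of "{..<n}" "- {..<n}" x x, OF Compl_disjoint] by (simp only: restr_Compl) simp
    also have "(norm (restr {..<n} x))\<^sup>2 = (\<Sum>i<n. (coord x i)\<^sup>2)"
      by (simp add: power2_norm_eq_inner restr_sym) (simp add: restr_finite inner_sum_right power2_eq_square)
    finally show ?thesis by (simp add: norm_minus_commute)
  qed
  moreover have "(\<lambda>n. (norm x)\<^sup>2 - (\<Sum>i<n. (coord x i)\<^sup>2)) \<longlonglongrightarrow> (norm x)\<^sup>2 - (norm x)\<^sup>2"
    using norm_sq_sums[of x] unfolding sums_def by (intro tendsto_intros)
  ultimately have "(\<lambda>n. sqrt ((norm (restr {..<n} x - x))\<^sup>2)) \<longlonglongrightarrow> sqrt 0"
    by (intro tendsto_intros) simp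
  then show ?thesis by (simp add: LIM_zero_iff tendsto_norm_zero_iff)
qed

section \<open>Two minimax principles\<close>

definition palais_smale :: "('h::real_inner \<Rightarrow> real) \<Rightarrow> ('h \<Rightarrow> 'h) \<Rightarrow> real \<Rightarrow> real \<Rightarrow> bool" where
  "palais_smale I G a b \<longleftrightarrow> (\<forall>u. (\<forall>n::nat. a \<le> I (u n) \<and> I (u n) \<le> b) \<and> (\<lambda>n. G (u n)) \<longlonglongrightarrow> 0
      \<longrightarrow> (\<exists>r l. strict_mono r \<and> (u \<circ> r) \<longlonglongrightarrow> l))"

context descent
begin

text \<open>Points with gradients tending to zero would accumulate, by Palais-Smale, at a critical
  point in the closed set \<open>S\<close> and in the same range of levels.\<close>

lemma gradient_bounded_below:
  assumes ps: "palais_smale I G a b" and S: "closed S"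
    and none: "\<And>w. \<lbrakk>w \<in> S; a \<le> I w; I w \<le> b\<rbrakk> \<Longrightarrow> G w \<noteq> 0"
  shows "\<exists>\<sigma>>0. \<forall>u\<in>S. a \<le> I u \<and> I u \<le> b \<longrightarrow> \<sigma> \<le> norm (G u)"
proof (rule ccontr)
  assume neg: "\<not> ?thesis"
  have "\<exists>u\<in>S. a \<le> I u \<and> I u \<le> b \<and> norm (G u) < inverse (real (Suc n))" for n
  proof -
    have "\<not> (\<forall>u\<in>S. a \<le> I u \<and> I u \<le> b \<longrightarrow> inverse (real (Suc n)) \<le> norm (G u))"
      using neg by (metis inverse_positive_iff_positive of_nat_0_less_iff zero_less_Suc)
    then show ?thesis by (auto simp: not_le)
  qed
  then obtain u where u: "\<And>n. u n \<in> S" "\<And>n. a \<le> I (u n)" "\<And>n. I (u n) \<le> b"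
    "\<And>n. norm (G (u n)) < inverse (real (Suc n))" by metis
  have G0: "(\<lambda>n. G (u n)) \<longlonglongrightarrow> 0"
    by (rule tendsto_norm_zero_cancel, rule real_tendsto_sandwich[OF _ _ tendsto_const LIMSEQ_inverse_real_of_nat])
      (use u(4) in \<open>auto intro!: always_eventually less_imp_le\<close>)
  obtain r l where r: "strict_mono r" "(u \<circ> r) \<longlonglongrightarrow> l"
    using ps u G0 unfolding palais_smale_def by blast
  have "l \<in> S" using closed_sequentially[OF S] u(1) r(2) by (metis comp_def)
  have Il: "(\<lambda>n. I ((u \<circ> r) n)) \<longlonglongrightarrow> I l"
    by (rule continuous_on_tendsto_compose[OF continuous_functional r(2)]) auto
  have Gl: "(\<lambda>n. G ((u \<circ> r) n)) \<longlonglongrightarrow> G l"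
    by (rule continuous_on_tendsto_compose[OF continuous_gradient r(2)]) auto
  have "G l = 0"
    using LIMSEQ_unique[OF Gl] LIMSEQ_subseq_LIMSEQ[OF G0 r(1)] by (simp add: o_def)
  moreover have "a \<le> I l" "I l \<le> b"
    using u by (auto intro!: LIMSEQ_le_const[OF Il] LIMSEQ_le_const2[OF Il])
  ultimately show False using none \<open>l \<in> S\<close> by blast
qed

end

lemma finite_basis_enum:
  assumes "finite A" "A \<noteq> {}"
  obtains b m where "b ` {..m::nat} = unit ` A"
    "\<And>i j. \<lbrakk>i \<le> m; j \<le> m\<rbrakk> \<Longrightarrow> b i \<bullet> b j = (if i = j then 1 else 0)"
proof -
  obtain e where e: "bij_betw e {0..<card A} A" using ex_bij_betw_nat_finite[OF assms(1)] by blast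
  have "card A > 0" using assms by (simp add: card_gt_0_iff)
  then have s: "{0..<card A} = {..card A - 1}" by auto
  show ?thesis
  proof (rule that[of "\<lambda>i. unit (e i)" "card A - 1"])
    show "(\<lambda>i. unit (e i)) ` {..card A - 1} = unit ` A" using e unfolding s by (auto simp: bij_betw_def image_image[symmetric])
    show "unit (e i) \<bullet> unit (e j) = (if i = j then 1 else 0)" if "i \<le> card A - 1" "j \<le> card A - 1" for i j
      using e that unfolding s by (auto simp: coord_unit bij_betw_def inj_on_def)
  qed
qed

lemma span_unit_decomp:
  assumes "y \<in> span (unit ` (A \<union> B))" "A \<inter> B = {}"
  shows "y = restr A y + restr B y"
  using restr_eq_span[OF assms(1)] restr_add_disjoint[OF assms(2)] by metis

text \<open>\<open>u1\<close> need not be critical: the first critical point comes from an arbitrary \<open>u1\<close>, the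
  second from taking the first one for \<open>u1\<close>.\<close>
theorem nabla_critical:
  fixes I :: "ell2 \<Rightarrow> real"
  assumes descent: "descent I G (restr A2)"
    and A: "finite A1" "finite A2" "A1 \<inter> A2 = {}"
    and pars: "0 < \<rho>'" "0 < \<rho>" "a' < a" "0 < \<gamma>" "0 < \<sigma>0"
    and upper: "\<And>y. y \<in> span (unit ` (A1 \<union> A2)) \<Longrightarrow> I y \<le> b"
    and inner: "\<And>y. \<lbrakk>y \<in> span (unit ` (A1 \<union> A2)); a' < I y\<rbrakk> \<Longrightarrow> \<rho>' < norm (restr A2 y) \<and> norm y \<le> R"
    and lower: "\<And>w. \<lbrakk>restr A1 w = 0; norm w = \<rho>\<rbrakk> \<Longrightarrow> a < I w"
    and nabla: "\<And>u. \<lbrakk>a' \<le> I u; I u \<le> b; norm (restr A2 u) \<le> 2 * \<gamma>\<rbrakk> \<Longrightarrow> \<sigma>0 \<le> norm (G u - restr A2 (G u))"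
    and ps: "palais_smale I G a' b"
    and u1: "restr A2 u1 \<noteq> 0"
  shows "\<exists>w. w \<noteq> u1 \<and> G w = 0 \<and> a' \<le> I w \<and> I w \<le> b"
proof (rule ccontr)
  assume neg: "\<not> ?thesis"
  interpret descent I G "restr A2" by (rule descent)
  let ?P = "restr A2" and ?Q = "restr A1"
  define Y where "Y = span (unit ` (A1 \<union> A2))"
  have A2: "A2 \<noteq> {}" using u1 by auto
  obtain b' m where b': "b' ` {..m::nat} = unit ` (A1 \<union> A2)"
      "\<And>i j. \<lbrakk>i \<le> m; j \<le> m\<rbrakk> \<Longrightarrow> b' i \<bullet> b' j = (if i = j then 1 else 0)"
    using finite_basis_enum[of "A1 \<union> A2"] A A2 by auto
  have noncrit: "\<exists>\<sigma>>0. \<forall>u. a' \<le> I u \<and> I u \<le> b \<and> r \<le> norm (u - u1) \<longrightarrow> \<sigma> \<le> norm (G u)" if "0 < r" for r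
  proof -
    have "closed {u. r \<le> norm (u - u1)}" by (intro closed_Collect_le continuous_intros)
    from gradient_bounded_below[OF ps this] neg that show ?thesis by fastforce
  qed
  \<comment> \<open>Radius of the trap around \<open>u1\<close>: strictly within this distance no
    point has a \<open>P\<close>-part that is a nonpositive multiple of
    \<open>?P u1\<close>.\<close>
  have r0: "0 < norm (?P u1)" using u1 by simp
  obtain h1 h2 where h: "continuous_on UNIV h1" "continuous_on UNIV h2"
    "\<And>u. I u \<le> a' \<Longrightarrow> h1 u = u" "\<And>u. I u \<le> a' \<Longrightarrow> h2 u = u"
    "\<And>u. ?P u \<noteq> 0 \<Longrightarrow> ?P (h1 u) \<noteq> 0"
    "\<And>u. \<lbrakk>norm u \<le> R; I u \<le> b\<rbrakk> \<Longrightarrow> norm (h1 u - u1) < norm (?P u1) \<or> I (h2 u) \<le> a"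
    "\<And>u. \<lbrakk>norm u \<le> R; I u \<le> b\<rbrakk> \<Longrightarrow> I (h2 u) \<le> I (h1 u)"
  proof (rule deformation[where b = b and ?u1.0 = u1 and ?R0.0 = R, OF pars(3,4) r0 pars(5)], goal_cases)
    case (1 u) show ?case by (rule nabla) (use 1 in auto)
  next
    case (2 r) show ?case by (rule noncrit) (use 2 in auto)
  next
    case (3 h1 h2) show ?case by (rule that[OF 3(2-8)])
  qed
  \<comment> \<open>The \<open>A1\<close>-part comes from \<open>h2\<close>, the direction inside
    \<open>A2\<close> from \<open>h1\<close>, and the length is the norm of everything in
    \<open>h2 y\<close> outside \<open>A1\<close>, including coordinates outside the span. Thus
    \<open>\<Phi> y = p\<close> puts \<open>h2 y\<close> on the sphere of \<open>lower\<close>,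
    while the direction of \<open>p\<close> is read off from \<open>h1 y\<close>, whose
    \<open>P\<close>-part does not vanish.\<close>
  define \<Phi> where "\<Phi> y = ?Q (h2 y) + norm (h2 y - ?Q (h2 y)) *\<^sub>R sgn (?P (h1 y))" for y
  \<comment> \<open>Near \<open>?P y = 0\<close> the direction is undefined and the identity is used
    instead. Where the cases meet, \<open>norm (?P y) = \<rho>'\<close>, so by \<open>inner\<close>
    the level is at most \<open>a'\<close>, and there \<open>h1\<close> and \<open>h2\<close> fix
    the point.\<close>
  define \<Psi> where "\<Psi> y = (if norm (?P y) \<le> \<rho>' then y else \<Phi> y)" for y
  have fix1: "\<Phi> y = y" if y: "y \<in> Y" "I y \<le> a'" "?P y \<noteq> 0" for y
  proof -
    have "y = ?Q y + ?P y" using span_unit_decomp[of y A1 A2] y A by (auto simp: Y_def)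
    then have "y - ?Q y = ?P y" by (metis add_diff_cancel_left')
    then show ?thesis using h(3,4)[OF y(2)] y(3) \<open>y = ?Q y + ?P y\<close> by (simp add: \<Phi>_def sgn_div_norm)
  qed
  have cQ: "continuous_on S ?Q" and cP: "continuous_on S ?P" for S
    by (intro linear_continuous_on restr_bounded_linear)+
  have ch: "continuous_on S h1" "continuous_on S h2" for S using h(1,2) continuous_on_subset by blast+
  have "continuous_on Y \<Psi>"
    unfolding \<Psi>_def
  proof (rule continuous_on_cases_le)
    show "continuous_on {t \<in> Y. \<rho>' \<le> norm (?P t)} \<Phi>"
      unfolding \<Phi>_def
      by (intro continuous_intros continuous_on_sgn continuous_on_compose2[OF cQ[of UNIV] ch(2)] 
          continuous_on_compose2[OF cP[of UNIV] ch(1)] ch) (use h(5) pars in force)+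
    show "continuous_on Y (\<lambda>x. norm (?P x))" by (intro continuous_intros cP)
    show "t = \<Phi> t" if "t \<in> Y" "norm (?P t) = \<rho>'" for t
      using fix1[OF that(1)] inner[of t] that pars unfolding Y_def by force
  qed auto
  moreover have "\<Psi> ` Y \<subseteq> Y"
  proof clarify
    fix y assume y: "y \<in> Y"
    have "?Q x \<in> Y" "?P x \<in> Y" for x unfolding Y_def by (intro restr_in_span A; auto)+
    then show "\<Psi> y \<in> Y" using y unfolding \<Psi>_def \<Phi>_def sgn_div_norm Y_def
      by (auto intro!: span_add span_scale)
  qed
  moreover have "\<Psi> y = y" if "y \<in> Y" "R + 1 \<le> norm y" for y
  proof -
    have "I y \<le> a'" using inner[of y] that by (force simp: Y_def)
    then show ?thesis using fix1[OF that(1)] pars by (cases "?P y = 0") (auto simp: \<Psi>_def)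
  qed
  \<comment> \<open>The target lies on the sphere, in the direction opposite to
    \<open>?P u1\<close>.\<close>
  moreover define p where "p = - (\<rho> / norm (?P u1)) *\<^sub>R ?P u1"
  have Qp: "?Q p = 0" and Pp: "?P p = p" and np: "norm p = \<rho>"
    using A pars r0 by (auto simp: p_def Int_commute)
  have "p \<in> Y" using Pp restr_in_span[of A2 "A1 \<union> A2" p] A unfolding Y_def by auto
  ultimately obtain y where y: "y \<in> Y" "\<Psi> y = p"
    using identity_near_infinity_onto[of m b' \<Psi> "R + 1" p] b' unfolding Y_def by metis
  have Ip: "a < I p" using lower Qp np by blast
  have big: "\<rho>' < norm (?P y)"
  proof (rule ccontr)
    assume n: "\<not> ?thesis"
    then have "y = p" using y by (simp add: \<Psi>_def)
    then show False using n inner[of p] Ip pars \<open>p \<in> Y\<close> by (auto simp: Y_def)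
  qed
  then have eq: "\<Phi> y = p" using y by (simp add: \<Psi>_def)
  have Psgn: "?P (sgn (?P (h1 y))) = sgn (?P (h1 y))" "?Q (sgn (?P (h1 y))) = 0"
    using A by (auto simp: sgn_div_norm)
  have "?Q (\<Phi> y) = ?Q (h2 y)" using Psgn by (simp add: \<Phi>_def)
  then have Q0: "?Q (h2 y) = 0" using eq Qp by simp
  then have e2: "norm (h2 y) *\<^sub>R sgn (?P (h1 y)) = p" using eq by (simp add: \<Phi>_def)
  have Ph1: "?P (h1 y) \<noteq> 0" using h(5)[of y] big pars by force
  then have n2: "norm (h2 y) = \<rho>" using arg_cong[OF e2, of norm] np by (simp add: norm_sgn)
  then have Ia: "a < I (h2 y)" using lower Q0 by blast
  have "\<not> I y \<le> a'" using h(4)[of y] Ia pars by auto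
  \<comment> \<open>Since \<open>h2 y\<close> stayed above \<open>a\<close>, the alternative in the
    deformation leaves only the trap around \<open>u1\<close>.\<close>
  then have "norm (h1 y - u1) < norm (?P u1)" using h(6)[of y] inner[of y] upper[of y] y(1) Ia unfolding Y_def by force
  moreover have "norm (?P u1) \<le> norm (h1 y - u1)"
  proof -
    define c where "c = norm (?P (h1 y)) / norm (?P u1)"
    have "sgn (?P (h1 y)) = (1 / \<rho>) *\<^sub>R (\<rho> *\<^sub>R sgn (?P (h1 y)))" using pars by simp
    also have "\<dots> = (1 / \<rho>) *\<^sub>R p" using e2 n2 by simp
    also have "\<dots> = - (1 / norm (?P u1)) *\<^sub>R ?P u1" using pars by (simp add: p_def)
    finally have s: "sgn (?P (h1 y)) = - (1 / norm (?P u1)) *\<^sub>R ?P u1" .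
    have "?P (h1 y) = norm (?P (h1 y)) *\<^sub>R sgn (?P (h1 y))" using Ph1 by (simp add: sgn_div_norm)
    also have "\<dots> = - c *\<^sub>R ?P u1" by (simp add: s c_def)
    finally have "?P (h1 y) = - c *\<^sub>R ?P u1" .
    then have d: "?P (h1 y - u1) = (- c - 1) *\<^sub>R ?P u1" by (simp add: scaleR_diff_left)
    have "0 \<le> c" by (simp add: c_def)
    then have "\<bar>- c - 1\<bar> = c + 1" by linarith
    then have "norm (?P (h1 y - u1)) = (c + 1) * norm (?P u1)" unfolding d norm_scaleR by simp
    moreover have "1 * norm (?P u1) \<le> (c + 1) * norm (?P u1)" using \<open>0 \<le> c\<close> by (intro mult_right_mono) auto
    ultimately show ?thesis using norm_restr_le[of A2 "h1 y - u1"] by linarith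
  qed
  ultimately show False by linarith
qed

text \<open>With \<open>P = 0\<close> the field is the gradient itself, and the tracked direction is
  the fixed vector \<open>unit j\<close>, on the half-space \<open>coord y j \<ge> 0\<close>. The
  deformation is taken around \<open>0\<close>, where \<open>I < a'\<close>: an orbit with
  \<open>I (h2 y) > a\<close> cannot have \<open>h1 y\<close> near \<open>0\<close>, because levels
  do not increase.\<close>

theorem linking_critical:
  fixes I :: "ell2 \<Rightarrow> real"
  assumes descent: "descent I G (\<lambda>_. 0)"
    and A: "finite A1" "j \<notin> A1"
    and pars: "0 < \<rho>" "a' < a" "I 0 < a'"
    and upper: "\<And>y. y \<in> span (unit ` (insert j A1)) \<Longrightarrow> I y \<le> b"
    and inner: "\<And>y. \<lbrakk>y \<in> span (unit ` (insert j A1)); a' < I y\<rbrakk> \<Longrightarrow> coord y j \<noteq> 0 \<and> norm y \<le> R"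
    and lower: "\<And>w. \<lbrakk>restr A1 w = 0; norm w = \<rho>\<rbrakk> \<Longrightarrow> a < I w"
    and ps: "palais_smale I G a' b"
  shows "\<exists>w. G w = 0 \<and> a' \<le> I w \<and> I w \<le> b"
proof (rule ccontr)
  assume neg: "\<not> ?thesis"
  interpret descent I G "\<lambda>_. 0" by (rule descent)
  let ?Q = "restr A1"
  define Y where "Y = span (unit ` (insert j A1))"
  obtain b' m where b': "b' ` {..m::nat} = unit ` (insert j A1)"
      "\<And>i j. \<lbrakk>i \<le> m; j \<le> m\<rbrakk> \<Longrightarrow> b' i \<bullet> b' j = (if i = j then 1 else 0)"
    using finite_basis_enum[of "insert j A1"] A by auto
  obtain \<sigma> where \<sigma>: "\<sigma> > 0" "\<And>u. a' \<le> I u \<Longrightarrow> I u \<le> b \<Longrightarrow> \<sigma> \<le> norm (G u)"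
    using gradient_bounded_below[OF ps, of UNIV] neg by auto
  have "isCont I 0" using continuous_functional by (simp add: continuous_on_eq_continuous_at)
  then obtain r0 where r0: "r0 > 0" "\<And>x. norm x < r0 \<Longrightarrow> I x < a'"
    unfolding continuous_at_eps_delta using pars(3)
    by (metis abs_less_iff diff_gt_0_iff_gt dist_0_norm dist_commute dist_real_def less_diff_eq diff_add_cancel)
  have noncrit: "\<exists>\<sigma>>0. \<forall>u. a' \<le> I u \<and> I u \<le> b \<and> r \<le> norm (u - 0) \<longrightarrow> \<sigma> \<le> norm (G u)" for r
    using \<sigma> by blast
  obtain h1 h2 where h: "continuous_on UNIV h2" "\<And>u. I u \<le> a' \<Longrightarrow> h2 u = u"
    "\<And>u. \<lbrakk>norm u \<le> R; I u \<le> b\<rbrakk> \<Longrightarrow> norm (h1 u - 0) < r0 \<or> I (h2 u) \<le> a"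
    "\<And>u. \<lbrakk>norm u \<le> R; I u \<le> b\<rbrakk> \<Longrightarrow> I (h2 u) \<le> I (h1 u)"
  proof (rule deformation[where b = b and ?u1.0 = 0 and ?R0.0 = R, OF pars(2) zero_less_one r0(1) \<sigma>(1)], goal_cases)
    case (1 u) then show ?case using \<sigma>(2) by simp
  next
    case (2 r) then show ?case by (intro noncrit)
  next
    case (3 h1 h2) show ?case by (rule that[OF 3(3,5,7,8)])
  qed
  define \<Phi> where "\<Phi> y = ?Q (h2 y) + norm (h2 y - ?Q (h2 y)) *\<^sub>R unit j" for y
  \<comment> \<open>On the face \<open>coord y j = 0\<close> the level is at most \<open>a'\<close>
    by \<open>inner\<close>, so its points are fixed and the identity continues
    \<open>\<Phi>\<close> across it.\<close>
  define \<Psi> where "\<Psi> y = (if coord y j \<le> 0 then y else \<Phi> y)" for y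
  have fix1: "\<Phi> y = y" if y: "y \<in> Y" "I y \<le> a'" "0 \<le> coord y j" for y
  proof -
    have "y = ?Q y + restr {j} y" using span_unit_decomp[of y A1 "{j}"] y A by (auto simp: Y_def)
    moreover have "restr {j} y = coord y j *\<^sub>R unit j" by (simp add: restr_finite)
    ultimately have "y = ?Q y + coord y j *\<^sub>R unit j" by simp
    then have "y - ?Q y = coord y j *\<^sub>R unit j" by (metis add_diff_cancel_left')
    moreover have "norm (unit j) = 1" by (simp add: norm_eq_sqrt_inner coord_unit)
    ultimately show ?thesis using h(2)[OF y(2)] y(3) \<open>y = ?Q y + coord y j *\<^sub>R unit j\<close> by (simp add: \<Phi>_def)
  qed
  have cQ: "continuous_on S ?Q" for S
    by (intro linear_continuous_on restr_bounded_linear)+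
  have ch: "continuous_on S h2" for S using h(1) continuous_on_subset by blast+
  have "continuous_on Y \<Psi>"
    unfolding \<Psi>_def
  proof (rule continuous_on_cases_le)
    show "continuous_on {t \<in> Y. 0 \<le> coord t j} \<Phi>"
      unfolding \<Phi>_def
      by (intro continuous_intros continuous_on_compose2[OF cQ[of UNIV] ch] ch) auto
    show "continuous_on Y (\<lambda>x. coord x j)"
      using continuous_on_inner[OF continuous_on_id continuous_on_const, of Y "unit j"] by simp
    show "t = \<Phi> t" if "t \<in> Y" "coord t j = 0" for t
      using fix1[OF that(1)] inner[of t] that unfolding Y_def by force
  qed auto
  moreover have "\<Psi> ` Y \<subseteq> Y"
  proof clarify
    fix y assume y: "y \<in> Y"
    have "?Q x \<in> Y" "unit j \<in> Y" for x
      using restr_in_span[OF A(1), of "insert j A1" x] unfolding Y_def by (auto intro: span_base)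
    then show "\<Psi> y \<in> Y" using y unfolding \<Psi>_def \<Phi>_def Y_def
      by (auto intro!: span_add span_scale)
  qed
  moreover have "\<Psi> y = y" if "y \<in> Y" "R + 1 \<le> norm y" for y
  proof -
    have "I y \<le> a'" using inner[of y] that by (force simp: Y_def)
    then show ?thesis using fix1[OF that(1)] by (auto simp: \<Psi>_def)
  qed
  moreover have "\<rho> *\<^sub>R unit j \<in> Y" unfolding Y_def by (intro span_scale) (auto intro: span_base)
  ultimately obtain y where y: "y \<in> Y" "\<Psi> y = \<rho> *\<^sub>R unit j"
    using identity_near_infinity_onto[of m b' \<Psi> "R + 1" "\<rho> *\<^sub>R unit j"] b' unfolding Y_def by metis
  have "0 < coord y j"
  proof (rule ccontr)
    assume n: "\<not> ?thesis"
    then have "coord y j = \<rho>" using y by (simp add: \<Psi>_def coord_unit)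
    then show False using n pars by simp
  qed
  then have eq: "\<Phi> y = \<rho> *\<^sub>R unit j" using y by (simp add: \<Psi>_def)
  have Qu: "?Q (unit j) = 0" using A by (auto intro!: ell2_eqI simp: coord_unit)
  then have Q0: "?Q (h2 y) = 0" using arg_cong[OF eq, of ?Q] by (simp add: \<Phi>_def)
  have nu: "norm (unit j) = 1" by (simp add: norm_eq_sqrt_inner coord_unit)
  have "norm (h2 y) = \<rho>" using arg_cong[OF eq, of norm] Q0 pars nu by (simp add: \<Phi>_def)
  then have Ia: "a < I (h2 y)" using lower Q0 by blast
  have "\<not> I y \<le> a'" using h(2)[of y] Ia pars by auto
  then have bd: "norm y \<le> R" "I y \<le> b" using inner[of y] upper[of y] y(1) unfolding Y_def by auto
  then have "norm (h1 y) < r0" using h(3)[OF bd] Ia by simp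
  then have "I (h1 y) < a'" by (rule r0(2))
  then show False using h(4)[OF bd] Ia pars by linarith
qed

section \<open>Three critical points to the left of an eigenvalue\<close>

text \<open>The \<open>\<mu> i\<close> are reciprocal eigenvalues; \<open>g\<close> is
  weak-to-strong continuous along subsequences. \<open>growth\<close> and
  \<open>superquadratic\<close> are subcritical growth and the lower bound (F3) in abstract form:
  the dual norm of \<open>g\<close> and the \<open>L2\<close> square are each dominated by an
  arbitrarily small multiple of \<open>\<Phi>\<close> plus a constant.\<close>

locale superquadratic =
  fixes \<mu> :: "nat \<Rightarrow> real" and \<Phi> :: "ell2 \<Rightarrow> real" and g :: "ell2 \<Rightarrow> ell2" and q :: real
  assumes \<mu>_pos: "\<And>i. 0 < \<mu> i" and \<mu>_null: "\<mu> \<longlonglongrightarrow> 0"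
    and \<Phi>_deriv: "\<And>u v. ((\<lambda>t. \<Phi> (u + t *\<^sub>R v)) has_real_derivative (g u \<bullet> v)) (at 0)"
    and g_compact: "\<And>x l. weakly x l \<Longrightarrow> \<exists>r. strict_mono r \<and> (\<lambda>n. g (x (r n))) \<longlonglongrightarrow> g l"
    and \<Phi>_zero: "\<Phi> 0 = 0"
    and small: "\<And>\<epsilon>. 0 < \<epsilon> \<Longrightarrow> \<exists>\<delta>>0. \<forall>u. norm u \<le> \<delta> \<longrightarrow> \<Phi> u \<le> \<epsilon> * (norm u)\<^sup>2 \<and> norm (g u) \<le> \<epsilon> * norm u"
    and q: "2 < q" and ambrosetti_rabinowitz: "\<And>u. q * \<Phi> u \<le> g u \<bullet> u"
    and \<Phi>_pos: "\<And>u. u \<noteq> 0 \<Longrightarrow> 0 < \<Phi> u"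
    and growth: "\<And>\<eta>. 0 < \<eta> \<Longrightarrow> \<exists>C. \<forall>u v. norm v \<le> 1 \<longrightarrow> \<bar>g u \<bullet> v\<bar> \<le> \<eta> * \<Phi> u + C"
    and superquadratic: "\<And>\<eta>. 0 < \<eta> \<Longrightarrow> \<exists>C. \<forall>u. diag \<mu> u \<bullet> u \<le> \<eta> * \<Phi> u + C"
begin

definition T :: "real \<Rightarrow> ell2 \<Rightarrow> ell2" where "T \<nu> u = u - \<nu> *\<^sub>R diag \<mu> u"
definition I :: "real \<Rightarrow> ell2 \<Rightarrow> real" where "I \<nu> u = (T \<nu> u \<bullet> u) / 2 - \<Phi> u"
definition G :: "real \<Rightarrow> ell2 \<Rightarrow> ell2" where "G \<nu> u = T \<nu> u - g u"

lemma bounded_\<mu>: "bounded (range \<mu>)"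
  using \<mu>_null convergent_imp_bounded by blast

lemma \<Phi>_nonneg: "0 \<le> \<Phi> u"
  using \<Phi>_pos[of u] \<Phi>_zero by (cases "u = 0") auto

lemma coord_T: "coord (T \<nu> u) i = (1 - \<nu> * \<mu> i) * coord u i"
  by (simp add: T_def coord_diag[OF bounded_\<mu>] algebra_simps)

lemma T_linear: "T \<nu> (x + y) = T \<nu> x + T \<nu> y" "T \<nu> (x - y) = T \<nu> x - T \<nu> y" "T \<nu> (c *\<^sub>R x) = c *\<^sub>R T \<nu> x"
  by (auto intro!: ell2_eqI simp: coord_T algebra_simps)

lemma T_sym: "T \<nu> x \<bullet> y = x \<bullet> T \<nu> y"
  by (simp add: T_def inner_diff_left inner_diff_right diag_sym[OF bounded_\<mu>])

lemma T_restr: "T \<nu> (restr A x) = restr A (T \<nu> x)"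
  by (rule ell2_eqI) (simp add: coord_T)

lemma T_lower: "(\<And>i. i \<in> A \<Longrightarrow> c \<le> 1 - \<nu> * \<mu> i) \<Longrightarrow> c * (norm (restr A u))\<^sup>2 \<le> T \<nu> (restr A u) \<bullet> restr A u"
  by (rule sums_le[OF _ sums_mult[OF norm_sq_sums] inner_sums])
    (auto simp: coord_T power2_eq_square mult.assoc intro!: mult_right_mono)

lemma T_upper: "(\<And>i. i \<in> A \<Longrightarrow> 1 - \<nu> * \<mu> i \<le> c) \<Longrightarrow> T \<nu> (restr A u) \<bullet> restr A u \<le> c * (norm (restr A u))\<^sup>2"
  by (rule sums_le[OF _ inner_sums sums_mult[OF norm_sq_sums]])
    (auto simp: coord_T power2_eq_square mult.assoc intro!: mult_right_mono)

text \<open>Two bounded sequences at vanishing distance have, along a common subsequence, the same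
  weak limit, and \<open>g\<close> sends both to the same strong limit.\<close>

lemma uniformly_continuous_g: "uniformly_continuous_on (cball 0 R) g"
proof (rule ccontr)
  assume "\<not> ?thesis"
  then obtain e where e: "e > 0" "\<And>d. d > 0 \<Longrightarrow> \<exists>x\<in>cball 0 R. \<exists>y\<in>cball 0 R. dist y x < d \<and> \<not> dist (g y) (g x) < e"
    unfolding uniformly_continuous_on_def by meson
  have "\<exists>x y. norm x \<le> R \<and> norm (y - x) < inverse (real (Suc n)) \<and> e \<le> norm (g y - g x)" for n
    using e(2)[of "inverse (real (Suc n))"] by (force simp: dist_norm not_less)
  then obtain x y where xy: "\<And>n. norm (x n) \<le> R" "\<And>n. norm (y n - x n) < inverse (real (Suc n))"
    "\<And>n. e \<le> norm (g (y n) - g (x n))" by metis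
  have d0: "(\<lambda>n. y n - x n) \<longlonglongrightarrow> 0"
    by (rule tendsto_norm_zero_cancel, rule real_tendsto_sandwich[OF _ _ tendsto_const LIMSEQ_inverse_real_of_nat])
      (use xy(2) in \<open>auto intro!: always_eventually less_imp_le\<close>)
  have "bounded (range x)" using xy(1) by (auto simp: bounded_iff)
  then obtain r l where r: "strict_mono r" "weakly (x \<circ> r) l" by (rule weakly_compact)
  obtain r1 where r1: "strict_mono r1" "(\<lambda>n. g ((x \<circ> r) (r1 n))) \<longlonglongrightarrow> g l" using g_compact[OF r(2)] by blast
  have m: "strict_mono (r \<circ> r1)" using r(1) r1(1) by (rule strict_mono_o)
  have "weakly (x \<circ> (r \<circ> r1)) l" using weakly_subseq[OF r(2) r1(1)] by (simp add: o_assoc)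
  moreover have "(\<lambda>n. (y \<circ> (r \<circ> r1)) n - (x \<circ> (r \<circ> r1)) n) \<longlonglongrightarrow> 0"
    using LIMSEQ_subseq_LIMSEQ[OF d0 m] by (simp add: o_def)
  ultimately have "weakly (y \<circ> (r \<circ> r1)) l" by (rule weakly_add_null)
  then obtain r2 where r2: "strict_mono r2" "(\<lambda>n. g ((y \<circ> (r \<circ> r1)) (r2 n))) \<longlonglongrightarrow> g l" using g_compact by blast
  have "(\<lambda>n. g ((x \<circ> (r \<circ> r1)) (r2 n))) \<longlonglongrightarrow> g l"
    using LIMSEQ_subseq_LIMSEQ[OF r1(2) r2(1)] by (simp add: o_def)
  from tendsto_norm[OF tendsto_diff[OF r2(2) this]]
  have "(\<lambda>n. norm (g ((y \<circ> (r \<circ> r1)) (r2 n)) - g ((x \<circ> (r \<circ> r1)) (r2 n)))) \<longlonglongrightarrow> 0" by simp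
  then have "e \<le> 0" using xy(3) by (intro LIMSEQ_le_const) (auto simp: o_def)
  then show False using e by simp
qed

sublocale phi: descent \<Phi> g "\<lambda>_. 0"
  by (rule descent.intro) (use \<Phi>_deriv uniformly_continuous_g in \<open>auto intro: bounded_linear_zero\<close>)

lemma bounded_linear_T: "bounded_linear (T \<nu>)"
  unfolding T_def by (intro bounded_linear_sub bounded_linear_ident bounded_linear_scaleR_right[THEN bounded_linear_compose] diag_bounded_linear)

lemma descent_I: "descent (I \<nu>) (G \<nu>) (restr A)"
proof (rule descent.intro)
  fix u v
  have e: "I \<nu> (u + t *\<^sub>R v) = (T \<nu> u \<bullet> u + 2 * t * (T \<nu> u \<bullet> v) + t * t * (T \<nu> v \<bullet> v)) / 2 - \<Phi> (u + t *\<^sub>R v)" for t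
    using T_sym[of \<nu> v u] by (simp add: I_def T_linear inner_add_left inner_add_right inner_commute algebra_simps)
  show "((\<lambda>t. I \<nu> (u + t *\<^sub>R v)) has_real_derivative (G \<nu> u \<bullet> v)) (at 0)"
    unfolding e by (auto intro!: derivative_eq_intros \<Phi>_deriv simp: G_def inner_diff_left)
next
  show "uniformly_continuous_on (cball 0 R) (G \<nu>)" for R
    unfolding G_def
    by (intro uniformly_continuous_on_diff uniformly_continuous_g bounded_linear.uniformly_continuous_on[OF bounded_linear_T] uniformly_continuous_on_id)
qed (rule restr_bounded_linear | simp add: restr_sym)+

lemma tendsto_I: "\<lbrakk>x \<longlonglongrightarrow> l; \<nu> \<longlonglongrightarrow> \<nu>0\<rbrakk> \<Longrightarrow> (\<lambda>n. I (\<nu> n) (x n)) \<longlonglongrightarrow> I \<nu>0 l"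
  unfolding I_def T_def
  by (intro tendsto_intros bounded_linear.tendsto[OF diag_bounded_linear] continuous_on_tendsto_compose[OF phi.continuous_functional]) auto

lemma tendsto_G: "\<lbrakk>x \<longlonglongrightarrow> l; \<nu> \<longlonglongrightarrow> \<nu>0\<rbrakk> \<Longrightarrow> (\<lambda>n. G (\<nu> n) (x n)) \<longlonglongrightarrow> G \<nu>0 l"
  unfolding G_def T_def
  by (intro tendsto_intros bounded_linear.tendsto[OF diag_bounded_linear] continuous_on_tendsto_compose[OF phi.continuous_gradient]) auto

lemma I_zero: "I \<nu> 0 = 0"
  by (simp add: I_def \<Phi>_zero)

text \<open>The factor \<open>(q + 2) / 2 = 2 * k + 2\<close> lies strictly between 2 and
  \<open>q = 4 * k + 2\<close>. The combination keeps \<open>k\<close> times the quadratic form and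
  a surplus \<open>2 * k * \<Phi> u\<close>. Half of the surplus absorbs the indefinite part of the
  form through \<open>superquadratic\<close>, the other half absorbs \<open>g u \<bullet> v\<close>
  through \<open>growth\<close>. The vector \<open>v\<close> is the component of \<open>u\<close> in
  which nothing is known about the gradient.\<close>

lemma coercive:
  obtains c C where "c > 0" "\<And>\<nu> u v. \<lbrakk>\<bar>\<nu>\<bar> \<le> \<Lambda>; norm v \<le> 1\<rbrakk> \<Longrightarrow>
     c * (norm u)\<^sup>2 - C \<le> (q + 2) / 2 * I \<nu> u - G \<nu> u \<bullet> (u - v)"
proof -
  define k where "k = (q - 2) / 4"
  have k: "k > 0" using q by (simp add: k_def)
  \<comment> \<open>The summand 1 makes \<open>1 / B\<close> an admissible parameter of
    \<open>superquadratic\<close>.\<close>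
  define B where "B = 1 + \<bar>\<Lambda>\<bar>"
  have B: "B > 0" by (simp add: B_def)
  obtain D where D: "\<And>i. \<bar>\<mu> i\<bar> \<le> D" using bounded_\<mu> by (auto simp: bounded_iff)
  have D0: "0 \<le> D" using D[of 0] by linarith
  obtain C1 where C1: "\<And>u v. norm v \<le> 1 \<Longrightarrow> \<bar>g u \<bullet> v\<bar> \<le> k * \<Phi> u + C1" using growth[OF k] by blast
  obtain C2 where C2: "\<And>u. diag \<mu> u \<bullet> u \<le> (1 / B) * \<Phi> u + C2" using superquadratic[of "1 / B"] B by auto
  define M where "M = 1 + B * D"
  show ?thesis
  proof (rule that[of "k / 2" "M\<^sup>2 / (2 * k) + C1 + k * B * \<bar>C2\<bar>"])
    show "0 < k / 2" using k by simp
    fix \<nu> u v assume l: "\<bar>\<nu>\<bar> \<le> \<Lambda>" and v: "norm (v :: ell2) \<le> 1"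
    have lB: "\<bar>\<nu>\<bar> \<le> B" using l by (simp add: B_def)
    have kk: "(q + 2) / 2 = 2 * k + 2" by (simp add: k_def field_simps)
    have q4: "q = 4 * k + 2" by (simp add: k_def field_simps)
    have K0: "0 \<le> diag \<mu> u \<bullet> u"
      using sums_le[OF _ sums_zero inner_sums[of "diag \<mu> u" u]] \<mu>_pos by (simp add: coord_diag[OF bounded_\<mu>] less_imp_le mult.assoc)
    have "\<nu> * (diag \<mu> u \<bullet> u) \<le> B * (diag \<mu> u \<bullet> u)" using lB K0 by (intro mult_right_mono) auto
    also have "\<dots> \<le> B * ((1 / B) * \<Phi> u + \<bar>C2\<bar>)" using C2[of u] B by (intro mult_left_mono) auto
    also have "\<dots> = \<Phi> u + B * \<bar>C2\<bar>" using B by (simp add: field_simps)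
    finally have a: "\<nu> * (diag \<mu> u \<bullet> u) \<le> \<Phi> u + B * \<bar>C2\<bar>" .
    have "\<bar>T \<nu> u \<bullet> v\<bar> \<le> norm (T \<nu> u) * norm v" by (rule Cauchy_Schwarz_ineq2)
    also have "\<dots> \<le> norm (T \<nu> u)" using v by (simp add: mult_left_le)
    also have "\<dots> \<le> norm u + \<bar>\<nu>\<bar> * norm (diag \<mu> u)" unfolding T_def by (metis norm_triangle_ineq4 norm_scaleR)
    also have "\<dots> \<le> norm u + B * (D * norm u)" using lB norm_diag_le[OF D] B by (intro add_mono mult_mono) auto
    also have "\<dots> = M * norm u" by (simp add: M_def algebra_simps)
    also have "\<dots> \<le> k / 2 * (norm u)\<^sup>2 + M\<^sup>2 / (2 * k)"
    proof -
      have "0 \<le> (k * norm u - M)\<^sup>2 / (2 * k)" using k by simp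
      also have "\<dots> = k / 2 * (norm u)\<^sup>2 - M * norm u + M\<^sup>2 / (2 * k)" using k by (simp add: power2_eq_square field_simps)
      finally show ?thesis by linarith
    qed
    finally have b: "\<bar>T \<nu> u \<bullet> v\<bar> \<le> k / 2 * (norm u)\<^sup>2 + M\<^sup>2 / (2 * k)" .
    have c: "\<bar>g u \<bullet> v\<bar> \<le> k * \<Phi> u + C1" by (rule C1[OF v])
    have TT: "T \<nu> u \<bullet> u = (norm u)\<^sup>2 - \<nu> * (diag \<mu> u \<bullet> u)" by (simp add: T_def inner_diff_left power2_norm_eq_inner)
    have "(q + 2) / 2 * I \<nu> u - G \<nu> u \<bullet> (u - v) = k * (T \<nu> u \<bullet> u) - (2 * k + 2) * \<Phi> u + g u \<bullet> u + T \<nu> u \<bullet> v - g u \<bullet> v"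
      unfolding kk by (simp add: I_def G_def inner_diff_left inner_diff_right algebra_simps)
    moreover have "k * (T \<nu> u \<bullet> u) \<ge> k * ((norm u)\<^sup>2 - (\<Phi> u + B * \<bar>C2\<bar>))"
      unfolding TT using a k by (intro mult_left_mono) auto
    moreover have "g u \<bullet> u \<ge> (4 * k + 2) * \<Phi> u" using ambrosetti_rabinowitz[of u] q4 by simp
    ultimately show "k / 2 * (norm u)\<^sup>2 - (M\<^sup>2 / (2 * k) + C1 + k * B * \<bar>C2\<bar>) \<le> (q + 2) / 2 * I \<nu> u - G \<nu> u \<bullet> (u - v)"
      using b c by (simp add: algebra_simps)
  qed
qed

text \<open>\<open>A = {}\<close> is the Palais-Smale condition; a general \<open>A\<close> is needed for the functional
  restricted to the sequences vanishing on \<open>A\<close>.\<close>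
lemma constrained_palais_smale:
  assumes "\<nu> \<longlonglongrightarrow> \<nu>0" "\<And>n. I (\<nu> n) (u n) \<le> b"
    and P: "(\<lambda>n. restr A (u n)) \<longlonglongrightarrow> 0"
    and Gr: "(\<lambda>n. G (\<nu> n) (u n) - restr A (G (\<nu> n) (u n))) \<longlonglongrightarrow> 0"
  obtains r l where "strict_mono (r :: nat \<Rightarrow> nat)" "(\<lambda>n. u (r n)) \<longlonglongrightarrow> l"
    "(\<lambda>n. I (\<nu> (r n)) (u (r n))) \<longlonglongrightarrow> I \<nu>0 l" "restr A l = 0" "G \<nu>0 l - restr A (G \<nu>0 l) = 0"
proof -
  let ?F = "\<lambda>n. G (\<nu> n) (u n) - restr A (G (\<nu> n) (u n))"
  obtain \<Lambda> where \<Lambda>: "\<And>n. \<bar>\<nu> n\<bar> \<le> \<Lambda>"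
    using convergent_imp_bounded[OF assms(1)] by (auto simp: bounded_iff)
  obtain c C where c: "c > 0" "\<And>\<nu> u v. \<lbrakk>\<bar>\<nu>\<bar> \<le> \<Lambda>; norm v \<le> 1\<rbrakk> \<Longrightarrow>
     c * (norm u)\<^sup>2 - C \<le> (q + 2) / 2 * I \<nu> u - G \<nu> u \<bullet> (u - v)" using coercive[of \<Lambda>] by metis
  obtain n0 where n0: "\<And>n. n \<ge> n0 \<Longrightarrow> norm (restr A (u n)) < 1" "\<And>n. n \<ge> n0 \<Longrightarrow> norm (?F n) < 1"
    using LIMSEQ_D[OF P zero_less_one] LIMSEQ_D[OF Gr zero_less_one] by (metis diff_zero linear order_trans)
  define K where "K = \<bar>C\<bar> + (q + 2) / 2 * \<bar>b\<bar>"
  \<comment> \<open>Dropping \<open>n0\<close> terms makes both smallness bounds valid at every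
    index.\<close>
  define x where "x n = u (n + n0)" for n
  have "norm (x n) \<le> (K + 1) / c + 1" for n
  proof -
    let ?n = "n + n0"
    \<comment> \<open>With \<open>v = restr A (u n)\<close> in \<open>coercive\<close>, only the
      part of the gradient outside \<open>A\<close> remains, and it tends to zero.\<close>
    have "G (\<nu> ?n) (u ?n) \<bullet> (u ?n - restr A (u ?n)) = ?F ?n \<bullet> u ?n"
      by (simp add: inner_diff_left inner_diff_right restr_sym)
    moreover have "\<bar>?F ?n \<bullet> u ?n\<bar> \<le> norm (?F ?n) * norm (u ?n)" by (rule Cauchy_Schwarz_ineq2)
    moreover have "norm (?F ?n) * norm (u ?n) \<le> norm (u ?n)" using n0(2)[of ?n] by (intro mult_left_le_one_le) auto
    moreover have "(q + 2) / 2 * I (\<nu> ?n) (u ?n) \<le> (q + 2) / 2 * \<bar>b\<bar>"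
      using assms(2)[of ?n] q by (intro mult_left_mono) auto
    ultimately have *: "c * (norm (x n))\<^sup>2 \<le> K + norm (x n)"
      using c(2)[of "\<nu> ?n" "restr A (u ?n)" "u ?n"] \<Lambda>[of ?n] n0(1)[of ?n] by (simp add: x_def K_def)
    show ?thesis
    proof (rule ccontr)
      assume "\<not> ?thesis"
      then have n: "norm (x n) > (K + 1) / c + 1" by simp
      have K: "0 \<le> K" using q by (simp add: K_def)
      then have "1 < norm (x n)" using n c(1) by (smt (verit) divide_nonneg_pos)
      have "K + 1 < c * norm (x n)" using n c(1) by (simp add: field_simps)
      then have "(K + 1) * norm (x n) < c * norm (x n) * norm (x n)" using \<open>1 < norm (x n)\<close> by (intro mult_strict_right_mono) auto
      moreover have "K * 1 \<le> K * norm (x n)" using K \<open>1 < norm (x n)\<close> by (intro mult_left_mono) auto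
      ultimately show False using * by (simp add: power2_eq_square algebra_simps)
    qed
  qed
  then have "bounded (range x)" by (auto simp: bounded_iff)
  then obtain r1 l where r1: "strict_mono r1" "weakly (x \<circ> r1) l" by (rule weakly_compact)
  obtain r2 where r2: "strict_mono r2" "(\<lambda>n. g ((x \<circ> r1) (r2 n))) \<longlonglongrightarrow> g l" using g_compact[OF r1(2)] by blast
  have Kl: "(\<lambda>n. diag \<mu> ((x \<circ> r1 \<circ> r2) n)) \<longlonglongrightarrow> diag \<mu> l"
    by (rule weakly_diag_tendsto[OF weakly_subseq[OF r1(2) r2(1)] \<mu>_null])
  define r where "r n = r1 (r2 n) + n0" for n
  have r: "strict_mono r" using r1(1) r2(1) by (auto simp: r_def strict_mono_def)
  have sub: "(\<lambda>n. X (r n)) \<longlonglongrightarrow> L" if "X \<longlonglongrightarrow> L" for X :: "nat \<Rightarrow> 'z::topological_space" and L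
    using LIMSEQ_subseq_LIMSEQ[OF that r] by (simp add: o_def)
  let ?v = "\<lambda>n. \<nu> (r n) *\<^sub>R diag \<mu> (u (r n)) + g (u (r n))"
  \<comment> \<open>Outside \<open>A\<close> the point is its gradient plus a compact image of
    itself; inside \<open>A\<close> it tends to zero. So weak convergence becomes strong, and
    \<open>l'\<close> is the limit that this forces.\<close>
  define l' where "l' = 0 + ((\<nu>0 *\<^sub>R diag \<mu> l + g l) - restr A (\<nu>0 *\<^sub>R diag \<mu> l + g l)) + 0"
  have "(\<lambda>n. ?F (r n) + (?v n - restr A (?v n)) + restr A (u (r n))) \<longlonglongrightarrow> l'"
    unfolding l'_def using Kl r2(2)
    by (intro tendsto_intros bounded_linear.tendsto[OF restr_bounded_linear] sub[OF assms(1)] sub[OF Gr] sub[OF P])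
      (auto simp: x_def r_def o_def)
  moreover have "?F (r n) + (?v n - restr A (?v n)) + restr A (u (r n)) = u (r n)" for n
    by (simp add: G_def T_def algebra_simps)
  ultimately have lim: "(\<lambda>n. u (r n)) \<longlonglongrightarrow> l'" by simp
  have "(\<lambda>n. restr A (u (r n))) \<longlonglongrightarrow> restr A l'" by (rule bounded_linear.tendsto[OF restr_bounded_linear lim])
  then have 1: "restr A l' = 0" using sub[OF P] LIMSEQ_unique by blast
  have "(\<lambda>n. ?F (r n)) \<longlonglongrightarrow> G \<nu>0 l' - restr A (G \<nu>0 l')"
    by (intro tendsto_intros bounded_linear.tendsto[OF restr_bounded_linear] tendsto_G lim sub[OF assms(1)])
  then have 2: "G \<nu>0 l' - restr A (G \<nu>0 l') = 0" using sub[OF Gr] LIMSEQ_unique by blast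
  show ?thesis by (rule that[OF r lim tendsto_I[OF lim sub[OF assms(1)]] 1 2])
qed

lemma palais_smale_I: "palais_smale (I \<nu>) (G \<nu>) a b"
  unfolding palais_smale_def
proof (intro allI impI, elim conjE)
  fix u :: "nat \<Rightarrow> ell2"
  assume u: "\<forall>n. a \<le> I \<nu> (u n) \<and> I \<nu> (u n) \<le> b" "(\<lambda>n. G \<nu> (u n)) \<longlonglongrightarrow> 0"
  obtain r l where "strict_mono r" "(\<lambda>n. u (r n)) \<longlonglongrightarrow> l"
    by (rule constrained_palais_smale[of "\<lambda>_. \<nu>" \<nu> u b "{}"]) (use u in auto)
  then show "\<exists>r l. strict_mono r \<and> (u \<circ> r) \<longlonglongrightarrow> l" by (auto simp: o_def)
qed

text \<open>On finitely many coordinates \<open>\<mu>\<close> has a positive minimum, taken as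
  \<open>m\<close>. \<open>superquadratic\<close> with factor \<open>m\<close> gives
  \<open>\<Phi> y \<ge> (norm y)\<^sup>2 - C / m\<close>, whereas the quadratic part is at most
  \<open>(norm y)\<^sup>2 / 2\<close> for every \<open>\<nu> \<ge> 0\<close>.\<close>

lemma finite_dim_upper:
  assumes "finite B"
  obtains C where "\<And>\<nu> y. \<lbrakk>0 \<le> \<nu>; y \<in> span (unit ` B)\<rbrakk> \<Longrightarrow> I \<nu> y \<le> C - (norm y)\<^sup>2 / 2"
proof -
  define m where "m = Min (insert 1 (\<mu> ` B))"
  have m: "m > 0" "\<And>i. i \<in> B \<Longrightarrow> m \<le> \<mu> i" using assms \<mu>_pos by (auto simp: m_def)
  obtain C where C: "\<And>u. diag \<mu> u \<bullet> u \<le> m * \<Phi> u + C" using superquadratic[OF m(1)] by blast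
  show ?thesis
  proof (rule that[of "C / m"])
    fix \<nu> :: real and y assume l: "0 \<le> \<nu>" and y: "y \<in> span (unit ` B)"
    have r: "restr B y = y" using restr_eq_span[OF y] .
    have cy: "coord y i = (if i \<in> B then coord y i else 0)" for i by (metis r coord_restr)
    have "m * (norm y)\<^sup>2 \<le> diag \<mu> y \<bullet> y"
    proof (rule sums_le[OF _ sums_mult[OF norm_sq_sums] inner_sums])
      show "m * (coord y n)\<^sup>2 \<le> coord (diag \<mu> y) n * coord y n" for n
        using m(2)[of n] cy[of n] by (cases "n \<in> B") (auto simp: coord_diag[OF bounded_\<mu>] power2_eq_square mult.assoc intro!: mult_right_mono)
    qed
    then have "m * (norm y)\<^sup>2 \<le> m * \<Phi> y + C" using C order_trans by blast
    then have "(norm y)\<^sup>2 \<le> \<Phi> y + C / m" using m(1) by (simp add: field_simps)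
    moreover have "T \<nu> (restr B y) \<bullet> restr B y \<le> 1 * (norm (restr B y))\<^sup>2"
      by (rule T_upper) (use l \<mu>_pos in \<open>simp add: less_imp_le\<close>)
    ultimately show "I \<nu> y \<le> C / m - (norm y)\<^sup>2 / 2" by (simp add: I_def r)
  qed
qed

section \<open>Spectral splitting at the eigenvalue \<open>1 / \<mu> k0\<close>\<close>

context
  fixes k0 :: nat
begin

text \<open>Passing to reciprocals reverses the order: the larger \<open>\<mu> i\<close>, in
  \<open>A1\<close>, belong to the smaller eigenvalues. Since \<open>\<mu>\<close> is a null
  sequence, \<open>A1\<close> and \<open>A2\<close> are finite.\<close>

definition "A1 = {i. \<mu> k0 < \<mu> i}"
definition "A2 = {i. \<mu> i = \<mu> k0}"
definition "A3 = {i. \<mu> i < \<mu> k0}"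
definition "\<nu>k = 1 / \<mu> k0"

lemma A_disjoint [simp]: "A1 \<inter> A2 = {}" "A2 \<inter> A1 = {}" "A1 \<inter> A3 = {}" "A3 \<inter> A1 = {}" "A2 \<inter> A3 = {}" "A3 \<inter> A2 = {}"
  by (auto simp: A1_def A2_def A3_def)

lemma finite_ge: "0 < c \<Longrightarrow> finite {i. c \<le> \<mu> i}"
proof -
  assume "0 < c"
  then obtain N where "\<And>i. i \<ge> N \<Longrightarrow> norm (\<mu> i - 0) < c" using LIMSEQ_D[OF \<mu>_null, of c] by blast
  then have "\<And>i. i \<ge> N \<Longrightarrow> \<mu> i < c" by (auto simp: abs_less_iff)
  then have "{i. c \<le> \<mu> i} \<subseteq> {..<N}" by (auto simp: not_less[symmetric])
  then show ?thesis using finite_subset by blast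
qed

lemma A_finite: "finite A1" "finite A2"
  by (rule finite_subset[OF _ finite_ge[OF \<mu>_pos[of k0]]]; auto simp: A1_def A2_def)+

lemma \<nu>k_pos: "0 < \<nu>k" using \<mu>_pos[of k0] by (simp add: \<nu>k_def)

text \<open>Only finitely many \<open>\<mu> i\<close> reach \<open>\<mu> k0 / 2\<close>; all others
  are at least \<open>\<mu> k0 / 2\<close> below \<open>\<mu> k0\<close>.\<close>

lemma gap:
  obtains \<theta> where "\<theta> > 0" "\<And>i. i \<in> A1 \<Longrightarrow> \<mu> k0 + \<theta> \<le> \<mu> i" "\<And>i. i \<in> A3 \<Longrightarrow> \<mu> i \<le> \<mu> k0 - \<theta>"
proof -
  have p: "0 < \<mu> k0" by (rule \<mu>_pos)
  let ?F = "(\<lambda>i. \<bar>\<mu> i - \<mu> k0\<bar>) ` {i. \<mu> k0 / 2 \<le> \<mu> i \<and> \<mu> i \<noteq> \<mu> k0}"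
  have f: "finite ?F" by (intro finite_imageI finite_subset[OF _ finite_ge[of "\<mu> k0 / 2"]]) (use p in auto)
  define \<theta> where "\<theta> = Min (insert (\<mu> k0 / 2) ?F)"
  have "\<theta> > 0" unfolding \<theta>_def using f p by (subst Min_gr_iff) auto
  moreover have "\<theta> \<le> \<mu> k0 / 2" unfolding \<theta>_def using f by (intro Min_le) auto
  moreover have m: "\<theta> \<le> \<bar>\<mu> i - \<mu> k0\<bar>" if "\<mu> k0 / 2 \<le> \<mu> i" "\<mu> i \<noteq> \<mu> k0" for i
    unfolding \<theta>_def using f that by (intro Min_le) auto
  moreover have "\<mu> k0 + \<theta> \<le> \<mu> i" if "i \<in> A1" for i using m[of i] that p by (simp add: A1_def)
  moreover have "\<mu> i \<le> \<mu> k0 - \<theta>" if "i \<in> A3" for i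
    using m[of i] that p \<open>\<theta> \<le> \<mu> k0 / 2\<close> by (cases "\<mu> k0 / 2 \<le> \<mu> i") (simp_all add: A3_def)
  ultimately show ?thesis by (intro that[of \<theta>])
qed

text \<open>For \<open>\<nu> \<ge> \<nu>k / 2\<close> the gap \<open>\<theta>\<close> moves
  \<open>\<nu> * \<mu> i\<close> by at least \<open>2 * c0\<close>, while \<open>\<delta>\<close>
  keeps \<open>\<nu> * \<mu> k0\<close> within \<open>c0\<close> of 1. So the quadratic form is
  definite on \<open>A1\<close> and on \<open>A3\<close> with one constant for all
  \<open>\<nu>\<close> in question, and degenerates on \<open>A2\<close> only.\<close>

lemma spectral_gap:
  obtains c0 \<delta> where "c0 > 0" "\<delta> > 0" "\<delta> < \<nu>k"
    "\<And>\<nu> i. \<lbrakk>\<nu>k - \<delta> \<le> \<nu>; \<nu> \<le> \<nu>k; i \<in> A1\<rbrakk> \<Longrightarrow> 1 - \<nu> * \<mu> i \<le> - c0"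
    "\<And>\<nu> i. \<lbrakk>\<nu>k - \<delta> \<le> \<nu>; \<nu> \<le> \<nu>k; i \<in> A3\<rbrakk> \<Longrightarrow> c0 \<le> 1 - \<nu> * \<mu> i"
    "\<And>\<nu>. \<lbrakk>\<nu>k - \<delta> \<le> \<nu>; \<nu> \<le> \<nu>k\<rbrakk> \<Longrightarrow> 1 - \<nu> * \<mu> k0 \<le> c0"
proof -
  obtain \<theta> where \<theta>: "\<theta> > 0" "\<And>i. i \<in> A1 \<Longrightarrow> \<mu> k0 + \<theta> \<le> \<mu> i" "\<And>i. i \<in> A3 \<Longrightarrow> \<mu> i \<le> \<mu> k0 - \<theta>"
    using gap by blast
  have p: "0 < \<mu> k0" by (rule \<mu>_pos)
  define c0 where "c0 = \<theta> * \<nu>k / 4"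
  define \<delta> where "\<delta> = min (\<nu>k / 2) (c0 / \<mu> k0)"
  have c0: "c0 > 0" using \<theta> \<nu>k_pos by (simp add: c0_def)
  have t: "1 - \<nu> * \<mu> k0 \<le> c0" "\<nu>k / 2 \<le> \<nu>" "\<nu> * \<mu> k0 \<le> 1" if "\<nu>k - \<delta> \<le> \<nu>" "\<nu> \<le> \<nu>k" for \<nu>
  proof -
    have "(\<nu>k - c0 / \<mu> k0) * \<mu> k0 \<le> \<nu> * \<mu> k0" using that p by (intro mult_right_mono) (auto simp: \<delta>_def)
    then show "1 - \<nu> * \<mu> k0 \<le> c0" using p by (simp add: \<nu>k_def left_diff_distrib)
    show "\<nu>k / 2 \<le> \<nu>" using that by (auto simp: \<delta>_def)
    show "\<nu> * \<mu> k0 \<le> 1" using that p by (simp add: \<nu>k_def field_simps)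
  qed
  have h: "2 * c0 \<le> \<nu> * \<theta>" if "\<nu>k / 2 \<le> \<nu>" for \<nu> 
    using mult_right_mono[OF that, of \<theta>] \<theta>(1) by (simp add: c0_def algebra_simps)
  show ?thesis
  proof (rule that[OF c0])
    show "\<delta> > 0" "\<delta> < \<nu>k" using c0 p \<nu>k_pos by (auto simp: \<delta>_def)
    show "1 - \<nu> * \<mu> i \<le> - c0" if l: "\<nu>k - \<delta> \<le> \<nu>" "\<nu> \<le> \<nu>k" and i: "i \<in> A1" for \<nu> i
    proof -
      have "\<nu> * (\<mu> k0 + \<theta>) \<le> \<nu> * \<mu> i" using \<theta>(2)[OF i] t(2)[OF l] \<nu>k_pos by (intro mult_left_mono) auto
      then show ?thesis using t(1)[OF l] h[OF t(2)[OF l]] by (simp add: distrib_left)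
    qed
    show "c0 \<le> 1 - \<nu> * \<mu> i" if l: "\<nu>k - \<delta> \<le> \<nu>" "\<nu> \<le> \<nu>k" and i: "i \<in> A3" for \<nu> i
    proof -
      have "\<nu> * \<mu> i \<le> \<nu> * (\<mu> k0 - \<theta>)" using \<theta>(3)[OF i] t(2)[OF l] \<nu>k_pos by (intro mult_left_mono) auto
      then show ?thesis using t(3)[OF l] h[OF t(2)[OF l]] c0 by (simp add: right_diff_distrib)
    qed
  qed (use t in auto)
qed

lemma decomp13: "restr A2 u = 0 \<Longrightarrow> u = restr A1 u + restr A3 u"
proof (rule ell2_eqI)
  fix i assume "restr A2 u = 0"
  then have "coord (restr A2 u) i = 0" by simp
  then show "coord u i = coord (restr A1 u + restr A3 u) i" by (auto simp: A1_def A2_def A3_def split: if_splits)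
qed

text \<open>Constrained critical points with \<open>\<nu>\<close> tending to \<open>\<nu>k\<close>
  and positive levels tending to 0 accumulate at one of level 0. There
  \<open>2 * \<Phi> l = g l \<bullet> l \<ge> q * \<Phi> l\<close>, which forces
  \<open>l = 0\<close>. But close to \<open>0\<close> there are no nonzero ones, because the form is
  uniformly definite on \<open>A1\<close> and on \<open>A3\<close> and \<open>g\<close> is of
  smaller order.\<close>

lemma no_constrained_critical:
  obtains \<epsilon> \<delta> where "\<epsilon> > 0" "\<delta> > 0"
    "\<And>\<nu> u. \<lbrakk>\<nu>k - \<delta> \<le> \<nu>; \<nu> \<le> \<nu>k; restr A2 u = 0; G \<nu> u - restr A2 (G \<nu> u) = 0; 0 < I \<nu> u\<rbrakk> \<Longrightarrow> \<epsilon> < I \<nu> u"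
proof -
  obtain c0 \<delta>0 where gap: "c0 > 0" "\<delta>0 > 0" "\<delta>0 < \<nu>k"
    "\<And>\<nu> i. \<lbrakk>\<nu>k - \<delta>0 \<le> \<nu>; \<nu> \<le> \<nu>k; i \<in> A1\<rbrakk> \<Longrightarrow> 1 - \<nu> * \<mu> i \<le> - c0"
    "\<And>\<nu> i. \<lbrakk>\<nu>k - \<delta>0 \<le> \<nu>; \<nu> \<le> \<nu>k; i \<in> A3\<rbrakk> \<Longrightarrow> c0 \<le> 1 - \<nu> * \<mu> i"
    using spectral_gap by metis
  have "\<exists>n. \<forall>\<nu> u. \<nu>k - \<delta>0 * inverse (real (Suc n)) \<le> \<nu> \<and> \<nu> \<le> \<nu>k \<and> restr A2 u = 0 \<and> G \<nu> u - restr A2 (G \<nu> u) = 0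
     \<and> 0 < I \<nu> u \<longrightarrow> inverse (real (Suc n)) < I \<nu> u"
  proof (rule ccontr)
    assume "\<not> ?thesis"
    then have "\<exists>\<nu> u. \<nu>k - \<delta>0 * inverse (real (Suc n)) \<le> \<nu> \<and> \<nu> \<le> \<nu>k \<and> restr A2 u = 0 \<and> G \<nu> u - restr A2 (G \<nu> u) = 0
        \<and> 0 < I \<nu> u \<and> \<not> inverse (real (Suc n)) < I \<nu> u" for n by blast
    then obtain \<nu> u where "\<And>n. \<nu>k - \<delta>0 * inverse (real (Suc n)) \<le> \<nu> n \<and> \<nu> n \<le> \<nu>k \<and> restr A2 (u n) = 0
        \<and> G (\<nu> n) (u n) - restr A2 (G (\<nu> n) (u n)) = 0 \<and> 0 < I (\<nu> n) (u n) \<and> \<not> inverse (real (Suc n)) < I (\<nu> n) (u n)" by metis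
    then have lu: "\<And>n. \<nu>k - \<delta>0 * inverse (real (Suc n)) \<le> \<nu> n" "\<And>n. \<nu> n \<le> \<nu>k"
      "\<And>n. restr A2 (u n) = 0" "\<And>n. G (\<nu> n) (u n) - restr A2 (G (\<nu> n) (u n)) = 0"
      "\<And>n. 0 < I (\<nu> n) (u n)" "\<And>n. I (\<nu> n) (u n) \<le> inverse (real (Suc n))"
      by (meson not_less)+
    have "(\<lambda>n. \<nu>k - \<delta>0 * inverse (real (Suc n))) \<longlonglongrightarrow> \<nu>k - \<delta>0 * 0"
      by (intro tendsto_intros LIMSEQ_inverse_real_of_nat)
    then have lim: "(\<lambda>n. \<nu>k - \<delta>0 * inverse (real (Suc n))) \<longlonglongrightarrow> \<nu>k" by (simp only: mult_zero_right diff_zero)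
    have l: "\<nu> \<longlonglongrightarrow> \<nu>k"
      by (rule real_tendsto_sandwich[OF always_eventually always_eventually lim tendsto_const]) (use lu in blast)+
    have i1: "inverse (real (Suc n)) \<le> 1" for n by (simp add: inverse_le_1_iff)
    have b1: "I (\<nu> n) (u n) \<le> 1" for n using lu(6)[of n] i1[of n] by linarith
    obtain r l where r: "strict_mono (r :: nat \<Rightarrow> nat)" "(\<lambda>n. u (r n)) \<longlonglongrightarrow> l"
      "(\<lambda>n. I (\<nu> (r n)) (u (r n))) \<longlonglongrightarrow> I \<nu>k l" "restr A2 l = 0" "G \<nu>k l - restr A2 (G \<nu>k l) = 0"
      by (rule constrained_palais_smale[OF l b1, of A2]) (use lu in auto)
    have "(\<lambda>n. I (\<nu> n) (u n)) \<longlonglongrightarrow> 0"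
      using lu(5,6) by (intro real_tendsto_sandwich[OF _ _ tendsto_const LIMSEQ_inverse_real_of_nat])
        (auto intro!: always_eventually less_imp_le)
    then have Il: "I \<nu>k l = 0"
      using LIMSEQ_unique[OF r(3)] LIMSEQ_subseq_LIMSEQ[OF _ r(1)] by (fastforce simp: o_def)
    have "G \<nu>k l \<bullet> l = (G \<nu>k l - restr A2 (G \<nu>k l)) \<bullet> l" using r(4) by (simp add: inner_diff_left restr_sym)
    then have "G \<nu>k l \<bullet> l = 0" using r(5) by simp
    then have "2 * \<Phi> l = g l \<bullet> l" using Il by (simp add: I_def G_def inner_diff_left)
    then have "(q - 2) * \<Phi> l \<le> 0" using ambrosetti_rabinowitz[of l] by (simp add: algebra_simps)
    then have "\<Phi> l \<le> 0" using q by (simp add: mult_le_0_iff)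
    then have l0: "l = 0" using \<Phi>_pos[of l] by force
    have c2: "0 < c0 / 2" using gap by simp
    obtain d where d: "d > 0" "\<And>u. norm u \<le> d \<Longrightarrow> norm (g u) \<le> c0 / 2 * norm u" using small[OF c2] by blast
    obtain n where "norm (u (r n)) < d" using LIMSEQ_D[OF r(2) d(1)] l0 by auto
    define v \<nu>' where "v = u (r n)" and "\<nu>' = \<nu> (r n)"
    have "\<delta>0 * inverse (real (Suc (r n))) \<le> \<delta>0 * 1" using gap(2) i1 by (intro mult_left_mono) auto
    then have lr: "\<nu>k - \<delta>0 \<le> \<nu>'" "\<nu>' \<le> \<nu>k" using lu(1,2)[of "r n"] by (auto simp: \<nu>'_def)
    have v: "norm v \<le> d" "restr A2 v = 0" "G \<nu>' v - restr A2 (G \<nu>' v) = 0" "v \<noteq> 0"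
      using \<open>norm (u (r n)) < d\<close> lu(3,4)[of "r n"] lu(5)[of "r n"] I_zero by (auto simp: v_def \<nu>'_def)
    define x y where "x = restr A1 v" and "y = restr A3 v"
    have xy: "v = x + y" using decomp13[OF v(2)] by (simp add: x_def y_def)
    have o: "T \<nu>' x \<bullet> y = 0" "T \<nu>' y \<bullet> x = 0" unfolding x_def y_def T_restr by (simp_all add: inner_restr_disjoint)
    have nv1: "(norm v)\<^sup>2 = (norm x)\<^sup>2 + (norm y)\<^sup>2"
      using norm_sq_add_disjoint[of A1 A3 v v] unfolding x_def[symmetric] y_def[symmetric] xy[symmetric] by simp
    have "restr A1 (- v) = - x" by (simp add: x_def)
    then have "(norm (y - x))\<^sup>2 = (norm y)\<^sup>2 + (norm x)\<^sup>2"
      using norm_sq_add_disjoint[of A3 A1 v "- v"] unfolding y_def[symmetric] by simp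
    then have nv: "(norm v)\<^sup>2 = (norm x)\<^sup>2 + (norm y)\<^sup>2" "(norm (y - x))\<^sup>2 = (norm v)\<^sup>2"
      using nv1 by simp_all
    have "c0 * (norm y)\<^sup>2 \<le> T \<nu>' y \<bullet> y" unfolding y_def by (rule T_lower) (use gap(5) lr in auto)
    moreover have "T \<nu>' x \<bullet> x \<le> - c0 * (norm x)\<^sup>2" unfolding x_def by (rule T_upper) (use gap(4) lr in auto)
    \<comment> \<open>Reversing the sign of the \<open>A1\<close>-part makes the indefinite form
      definite. As \<open>y - x\<close> has no \<open>A2\<close>-part, the constrained equation may
      be tested with it.\<close>
    ultimately have "c0 * (norm v)\<^sup>2 \<le> T \<nu>' v \<bullet> (y - x)"
      using o unfolding nv(1) by (simp add: xy T_linear inner_add_left inner_diff_right algebra_simps)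
    also have "\<dots> = g v \<bullet> (y - x)"
    proof -
      have "restr A2 (y - x) = 0" by (simp add: x_def y_def)
      then have "G \<nu>' v \<bullet> (y - x) = (G \<nu>' v - restr A2 (G \<nu>' v)) \<bullet> (y - x)" by (simp add: inner_diff_left restr_sym)
      also have "\<dots> = 0" unfolding v(3) by simp
      finally show ?thesis by (simp add: G_def inner_diff_left)
    qed
    also have "\<dots> \<le> norm (g v) * norm (y - x)" by (rule norm_cauchy_schwarz)
    also have "norm (y - x) = norm v" using nv(2) by simp
    also have "norm (g v) * norm v \<le> c0 / 2 * norm v * norm v" using d(2)[OF v(1)] by (intro mult_right_mono) auto
    finally have "c0 * (norm v)\<^sup>2 \<le> c0 / 2 * (norm v)\<^sup>2" by (simp add: power2_eq_square)
    moreover have "0 < c0 * (norm v)\<^sup>2" using gap(1) v(4) by simp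
    ultimately show False by linarith
  qed
  then obtain n where n: "\<And>\<nu> u. \<lbrakk>\<nu>k - \<delta>0 * inverse (real (Suc n)) \<le> \<nu>; \<nu> \<le> \<nu>k; restr A2 u = 0; G \<nu> u - restr A2 (G \<nu> u) = 0;
      0 < I \<nu> u\<rbrakk> \<Longrightarrow> inverse (real (Suc n)) < I \<nu> u" by blast
  show ?thesis by (rule that[of "inverse (real (Suc n))" "\<delta>0 * inverse (real (Suc n))"]) (use gap n in auto)
qed

text \<open>By the constrained Palais-Smale property, absence of constrained critical points with
  level in \<open>[a, b]\<close> persists, quantitatively, in a neighbourhood of the subspace
  \<open>restr A2 u = 0\<close>.\<close>

lemma nabla_condition:
  assumes no: "\<And>u. \<lbrakk>restr A2 u = 0; G \<nu> u - restr A2 (G \<nu> u) = 0; a \<le> I \<nu> u; I \<nu> u \<le> b\<rbrakk> \<Longrightarrow> False"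
  obtains \<gamma> \<sigma> where "\<gamma> > 0" "\<sigma> > 0" 
    "\<And>u. \<lbrakk>a \<le> I \<nu> u; I \<nu> u \<le> b; norm (restr A2 u) \<le> 2 * \<gamma>\<rbrakk> \<Longrightarrow> \<sigma> \<le> norm (G \<nu> u - restr A2 (G \<nu> u))"
proof -
  let ?i = "\<lambda>n. inverse (real (Suc n))"
  have "\<exists>n. \<forall>u. a \<le> I \<nu> u \<and> I \<nu> u \<le> b \<and> norm (restr A2 u) \<le> ?i n \<longrightarrow> ?i n \<le> norm (G \<nu> u - restr A2 (G \<nu> u))"
  proof (rule ccontr)
    assume "\<not> ?thesis"
    then obtain u where u: "\<And>n. a \<le> I \<nu> (u n)" "\<And>n. I \<nu> (u n) \<le> b" "\<And>n. norm (restr A2 (u n)) \<le> ?i n"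
      "\<And>n. norm (G \<nu> (u n) - restr A2 (G \<nu> (u n))) < ?i n"
      by (simp add: not_le) metis
    have z: "X \<longlonglongrightarrow> 0" if "\<And>n. norm (X n) \<le> ?i n" for X :: "nat \<Rightarrow> ell2"
      by (rule tendsto_norm_zero_cancel, rule real_tendsto_sandwich[OF _ _ tendsto_const LIMSEQ_inverse_real_of_nat])
        (use that in \<open>auto intro!: always_eventually\<close>)
    have z1: "(\<lambda>n. restr A2 (u n)) \<longlonglongrightarrow> 0" by (rule z[OF u(3)])
    have z2: "(\<lambda>n. G \<nu> (u n) - restr A2 (G \<nu> (u n))) \<longlonglongrightarrow> 0" by (rule z[OF less_imp_le[OF u(4)]])
    obtain r l where r: "strict_mono (r :: nat \<Rightarrow> nat)"
      "(\<lambda>n. I \<nu> (u (r n))) \<longlonglongrightarrow> I \<nu> l" "restr A2 l = 0" "G \<nu> l - restr A2 (G \<nu> l) = 0"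
      by (rule constrained_palais_smale[OF tendsto_const u(2) z1 z2])
    have "a \<le> I \<nu> l" "I \<nu> l \<le> b" using u by (auto intro!: LIMSEQ_le_const[OF r(2)] LIMSEQ_le_const2[OF r(2)])
    then show False using no r by blast
  qed
  then obtain n where "\<And>u. \<lbrakk>a \<le> I \<nu> u; I \<nu> u \<le> b; norm (restr A2 u) \<le> ?i n\<rbrakk> \<Longrightarrow> ?i n \<le> norm (G \<nu> u - restr A2 (G \<nu> u))" by blast
  then show ?thesis by (intro that[of "?i n / 2" "?i n"]) auto
qed

text \<open>\<open>\<epsilon>\<close>, \<open>\<alpha>\<close> and \<open>R\<close> do not depend on
  \<open>\<nu>\<close>, whereas \<open>b = t * R\<^sup>2 / 2\<close> with
  \<open>t = 1 - \<nu> * \<mu> k0\<close> small. Hence \<open>b < \<epsilon>\<close>, which rules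
  out constrained critical points in \<open>(0, b]\<close>, and \<open>b < \<alpha> / 2\<close>,
  which separates the third level from the first two.\<close>

theorem three_critical_points:
  "\<exists>\<delta>>0. \<forall>\<nu>. \<nu>k - \<delta> < \<nu> \<and> \<nu> < \<nu>k \<longrightarrow>
     (\<exists>w1 w2 w3. G \<nu> w1 = 0 \<and> G \<nu> w2 = 0 \<and> G \<nu> w3 = 0 \<and> w1 \<noteq> 0 \<and> w2 \<noteq> 0 \<and> w3 \<noteq> 0
        \<and> w1 \<noteq> w2 \<and> w1 \<noteq> w3 \<and> w2 \<noteq> w3)"
proof -
  obtain c0 \<delta>0 where gap: "c0 > 0" "\<delta>0 > 0" "\<delta>0 < \<nu>k"
    "\<And>\<nu> i. \<lbrakk>\<nu>k - \<delta>0 \<le> \<nu>; \<nu> \<le> \<nu>k; i \<in> A1\<rbrakk> \<Longrightarrow> 1 - \<nu> * \<mu> i \<le> - c0"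
    "\<And>\<nu> i. \<lbrakk>\<nu>k - \<delta>0 \<le> \<nu>; \<nu> \<le> \<nu>k; i \<in> A3\<rbrakk> \<Longrightarrow> c0 \<le> 1 - \<nu> * \<mu> i"
    "\<And>\<nu>. \<lbrakk>\<nu>k - \<delta>0 \<le> \<nu>; \<nu> \<le> \<nu>k\<rbrakk> \<Longrightarrow> 1 - \<nu> * \<mu> k0 \<le> c0"
    using spectral_gap by metis
  obtain \<epsilon> \<delta>1 where nc: "\<epsilon> > 0" "\<delta>1 > 0"
    "\<And>\<nu> u. \<lbrakk>\<nu>k - \<delta>1 \<le> \<nu>; \<nu> \<le> \<nu>k; restr A2 u = 0; G \<nu> u - restr A2 (G \<nu> u) = 0; 0 < I \<nu> u\<rbrakk> \<Longrightarrow> \<epsilon> < I \<nu> u"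
    using no_constrained_critical by metis
  have c4: "0 < c0 / 4" using gap by simp
  obtain \<rho>3 where \<rho>3: "\<rho>3 > 0" "\<And>u. norm u \<le> \<rho>3 \<Longrightarrow> \<Phi> u \<le> c0 / 4 * (norm u)\<^sup>2" using small[OF c4] by blast
  \<comment> \<open>On the sphere of radius \<open>\<rho>3\<close> in \<open>A3\<close> half the
    form is at least \<open>c0 * \<rho>3\<^sup>2 / 2\<close> and \<open>\<Phi>\<close> takes away at
    most half of that, leaving twice \<open>\<alpha>\<close>.\<close>
  define \<alpha> where "\<alpha> = c0 * \<rho>3\<^sup>2 / 8"
  have \<alpha>: "\<alpha> > 0" using gap \<rho>3 by (simp add: \<alpha>_def)
  have S3: "\<alpha> < I \<nu> w" if l: "\<nu>k - \<delta>0 \<le> \<nu>" "\<nu> \<le> \<nu>k" and w: "restr (A1 \<union> A2) w = 0" "norm w = \<rho>3" for \<nu> w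
  proof -
    have r: "restr A3 w = w"
    proof (rule ell2_eqI)
      fix i have "coord (restr (A1 \<union> A2) w) i = 0" using w by simp
      then show "coord (restr A3 w) i = coord w i" by (auto simp: A1_def A2_def A3_def split: if_splits)
    qed
    have "c0 * (norm (restr A3 w))\<^sup>2 \<le> T \<nu> (restr A3 w) \<bullet> restr A3 w" by (rule T_lower) (use gap l in auto)
    then have "c0 * \<rho>3\<^sup>2 \<le> T \<nu> w \<bullet> w" using r w by simp
    moreover have "\<Phi> w \<le> c0 / 4 * \<rho>3\<^sup>2" using \<rho>3(2)[of w] w by simp
    moreover have "0 < c0 * \<rho>3\<^sup>2" using gap \<rho>3 by simp
    ultimately show ?thesis by (simp add: I_def \<alpha>_def)
  qed
  let ?A = "A1 \<union> A2"
  have fA: "finite ?A" using A_finite by simp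
  obtain C where C: "\<And>\<nu> y. \<lbrakk>0 \<le> \<nu>; y \<in> span (unit ` ?A)\<rbrakk> \<Longrightarrow> I \<nu> y \<le> C - (norm y)\<^sup>2 / 2"
    by (rule finite_dim_upper[OF fA]) blast
  obtain j where j: "j \<notin> ?A" using fA infinite_UNIV_nat ex_new_if_finite by blast
  have fj: "finite (insert j ?A)" using fA by simp
  obtain C3 where C3: "\<And>\<nu> y. \<lbrakk>0 \<le> \<nu>; y \<in> span (unit ` (insert j ?A))\<rbrakk> \<Longrightarrow> I \<nu> y \<le> C3 - (norm y)\<^sup>2 / 2"
    by (rule finite_dim_upper[OF fj]) blast
  define R where "R = sqrt (2 * \<bar>C\<bar> + 2 * \<bar>C3\<bar>)"
  have R2: "R\<^sup>2 = 2 * \<bar>C\<bar> + 2 * \<bar>C3\<bar>" "0 \<le> R" by (auto simp: R_def)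
  have inR: "norm y \<le> R" if "0 < C - (norm y)\<^sup>2 / 2 \<or> 0 < C3 - (norm y)\<^sup>2 / 2" for y :: ell2
  proof (rule power2_le_imp_le[OF _ R2(2)])
    show "(norm y)\<^sup>2 \<le> R\<^sup>2" unfolding R2(1) using that by auto
  qed
  \<comment> \<open>Since \<open>t = (\<nu>k - \<nu>) * \<mu> k0\<close>, this yields
    \<open>t * (R\<^sup>2 + 1) < min \<epsilon> \<alpha>\<close>.\<close>
  define \<delta> where "\<delta> = min (min \<delta>0 \<delta>1) (min \<epsilon> \<alpha> / (\<mu> k0 * (R\<^sup>2 + 1)))"
  have mp: "0 < \<mu> k0" by (rule \<mu>_pos)
  have R1: "0 < R\<^sup>2 + 1" by (simp add: add_nonneg_pos)
  have \<delta>: "\<delta> > 0" using gap nc \<alpha> mp R1 by (simp add: \<delta>_def)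
  show ?thesis
  proof (intro exI[of _ \<delta>] conjI \<delta> allI impI, elim conjE)
    fix \<nu> assume lam: "\<nu>k - \<delta> < \<nu>" "\<nu> < \<nu>k"
    have l0: "\<nu>k - \<delta>0 \<le> \<nu>" "\<nu>k - \<delta>1 \<le> \<nu>" "\<nu> \<le> \<nu>k" "0 \<le> \<nu>" using lam gap(3) by (auto simp: \<delta>_def)
    define t where "t = 1 - \<nu> * \<mu> k0"
    have t: "0 < t" "t \<le> c0" using gap(6)[OF l0(1,3)] lam mp by (auto simp: t_def \<nu>k_def field_simps)
    define b where "b = t * R\<^sup>2 / 2"
    have tsmall: "t * (R\<^sup>2 + 1) < min \<epsilon> \<alpha>"
    proof -
      have "t = (\<nu>k - \<nu>) * \<mu> k0" using mp by (simp add: t_def \<nu>k_def left_diff_distrib)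
      also have "\<dots> < min \<epsilon> \<alpha> / (\<mu> k0 * (R\<^sup>2 + 1)) * \<mu> k0"
        using lam mp by (intro mult_strict_right_mono) (auto simp: \<delta>_def)
      also have "\<dots> = min \<epsilon> \<alpha> / (R\<^sup>2 + 1)" using mp by simp
      finally show ?thesis using R1 by (simp add: pos_less_divide_eq)
    qed
    have b0: "0 \<le> b" using t by (simp add: b_def)
    have "2 * b < min \<epsilon> \<alpha>" using tsmall t by (simp add: b_def distrib_left)
    then have b: "b < \<epsilon>" "b < \<alpha> / 2" using b0 by auto
    have IY: "I \<nu> y \<le> t * (norm (restr A2 y))\<^sup>2 / 2" if y: "y \<in> span (unit ` ?A)" for y
    proof -
      define u v where "u = restr A1 y" and "v = restr A2 y"
      have yuv: "y = u + v" using span_unit_decomp[OF y] by (simp add: u_def v_def)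
      have o: "T \<nu> u \<bullet> v = 0" "T \<nu> v \<bullet> u = 0" unfolding u_def v_def T_restr by (simp_all add: inner_restr_disjoint)
      have "T \<nu> u \<bullet> u \<le> - c0 * (norm u)\<^sup>2" unfolding u_def by (rule T_upper) (use gap(4) l0 in auto)
      moreover have "T \<nu> v \<bullet> v \<le> t * (norm v)\<^sup>2" unfolding v_def by (rule T_upper) (auto simp: A2_def t_def)
      moreover have "0 \<le> c0 * (norm u)\<^sup>2" using gap(1) by simp
      ultimately have "T \<nu> y \<bullet> y \<le> t * (norm v)\<^sup>2"
        using o by (simp add: yuv T_linear inner_add_left inner_add_right)
      then show ?thesis using \<Phi>_nonneg[of y] by (simp add: I_def v_def)
    qed
    have YR: "norm y \<le> R" if "y \<in> span (unit ` ?A)" "0 < I \<nu> y" for y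
      using C[OF l0(4) that(1)] that(2) by (intro inR) linarith
    have Yb: "I \<nu> y \<le> b" if y: "y \<in> span (unit ` ?A)" for y
    proof (cases "0 < I \<nu> y")
      case True
      have "(norm (restr A2 y))\<^sup>2 \<le> R\<^sup>2"
        using YR[OF y True] norm_restr_le[of A2 y] by (intro power_mono) auto
      then have "t * (norm (restr A2 y))\<^sup>2 \<le> t * R\<^sup>2" using t by (intro mult_left_mono) auto
      then show ?thesis using IY[OF y] by (simp add: b_def)
    qed (use b0 in simp)
    have t8: "0 < t / 8" using t by simp
    obtain \<rho> where \<rho>: "\<rho> > 0" "\<And>u. norm u \<le> \<rho> \<Longrightarrow> \<Phi> u \<le> t / 8 * (norm u)\<^sup>2" using small[OF t8] by blast
    \<comment> \<open>On the sphere of radius \<open>\<rho>\<close> in \<open>A2 \<union> A3\<close>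
      the level is at least \<open>3 * t * \<rho>\<^sup>2 / 8\<close>, above \<open>a\<close>. On
      the span, \<open>norm (restr A2 y) \<le> \<rho> / 2\<close> bounds the level by
      \<open>t * (\<rho> / 2)\<^sup>2 / 2 = a'\<close>.\<close>
    define a' a where "a' = t * \<rho>\<^sup>2 / 8" and "a = t * \<rho>\<^sup>2 / 4"
    have tr: "0 < t * \<rho>\<^sup>2" using t \<rho> by simp
    have aa: "0 < a'" "a' < a" using tr by (simp_all add: a'_def a_def)
    have no: False if "restr A2 u = 0" "G \<nu> u - restr A2 (G \<nu> u) = 0" "a' \<le> I \<nu> u" "I \<nu> u \<le> b" for u
      using nc(3)[OF l0(2,3) that(1,2)] that(3,4) aa b by linarith
    obtain \<gamma> \<sigma> where gs: "\<gamma> > 0" "\<sigma> > 0" 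
      "\<And>u. \<lbrakk>a' \<le> I \<nu> u; I \<nu> u \<le> b; norm (restr A2 u) \<le> 2 * \<gamma>\<rbrakk> \<Longrightarrow> \<sigma> \<le> norm (G \<nu> u - restr A2 (G \<nu> u))"
    proof (rule nabla_condition[of \<nu> a' b], goal_cases)
      case (1 u) then show ?case using no by blast
    next
      case (2 \<gamma> \<sigma>) show ?case by (rule that[OF 2(2-4)])
    qed
    have two: "\<exists>w. w \<noteq> u1 \<and> G \<nu> w = 0 \<and> a' \<le> I \<nu> w \<and> I \<nu> w \<le> b" if u1: "restr A2 u1 \<noteq> 0" for u1
    proof (rule nabla_critical[OF descent_I A_finite A_disjoint(1), where \<rho>' = "\<rho> / 2" and \<rho> = \<rho> and a = a and \<gamma> = \<gamma> and ?\<sigma>0.0 = \<sigma> and R = R])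
      show "\<rho> / 2 < norm (restr A2 y) \<and> norm y \<le> R" if y: "y \<in> span (unit ` ?A)" "a' < I \<nu> y" for y
      proof
        show "norm y \<le> R" using YR y aa by force
        show "\<rho> / 2 < norm (restr A2 y)"
        proof (rule ccontr)
          assume "\<not> ?thesis"
          then have "(norm (restr A2 y))\<^sup>2 \<le> (\<rho> / 2)\<^sup>2" by (intro power_mono) auto
          then have "t * (norm (restr A2 y))\<^sup>2 \<le> t * (\<rho> / 2)\<^sup>2" using t by (intro mult_left_mono) auto
          then have "I \<nu> y \<le> a'" using IY[OF y(1)] by (simp add: a'_def power_divide)
          then show False using y by simp
        qed
      qed
      show "a < I \<nu> w" if w: "restr A1 w = 0" "norm w = \<rho>" for w
      proof -
        have r: "restr (A2 \<union> A3) w = w"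
        proof (rule ell2_eqI)
          fix i have "coord (restr A1 w) i = 0" using w by simp
          then show "coord (restr (A2 \<union> A3) w) i = coord w i" by (auto simp: A1_def A2_def A3_def split: if_splits)
        qed
        have "t * (norm (restr (A2 \<union> A3) w))\<^sup>2 \<le> T \<nu> (restr (A2 \<union> A3) w) \<bullet> restr (A2 \<union> A3) w"
        proof (rule T_lower)
          show "t \<le> 1 - \<nu> * \<mu> i" if "i \<in> A2 \<union> A3" for i
            using that gap(5)[OF l0(1,3), of i] t by (auto simp: A2_def t_def)
        qed
        then have "t * \<rho>\<^sup>2 \<le> T \<nu> w \<bullet> w" using r w by simp
        moreover have "\<Phi> w \<le> t / 8 * \<rho>\<^sup>2" using \<rho>(2)[of w] w by simp
        ultimately show ?thesis using tr by (simp add: I_def a_def)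
      qed
    qed (use \<rho> aa gs Yb palais_smale_I u1 in auto)
    have "coord (restr A2 (unit k0)) k0 \<noteq> 0" by (simp add: A2_def coord_unit)
    then have "restr A2 (unit k0) \<noteq> 0" by force
    from two[OF this] obtain w1 where w1: "G \<nu> w1 = 0" "a' \<le> I \<nu> w1" "I \<nu> w1 \<le> b" by blast
    \<comment> \<open>A critical point without \<open>A2\<close>-part would be a constrained one at
      a forbidden level.\<close>
    have "restr A2 w1 \<noteq> 0" using no[of w1] w1 by auto
    from two[OF this] obtain w2 where w2: "w2 \<noteq> w1" "G \<nu> w2 = 0" "a' \<le> I \<nu> w2" "I \<nu> w2 \<le> b" by blast
    have d0: "descent (I \<nu>) (G \<nu>) (\<lambda>_. 0)" 
    proof -
      have "restr {} = (\<lambda>_. 0)" by (rule ext) simp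
      then show ?thesis using descent_I[of \<nu> "{}"] by simp
    qed
    \<comment> \<open>\<open>3 * \<alpha> / 4\<close> exceeds \<open>b\<close>, so the face of the
      enlarged span where coordinate \<open>j\<close> vanishes lies below it.\<close>
    have "\<exists>w. G \<nu> w = 0 \<and> 3 * \<alpha> / 4 \<le> I \<nu> w \<and> I \<nu> w \<le> C3"
    proof (rule linking_critical[OF d0 fA j \<rho>3(1), where a = \<alpha> and R = R])
      show "I \<nu> y \<le> C3" if "y \<in> span (unit ` insert j ?A)" for y
        using C3[OF l0(4) that] by (smt (verit) zero_le_power2 divide_nonneg_nonneg)
      show "coord y j \<noteq> 0 \<and> norm y \<le> R" if y: "y \<in> span (unit ` insert j ?A)" "3 * \<alpha> / 4 < I \<nu> y" for y
      proof
        show "norm y \<le> R" using C3[OF l0(4) y(1)] y(2) \<alpha> by (intro inR) linarith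
        show "coord y j \<noteq> 0"
        proof
          assume z: "coord y j = 0"
          have "y = restr (insert j ?A) y" using restr_eq_span[OF y(1)] by simp
          also have "\<dots> = restr ?A y" using z by (intro ell2_eqI) auto
          also have "\<dots> \<in> span (unit ` ?A)" using fA by (intro restr_in_span) auto
          finally have "I \<nu> y \<le> b" by (rule Yb)
          then show False using y(2) b \<alpha> by linarith
        qed
      qed
      show "\<alpha> < I \<nu> w" if "restr ?A w = 0" "norm w = \<rho>3" for w using S3[OF l0(1,3) that] .
    qed (use \<alpha> palais_smale_I in \<open>auto simp: I_zero\<close>)
    then obtain w3 where w3: "G \<nu> w3 = 0" "3 * \<alpha> / 4 \<le> I \<nu> w3" by blast
    have "w1 \<noteq> 0" "w2 \<noteq> 0" "w3 \<noteq> 0" using w1 w2 w3 aa \<alpha> I_zero by fastforce+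
    moreover have "w1 \<noteq> w3" "w2 \<noteq> w3" using w1 w2 w3 b \<alpha> by fastforce+
    ultimately show "\<exists>w1 w2 w3. G \<nu> w1 = 0 \<and> G \<nu> w2 = 0 \<and> G \<nu> w3 = 0 \<and> w1 \<noteq> 0 \<and> w2 \<noteq> 0 \<and> w3 \<noteq> 0
        \<and> w1 \<noteq> w2 \<and> w1 \<noteq> w3 \<and> w2 \<noteq> w3" using w1 w2 w3 by blast
  qed
qed

end

end

section \<open>Eigenbasis coordinates for a compact embedding\<close>

text \<open>The coordinates have to be \<open>L (unit i)\<close>. Evaluating \<open>L\<close> at the
  truncation \<open>x\<close> with these coordinates gives \<open>s = L x \<le> C * sqrt s\<close>,
  which bounds the partial sums of squares.\<close>

lemma ell2_riesz:
  fixes L :: "ell2 \<Rightarrow> real"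
  assumes add: "\<And>h k. L (h + k) = L h + L k" and scale: "\<And>c h. L (c *\<^sub>R h) = c * L h"
    and bound: "\<And>h. \<bar>L h\<bar> \<le> C * norm h"
  obtains z where "\<And>h. z \<bullet> h = L h"
proof -
  have lin: "linear L" by (rule linearI) (simp_all add: add scale)
  have C0: "0 \<le> C"
    using bound[of "unit 0"] by (simp add: norm_eq_sqrt_inner coord_unit)
  have rs: "L (restr {..<n} h) = (\<Sum>i<n. coord h i * L (unit i))" for n h
    by (simp add: restr_finite linear_sum[OF lin] scale)
  have "(\<Sum>i<n. (L (unit i))\<^sup>2) \<le> C\<^sup>2" for n
  proof -
    define x where "x = (\<Sum>i<n. L (unit i) *\<^sub>R unit i)"
    define s where "s = (\<Sum>i<n. (L (unit i))\<^sup>2)"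
    have "s = L x" by (simp add: x_def s_def linear_sum[OF lin] scale power2_eq_square)
    have "x \<bullet> x = s"
    proof -
      have "coord x i = (if i < n then L (unit i) else 0)" for i
        by (simp add: x_def coord_unit if_distrib cong: if_cong)
      then show ?thesis by (subst (2) x_def) (simp add: inner_sum_right s_def power2_eq_square)
    qed
    then have nx: "norm x = sqrt s" by (simp add: norm_eq_sqrt_inner)
    have s0: "0 \<le> s" by (auto simp: s_def intro: sum_nonneg)
    have "s \<le> C * sqrt s" using bound[of x] nx \<open>s = L x\<close> by simp
    show "s \<le> C\<^sup>2"
    proof (cases "s = 0")
      case False
      then have "sqrt s > 0" using s0 by simp
      moreover have "sqrt s * sqrt s \<le> C * sqrt s" using \<open>s \<le> C * sqrt s\<close> s0 by simp
      ultimately have "sqrt s \<le> C" by (metis mult_right_le_imp_le)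
      then have "(sqrt s)\<^sup>2 \<le> C\<^sup>2" using s0 by (intro power_mono) auto
      then show ?thesis using s0 by simp
    qed simp
  qed
  from ell2_exI[OF this C0] obtain z where z: "coord z = (\<lambda>i. L (unit i))" by blast
  show ?thesis
  proof (rule that[of z])
    fix h
    have "(\<lambda>n. L (restr {..<n} h)) \<longlonglongrightarrow> z \<bullet> h"
      using inner_sums[of h z] unfolding sums_def rs by (simp add: z inner_commute)
    moreover have "(\<lambda>n. L (restr {..<n} h)) \<longlonglongrightarrow> L h"
    proof -
      have "bounded_linear L" by (rule bounded_linear_intro[of _ C]) (use add scale bound in \<open>auto simp: mult.commute\<close>)
      from bounded_linear.tendsto[OF this restr_lessThan_tendsto] show ?thesis .
    qed
    ultimately show "z \<bullet> h = L h" by (rule LIMSEQ_unique)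
  qed
qed

text \<open>Only semidefinite, because \<open>X0\<close> consists of functions rather than of classes modulo null functions.\<close>
locale semi_inner =
  fixes X :: "'b::real_vector set" and F :: "'b \<Rightarrow> 'b \<Rightarrow> real"
  assumes sub: "subspace X"
    and F_add: "\<And>u v w. \<lbrakk>u \<in> X; v \<in> X; w \<in> X\<rbrakk> \<Longrightarrow> F (u + v) w = F u w + F v w"
    and F_scale: "\<And>c u w. \<lbrakk>u \<in> X; w \<in> X\<rbrakk> \<Longrightarrow> F (c *\<^sub>R u) w = c * F u w"
    and F_sym: "\<And>u v. F u v = F v u"
    and F_nonneg: "\<And>u. 0 \<le> F u u"
begin

lemma in_X [simp]: "\<lbrakk>u \<in> X; v \<in> X\<rbrakk> \<Longrightarrow> u + v \<in> X" "u \<in> X \<Longrightarrow> c *\<^sub>R u \<in> X" "\<lbrakk>u \<in> X; v \<in> X\<rbrakk> \<Longrightarrow> u - v \<in> X" "0 \<in> X" "u \<in> X \<Longrightarrow> - u \<in> X"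
  using sub by (auto simp: subspace_add subspace_scale subspace_diff subspace_0 subspace_neg)

lemma sum_in_X [simp]: "(\<And>i. i \<in> A \<Longrightarrow> f i \<in> X) \<Longrightarrow> sum f A \<in> X"
  using sub by (rule subspace_sum)

lemma F_diff: "\<lbrakk>u \<in> X; v \<in> X; w \<in> X\<rbrakk> \<Longrightarrow> F (u - v) w = F u w - F v w"
  using F_add[of u "(-1) *\<^sub>R v" w] F_scale[of v w "-1"] by simp

lemma F_add2: "\<lbrakk>u \<in> X; v \<in> X; w \<in> X\<rbrakk> \<Longrightarrow> F w (u + v) = F w u + F w v"
  and F_scale2: "\<lbrakk>u \<in> X; w \<in> X\<rbrakk> \<Longrightarrow> F w (c *\<^sub>R u) = c * F w u"
  and F_diff2: "\<lbrakk>u \<in> X; v \<in> X; w \<in> X\<rbrakk> \<Longrightarrow> F w (u - v) = F w u - F w v"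
  using F_add[of u v w] F_scale[of u w c] F_diff[of u v w] by (simp_all add: F_sym[of w])

lemmas F_lin = F_add F_scale F_diff F_add2 F_scale2 F_diff2

lemma F_zero [simp]: "w \<in> X \<Longrightarrow> F 0 w = 0" "w \<in> X \<Longrightarrow> F w 0 = 0"
  using F_scale[of w w 0] F_scale2[of w w 0] by simp_all

lemma F_sum: "\<lbrakk>\<And>i. i \<in> A \<Longrightarrow> x i \<in> X; w \<in> X\<rbrakk> \<Longrightarrow> F (\<Sum>i\<in>A. c i *\<^sub>R x i) w = (\<Sum>i\<in>A. c i * F (x i) w)"
  by (induction A rule: infinite_finite_induct) (simp_all add: F_lin)

lemma cauchy_schwarz:
  assumes "u \<in> X" "v \<in> X" shows "(F u v)\<^sup>2 \<le> F u u * F v v"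
proof -
  have q: "0 \<le> F u u + 2 * t * F u v + t\<^sup>2 * F v v" for t
    using F_nonneg[of "u + t *\<^sub>R v"] assms by (simp add: F_lin F_sym[of v u] power2_eq_square algebra_simps)
  show ?thesis
  proof (cases "F v v = 0")
    case True
    have "F u v = 0"
    proof (rule ccontr)
      assume n: "F u v \<noteq> 0"
      then show False using q[of "- (F u u + 1) / (2 * F u v)"] True by (simp add: field_simps)
    qed
    then show ?thesis using True by simp
  next
    case False
    then have p: "0 < F v v" using F_nonneg[of v] by simp
    have "0 \<le> (F u u + 2 * (- F u v / F v v) * F u v + (- F u v / F v v)\<^sup>2 * F v v) * F v v"
      by (intro mult_nonneg_nonneg q) (use p in auto)
    also have "\<dots> = F u u * F v v - (F u v)\<^sup>2" using p by (simp add: field_simps power2_eq_square)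
    finally show ?thesis by simp
  qed
qed

lemma F_tendsto:
  assumes "\<And>n. u n \<in> X" "l \<in> X" "w \<in> X" "(\<lambda>n. F (u n - l) (u n - l)) \<longlonglongrightarrow> 0"
  shows "(\<lambda>n. F (u n) w) \<longlonglongrightarrow> F l w"
proof -
  have "(\<lambda>n. F (u n - l) w) \<longlonglongrightarrow> 0"
  proof (rule tendsto_0_le[where K = 1])
    have "(\<lambda>n. sqrt (F (u n - l) (u n - l) * F w w)) \<longlonglongrightarrow> sqrt (0 * F w w)" by (intro tendsto_intros assms)
    then show "(\<lambda>n. sqrt (F (u n - l) (u n - l) * F w w)) \<longlonglongrightarrow> 0" by simp
    show "\<forall>\<^sub>F n in sequentially. norm (F (u n - l) w) \<le> norm (sqrt (F (u n - l) (u n - l) * F w w)) * 1"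
    proof (intro always_eventually allI)
      fix n
      have "\<bar>F (u n - l) w\<bar> \<le> sqrt (F (u n - l) (u n - l) * F w w)"
        using cauchy_schwarz[of "u n - l" w] assms by (intro real_le_rsqrt) simp
      then show "norm (F (u n - l) w) \<le> norm (sqrt (F (u n - l) (u n - l) * F w w)) * 1" by simp
    qed
  qed
  then show ?thesis using assms by (simp add: F_diff LIM_zero_iff)
qed

lemma F_tendsto_diag:
  assumes "\<And>n. u n \<in> X" "l \<in> X" "(\<lambda>n. F (u n - l) (u n - l)) \<longlonglongrightarrow> 0"
  shows "(\<lambda>n. F (u n) (u n)) \<longlonglongrightarrow> F l l"
proof -
  have "F (u n) (u n) = F (u n - l) (u n - l) + 2 * F (u n) l - F l l" for n
    using assms by (simp add: F_lin F_sym[of l "u n"])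
  moreover have "(\<lambda>n. F (u n - l) (u n - l) + 2 * F (u n) l - F l l) \<longlonglongrightarrow> 0 + 2 * F l l - F l l"
    by (intro tendsto_intros assms F_tendsto)
  ultimately show ?thesis by simp
qed

end

text \<open>\<open>E\<close> is the energy and \<open>B\<close> the \<open>L2\<close> product.
  \<open>infinite_dim\<close> guarantees that the successive maximisation never stops, so that the
  coordinates run through all natural numbers.\<close>

locale compact_embedding = E: semi_inner X E + B: semi_inner X B
  for X :: "'b::real_vector set" and E B :: "'b \<Rightarrow> 'b \<Rightarrow> real" +
  assumes poincare: "\<exists>C. \<forall>u\<in>X. B u u \<le> C * E u u"
    and B_zero: "\<And>u. \<lbrakk>u \<in> X; B u u = 0\<rbrakk> \<Longrightarrow> E u u = 0"
    and complete: "\<And>u. \<lbrakk>\<And>n::nat. u n \<in> X; \<And>e. 0 < e \<Longrightarrow> \<exists>N. \<forall>m\<ge>N. \<forall>n\<ge>N. E (u m - u n) (u m - u n) < e\<rbrakk>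
        \<Longrightarrow> \<exists>l\<in>X. (\<lambda>n. E (u n - l) (u n - l)) \<longlonglongrightarrow> 0"
    and compact: "\<And>u C. \<lbrakk>\<And>n::nat. u n \<in> X; \<And>n. E (u n) (u n) \<le> C\<rbrakk>
        \<Longrightarrow> \<exists>r::nat \<Rightarrow> nat. strict_mono r \<and> (\<forall>e>0. \<exists>N. \<forall>m\<ge>N. \<forall>n\<ge>N. B (u (r m) - u (r n)) (u (r m) - u (r n)) < e)"
    and infinite_dim: "\<exists>w. \<forall>i j::nat. w i \<in> X \<and> B (w i) (w j) = (if i = j then 1 else 0)"
begin

text \<open>The equation says that \<open>e i\<close> is an eigenvector of the operator representing
  \<open>B\<close> in the inner product \<open>E\<close>. Its eigenvalue
  \<open>B (e i) (e i)\<close> is the reciprocal of a Dirichlet eigenvalue.\<close>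

definition eigen :: "(nat \<Rightarrow> 'b) \<Rightarrow> nat \<Rightarrow> bool" where
  "eigen e n \<longleftrightarrow> (\<forall>i<n. e i \<in> X \<and> 0 < B (e i) (e i) \<and> (\<forall>\<phi>\<in>X. B (e i) \<phi> = B (e i) (e i) * E (e i) \<phi>)
     \<and> (\<forall>j<n. E (e i) (e j) = (if i = j then 1 else 0)))"

text \<open>By the eigenvector equation, \<open>E\<close>-orthogonality of \<open>v\<close> to the
  \<open>e i\<close> implies \<open>B\<close>-orthogonality, so Pythagoras holds for both forms at
  once.\<close>

lemma projection:
  assumes e: "eigen e n" and u: "u \<in> X"
  defines "v \<equiv> u - (\<Sum>i<n. E u (e i) *\<^sub>R e i)"
  shows "v \<in> X" "\<And>j. j < n \<Longrightarrow> E v (e j) = 0"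
    "E u u = E v v + (\<Sum>i<n. (E u (e i))\<^sup>2)" "B u u = B v v + (\<Sum>i<n. B (e i) (e i) * (E u (e i))\<^sup>2)"
proof -
  have eX: "e i \<in> X" and eE: "\<And>j. j < n \<Longrightarrow> E (e i) (e j) = (if i = j then 1 else 0)"
    and eB: "\<And>\<phi>. \<phi> \<in> X \<Longrightarrow> B (e i) \<phi> = B (e i) (e i) * E (e i) \<phi>" if "i < n" for i
    using e that unfolding eigen_def by blast+
  let ?p = "\<Sum>i<n. E u (e i) *\<^sub>R e i"
  have p: "?p \<in> X" using eX by (intro E.sum_in_X E.in_X) auto
  show v: "v \<in> X" unfolding v_def using u p by simp
  show o: "E v (e j) = 0" if "j < n" for j
  proof -
    have "E ?p (e j) = (\<Sum>i<n. E u (e i) * E (e i) (e j))" by (rule E.F_sum) (use eX that in auto)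
    also have "\<dots> = (\<Sum>i<n. if i = j then E u (e i) else 0)" using eE[OF _ that] by (intro sum.cong) auto
    also have "\<dots> = E u (e j)" using that by simp
    finally have "E ?p (e j) = E u (e j)" .
    then show ?thesis unfolding v_def using u p eX[OF that] that by (simp add: E.F_lin)
  qed
  have upv: "u = v + ?p" by (simp add: v_def)
  have Evp: "E v ?p = 0" unfolding E.F_sym[of v] using v eX o by (subst E.F_sum) (auto simp: E.F_sym[of "e _" v])
  have "B (e i) v = 0" if "i < n" for i using eB[OF that v] o[OF that] by (simp add: E.F_sym[of "e i" v])
  then have Bvp: "B v ?p = 0" unfolding B.F_sym[of v] using v eX by (subst B.F_sum) auto
  have pj: "E ?p (e j) = E u (e j)" if "j < n" for j
    using o[OF that] eX[OF that] u p unfolding v_def by (simp add: E.F_lin)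
  have "E ?p ?p = (\<Sum>i<n. (E u (e i))\<^sup>2)"
    using eX p by (subst E.F_sum) (auto simp: E.F_sym[of "e _" ?p] pj power2_eq_square intro!: sum.cong)
  moreover have "B ?p ?p = (\<Sum>i<n. B (e i) (e i) * (E u (e i))\<^sup>2)"
  proof -
    have "B (e i) ?p = B (e i) (e i) * E u (e i)" if "i < n" for i
      unfolding eB[OF that p] E.F_sym[of "e i" ?p] pj[OF that] ..
    then show ?thesis using eX p by (subst B.F_sum) (auto simp: power2_eq_square intro!: sum.cong)
  qed
  moreover have "E u u = E v v + 2 * E v ?p + E ?p ?p" "B u u = B v v + 2 * B v ?p + B ?p ?p"
    by (subst (1 2) upv, use v p in \<open>simp add: E.F_lin E.F_sym[of ?p v] del: E.F_sum\<close>,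
        subst (1 2) upv, use v p in \<open>simp add: B.F_lin B.F_sym[of ?p v] del: B.F_sum\<close>)
  ultimately show "E u u = E v v + (\<Sum>i<n. (E u (e i))\<^sup>2)" "B u u = B v v + (\<Sum>i<n. B (e i) (e i) * (E u (e i))\<^sup>2)"
    using Evp Bvp by simp_all
qed

lemma B_null: "\<lbrakk>u \<in> X; E u u = 0\<rbrakk> \<Longrightarrow> B u u = 0"
  using poincare B.F_nonneg[of u] by (metis antisym mult_zero_right)

text \<open>If the orthogonal complement were null, \<open>E\<close> would be dominated by
  \<open>B\<close>. The \<open>B\<close>-orthonormal sequence of \<open>infinite_dim\<close> would
  then be bounded in energy and have a \<open>B\<close>-Cauchy subsequence, although its members are
  at squared distance 2.\<close>

lemma orthogonal_exists:
  assumes e: "eigen e n"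
  shows "\<exists>u\<in>X. (\<forall>i<n. E u (e i) = 0) \<and> 0 < E u u"
proof (rule ccontr)
  assume "\<not> ?thesis"
  then have neg: "E u u = 0" if "u \<in> X" "\<And>i. i < n \<Longrightarrow> E u (e i) = 0" for u
    using that E.F_nonneg[of u] by (metis less_eq_real_def)
  define c where "c = Min (insert 1 ((\<lambda>i. B (e i) (e i)) ` {..<n}))"
  have "0 < B (e i) (e i)" if "i < n" for i using e that unfolding eigen_def by blast
  then have c: "c > 0" "\<And>i. i < n \<Longrightarrow> c \<le> B (e i) (e i)" by (auto simp: c_def)
  have bd: "c * E u u \<le> B u u" if u: "u \<in> X" for u
  proof -
    let ?v = "u - (\<Sum>i<n. E u (e i) *\<^sub>R e i)"
    note p = projection[OF e u]
    have "E ?v ?v = 0" by (rule neg[OF p(1,2)])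
    then have "E u u = (\<Sum>i<n. (E u (e i))\<^sup>2)" "B u u = (\<Sum>i<n. B (e i) (e i) * (E u (e i))\<^sup>2)"
      using p(3,4) B_null[OF p(1)] by auto
    then show ?thesis using c by (auto simp: sum_distrib_left intro!: sum_mono mult_right_mono)
  qed
  obtain w where w: "\<And>i::nat. w i \<in> X" "\<And>i j. B (w i) (w j) = (if i = j then 1 else 0)" using infinite_dim by metis
  have "E (w i) (w i) \<le> 1 / c" for i using bd[OF w(1), of i] w(2)[of i i] c by (simp add: field_simps)
  from compact[of w, OF w(1) this] obtain r where r: "strict_mono (r :: nat \<Rightarrow> nat)"
    "\<forall>e>0. \<exists>N. \<forall>m\<ge>N. \<forall>n\<ge>N. B (w (r m) - w (r n)) (w (r m) - w (r n)) < e" by blast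
  then obtain N where N: "\<And>m n. \<lbrakk>m \<ge> N; n \<ge> N\<rbrakk> \<Longrightarrow> B (w (r m) - w (r n)) (w (r m) - w (r n)) < 1" by (meson zero_less_one)
  have "r N \<noteq> r (Suc N)" using r(1) by (metis lessI nat_neq_iff strict_mono_less)
  then have "B (w (r N) - w (r (Suc N))) (w (r N) - w (r (Suc N))) = 2"
    using w by (simp add: B.F_lin)
  then show False using N[of N "Suc N"] by simp
qed

text \<open>The Rayleigh quotient of \<open>B\<close> by \<open>E\<close> is maximised on the
  complement of the earlier eigenvectors. The first variation gives the eigenvector equation against
  that complement; against the earlier vectors both sides vanish.\<close>

lemma maximizer:
  assumes e: "eigen e n"
  shows "\<exists>u\<in>X. E u u = 1 \<and> (\<forall>i<n. E u (e i) = 0) \<and> 0 < B u u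
     \<and> (\<forall>\<phi>\<in>X. (\<forall>i<n. E \<phi> (e i) = 0) \<longrightarrow> B \<phi> \<phi> \<le> B u u * E \<phi> \<phi>) \<and> (\<forall>\<phi>\<in>X. B u \<phi> = B u u * E u \<phi>)"
proof -
  have eX: "e i \<in> X" and eB: "\<And>\<phi>. \<phi> \<in> X \<Longrightarrow> B (e i) \<phi> = B (e i) (e i) * E (e i) \<phi>" if "i < n" for i
    using e that unfolding eigen_def by blast+
  define X' where "X' = {u \<in> X. \<forall>i<n. E u (e i) = 0}"
  have X': "u + v \<in> X'" "c *\<^sub>R u \<in> X'" "u - v \<in> X'" if "u \<in> X'" "v \<in> X'" for u v c
    using that eX by (auto simp: X'_def E.F_lin)
  have XX: "u \<in> X" if "u \<in> X'" for u using that by (simp add: X'_def)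
  define S where "S = {B u u | u. u \<in> X' \<and> E u u = 1}"
  obtain C where C: "\<And>u. u \<in> X \<Longrightarrow> B u u \<le> C * E u u" using poincare by blast
  obtain u0 where u0: "u0 \<in> X'" "0 < E u0 u0" using orthogonal_exists[OF e] by (auto simp: X'_def)
  have norm1: "E ((1 / sqrt (E u u)) *\<^sub>R u) ((1 / sqrt (E u u)) *\<^sub>R u) = 1"
    "B ((1 / sqrt (E u u)) *\<^sub>R u) ((1 / sqrt (E u u)) *\<^sub>R u) = B u u / E u u" if "u \<in> X" "0 < E u u" for u
    using that by (simp_all add: E.F_lin B.F_lin)
  have bdd: "bdd_above S" using C XX by (intro bdd_aboveI[of _ C]) (fastforce simp: S_def)
  have S0: "B u u / E u u \<in> S" if "u \<in> X'" "0 < E u u" for u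
    unfolding S_def using norm1[OF XX that(2)] X'(2)[OF that(1) that(1)] that(1) by force
  define s where "s = Sup S"
  have sup: "B \<phi> \<phi> \<le> s * E \<phi> \<phi>" if "\<phi> \<in> X'" for \<phi>
  proof (cases "E \<phi> \<phi> = 0")
    case True then show ?thesis using B_null[OF XX[OF that]] by simp
  next
    case False
    then have p: "0 < E \<phi> \<phi>" using E.F_nonneg[of \<phi>] by simp
    have "B \<phi> \<phi> / E \<phi> \<phi> \<le> s" unfolding s_def by (rule cSup_upper[OF S0[OF that p] bdd])
    then show ?thesis using p by (simp add: field_simps)
  qed
  have "B u0 u0 \<noteq> 0" using B_zero[OF XX[OF u0(1)]] u0 by auto
  then have "0 < B u0 u0" using B.F_nonneg[of u0] by simp
  then have s: "0 < s" using sup[OF u0(1)] u0(2) by (smt (verit) mult_nonpos_nonneg)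
  have "\<exists>u\<in>X'. E u u = 1 \<and> s - inverse (real (Suc k)) < B u u" for k
  proof -
    have "s - inverse (real (Suc k)) < Sup S" by (simp add: s_def)
    then show ?thesis using less_cSup_iff[of S] S0[OF u0] bdd by (auto simp: S_def)
  qed
  then obtain u where u: "\<And>k. u k \<in> X'" "\<And>k. E (u k) (u k) = 1" "\<And>k. s - inverse (real (Suc k)) < B (u k) (u k)"
    by metis
  have uX: "u k \<in> X" for k using XX u by blast
  obtain r where r: "strict_mono (r :: nat \<Rightarrow> nat)"
    "\<forall>e>0. \<exists>N. \<forall>m\<ge>N. \<forall>n\<ge>N. B (u (r m) - u (r n)) (u (r m) - u (r n)) < e"
  proof -
    have "\<exists>r::nat \<Rightarrow> nat. strict_mono r \<and> (\<forall>e>0. \<exists>N. \<forall>m\<ge>N. \<forall>n\<ge>N. B (u (r m) - u (r n)) (u (r m) - u (r n)) < e)"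
      by (rule compact[of u 1]) (use uX u(2) in auto)
    then show ?thesis using that by blast
  qed
  \<comment> \<open>Parallelogram law: since \<open>sup\<close> also applies to the sum,
    near-maximisers that are \<open>B\<close>-close are \<open>E\<close>-close. Compactness in
    \<open>B\<close> thus yields convergence in \<open>E\<close>.\<close>
  have par: "s * E (u k - u l) (u k - u l) \<le> 2 * inverse (real (Suc k)) + 2 * inverse (real (Suc l)) + B (u k - u l) (u k - u l)" for k l
  proof -
    have "B (u k + u l) (u k + u l) \<le> s * E (u k + u l) (u k + u l)" by (intro sup X' u)
    moreover have "E (u k + u l) (u k + u l) = 4 - E (u k - u l) (u k - u l)"
      using uX u(2) by (simp add: E.F_lin)
    moreover have "B (u k + u l) (u k + u l) = 2 * B (u k) (u k) + 2 * B (u l) (u l) - B (u k - u l) (u k - u l)"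
      using uX by (simp add: B.F_lin)
    ultimately show ?thesis using u(3)[of k] u(3)[of l] by (simp add: algebra_simps)
  qed
  have "\<exists>N. \<forall>m\<ge>N. \<forall>n\<ge>N. E (u (r m) - u (r n)) (u (r m) - u (r n)) < e" if e: "0 < e" for e
  proof -
    have se: "0 < s * e / 2" "0 < s * e / 8" using s e by auto
    obtain N1 where N1: "\<And>m n. \<lbrakk>m \<ge> N1; n \<ge> N1\<rbrakk> \<Longrightarrow> B (u (r m) - u (r n)) (u (r m) - u (r n)) < s * e / 2"
      using r(2) se(1) by meson
    obtain N2 where N2: "inverse (real (Suc N2)) < s * e / 8" using reals_Archimedean[OF se(2)] by blast
    have inv: "inverse (real (Suc (r m))) < s * e / 8" if "m \<ge> N2" for m
    proof -
      have "N2 \<le> r m" using that seq_suble[OF r(1), of m] by linarith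
      then have "inverse (real (Suc (r m))) \<le> inverse (real (Suc N2))" by simp
      then show ?thesis using N2 by linarith
    qed
    have "E (u (r m) - u (r n)) (u (r m) - u (r n)) < e" if "m \<ge> max N1 N2" "n \<ge> max N1 N2" for m n
    proof -
      have "s * E (u (r m) - u (r n)) (u (r m) - u (r n)) < s * e"
        using par[of "r m" "r n"] N1[of m n] inv[of m] inv[of n] that by simp
      then show ?thesis using s by simp
    qed
    then show ?thesis by blast
  qed
  from complete[of "\<lambda>n. u (r n)", OF uX this] obtain l where l: "l \<in> X" "(\<lambda>n. E (u (r n) - l) (u (r n) - l)) \<longlonglongrightarrow> 0"
    by auto
  have Bl: "(\<lambda>n. B (u (r n) - l) (u (r n) - l)) \<longlonglongrightarrow> 0"
  proof (rule tendsto_0_le[OF l(2), where K = "\<bar>C\<bar>"], intro always_eventually allI)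
    fix n
    have "B (u (r n) - l) (u (r n) - l) \<le> C * E (u (r n) - l) (u (r n) - l)" using C uX l by simp
    also have "\<dots> \<le> \<bar>C\<bar> * E (u (r n) - l) (u (r n) - l)" using E.F_nonneg by (intro mult_right_mono) auto
    finally show "norm (B (u (r n) - l) (u (r n) - l)) \<le> norm (E (u (r n) - l) (u (r n) - l)) * \<bar>C\<bar>"
      using B.F_nonneg E.F_nonneg by (simp add: mult.commute)
  qed
  have "(\<lambda>n. E (u (r n)) (u (r n))) \<longlonglongrightarrow> E l l" by (rule E.F_tendsto_diag[OF uX l])
  then have "(\<lambda>n. 1) \<longlonglongrightarrow> E l l" unfolding u(2) .
  then have El: "E l l = 1" by (rule LIMSEQ_unique[OF _ tendsto_const])
  have El0: "E l (e i) = 0" if "i < n" for i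
  proof -
    have "(\<lambda>n. E (u (r n)) (e i)) \<longlonglongrightarrow> E l (e i)" by (rule E.F_tendsto[OF uX l(1) eX[OF that] l(2)])
    moreover have "E (u k) (e i) = 0" for k using u(1)[of k] that by (simp add: X'_def)
    ultimately have "(\<lambda>n. 0) \<longlonglongrightarrow> E l (e i)" by simp
    then show ?thesis by (rule LIMSEQ_unique[OF _ tendsto_const])
  qed
  have lX': "l \<in> X'" using l El0 by (simp add: X'_def)
  have Bs: "B l l = s"
  proof (rule antisym)
    show "B l l \<le> s" using sup[OF lX'] El by simp
    have a: "(\<lambda>n. B (u (r n)) (u (r n))) \<longlonglongrightarrow> B l l" by (rule B.F_tendsto_diag[OF uX l(1) Bl])
    have "(\<lambda>n. s - inverse (real (Suc (r n)))) \<longlonglongrightarrow> s - 0"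
      using LIMSEQ_subseq_LIMSEQ[OF LIMSEQ_inverse_real_of_nat r(1)] by (intro tendsto_intros) (simp add: o_def)
    then have b: "(\<lambda>n. s - inverse (real (Suc (r n)))) \<longlonglongrightarrow> s" by simp
    show "s \<le> B l l" by (rule LIMSEQ_le[OF b a]) (use u(3) less_imp_le in blast)
  qed
  have lin0: "a = 0" if "\<And>t. 0 \<le> 2 * t * a + t\<^sup>2 * b" for a b :: real
  proof (rule ccontr)
    assume a: "a \<noteq> 0"
    define d where "d = \<bar>b\<bar> + 1"
    have d: "d > 0" by (simp add: d_def)
    define t where "t = - a / d"
    have "2 * t * a + t\<^sup>2 * b = (a / d)\<^sup>2 * (b - 2 * d)"
      using d by (simp add: t_def power2_eq_square field_simps)
    moreover have "0 < (a / d)\<^sup>2" using a d by simp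
    moreover have "b - 2 * d < 0" by (simp add: d_def)
    ultimately have "2 * t * a + t\<^sup>2 * b < 0" by (simp add: mult_pos_neg)
    then show False using that[of t] by linarith
  qed
  have EL': "B l \<phi> = s * E l \<phi>" if p: "\<phi> \<in> X'" for \<phi>
  proof -
    have "s * E l \<phi> - B l \<phi> = 0"
    proof (rule lin0[where b = "s * E \<phi> \<phi> - B \<phi> \<phi>"])
      fix t
      have "B (l + t *\<^sub>R \<phi>) (l + t *\<^sub>R \<phi>) \<le> s * E (l + t *\<^sub>R \<phi>) (l + t *\<^sub>R \<phi>)"
        by (intro sup X'(1) lX' X'(2)[OF p p])
      then show "0 \<le> 2 * t * (s * E l \<phi> - B l \<phi>) + t\<^sup>2 * (s * E \<phi> \<phi> - B \<phi> \<phi>)"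
        using XX[OF p] l Bs El
        by (simp add: E.F_lin B.F_lin E.F_sym[of \<phi> l] B.F_sym[of \<phi> l] power2_eq_square algebra_simps)
    qed
    then show ?thesis by simp
  qed
  have EL: "B l \<phi> = B l l * E l \<phi>" if p: "\<phi> \<in> X" for \<phi>
  proof -
    let ?p = "\<Sum>i<n. E \<phi> (e i) *\<^sub>R e i"
    have vX: "\<phi> - ?p \<in> X'" using projection(1,2)[OF e p] by (simp add: X'_def)
    have pX: "?p \<in> X" using eX by (intro E.sum_in_X E.in_X) auto
    have "E l ?p = 0" unfolding E.F_sym[of l] using l eX El0 by (subst E.F_sum) (auto simp: E.F_sym[of "e _" l])
    moreover have "B (e i) l = 0" if "i < n" for i using eB[OF that l(1)] El0[OF that] by (simp add: E.F_sym[of "e i" l])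
    then have "B l ?p = 0" unfolding B.F_sym[of l] using l eX by (subst B.F_sum) auto
    ultimately show ?thesis using EL'[OF vX] l p pX Bs by (simp add: E.F_diff2 B.F_diff2)
  qed
  have "B \<phi> \<phi> \<le> B l l * E \<phi> \<phi>" if "\<phi> \<in> X" "\<forall>i<n. E \<phi> (e i) = 0" for \<phi>
    unfolding Bs using that by (intro sup) (simp add: X'_def)
  moreover have "0 < B l l" unfolding Bs by (rule s)
  ultimately show ?thesis using l(1) El El0 EL by blast
qed

text \<open>Each vector maximises under constraints set by all earlier ones, whence the choice by
  well-founded recursion. The maxima decrease, and a \<open>B\<close>-Cauchy subsequence of the
  mutually \<open>B\<close>-orthogonal \<open>e i\<close> forces them to 0. A vector orthogonal to
  all \<open>e i\<close> satisfies \<open>B u u \<le> B (e n) (e n) * E u u\<close> for every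
  \<open>n\<close>, so it is null.\<close>

lemma eigenbasis:
  obtains e where "\<And>i::nat. e i \<in> X" "\<And>i j. E (e i) (e j) = (if i = j then 1 else 0)"
    "\<And>i. 0 < B (e i) (e i)" "\<And>i \<phi>. \<phi> \<in> X \<Longrightarrow> B (e i) \<phi> = B (e i) (e i) * E (e i) \<phi>"
    "(\<lambda>i. B (e i) (e i)) \<longlonglongrightarrow> 0"
    "\<And>u. \<lbrakk>u \<in> X; \<And>i. E u (e i) = 0\<rbrakk> \<Longrightarrow> E u u = 0"
proof -
  define Q where "Q e n u \<longleftrightarrow> u \<in> X \<and> E u u = 1 \<and> (\<forall>i<n. E u (e i) = 0) \<and> 0 < B u u
     \<and> (\<forall>\<phi>\<in>X. (\<forall>i<n. E \<phi> (e i) = 0) \<longrightarrow> B \<phi> \<phi> \<le> B u u * E \<phi> \<phi>) \<and> (\<forall>\<phi>\<in>X. B u \<phi> = B u u * E u \<phi>)" for e and n :: nat and u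
  have orth: "E (e i) (e j) = (if i = j then 1 else 0)" if "\<And>k. k < n \<Longrightarrow> Q e k (e k)" "i < n" "j < n" for e n i j
  proof -
    have *: "E (e k) (e k) = 1" "\<And>l. l < k \<Longrightarrow> E (e k) (e l) = 0" if "k < n" for k
      using \<open>\<And>k. k < n \<Longrightarrow> Q e k (e k)\<close>[OF that] unfolding Q_def by blast+
    show ?thesis using *[OF that(2)] *[OF that(3)] E.F_sym[of "e i" "e j"]
      by (cases i j rule: linorder_cases) auto
  qed
  have "\<exists>e. \<forall>n. Q e n (e n)"
  proof (rule dependent_wf_choice[OF wf_less_than])
    show "Q f n u = Q g n u" if "\<And>z. (z, n) \<in> less_than \<Longrightarrow> f z = g z" for f g n u
      using that by (auto simp: Q_def)
    show "\<exists>u. Q f n u" if "\<And>k. (k, n) \<in> less_than \<Longrightarrow> Q f k (f k)" for n f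
    proof -
      have "eigen f n" unfolding eigen_def
      proof (intro allI impI conjI)
        fix i j assume "i < n" "j < n"
        then show "E (f i) (f j) = (if i = j then 1 else 0)" using orth[of n f i j] that by simp
      qed (use that[unfolded less_than_iff Q_def] in blast)+
      then show ?thesis using maximizer[of f n] unfolding Q_def by blast
    qed
  qed
  then obtain e where e: "\<And>n. Q e n (e n)" by blast
  have eX: "\<And>i. e i \<in> X" and pos: "\<And>i. 0 < B (e i) (e i)" and EL: "\<And>i \<phi>. \<phi> \<in> X \<Longrightarrow> B (e i) \<phi> = B (e i) (e i) * E (e i) \<phi>"
    using e unfolding Q_def by blast+
  have o: "E (e i) (e j) = (if i = j then 1 else 0)" for i j
    using orth[of "Suc (max i j)" e i j] e by simp
  have max: "B \<phi> \<phi> \<le> B (e n) (e n) * E \<phi> \<phi>" if "\<phi> \<in> X" "\<And>i. i < n \<Longrightarrow> E \<phi> (e i) = 0" for \<phi> n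
    using e[of n] that unfolding Q_def by blast
  have mono: "B (e j) (e j) \<le> B (e i) (e i)" if "i \<le> j" for i j
    using max[OF eX, of i j] that o by simp
  have null: "(\<lambda>i. B (e i) (e i)) \<longlonglongrightarrow> 0"
  proof (rule LIMSEQ_I)
    fix d :: real assume d: "0 < d"
    obtain r where r: "strict_mono (r :: nat \<Rightarrow> nat)"
      "\<forall>d>0. \<exists>N. \<forall>m\<ge>N. \<forall>n\<ge>N. B (e (r m) - e (r n)) (e (r m) - e (r n)) < d"
    proof -
      have "\<exists>r::nat \<Rightarrow> nat. strict_mono r \<and> (\<forall>d>0. \<exists>N. \<forall>m\<ge>N. \<forall>n\<ge>N. B (e (r m) - e (r n)) (e (r m) - e (r n)) < d)"
        by (rule compact[of e 1]) (use eX o in auto)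
      then show ?thesis using that by blast
    qed
    then obtain N where N: "\<And>m n. \<lbrakk>m \<ge> N; n \<ge> N\<rbrakk> \<Longrightarrow> B (e (r m) - e (r n)) (e (r m) - e (r n)) < d" using d by meson
    have "r N < r (Suc N)" using r(1) by (simp add: strict_mono_less)
    then have "B (e (r N)) (e (r (Suc N))) = 0" using EL[OF eX, of "r N" "r (Suc N)"] o by simp
    then have "B (e (r N)) (e (r N)) < d" using N[of N "Suc N"] eX pos[of "r (Suc N)"]
      by (simp add: B.F_lin B.F_sym[of "e (r (Suc N))" "e (r N)"])
    then have "\<bar>B (e n) (e n)\<bar> < d" if "n \<ge> r N" for n using mono[OF that] pos[of n] by simp
    then show "\<exists>no. \<forall>n\<ge>no. norm (B (e n) (e n) - 0) < d" by auto
  qed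
  have "E u u = 0" if u: "u \<in> X" "\<And>i. E u (e i) = 0" for u
  proof -
    have "(\<lambda>n. B (e n) (e n) * E u u) \<longlonglongrightarrow> 0 * E u u" by (intro tendsto_intros null)
    then have "B u u \<le> 0" using max[OF u] by (intro LIMSEQ_le_const) auto
    then show ?thesis using B_zero[OF u(1)] B.F_nonneg[of u] by simp
  qed
  with that[of e] eX o pos EL null show ?thesis by blast
qed

text \<open>\<open>J h\<close> is an energy limit of the partial sums of the eigenvector expansion,
  chosen among limits that differ by null vectors. Hence \<open>J\<close> respects both forms, but
  linearity is not claimed.\<close>

theorem ell2_coordinates:
  obtains \<mu> J where "\<And>i. 0 < \<mu> i" "\<mu> \<longlonglongrightarrow> 0" "\<And>h. J h \<in> X" "\<And>h k. E (J h) (J k) = h \<bullet> k"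
    "\<And>h k. B (J h) (J k) = diag \<mu> h \<bullet> k" "\<And>u. u \<in> X \<Longrightarrow> \<exists>h. E (u - J h) (u - J h) = 0"
proof -
  obtain e where e: "\<And>i::nat. e i \<in> X" "\<And>i j. E (e i) (e j) = (if i = j then 1 else 0)"
    "\<And>i. 0 < B (e i) (e i)" "\<And>i \<phi>. \<phi> \<in> X \<Longrightarrow> B (e i) \<phi> = B (e i) (e i) * E (e i) \<phi>"
    "(\<lambda>i. B (e i) (e i)) \<longlonglongrightarrow> 0"
    "\<And>u. \<lbrakk>u \<in> X; \<And>i. E u (e i) = 0\<rbrakk> \<Longrightarrow> E u u = 0" by (rule eigenbasis) blast
  define S where "S h n = (\<Sum>i<n. coord h i *\<^sub>R e i)" for h n
  have SX: "S h n \<in> X" for h n unfolding S_def by (intro E.sum_in_X E.in_X e)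
  have ESu: "E (S h n) u = (\<Sum>i<n. coord h i * E (e i) u)" if "u \<in> X" for h n u
    unfolding S_def by (rule E.F_sum) (use e(1) that in auto)
  have ESe: "E (S h n) (e j) = (if j < n then coord h j else 0)" for h n j
    using ESu[OF e(1), of h n j] e(2) by (simp add: if_distrib cong: if_cong)
  have ESS: "E (S h m) (S h n) = (\<Sum>i<min m n. (coord h i)\<^sup>2)" for h m n
  proof -
    have "E (S h m) (S h n) = (\<Sum>i<m. if i < n then (coord h i)\<^sup>2 else 0)"
      unfolding ESu[OF SX] by (intro sum.cong) (auto simp: E.F_sym[of "e _"] ESe power2_eq_square)
    also have "\<dots> = (\<Sum>i<min m n. (coord h i)\<^sup>2)"
      by (simp add: sum.If_cases) (rule sum.cong, auto)
    finally show ?thesis .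
  qed
  have "\<exists>l\<in>X. (\<lambda>n. E (S h n - l) (S h n - l)) \<longlonglongrightarrow> 0" for h
  proof (rule complete)
    fix d :: real assume d: "0 < d"
    have "Cauchy (\<lambda>n. \<Sum>i<n. (coord h i)\<^sup>2)" using summable_coord[of h] by (auto simp: summable_iff_convergent intro: convergent_Cauchy)
    then obtain N where N: "\<And>m n. \<lbrakk>m \<ge> N; n \<ge> N\<rbrakk> \<Longrightarrow> \<bar>(\<Sum>i<m. (coord h i)\<^sup>2) - (\<Sum>i<n. (coord h i)\<^sup>2)\<bar> < d"
      using d unfolding Cauchy_def dist_real_def by blast
    have "E (S h m - S h n) (S h m - S h n) = \<bar>(\<Sum>i<m. (coord h i)\<^sup>2) - (\<Sum>i<n. (coord h i)\<^sup>2)\<bar>" for m n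
    proof -
      have mono: "(\<Sum>i<m. (coord h i)\<^sup>2) \<le> (\<Sum>i<n. (coord h i)\<^sup>2)" if "m \<le> n" for m n
        using that by (intro sum_mono2) auto
      show ?thesis using SX mono[of m n] mono[of n m] 
        by (cases "m \<le> n") (simp_all add: E.F_lin ESS min_def)
    qed
    with N show "\<exists>N. \<forall>m\<ge>N. \<forall>n\<ge>N. E (S h m - S h n) (S h m - S h n) < d" by auto
  qed (rule SX)
  then obtain J where J: "\<And>h. J h \<in> X" "\<And>h. (\<lambda>n. E (S h n - J h) (S h n - J h)) \<longlonglongrightarrow> 0" by metis
  have EJ: "(\<lambda>n. \<Sum>i<n. coord h i * E (e i) u) \<longlonglongrightarrow> E (J h) u" if "u \<in> X" for h u
    using E.F_tendsto[OF SX J(1) that J(2)] by (simp add: ESu[OF that])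
  obtain C where C: "\<And>u. u \<in> X \<Longrightarrow> B u u \<le> C * E u u" using poincare by blast
  have BJ0: "(\<lambda>n. B (S h n - J h) (S h n - J h)) \<longlonglongrightarrow> 0" for h
  proof (rule tendsto_0_le[OF J(2)[of h], where K = "\<bar>C\<bar>"], intro always_eventually allI)
    fix n
    have "B (S h n - J h) (S h n - J h) \<le> C * E (S h n - J h) (S h n - J h)" using C SX J by simp
    also have "\<dots> \<le> \<bar>C\<bar> * E (S h n - J h) (S h n - J h)" using E.F_nonneg by (intro mult_right_mono) auto
    finally show "norm (B (S h n - J h) (S h n - J h)) \<le> norm (E (S h n - J h) (S h n - J h)) * \<bar>C\<bar>"
      using B.F_nonneg E.F_nonneg by (simp add: mult.commute)
  qed
  have BJ: "(\<lambda>n. \<Sum>i<n. coord h i * B (e i) u) \<longlonglongrightarrow> B (J h) u" if "u \<in> X" for h u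
  proof -
    have "B (S h n) u = (\<Sum>i<n. coord h i * B (e i) u)" for n
      unfolding S_def by (rule B.F_sum) (use e(1) that in auto)
    moreover have "(\<lambda>n. B (S h n) u) \<longlonglongrightarrow> B (J h) u" by (rule B.F_tendsto[OF SX J(1) that BJ0])
    ultimately show ?thesis by simp
  qed
  have EJe: "E (J h) (e j) = coord h j" for h j
  proof -
    have "(\<lambda>n. E (S h n) (e j)) \<longlonglongrightarrow> E (J h) (e j)" by (rule E.F_tendsto[OF SX J(1) e(1) J(2)])
    moreover have "(\<lambda>n. E (S h n) (e j)) \<longlonglongrightarrow> coord h j"
      by (rule tendsto_eventually, rule eventually_sequentiallyI[of "Suc j"]) (simp add: ESe)
    ultimately show ?thesis by (rule LIMSEQ_unique)
  qed
  define \<mu> where "\<mu> i = B (e i) (e i)" for i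
  have "\<mu> = (\<lambda>i. B (e i) (e i))" by (rule ext) (simp add: \<mu>_def)
  then have m0: "\<mu> \<longlonglongrightarrow> 0" using e(5) by simp
  have mpos: "0 < \<mu> i" for i using e(3) by (simp add: \<mu>_def)
  have bm: "bounded (range \<mu>)" using m0 convergent_imp_bounded by blast
  have EJJ: "E (J h) (J k) = h \<bullet> k" for h k
    using EJ[OF J(1), of h k] inner_sums[of h k] EJe unfolding sums_def
    by (simp add: E.F_sym[of "e _"] LIMSEQ_unique)
  have BJJ: "B (J h) (J k) = diag \<mu> h \<bullet> k" for h k
  proof -
    have "B (e i) (J k) = \<mu> i * coord k i" for i
      using e(4)[OF J(1)] EJe by (simp add: \<mu>_def E.F_sym[of "e i"])
    then have eq: "coord h i * B (e i) (J k) = coord (diag \<mu> h) i * coord k i" for i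
      by (simp add: coord_diag[OF bm])
    have "(\<lambda>n. \<Sum>i<n. coord (diag \<mu> h) i * coord k i) \<longlonglongrightarrow> B (J h) (J k)"
      using BJ[OF J(1), of h k] unfolding eq .
    then show ?thesis using inner_sums[of "diag \<mu> h" k] unfolding sums_def by (rule LIMSEQ_unique)
  qed
  have surj: "\<exists>h. E (u - J h) (u - J h) = 0" if u: "u \<in> X" for u
  proof -
    have "(\<Sum>i<n. (E u (e i))\<^sup>2) \<le> (sqrt (E u u))\<^sup>2" for n
    proof -
      have "eigen e n" unfolding eigen_def by (intro allI impI conjI ballI e)
      from projection(3)[OF this u] have "(\<Sum>i<n. (E u (e i))\<^sup>2) \<le> E u u"
        using E.F_nonneg[of "u - (\<Sum>i<n. E u (e i) *\<^sub>R e i)"] by linarith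
      then show ?thesis using E.F_nonneg[of u] by simp
    qed
    from ell2_exI[OF this] obtain h where h: "coord h = (\<lambda>i. E u (e i))" using E.F_nonneg by auto
    have "E (u - J h) (u - J h) = 0"
      by (rule e(6)) (simp_all add: E.F_lin u J e(1) EJe h)
    then show ?thesis by blast
  qed
  show ?thesis by (rule that[OF mpos m0 J(1) EJJ BJJ surj])
qed

end

section \<open>The Gagliardo space\<close>

text \<open>Pointwise operations, so that \<open>semi_inner\<close> applies to sets of
  functions.\<close>

instantiation "fun" :: (type, real_vector) real_vector
begin
definition scaleR_fun :: "real \<Rightarrow> ('a \<Rightarrow> 'b) \<Rightarrow> 'a \<Rightarrow> 'b" where "scaleR_fun c f = (\<lambda>x. c *\<^sub>R f x)"
instance by standard (auto simp: scaleR_fun_def fun_eq_iff algebra_simps)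
end

lemma scaleR_fun_apply [simp]: "(c *\<^sub>R f) x = c *\<^sub>R f x"
  by (simp add: scaleR_fun_def)

lemma minus_fun_apply' [simp]: "(f - g) x = f x - g x" for f g :: "'a \<Rightarrow> 'b::real_vector"
  by (simp add: fun_diff_def)

lemma sigma_finite_lebesgue: "sigma_finite_measure (lebesgue :: 'a::euclidean_space measure)"
proof
  let ?A = "range (\<lambda>n::nat. ball (0::'a) (real n))"
  have "x \<in> \<Union>?A" for x :: 'a using reals_Archimedean2[of "norm x"] by auto
  then show "\<exists>A::'a set set. countable A \<and> A \<subseteq> sets lebesgue \<and> \<Union>A = space lebesgue \<and> (\<forall>a\<in>A. emeasure lebesgue a \<noteq> \<infinity>)"
    by (intro exI[of _ ?A]) (use emeasure_lborel_ball_finite in \<open>auto simp: space_completion less_top\<close>)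
qed

interpretation lebesgue: sigma_finite_measure "lebesgue :: 'a::euclidean_space measure"
  by (rule sigma_finite_lebesgue)

interpretation lebesgue_pair: pair_sigma_finite "lebesgue :: 'a::euclidean_space measure" "lebesgue :: 'b::euclidean_space measure" ..

text \<open>The exceptional set becomes two null strips in the product. Almost-everywhere statements
  about functions pass to their difference quotients in this way.\<close>

lemma AE_lebesgue_pair:
  fixes Q :: "'a::euclidean_space \<Rightarrow> bool"
  assumes "AE x in lebesgue. Q x"
  shows "AE z in (lebesgue \<Otimes>\<^sub>M lebesgue :: ('a \<times> 'a) measure). Q (fst z) \<and> Q (snd z)"
proof -
  obtain N where N: "N \<in> null_sets lebesgue" "{x. \<not> Q x} \<subseteq> N"
    using assms by (auto simp: eventually_ae_filter space_completion)
  have NN: "N \<times> (UNIV :: 'a set) \<in> null_sets (lebesgue \<Otimes>\<^sub>M lebesgue)" "(UNIV :: 'a set) \<times> N \<in> null_sets (lebesgue \<Otimes>\<^sub>M lebesgue)"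
    using N(1) lebesgue.emeasure_pair_measure_Times[of N lebesgue UNIV] lebesgue.emeasure_pair_measure_Times[of UNIV lebesgue N]
    by (auto simp: null_sets_def intro!: pair_measureI) 
  have "{z. \<not> (Q (fst z) \<and> Q (snd z))} \<subseteq> N \<times> UNIV \<union> UNIV \<times> N" using N(2) by auto
  with null_sets.Un[OF NN] show ?thesis by (auto simp: eventually_ae_filter space_pair_measure space_completion)
qed

text \<open>Each factor receives the square root of the singular kernel, so that energy and inner
  product become \<open>L2\<close> expressions in \<open>dq\<close>. On the diagonal the numerator
  is 0.\<close>

definition dq :: "real \<Rightarrow> ('a::euclidean_space \<Rightarrow> real) \<Rightarrow> 'a \<times> 'a \<Rightarrow> real" where
  "dq s g z = (g (fst z) - g (snd z)) / norm (fst z - snd z) powr ((real DIM('a) + 2 * s) / 2)"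

lemma dq_mult: "dq s u z * dq s v z
    = (u (fst z) - u (snd z)) * (v (fst z) - v (snd z)) / norm (fst z - snd z) powr (real DIM('a) + 2 * s)"
  for u v :: "'a::euclidean_space \<Rightarrow> real"
  using powr_add[of "norm (fst z - snd z)" "(real DIM('a) + 2 * s) / 2" "(real DIM('a) + 2 * s) / 2"]
  by (simp add: dq_def)

lemma dq_linear: "dq s (u + v) z = dq s u z + dq s v z" "dq s (c *\<^sub>R u) z = c * dq s u z" "dq s (u - v) z = dq s u z - dq s v z"
  by (auto simp: dq_def diff_divide_distrib algebra_simps add_divide_distrib)

lemma measurable_id_lebesgue: "(\<lambda>x. x) \<in> borel_measurable lebesgue"
  by (intro measurable_completion) simp

lemma measurable_fst_lebesgue: "fst \<in> borel_measurable (lebesgue \<Otimes>\<^sub>M (M :: 'b measure))"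
  and measurable_snd_lebesgue: "snd \<in> borel_measurable ((M :: 'b measure) \<Otimes>\<^sub>M lebesgue)"
  using measurable_compose[OF measurable_fst measurable_id_lebesgue] measurable_compose[OF measurable_snd measurable_id_lebesgue] by auto

lemma measurable_dq [measurable]:
  fixes u :: "'a::euclidean_space \<Rightarrow> real"
  assumes [measurable]: "u \<in> borel_measurable lebesgue"
  shows "dq s u \<in> borel_measurable (lebesgue \<Otimes>\<^sub>M lebesgue)"
proof -
  note [measurable] = measurable_fst_lebesgue measurable_snd_lebesgue
  have [measurable]: "(\<lambda>z. u (fst z)) \<in> borel_measurable (lebesgue \<Otimes>\<^sub>M lebesgue)" "(\<lambda>z. u (snd z)) \<in> borel_measurable (lebesgue \<Otimes>\<^sub>M lebesgue)"
    using measurable_compose[OF measurable_fst assms] measurable_compose[OF measurable_snd assms] by auto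
  have "(\<lambda>z. (u (fst z) - u (snd z)) / norm (fst z - snd z) powr ((real DIM('a) + 2 * s) / 2)) \<in> borel_measurable (lebesgue \<Otimes>\<^sub>M lebesgue)"
    by measurable
  then show ?thesis by (simp add: dq_def[abs_def])
qed

lemma gagliardo_energy_dq: "gagliardo_energy s u = (\<integral>\<^sup>+ z. ennreal ((dq s u z)\<^sup>2) \<partial>(lebesgue \<Otimes>\<^sub>M lebesgue))"
  unfolding gagliardo_energy_def power2_eq_square dq_mult ..

lemma X0_inner_dq: "X0_inner s u v = (\<integral>z. dq s u z * dq s v z \<partial>(lebesgue \<Otimes>\<^sub>M lebesgue))"
  unfolding X0_inner_def dq_mult ..

lemma gagliardo_finite_iff:
  assumes "u \<in> borel_measurable lebesgue"
  shows "gagliardo_energy s u < \<infinity> \<longleftrightarrow> integrable (lebesgue \<Otimes>\<^sub>M lebesgue) (\<lambda>z. (dq s u z)\<^sup>2)"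
proof -
  have [measurable]: "dq s u \<in> borel_measurable (lebesgue \<Otimes>\<^sub>M lebesgue)" using assms by simp
  show ?thesis unfolding gagliardo_energy_dq integrable_iff_bounded by simp
qed

lemma integrable_mult_sq:
  fixes f g :: "'z \<Rightarrow> real"
  assumes [measurable]: "f \<in> borel_measurable M" "g \<in> borel_measurable M"
    and "integrable M (\<lambda>x. (f x)\<^sup>2)" "integrable M (\<lambda>x. (g x)\<^sup>2)"
  shows "integrable M (\<lambda>x. f x * g x)"
proof (rule Bochner_Integration.integrable_bound)
  show "integrable M (\<lambda>x. (f x)\<^sup>2 + (g x)\<^sup>2)" using assms by simp
  have "\<bar>a * b\<bar> \<le> a\<^sup>2 + b\<^sup>2" for a b :: real
  proof -
    have "0 \<le> \<bar>a * b\<bar>" "2 * \<bar>a * b\<bar> \<le> a\<^sup>2 + b\<^sup>2"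
      using sum_squares_bound[of "\<bar>a\<bar>" "\<bar>b\<bar>"] by (auto simp: abs_mult mult.assoc)
    then show ?thesis by linarith
  qed
  then show "AE x in M. norm (f x * g x) \<le> norm ((f x)\<^sup>2 + (g x)\<^sup>2)" by auto
qed simp

lemma integrable_add_sq:
  fixes f g :: "'z \<Rightarrow> real"
  assumes "f \<in> borel_measurable M" "g \<in> borel_measurable M"
    and "integrable M (\<lambda>x. (f x)\<^sup>2)" "integrable M (\<lambda>x. (g x)\<^sup>2)"
  shows "integrable M (\<lambda>x. (f x + g x)\<^sup>2)"
proof -
  have "integrable M (\<lambda>x. (f x)\<^sup>2 + (g x)\<^sup>2 + 2 * (f x * g x))"
    using assms integrable_mult_sq[OF assms] by simp
  then show ?thesis by (simp add: power2_sum mult.assoc)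
qed

locale frac_domain =
  fixes \<Omega> :: "'a::euclidean_space set" and s :: real
  assumes s: "0 < s" "s < 1" and \<Omega>: "open \<Omega>" "bounded \<Omega>"
begin

abbreviation "LL \<equiv> (lebesgue \<Otimes>\<^sub>M lebesgue :: ('a \<times> 'a) measure)"
definition \<alpha> :: real where "\<alpha> = real DIM('a) + 2 * s"

lemma sets_\<Omega> [measurable]: "\<Omega> \<in> sets lebesgue" using \<Omega>(1) by (simp add: borel_open)

lemma emeasure_\<Omega>: "emeasure lebesgue \<Omega> < \<infinity>"
  using emeasure_bounded_finite[OF \<Omega>(2)] \<Omega>(1) by (simp add: borel_open)

definition H :: "('a \<Rightarrow> real) set" where "H = X0 \<Omega> s"
definition E :: "('a \<Rightarrow> real) \<Rightarrow> ('a \<Rightarrow> real) \<Rightarrow> real" where "E = X0_inner s"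
definition B :: "('a \<Rightarrow> real) \<Rightarrow> ('a \<Rightarrow> real) \<Rightarrow> real" where "B u v = (\<integral>x. u x * v x \<partial>lebesgue)"

lemma H_iff: "u \<in> H \<longleftrightarrow> u \<in> borel_measurable lebesgue \<and> (AE x in lebesgue. x \<notin> \<Omega> \<longrightarrow> u x = 0)
    \<and> integrable lebesgue (\<lambda>x. (u x)\<^sup>2) \<and> integrable LL (\<lambda>z. (dq s u z)\<^sup>2)"
proof -
  have "set_integrable lebesgue \<Omega> (\<lambda>x. (u x)\<^sup>2) \<longleftrightarrow> integrable lebesgue (\<lambda>x. (u x)\<^sup>2)"
    if [measurable]: "u \<in> borel_measurable lebesgue" and z: "AE x in lebesgue. x \<notin> \<Omega> \<longrightarrow> u x = 0"
    unfolding set_integrable_def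
    by (rule integrable_cong_AE) (use z in \<open>auto simp: indicator_def\<close>)
  then show ?thesis unfolding H_def X0_def using gagliardo_finite_iff by blast
qed

lemma H_D: assumes "u \<in> H" shows "u \<in> borel_measurable lebesgue" "AE x in lebesgue. x \<notin> \<Omega> \<longrightarrow> u x = 0"
   "integrable lebesgue (\<lambda>x. (u x)\<^sup>2)" "integrable LL (\<lambda>z. (dq s u z)\<^sup>2)" "dq s u \<in> borel_measurable LL"
  using assms by (auto simp: H_iff)

lemma subspace_H: "subspace H"
proof (rule subspaceI)
  show "0 \<in> H" by (auto simp: H_iff dq_def zero_fun_def)
  fix u v assume u: "u \<in> H" and v: "v \<in> H"
  show "u + v \<in> H" unfolding H_iff
  proof (intro conjI)
    show "u + v \<in> borel_measurable lebesgue" using H_D[OF u] H_D[OF v] by (simp add: plus_fun_def)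
    show "AE x in lebesgue. x \<notin> \<Omega> \<longrightarrow> (u + v) x = 0" using H_D(2)[OF u] H_D(2)[OF v] by eventually_elim auto
    show "integrable lebesgue (\<lambda>x. ((u + v) x)\<^sup>2)" using integrable_add_sq[OF H_D(1)[OF u] H_D(1)[OF v] H_D(3)[OF u] H_D(3)[OF v]] by simp
    show "integrable LL (\<lambda>z. (dq s (u + v) z)\<^sup>2)"
      using integrable_add_sq[OF H_D(5)[OF u] H_D(5)[OF v] H_D(4)[OF u] H_D(4)[OF v]] by (simp add: dq_linear)
  qed
next
  fix u c assume u: "u \<in> H"
  show "c *\<^sub>R u \<in> H" unfolding H_iff
  proof (intro conjI)
    show "c *\<^sub>R u \<in> borel_measurable lebesgue" using H_D(1)[OF u] by (simp add: scaleR_fun_def)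
    show "AE x in lebesgue. x \<notin> \<Omega> \<longrightarrow> (c *\<^sub>R u) x = 0" using H_D(2)[OF u] by eventually_elim auto
  qed (use H_D[OF u] in \<open>auto simp: dq_linear power_mult_distrib\<close>)
qed

lemma E_eq: "E u v = (\<integral>z. dq s u z * dq s v z \<partial>LL)" by (simp add: E_def X0_inner_dq)

sublocale E: semi_inner H E
proof
  show "subspace H" by (rule subspace_H)
  fix u v w assume u: "u \<in> H" and v: "v \<in> H" and w: "w \<in> H"
  show "E (u + v) w = E u w + E v w"
    unfolding E_eq dq_linear distrib_right
    by (rule Bochner_Integration.integral_add) (intro integrable_mult_sq H_D u v w)+
next
  show "E (c *\<^sub>R u) w = c * E u w" for c u w by (simp add: E_eq dq_linear mult.assoc)
  show "E u v = E v u" for u v by (simp add: E_eq mult.commute)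
  show "0 \<le> E u u" for u by (simp add: E_eq)
qed

sublocale B: semi_inner H B
proof
  show "subspace H" by (rule subspace_H)
  fix u v w assume u: "u \<in> H" and v: "v \<in> H" and w: "w \<in> H"
  show "B (u + v) w = B u w + B v w"
    unfolding B_def plus_fun_apply distrib_right
    by (rule Bochner_Integration.integral_add) (intro integrable_mult_sq H_D u v w)+
next
  show "B (c *\<^sub>R u) w = c * B u w" for c u w by (simp add: B_def mult.assoc)
  show "B u v = B v u" for u v by (simp add: B_def mult.commute)
  show "0 \<le> B u u" for u by (simp add: B_def)
qed

lemma nn_E: "u \<in> H \<Longrightarrow> (\<integral>\<^sup>+ z. ennreal ((dq s u z)\<^sup>2) \<partial>LL) = ennreal (E u u)"
  unfolding E_eq power2_eq_square[symmetric] by (rule nn_integral_eq_integral) (auto intro: H_D)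

lemma nn_B: "u \<in> H \<Longrightarrow> (\<integral>\<^sup>+ x. ennreal ((u x)\<^sup>2) \<partial>lebesgue) = ennreal (B u u)"
  unfolding B_def power2_eq_square[symmetric] by (rule nn_integral_eq_integral) (auto intro: H_D)

lemma set_integral_mult:
  assumes "u \<in> H" "v \<in> borel_measurable lebesgue"
  shows "(\<integral>x\<in>\<Omega>. u x * v x \<partial>lebesgue) = (\<integral>x. u x * v x \<partial>lebesgue)"
proof -
  note [measurable] = H_D(1)[OF assms(1)] assms(2)
  show ?thesis unfolding set_lebesgue_integral_def
    by (rule integral_cong_AE) (use H_D(2)[OF assms(1)] in \<open>auto simp: indicator_def\<close>)
qed

text \<open>The energy of \<open>u\<close> seen from \<open>x\<close>; by Tonelli its integral over
  \<open>x\<close> is the full energy. The Poincare, compactness and Sobolev estimates all bound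
  \<open>u x\<close> pointwise by it and then integrate.\<close>

definition local_energy :: "('a \<Rightarrow> real) \<Rightarrow> 'a \<Rightarrow> ennreal" where
  "local_energy u x = (\<integral>\<^sup>+ y. ennreal ((dq s u (x, y))\<^sup>2) \<partial>lebesgue)"

lemma measurable_local_energy [measurable]: "u \<in> borel_measurable lebesgue \<Longrightarrow> local_energy u \<in> borel_measurable lebesgue"
  unfolding local_energy_def by (rule lebesgue.borel_measurable_nn_integral_fst) measurable

lemma nn_local_energy: "u \<in> borel_measurable lebesgue \<Longrightarrow> (\<integral>\<^sup>+ x. local_energy u x \<partial>lebesgue) = (\<integral>\<^sup>+ z. ennreal ((dq s u z)\<^sup>2) \<partial>LL)"
  unfolding local_energy_def by (rule lebesgue.nn_integral_fst) measurable

lemma diff_sq_le: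
  fixes u :: "'a \<Rightarrow> real"
  assumes "norm (x - y) \<le> r" "0 \<le> r"
  shows "(u x - u y)\<^sup>2 \<le> r powr \<alpha> * (dq s u (x, y))\<^sup>2"
proof (cases "x = y")
  case False
  have p: "0 < \<alpha>" using s by (simp add: \<alpha>_def)
  have n: "0 < norm (x - y) powr \<alpha>" using False by simp
  have "(u x - u y)\<^sup>2 = norm (x - y) powr \<alpha> * (dq s u (x, y))\<^sup>2"
    using n by (simp add: power2_eq_square dq_mult \<alpha>_def)
  also have "\<dots> \<le> r powr \<alpha> * (dq s u (x, y))\<^sup>2"
    using assms p by (intro mult_right_mono powr_mono2) auto
  finally show ?thesis .
qed simp

text \<open>Near the bounded set there is a ball \<open>D\<close> on which \<open>u\<close> vanishes
  almost everywhere. For \<open>x\<close> in \<open>\<Omega>\<close> and almost every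
  \<open>y\<close> in \<open>D\<close>, \<open>(u x)\<^sup>2 = (u x - u y)\<^sup>2\<close> is at
  most a constant times the energy density; integrate over \<open>D\<close>. The extended integrals
  allow use for functions not yet known to lie in \<open>H\<close>.\<close>

lemma poincare_nn:
  obtains C where "0 \<le> C" "\<And>u. \<lbrakk>u \<in> borel_measurable lebesgue; AE x in lebesgue. x \<notin> \<Omega> \<longrightarrow> u x = 0\<rbrakk>
     \<Longrightarrow> (\<integral>\<^sup>+ x. ennreal ((u x)\<^sup>2) \<partial>lebesgue) \<le> ennreal C * (\<integral>\<^sup>+ z. ennreal ((dq s u z)\<^sup>2) \<partial>LL)"
proof -
  obtain R where R: "R > 0" "\<And>x. x \<in> \<Omega> \<Longrightarrow> norm x \<le> R" using \<Omega>(2) bounded_pos by blast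
  obtain b :: 'a where b: "b \<in> Basis" using nonempty_Basis by blast
  \<comment> \<open>The unit ball around a point of norm \<open>R + 2\<close> misses the ball of
    radius \<open>R\<close>, and distances between points of the two are at most
    \<open>2 * R + 3\<close>.\<close>
  define c where "c = (R + 2) *\<^sub>R b"
  define D where "D = ball c 1"
  have nc: "norm c = R + 2" using b R by (simp add: c_def)
  have D: "norm (x - y) \<le> 2 * R + 3" "y \<notin> \<Omega>" if "y \<in> D" "norm x \<le> R" for x y
  proof -
    have d: "norm (c - y) < 1" using that by (simp add: D_def dist_norm)
    have "norm y \<le> norm c + norm (c - y)" using norm_triangle_sub[of y c] by (simp add: norm_minus_commute)
    then show "norm (x - y) \<le> 2 * R + 3" using norm_triangle_ineq4[of x y] that nc d by linarith
    have "norm c \<le> norm y + norm (c - y)" using norm_triangle_sub[of c y] by simp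
    then show "y \<notin> \<Omega>" using R(2)[of y] nc d by force
  qed
  have Dm [measurable]: "D \<in> sets lebesgue" by (simp add: D_def)
  define v where "v = measure lebesgue D"
  have v: "emeasure lebesgue D = ennreal v" "v > 0"
  proof -
    have "emeasure lebesgue D < \<infinity>" unfolding D_def using emeasure_bounded_finite[of "ball c 1"] by simp
    then show "emeasure lebesgue D = ennreal v" unfolding v_def by (intro emeasure_eq_ennreal_measure) auto
    show "v > 0" unfolding v_def D_def by (simp add: content_ball_pos)
  qed
  define M where "M = (2 * R + 3) powr \<alpha>"
  show ?thesis
  proof (rule that[of "M / v"])
    show "0 \<le> M / v" using v by (simp add: M_def)
    fix u :: "'a \<Rightarrow> real" assume um [measurable]: "u \<in> borel_measurable lebesgue" and z: "AE x in lebesgue. x \<notin> \<Omega> \<longrightarrow> u x = 0"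
    have pt: "ennreal ((u x)\<^sup>2) \<le> ennreal (M / v) * local_energy u x" if x: "x \<notin> \<Omega> \<longrightarrow> u x = 0" for x
    proof (cases "x \<in> \<Omega>")
      case True
      have "ennreal ((u x)\<^sup>2) * ennreal v = (\<integral>\<^sup>+ y. ennreal ((u x)\<^sup>2) * indicator D y \<partial>lebesgue)"
        by (subst nn_integral_cmult_indicator) (auto simp: v)
      also have "\<dots> \<le> (\<integral>\<^sup>+ y. ennreal M * ennreal ((dq s u (x, y))\<^sup>2) \<partial>lebesgue)"
      proof (rule nn_integral_mono_AE, use z in eventually_elim)
        fix y assume y: "y \<notin> \<Omega> \<longrightarrow> u y = 0"
        show "ennreal ((u x)\<^sup>2) * indicator D y \<le> ennreal M * ennreal ((dq s u (x, y))\<^sup>2)"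
        proof (cases "y \<in> D")
          case True
          have "u y = 0" using D(2)[OF True R(2)[OF \<open>x \<in> \<Omega>\<close>]] y by simp
          then have "(u x)\<^sup>2 \<le> M * (dq s u (x, y))\<^sup>2"
            using diff_sq_le[OF D(1)[OF True R(2)[OF \<open>x \<in> \<Omega>\<close>]], of u] R by (simp add: M_def)
          then show ?thesis using True by (simp add: ennreal_mult[symmetric] M_def)
        qed simp
      qed
      also have "\<dots> = ennreal M * local_energy u x" unfolding local_energy_def by (rule nn_integral_cmult) measurable
      finally have "ennreal (1 / v) * (ennreal ((u x)\<^sup>2) * ennreal v) \<le> ennreal (1 / v) * (ennreal M * local_energy u x)"
        by (rule mult_left_mono) simp
      moreover have "ennreal (1 / v) * (ennreal ((u x)\<^sup>2) * ennreal v) = ennreal ((u x)\<^sup>2)"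
        using v by (simp add: ennreal_mult[symmetric])
      moreover have "ennreal (1 / v) * (ennreal M * local_energy u x) = ennreal (M / v) * local_energy u x"
        using v by (simp add: mult.assoc[symmetric] ennreal_mult[symmetric] M_def)
      ultimately show ?thesis by simp
    qed (use x in simp)
    have "(\<integral>\<^sup>+ x. ennreal ((u x)\<^sup>2) \<partial>lebesgue) \<le> (\<integral>\<^sup>+ x. ennreal (M / v) * local_energy u x \<partial>lebesgue)"
      by (rule nn_integral_mono_AE, use z in eventually_elim) (rule pt)
    also have "\<dots> = ennreal (M / v) * (\<integral>\<^sup>+ x. local_energy u x \<partial>lebesgue)" by (rule nn_integral_cmult) measurable
    finally show "(\<integral>\<^sup>+ x. ennreal ((u x)\<^sup>2) \<partial>lebesgue) \<le> ennreal (M / v) * (\<integral>\<^sup>+ z. ennreal ((dq s u z)\<^sup>2) \<partial>LL)"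
      by (simp add: nn_local_energy[OF um])
  qed
qed

lemma poincare_E: "\<exists>C. \<forall>u\<in>H. B u u \<le> C * E u u"
proof -
  obtain C where C: "0 \<le> C" "\<And>u. \<lbrakk>u \<in> borel_measurable lebesgue; AE x in lebesgue. x \<notin> \<Omega> \<longrightarrow> u x = 0\<rbrakk>
     \<Longrightarrow> (\<integral>\<^sup>+ x. ennreal ((u x)\<^sup>2) \<partial>lebesgue) \<le> ennreal C * (\<integral>\<^sup>+ z. ennreal ((dq s u z)\<^sup>2) \<partial>LL)" by (rule poincare_nn) blast
  have "B u u \<le> C * E u u" if u: "u \<in> H" for u
    using C(2)[OF H_D(1,2)[OF u]] C(1) E.F_nonneg[of u]
    by (simp add: nn_E[OF u] nn_B[OF u] ennreal_mult[symmetric])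
  then show ?thesis by blast
qed

lemma B_zero_iff: "u \<in> H \<Longrightarrow> B u u = 0 \<longleftrightarrow> (AE x in lebesgue. u x = 0)"
  unfolding B_def power2_eq_square[symmetric] by (subst integral_nonneg_eq_0_iff_AE) (auto intro: H_D)

lemma E_cong_AE:
  assumes "u \<in> H" "AE x in lebesgue. u x = 0" shows "E u u = 0"
proof -
  have "AE z in LL. dq s u z * dq s u z = 0"
    using AE_lebesgue_pair[OF assms(2)] by eventually_elim (auto simp: dq_def)
  then show ?thesis unfolding E_eq by (rule integral_eq_zero_AE)
qed

lemma E_zero_iff:
  assumes "u \<in> H" shows "E u u = 0 \<longleftrightarrow> (AE x in lebesgue. u x = 0)"
proof
  assume "E u u = 0"
  then have "B u u = 0" using poincare_E assms B.F_nonneg[of u] by (metis antisym mult_zero_right)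
  then show "AE x in lebesgue. u x = 0" using B_zero_iff assms by blast
qed (use E_cong_AE assms in blast)

text \<open>From \<open>\<bar>t\<bar> \<le> e + t\<^sup>2 / e\<close> on a set of finite measure.
  The free parameter lets smallness in \<open>L2\<close> yield smallness in
  \<open>L1\<close>.\<close>

lemma integrable_H: 
  assumes u: "u \<in> H" and that: "0 < e"
  shows "integrable lebesgue u" "(\<integral>x. \<bar>u x\<bar> \<partial>lebesgue) \<le> e * measure lebesgue \<Omega> + B u u / e"
proof -
  note [measurable] = H_D(1)[OF u]
  have i: "integrable lebesgue (\<lambda>x. e * indicator \<Omega> x + (u x)\<^sup>2 / e)"
    using H_D(3)[OF u] emeasure_\<Omega> by (intro Bochner_Integration.integrable_add) auto
  have "\<bar>t\<bar> \<le> e + t\<^sup>2 / e" for t :: real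
  proof (cases "\<bar>t\<bar> \<le> e")
    case True
    have "0 \<le> t\<^sup>2 / e" using that by simp
    then show ?thesis using True by linarith
  next
    case False
    then have "e * \<bar>t\<bar> \<le> \<bar>t\<bar> * \<bar>t\<bar>" by (intro mult_right_mono) auto
    then have "e * \<bar>t\<bar> \<le> t\<^sup>2" by (simp add: power2_eq_square)
    then have "\<bar>t\<bar> \<le> t\<^sup>2 / e" using that by (simp add: field_simps)
    then show ?thesis using that by linarith
  qed
  then have b: "AE x in lebesgue. \<bar>u x\<bar> \<le> e * indicator \<Omega> x + (u x)\<^sup>2 / e"
    using H_D(2)[OF u] by (auto simp: indicator_def)
  show 1: "integrable lebesgue u"
  proof (rule Bochner_Integration.integrable_bound[OF i])
    show "AE x in lebesgue. norm (u x) \<le> norm (e * indicator \<Omega> x + (u x)\<^sup>2 / e)" using b by eventually_elim auto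
  qed simp
  have "(\<integral>x. \<bar>u x\<bar> \<partial>lebesgue) \<le> (\<integral>x. e * indicator \<Omega> x + (u x)\<^sup>2 / e \<partial>lebesgue)"
    by (rule integral_mono_AE) (use 1 i b in auto)
  also have "\<dots> = e * measure lebesgue \<Omega> + B u u / e"
    using H_D(3)[OF u] emeasure_\<Omega> by (subst Bochner_Integration.integral_add) (auto simp: B_def power2_eq_square)
  finally show "(\<integral>x. \<bar>u x\<bar> \<partial>lebesgue) \<le> e * measure lebesgue \<Omega> + B u u / e" .
qed

end

section \<open>Completeness and compactness\<close>

text \<open>Sequential compactness of a countable power of \<open>{-C..C}\<close> takes the place of
  an explicit diagonal choice.\<close>

lemma diagonal_subsequence:
  fixes x :: "nat \<Rightarrow> nat \<Rightarrow> real"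
  assumes "\<And>n k. \<bar>x n k\<bar> \<le> C"
  obtains r l where "strict_mono (r :: nat \<Rightarrow> nat)" "\<And>k. (\<lambda>n. x (r n) k) \<longlonglongrightarrow> l k"
proof -
  have c: "compact (PiE UNIV (\<lambda>_::nat. {-C..C}))"
    using compactin_PiE[of "\<lambda>_. euclidean" UNIV "\<lambda>_. {-C..C}"] by (simp add: euclidean_product_topology)
  have m: "x n \<in> PiE UNIV (\<lambda>_::nat. {-C..C})" for n
    using assms[of n] by (auto simp: abs_le_iff) (smt (verit))+
  obtain l r where r: "strict_mono (r :: nat \<Rightarrow> nat)" "(x \<circ> r) \<longlonglongrightarrow> l"
    using spec[OF compact_imp_seq_compact[OF c, unfolded seq_compact_def], of x] m by auto
  have "(\<lambda>n. x (r n) k) \<longlonglongrightarrow> l k" for k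
    using continuous_on_tendsto_compose[OF continuous_on_product_coordinates[of k] r(2)]
    by (simp add: o_def)
  with r(1) that show ?thesis by blast
qed

context frac_domain
begin

lemma H_I:
  assumes m: "u \<in> borel_measurable lebesgue" and z: "AE x in lebesgue. x \<notin> \<Omega> \<longrightarrow> u x = 0"
    and f: "(\<integral>\<^sup>+ z. ennreal ((dq s u z)\<^sup>2) \<partial>LL) < \<infinity>"
  shows "u \<in> H"
proof -
  note [measurable] = m
  obtain C where "\<And>u. \<lbrakk>u \<in> borel_measurable lebesgue; AE x in lebesgue. x \<notin> \<Omega> \<longrightarrow> u x = 0\<rbrakk>
     \<Longrightarrow> (\<integral>\<^sup>+ x. ennreal ((u x)\<^sup>2) \<partial>lebesgue) \<le> ennreal C * (\<integral>\<^sup>+ z. ennreal ((dq s u z)\<^sup>2) \<partial>LL)"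
    by (rule poincare_nn) blast
  from this[OF m z] have "(\<integral>\<^sup>+ x. ennreal ((u x)\<^sup>2) \<partial>lebesgue) \<le> ennreal C * (\<integral>\<^sup>+ z. ennreal ((dq s u z)\<^sup>2) \<partial>LL)" .
  also have "\<dots> < \<infinity>" using f by (simp add: ennreal_mult_less_top)
  finally have "integrable lebesgue (\<lambda>x. (u x)\<^sup>2)" unfolding integrable_iff_bounded by simp
  moreover have "integrable LL (\<lambda>z. (dq s u z)\<^sup>2)" unfolding integrable_iff_bounded using f by simp
  ultimately show ?thesis using m z by (simp add: H_iff)
qed

lemma L1_cauchy:
  assumes u: "\<And>n::nat. u n \<in> H" and c: "\<And>e. 0 < e \<Longrightarrow> \<exists>N. \<forall>m\<ge>N. \<forall>n\<ge>N. B (u m - u n) (u m - u n) < e" and e: "0 < e"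
  shows "\<exists>N. \<forall>i\<ge>N. \<forall>j\<ge>N. (\<integral>x. norm (u i x - u j x) \<partial>lebesgue) < e"
proof -
  define m where "m = measure lebesgue \<Omega> + 1"
  have m: "m > 0" by (simp add: m_def add_nonneg_pos)
  define d where "d = e / (2 * m)"
  have d: "d > 0" using m e by (simp add: d_def)
  have "0 < d * e / 2" using d e by simp
  then obtain N where N: "\<And>i j. \<lbrakk>i \<ge> N; j \<ge> N\<rbrakk> \<Longrightarrow> B (u i - u j) (u i - u j) < d * e / 2" using c by meson
  have "(\<integral>x. norm (u i x - u j x) \<partial>lebesgue) < e" if "i \<ge> N" "j \<ge> N" for i j
  proof -
    have "u i - u j \<in> H" using u by simp
    from integrable_H(2)[OF this d] have "(\<integral>x. norm (u i x - u j x) \<partial>lebesgue) \<le> d * measure lebesgue \<Omega> + B (u i - u j) (u i - u j) / d" by simp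
    also have "B (u i - u j) (u i - u j) / d < e / 2" using N[OF that] d by (simp add: field_simps)
    also have "d * measure lebesgue \<Omega> \<le> d * m" using d by (simp add: m_def)
    also have "d * m = e / 2" using m by (simp add: d_def)
    finally show ?thesis by simp
  qed
  then show ?thesis by blast
qed

text \<open>An energy-Cauchy sequence is Cauchy in \<open>L2\<close> by Poincare, hence in
  \<open>L1\<close>, so a subsequence converges almost everywhere. Fatou's lemma for the difference
  quotients shows that the pointwise limit is a limit in energy.\<close>

lemma complete_H:
  assumes u: "\<And>n::nat. u n \<in> H" and c: "\<And>e. 0 < e \<Longrightarrow> \<exists>N. \<forall>m\<ge>N. \<forall>n\<ge>N. E (u m - u n) (u m - u n) < e"
  shows "\<exists>l\<in>H. (\<lambda>n. E (u n - l) (u n - l)) \<longlonglongrightarrow> 0"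
proof -
  note [measurable] = H_D(1)[OF u]
  obtain C where C: "\<And>u. u \<in> H \<Longrightarrow> B u u \<le> C * E u u" using poincare_E by blast
  have "\<exists>N. \<forall>m\<ge>N. \<forall>n\<ge>N. B (u m - u n) (u m - u n) < e" if e: "0 < e" for e
  proof -
    have "0 < e / (\<bar>C\<bar> + 1)" using e by (simp add: add_nonneg_pos)
    then obtain N where N: "\<And>i j. \<lbrakk>i \<ge> N; j \<ge> N\<rbrakk> \<Longrightarrow> E (u i - u j) (u i - u j) < e / (\<bar>C\<bar> + 1)" using c by meson
    have "B (u i - u j) (u i - u j) < e" if "i \<ge> N" "j \<ge> N" for i j
    proof -
      have "B (u i - u j) (u i - u j) \<le> C * E (u i - u j) (u i - u j)" using C u by simp
      also have "\<dots> \<le> (\<bar>C\<bar> + 1) * E (u i - u j) (u i - u j)" using E.F_nonneg by (intro mult_right_mono) auto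
      also have "\<dots> < e" using N[OF that] by (simp add: field_simps add_nonneg_pos)
      finally show ?thesis .
    qed
    then show ?thesis by blast
  qed
  then have l1: "\<exists>N. \<forall>i\<ge>N. \<forall>j\<ge>N. (\<integral>x. norm (u i x - u j x) \<partial>lebesgue) < e" if "0 < e" for e
    by (rule L1_cauchy[OF u _ that])
  obtain r where r: "strict_mono r" "AE x in lebesgue. Cauchy (\<lambda>i. u (r i) x)"
    by (rule cauchy_L1_AE_cauchy_subseq[of lebesgue u]) (use integrable_H(1)[OF u zero_less_one] l1 in auto)
  \<comment> \<open>The value 0 outside \<open>\<Omega>\<close> secures the exterior condition;
    inside, \<open>lim\<close> is arbitrary on the null set without convergence.\<close>
  define l where "l x = (if x \<in> \<Omega> then lim (\<lambda>i. u (r i) x) else 0)" for x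
  have lm [measurable]: "l \<in> borel_measurable lebesgue"
    unfolding l_def by (intro measurable_If borel_measurable_lim_metric) auto
  have "AE x in lebesgue. \<forall>i. x \<notin> \<Omega> \<longrightarrow> u i x = 0" unfolding AE_all_countable using H_D(2)[OF u] by blast
  with r(2) have lim: "AE x in lebesgue. (\<lambda>i. u (r i) x) \<longlonglongrightarrow> l x"
    by eventually_elim (auto simp: l_def convergent_LIMSEQ_iff[symmetric] real_Cauchy_convergent)
  have fatou: "(\<integral>\<^sup>+ z. ennreal ((dq s (u n - l) z)\<^sup>2) \<partial>LL) \<le> ennreal e" if n: "\<And>m. m \<ge> N \<Longrightarrow> E (u n - u m) (u n - u m) \<le> e" for n N e
  proof -
    have [measurable]: "u n - u m \<in> borel_measurable lebesgue" for n m using H_D(1) u by simp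
    have "(\<integral>\<^sup>+ z. ennreal ((dq s (u n - l) z)\<^sup>2) \<partial>LL) = (\<integral>\<^sup>+ z. liminf (\<lambda>k. ennreal ((dq s (u n - u (r k)) z)\<^sup>2)) \<partial>LL)"
    proof (rule nn_integral_cong_AE, use AE_lebesgue_pair[OF lim] in eventually_elim)
      fix z assume z: "(\<lambda>i. u (r i) (fst z)) \<longlonglongrightarrow> l (fst z) \<and> (\<lambda>i. u (r i) (snd z)) \<longlonglongrightarrow> l (snd z)"
      have "(\<lambda>k. ennreal ((dq s (u n - u (r k)) z)\<^sup>2)) \<longlonglongrightarrow> ennreal ((dq s (u n - l) z)\<^sup>2)"
        unfolding dq_def minus_fun_apply' divide_inverse using z by (intro tendsto_intros) auto
      then show "ennreal ((dq s (u n - l) z)\<^sup>2) = liminf (\<lambda>k. ennreal ((dq s (u n - u (r k)) z)\<^sup>2))"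
        by (rule lim_imp_Liminf[OF trivial_limit_sequentially, symmetric])
    qed
    also have "\<dots> \<le> liminf (\<lambda>k. \<integral>\<^sup>+ z. ennreal ((dq s (u n - u (r k)) z)\<^sup>2) \<partial>LL)"
      by (rule nn_integral_liminf) measurable
    also have "\<dots> = liminf (\<lambda>k. ennreal (E (u n - u (r k)) (u n - u (r k))))" using u by (simp add: nn_E)
    also have "\<dots> \<le> limsup (\<lambda>k. ennreal (E (u n - u (r k)) (u n - u (r k))))" by (rule Liminf_le_Limsup) simp
    also have "\<dots> \<le> ennreal e"
    proof (rule Limsup_bounded, rule eventually_sequentiallyI[of N])
      fix k assume "k \<ge> N"
      then have "r k \<ge> N" using seq_suble[OF r(1), of k] by linarith
      then show "ennreal (E (u n - u (r k)) (u n - u (r k))) \<le> ennreal e" using n by (intro ennreal_leI) auto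
    qed
    finally show ?thesis .
  qed
  have z: "AE x in lebesgue. x \<notin> \<Omega> \<longrightarrow> (u n - l) x = 0" for n
    using H_D(2)[OF u[of n]] by eventually_elim (auto simp: l_def)
  have mm: "u n - l \<in> borel_measurable lebesgue" for n by (simp add: fun_diff_def)
  obtain N1 where N1: "\<And>m n. \<lbrakk>m \<ge> N1; n \<ge> N1\<rbrakk> \<Longrightarrow> E (u m - u n) (u m - u n) < 1" using c[of 1] by auto
  have "(\<integral>\<^sup>+ z. ennreal ((dq s (u N1 - l) z)\<^sup>2) \<partial>LL) \<le> ennreal 1"
    by (rule fatou[of N1]) (use N1 in \<open>auto intro: less_imp_le\<close>)
  also have "\<dots> < \<infinity>" by simp
  finally have "u N1 - l \<in> H" by (rule H_I[OF mm z])
  \<comment> \<open>Fatou gives finite energy of the difference \<open>u N1 - l\<close>;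
    \<open>l\<close> itself follows by linearity.\<close>
  then have "u N1 - (u N1 - l) \<in> H" by (rule E.in_X(3)[OF u])
  moreover have "u N1 - (u N1 - l) = l" by simp
  ultimately have lH: "l \<in> H" by (simp only:)
  moreover have "(\<lambda>n. E (u n - l) (u n - l)) \<longlonglongrightarrow> 0"
  proof (rule LIMSEQ_I)
    fix e :: real assume e: "0 < e"
    then obtain N where N: "\<And>i j. \<lbrakk>i \<ge> N; j \<ge> N\<rbrakk> \<Longrightarrow> E (u i - u j) (u i - u j) < e / 2" using c[of "e / 2"] by auto
    have "E (u n - l) (u n - l) \<le> e / 2" if "n \<ge> N" for n
    proof -
      have "(\<integral>\<^sup>+ z. ennreal ((dq s (u n - l) z)\<^sup>2) \<partial>LL) \<le> ennreal (e / 2)"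
        by (rule fatou[of N]) (use N that in \<open>auto intro: less_imp_le\<close>)
      then show ?thesis using nn_E[of "u n - l"] u lH e by simp
    qed
    then show "\<exists>no. \<forall>n\<ge>no. norm (E (u n - l) (u n - l) - 0) < e" using e E.F_nonneg by (force intro!: exI[of _ N])
  qed
  ultimately show ?thesis by blast
qed

section \<open>Grid cubes and compactness of the embedding into \<open>L2\<close>\<close>

definition cube :: "real \<Rightarrow> 'a \<Rightarrow> 'a set" where
  "cube d x = {y. \<forall>b\<in>Basis. \<lfloor>y \<bullet> b / d\<rfloor> = \<lfloor>x \<bullet> b / d\<rfloor>}"

lemma cube_measurable [measurable]: "cube d x \<in> sets lebesgue"
proof -
  have "cube d x = (\<Inter>b\<in>Basis. (\<lambda>y. \<lfloor>y \<bullet> b / d\<rfloor>) -` {\<lfloor>x \<bullet> b / d\<rfloor>} \<inter> space borel)" by (auto simp: cube_def)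
  also have "\<dots> \<in> sets borel"
    by (intro sets.finite_INT measurable_sets[where A = "count_space UNIV"]) auto
  finally show ?thesis by simp
qed

lemma cube_diam:
  assumes "y \<in> cube d x" "0 < d" shows "norm (x - y) \<le> real DIM('a) * d"
proof -
  have "\<bar>(x - y) \<bullet> b\<bar> \<le> d" if "b \<in> Basis" for b
  proof -
    have "\<lfloor>y \<bullet> b / d\<rfloor> = \<lfloor>x \<bullet> b / d\<rfloor>" using assms that by (simp add: cube_def)
    then have "\<bar>x \<bullet> b / d - y \<bullet> b / d\<bar> \<le> 1" by linarith
    then have "\<bar>(x - y) \<bullet> b / d\<bar> \<le> 1" by (simp add: inner_diff_left diff_divide_distrib)
    then show ?thesis using assms(2) by (simp add: abs_divide)
  qed
  then have "(\<Sum>b\<in>Basis. \<bar>(x - y) \<bullet> b\<bar>) \<le> (\<Sum>b\<in>(Basis::'a set). d)" by (intro sum_mono) auto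
  then show ?thesis using norm_le_l1[of "x - y"] by simp
qed

lemma cube_measure:
  assumes d: "0 < d"
  shows "emeasure lebesgue (cube d x) = ennreal (measure lebesgue (cube d x))" "d ^ DIM('a) \<le> measure lebesgue (cube d x)"
proof -
  have "cube d x \<subseteq> cball x (real DIM('a) * d)" using cube_diam[OF _ d] by (auto simp: dist_norm)
  then have "emeasure lebesgue (cube d x) \<le> emeasure lebesgue (cball x (real DIM('a) * d))" by (intro emeasure_mono) auto
  also have "\<dots> < \<infinity>" using emeasure_bounded_finite[of "cball x (real DIM('a) * d)"] by simp
  finally have fin: "emeasure lebesgue (cube d x) \<noteq> \<infinity>" by simp
  then show "emeasure lebesgue (cube d x) = ennreal (measure lebesgue (cube d x))" by (intro emeasure_eq_ennreal_measure) auto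
  define p where "p = (\<Sum>b\<in>Basis. (d * of_int \<lfloor>x \<bullet> b / d\<rfloor>) *\<^sub>R b)"
  define p' where "p' = (\<Sum>b\<in>Basis. (d * of_int \<lfloor>x \<bullet> b / d\<rfloor> + d) *\<^sub>R b)"
  have pb: "p \<bullet> b = d * of_int \<lfloor>x \<bullet> b / d\<rfloor>" "p' \<bullet> b = p \<bullet> b + d" if "b \<in> Basis" for b
    using that by (simp_all add: p_def p'_def)
  have sub: "box p p' \<subseteq> cube d x"
  proof
    fix y assume y: "y \<in> box p p'"
    show "y \<in> cube d x" unfolding cube_def
    proof (clarify)
      fix b :: 'a assume b: "b \<in> Basis"
      have "p \<bullet> b < y \<bullet> b" "y \<bullet> b < p \<bullet> b + d" using y b pb(2)[OF b] by (auto simp: mem_box)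
      then have "of_int \<lfloor>x \<bullet> b / d\<rfloor> \<le> y \<bullet> b / d" "y \<bullet> b / d < of_int \<lfloor>x \<bullet> b / d\<rfloor> + 1"
        using d pb(1)[OF b] by (simp_all add: field_simps)
      then show "\<lfloor>y \<bullet> b / d\<rfloor> = \<lfloor>x \<bullet> b / d\<rfloor>" by (rule floor_unique)
    qed
  qed
  have "measure lebesgue (box p p') = (\<Prod>b\<in>Basis. (p' - p) \<bullet> b)"
    using pb d by (subst measure_completion) (auto simp: measure_lborel_box_eq)
  also have "\<dots> = (\<Prod>b\<in>(Basis::'a set). d)" using pb by (intro prod.cong) (auto simp: inner_diff_left)
  also have "\<dots> = d ^ DIM('a)" by simp
  finally have "measure lebesgue (box p p') = d ^ DIM('a)" .
  then show "d ^ DIM('a) \<le> measure lebesgue (cube d x)"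
  proof -
    have "cube d x \<in> fmeasurable lebesgue" using fin by (intro fmeasurableI) (auto simp: less_top)
    from measure_mono_fmeasurable[OF sub _ this] show ?thesis using \<open>measure lebesgue (box p p') = d ^ DIM('a)\<close> by simp
  qed
qed

lemma finite_cubes:
  assumes d: "0 < d" shows "finite (cube d ` \<Omega>)"
proof -
  obtain R where R: "R > 0" "\<And>x. x \<in> \<Omega> \<Longrightarrow> norm x \<le> R" using \<Omega>(2) bounded_pos by blast
  define K where "K = \<lceil>R / d\<rceil> + 1"
  let ?F = "PiE Basis (\<lambda>_::'a. {-K..K})"
  have "cube d x \<in> (\<lambda>c. {y. \<forall>b\<in>Basis. \<lfloor>y \<bullet> b / d\<rfloor> = c b}) ` ?F" if x: "x \<in> \<Omega>" for x
  proof (rule image_eqI)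
    show "restrict (\<lambda>b. \<lfloor>x \<bullet> b / d\<rfloor>) Basis \<in> ?F"
    proof (rule restrict_PiE_iff[THEN iffD2], clarify)
      fix b :: 'a assume b: "b \<in> Basis"
      have "\<bar>x \<bullet> b\<bar> \<le> R" using Basis_le_norm[OF b, of x] R(2)[OF x] by linarith
      then have "\<bar>x \<bullet> b / d\<bar> \<le> R / d" using d by (simp add: abs_divide divide_right_mono)
      then have "x \<bullet> b / d \<le> R / d" "- (R / d) \<le> x \<bullet> b / d" by linarith+
      then show "\<lfloor>x \<bullet> b / d\<rfloor> \<in> {-K..K}" unfolding K_def
        using le_of_int_ceiling[of "R / d"] of_int_floor_le[of "x \<bullet> b / d"] floor_correct[of "x \<bullet> b / d"] by simp linarith
    qed
  qed (auto simp: cube_def)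
  then have "cube d ` \<Omega> \<subseteq> (\<lambda>c. {y. \<forall>b\<in>Basis. \<lfloor>y \<bullet> b / d\<rfloor> = c b}) ` ?F" by blast
  moreover have "finite ?F" by (rule finite_PiE) simp_all
  ultimately show ?thesis by (rule finite_subset[OF _ finite_imageI])
qed

text \<open>The integral over \<open>Q\<close>, not divided by the measure of \<open>Q\<close>; the
  division takes place in \<open>avg_pointwise\<close>.\<close>

definition avg :: "('a \<Rightarrow> real) \<Rightarrow> 'a set \<Rightarrow> real" where "avg u Q = (\<integral>x. u x * indicator Q x \<partial>lebesgue)"

lemma integrable_indicator_mult:
  fixes f :: "'a \<Rightarrow> real"
  shows "integrable lebesgue f \<Longrightarrow> Q \<in> sets lebesgue \<Longrightarrow> integrable lebesgue (\<lambda>x. f x * indicator Q x)"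
  using integrable_mult_indicator[of Q lebesgue f] by (simp add: mult.commute)

text \<open>The squared deviation of \<open>u x\<close> from the mean \<open>m\<close> over the cube
  is at most the mean of \<open>(u x - u y)\<^sup>2\<close>, which the diameter of the cube bounds
  by the energy seen from \<open>x\<close>. Then
  \<open>(u x)\<^sup>2 \<le> 2 * (u x - m)\<^sup>2 + 2 * m\<^sup>2\<close>.\<close>

lemma avg_pointwise:
  assumes u: "u \<in> H" and d: "0 < d"
  shows "ennreal ((u x)\<^sup>2) \<le> ennreal (2 * (real DIM('a) * d) powr \<alpha> / d ^ DIM('a)) * local_energy u x
      + ennreal (2 * (avg u (cube d x))\<^sup>2 / (d ^ DIM('a))\<^sup>2)"
proof -
  note [measurable] = H_D(1)[OF u]
  define Q where "Q = cube d x"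
  have Qm [measurable]: "Q \<in> sets lebesgue" by (simp add: Q_def)
  define v where "v = measure lebesgue Q"
  define D where "D = d ^ DIM('a)"
  have D: "0 < D" "D \<le> v" and eQ: "emeasure lebesgue Q = ennreal v"
    using cube_measure[OF d, of x] d by (auto simp: D_def v_def Q_def)
  have v: "0 < v" using D by linarith
  define m where "m = avg u Q / v"
  have iu: "integrable lebesgue (\<lambda>y. u y * indicator Q y)" using integrable_H(1)[OF u zero_less_one] by (rule integrable_indicator_mult) simp
  have iu2: "integrable lebesgue (\<lambda>y. (u y)\<^sup>2 * indicator Q y)" using H_D(3)[OF u] by (rule integrable_indicator_mult) simp
  have iQ: "integrable lebesgue (indicator Q :: 'a \<Rightarrow> real)" using eQ by (intro integrable_real_indicator) auto
  have "integrable lebesgue (\<lambda>y. (u x)\<^sup>2 * indicator Q y - 2 * u x * (u y * indicator Q y) + (u y)\<^sup>2 * indicator Q y)"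
    by (intro Bochner_Integration.integrable_add Bochner_Integration.integrable_diff integrable_mult_right iu iu2 iQ)
  moreover have eq: "(u x - u y)\<^sup>2 * indicator Q y = (u x)\<^sup>2 * indicator Q y - 2 * u x * (u y * indicator Q y) + (u y)\<^sup>2 * indicator Q y" for y
    by (simp add: power2_diff algebra_simps)
  ultimately have i1: "integrable lebesgue (\<lambda>y. (u x - u y)\<^sup>2 * indicator Q y)" by simp
  have i2: "integrable lebesgue (\<lambda>y. 2 * (u x - m) * ((u x - u y) * indicator Q y) - (u x - m)\<^sup>2 * indicator Q y)"
    using iu iQ by (auto simp: left_diff_distrib)
  \<comment> \<open>Jensen's inequality for the square, by integrating a completed square over the
    cube.\<close>
  have "(\<integral>y. 2 * (u x - m) * ((u x - u y) * indicator Q y) - (u x - m)\<^sup>2 * indicator Q y \<partial>lebesgue) \<le> (\<integral>y. (u x - u y)\<^sup>2 * indicator Q y \<partial>lebesgue)"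
  proof (rule integral_mono[OF i2 i1])
    fix y
    have "0 \<le> ((u x - u y) - (u x - m))\<^sup>2" by simp
    then show "2 * (u x - m) * ((u x - u y) * indicator Q y) - (u x - m)\<^sup>2 * indicator Q y \<le> (u x - u y)\<^sup>2 * indicator Q y"
      by (simp add: power2_diff indicator_def power2_eq_square algebra_simps)
  qed
  moreover have "(\<integral>y. 2 * (u x - m) * ((u x - u y) * indicator Q y) - (u x - m)\<^sup>2 * indicator Q y \<partial>lebesgue)
      = 2 * (u x - m) * (u x * v - avg u Q) - (u x - m)\<^sup>2 * v"
    using iu iQ by (simp add: left_diff_distrib avg_def v_def)
  moreover have "2 * (u x - m) * (u x * v - avg u Q) - (u x - m)\<^sup>2 * v = (u x - m)\<^sup>2 * v"
    using v by (simp add: m_def power2_eq_square field_simps)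
  ultimately have var: "(u x - m)\<^sup>2 * v \<le> (\<integral>y. (u x - u y)\<^sup>2 * indicator Q y \<partial>lebesgue)" by (simp only:)
  define M where "M = (real DIM('a) * d) powr \<alpha>"
  have M: "0 \<le> M" by (simp add: M_def)
  have "ennreal ((u x - m)\<^sup>2 * v) \<le> (\<integral>\<^sup>+ y. ennreal ((u x - u y)\<^sup>2 * indicator Q y) \<partial>lebesgue)"
    using var nn_integral_eq_integral[OF i1] by (simp add: ennreal_leI)
  also have "\<dots> \<le> (\<integral>\<^sup>+ y. ennreal M * ennreal ((dq s u (x, y))\<^sup>2) \<partial>lebesgue)"
  proof (rule nn_integral_mono)
    fix y
    show "ennreal ((u x - u y)\<^sup>2 * indicator Q y) \<le> ennreal M * ennreal ((dq s u (x, y))\<^sup>2)"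
      using diff_sq_le[OF cube_diam[OF _ d], of y x u] d M
      by (auto simp: indicator_def Q_def M_def ennreal_mult[symmetric] intro!: ennreal_leI)
  qed
  also have "\<dots> = ennreal M * local_energy u x" unfolding local_energy_def by (rule nn_integral_cmult) measurable
  finally have 1: "ennreal ((u x - m)\<^sup>2 * v) \<le> ennreal M * local_energy u x" .
  have "ennreal ((u x - m)\<^sup>2) \<le> ennreal (1 / D) * ennreal ((u x - m)\<^sup>2 * v)"
  proof -
    have "(u x - m)\<^sup>2 * D \<le> (u x - m)\<^sup>2 * v" using D by (intro mult_left_mono) auto
    then have "(u x - m)\<^sup>2 \<le> 1 / D * ((u x - m)\<^sup>2 * v)" using D by (simp add: field_simps)
    then show ?thesis using D v by (subst ennreal_mult[symmetric]) (auto intro: ennreal_leI)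
  qed
  also have "\<dots> \<le> ennreal (1 / D) * (ennreal M * local_energy u x)" by (intro mult_left_mono 1) simp
  finally have 2: "ennreal ((u x - m)\<^sup>2) \<le> ennreal (M / D) * local_energy u x" using M D by (simp add: mult.assoc[symmetric] ennreal_mult[symmetric])
  have 3: "m\<^sup>2 \<le> (avg u Q)\<^sup>2 / D\<^sup>2"
    unfolding m_def power_divide using D by (intro divide_left_mono power_mono mult_pos_pos) auto
  have "(u x)\<^sup>2 \<le> 2 * (u x - m)\<^sup>2 + 2 * m\<^sup>2"
    using sum_squares_bound[of "u x - m" m] by (simp add: power2_eq_square algebra_simps)
  also have "\<dots> \<le> 2 * (u x - m)\<^sup>2 + 2 * (avg u Q)\<^sup>2 / D\<^sup>2" using 3 by simp
  finally have "ennreal ((u x)\<^sup>2) \<le> ennreal (2 * (u x - m)\<^sup>2 + 2 * (avg u Q)\<^sup>2 / D\<^sup>2)" by (rule ennreal_leI)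
  also have "\<dots> = ennreal 2 * ennreal ((u x - m)\<^sup>2) + ennreal (2 * (avg u Q)\<^sup>2 / D\<^sup>2)"
    by (subst ennreal_plus) (auto simp: ennreal_mult)
  also have "\<dots> \<le> ennreal 2 * (ennreal (M / D) * local_energy u x) + ennreal (2 * (avg u Q)\<^sup>2 / D\<^sup>2)"
    by (intro add_right_mono mult_left_mono 2) simp
  also have "ennreal 2 * (ennreal (M / D) * local_energy u x) = ennreal (2 * M / D) * local_energy u x"
    using M D unfolding mult.assoc[symmetric] by (subst ennreal_mult[symmetric]) auto
  finally show ?thesis by (simp add: M_def D_def Q_def)
qed

text \<open>The factor of \<open>local_energy\<close> in \<open>avg_pointwise\<close> scales as
  \<open>d powr (2 * s)\<close>, so a fine grid makes it equal to \<open>e\<close>. Up to a small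
  multiple of the energy, finitely many linear functionals control the \<open>L2\<close>
  norm.\<close>

lemma finite_rank_estimate:
  assumes e: "0 < e"
  obtains \<Q> M where "finite \<Q>" "\<And>Q. Q \<in> \<Q> \<Longrightarrow> Q \<in> sets lebesgue" "0 \<le> M"
    "\<And>u. u \<in> H \<Longrightarrow> B u u \<le> e * E u u + M * (\<Sum>Q\<in>\<Q>. (avg u Q)\<^sup>2)"
proof -
  let ?n = "real DIM('a)"
  define c where "c = 2 * ?n powr \<alpha>"
  have n: "0 < ?n" by simp
  have c: "0 < c" by (simp add: c_def)
  \<comment> \<open>Solves \<open>2 * (?n * d) powr \<alpha> / d powr ?n = e\<close>, as
    \<open>\<alpha> - ?n = 2 * s\<close>.\<close>
  define d where "d = (e / c) powr (1 / (2 * s))"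
  have d: "0 < d" using e c by (simp add: d_def)
  have ed: "2 * (?n * d) powr \<alpha> / d ^ DIM('a) = e"
  proof -
    have "d ^ DIM('a) = d powr ?n" using d by (simp add: powr_realpow)
    then have "(?n * d) powr \<alpha> / d ^ DIM('a) = ?n powr \<alpha> * d powr (2 * s)"
    proof -
      have "(?n * d) powr \<alpha> / d powr ?n = ?n powr \<alpha> * (d powr \<alpha> / d powr ?n)" using d by (simp add: powr_mult)
      also have "d powr \<alpha> / d powr ?n = d powr (2 * s)" by (simp add: powr_diff[symmetric] \<alpha>_def)
      finally show ?thesis using \<open>d ^ DIM('a) = d powr ?n\<close> by simp
    qed
    also have "d powr (2 * s) = e / c" unfolding d_def using e c s by (simp add: powr_powr)
    also have "?n powr \<alpha> * (e / c) = e / 2" by (simp add: c_def)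
    finally show ?thesis by (simp add: mult.commute)
  qed
  define \<Q> where "\<Q> = cube d ` \<Omega>"
  define D where "D = (d ^ DIM('a))\<^sup>2"
  have D: "0 < D" using d by (simp add: D_def)
  define V where "V = measure lebesgue \<Omega>"
  have V: "emeasure lebesgue \<Omega> = ennreal V" "0 \<le> V" using emeasure_\<Omega> by (auto simp: V_def emeasure_eq_ennreal_measure)
  show ?thesis
  proof (rule that[of \<Q> "2 / D * V"])
    show "finite \<Q>" unfolding \<Q>_def by (rule finite_cubes[OF d])
    show "Q \<in> sets lebesgue" if "Q \<in> \<Q>" for Q using that by (auto simp: \<Q>_def)
    show "0 \<le> 2 / D * V" using D V by simp
    fix u assume u: "u \<in> H"
    note [measurable] = H_D(1)[OF u]
    define S where "S = (\<Sum>Q\<in>\<Q>. (avg u Q)\<^sup>2)"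
    have S: "0 \<le> S" by (auto simp: S_def intro: sum_nonneg)
    have "ennreal (B u u) = (\<integral>\<^sup>+ x. ennreal ((u x)\<^sup>2) \<partial>lebesgue)" by (simp add: nn_B[OF u])
    also have "\<dots> \<le> (\<integral>\<^sup>+ x. ennreal e * local_energy u x + ennreal (2 * S / D) * indicator \<Omega> x \<partial>lebesgue)"
    proof (rule nn_integral_mono_AE, use H_D(2)[OF u] in eventually_elim)
      fix x assume x: "x \<notin> \<Omega> \<longrightarrow> u x = 0"
      show "ennreal ((u x)\<^sup>2) \<le> ennreal e * local_energy u x + ennreal (2 * S / D) * indicator \<Omega> x"
      proof (cases "x \<in> \<Omega>")
        case True
        have "(avg u (cube d x))\<^sup>2 \<le> S" unfolding S_def using finite_cubes[OF d] True
          by (intro member_le_sum) (auto simp: \<Q>_def)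
        then have "2 * (avg u (cube d x))\<^sup>2 / D \<le> 2 * S / D" using D by (simp add: divide_right_mono)
        then have "ennreal (2 * (avg u (cube d x))\<^sup>2 / D) \<le> ennreal (2 * S / D)" by (rule ennreal_leI)
        then show ?thesis using avg_pointwise[OF u d, of x] True unfolding ed D_def[symmetric]
          by (auto intro: order_trans add_left_mono)
      qed (use x in simp)
    qed
    also have "\<dots> = ennreal e * (\<integral>\<^sup>+ x. local_energy u x \<partial>lebesgue) + ennreal (2 * S / D) * emeasure lebesgue \<Omega>"
      by (subst nn_integral_add) (auto simp: nn_integral_cmult nn_integral_cmult_indicator)
    also have "\<dots> = ennreal (e * E u u + 2 / D * V * S)"
      using e E.F_nonneg[of u] D V S by (simp add: nn_local_energy nn_E[OF u] ennreal_mult[symmetric] ennreal_plus[symmetric] mult_ac del: ennreal_plus)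
    finally have "ennreal (B u u) \<le> ennreal (e * E u u + 2 / D * V * S)" .
    moreover have "0 \<le> e * E u u + 2 / D * V * S" using e E.F_nonneg[of u] D V S by simp
    ultimately show "B u u \<le> e * E u u + 2 / D * V * (\<Sum>Q\<in>\<Q>. (avg u Q)\<^sup>2)"
      unfolding S_def[symmetric] using ennreal_le_iff by blast
  qed
qed

end

context frac_domain
begin

lemma avg_diff: "\<lbrakk>u \<in> H; v \<in> H; Q \<in> sets lebesgue\<rbrakk> \<Longrightarrow> avg (u - v) Q = avg u Q - avg v Q"
  using integrable_indicator_mult[of u Q] integrable_indicator_mult[of v Q] integrable_H(1)[of u 1] integrable_H(1)[of v 1]
  by (simp add: avg_def left_diff_distrib)

lemma abs_avg_le:
  assumes u: "u \<in> H" and Q: "Q \<in> sets lebesgue"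
  shows "\<bar>avg u Q\<bar> \<le> measure lebesgue \<Omega> + B u u"
proof -
  have i: "integrable lebesgue u" using integrable_H(1)[OF u zero_less_one] .
  have "\<bar>avg u Q\<bar> \<le> (\<integral>x. \<bar>u x * indicator Q x\<bar> \<partial>lebesgue)" unfolding avg_def by (rule integral_abs_bound)
  also have "\<dots> \<le> (\<integral>x. \<bar>u x\<bar> \<partial>lebesgue)"
    by (rule integral_mono) (use i integrable_indicator_mult[OF i Q] in \<open>auto simp: indicator_def\<close>)
  also have "\<dots> \<le> measure lebesgue \<Omega> + B u u" using integrable_H(2)[OF u zero_less_one] by simp
  finally show ?thesis .
qed

text \<open>The grids for all tolerances \<open>1 / (m + 1)\<close> together have countably many
  cubes, so one subsequence makes every cube integral converge; \<open>finite_rank_estimate\<close>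
  turns this into the Cauchy property in \<open>L2\<close>.\<close>

lemma compact_H:
  assumes u: "\<And>n::nat. u n \<in> H" and C: "\<And>n. E (u n) (u n) \<le> C"
  shows "\<exists>r::nat \<Rightarrow> nat. strict_mono r \<and> (\<forall>e>0. \<exists>N. \<forall>m\<ge>N. \<forall>n\<ge>N. B (u (r m) - u (r n)) (u (r m) - u (r n)) < e)"
proof -
  have "\<exists>\<Q> M. finite \<Q> \<and> (\<forall>Q\<in>\<Q>. Q \<in> sets lebesgue) \<and> 0 \<le> M \<and>
    (\<forall>u\<in>H. B u u \<le> inverse (real (Suc m)) * E u u + M * (\<Sum>Q\<in>\<Q>. (avg u Q)\<^sup>2))" for m
    by (rule finite_rank_estimate[of "inverse (real (Suc m))"]) (simp, blast)
  then obtain \<Q> M where QM: "\<And>m. finite (\<Q> m)" "\<And>m Q. Q \<in> \<Q> m \<Longrightarrow> Q \<in> sets lebesgue" "\<And>m. 0 \<le> M m"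
    "\<And>m u. u \<in> H \<Longrightarrow> B u u \<le> inverse (real (Suc m)) * E u u + M m * (\<Sum>Q\<in>\<Q> m. (avg u Q)\<^sup>2)" by metis
  \<comment> \<open>The empty set makes the collection nonempty, as the enumeration
    requires.\<close>
  define \<A> where "\<A> = insert {} (\<Union>m. \<Q> m)"
  have "countable \<A>" unfolding \<A>_def using QM(1) by (intro countable_insert countable_UN) (auto intro: countable_finite)
  define q where "q = from_nat_into \<A>"
  have q: "range q = \<A>" unfolding q_def by (rule range_from_nat_into) (use \<open>countable \<A>\<close> in \<open>auto simp: \<A>_def\<close>)
  then have qm: "q k \<in> sets lebesgue" for k using QM(2) unfolding \<A>_def by (metis UN_E empty_iff insertE rangeI sets.empty_sets)
  obtain D where D: "\<And>u. u \<in> H \<Longrightarrow> B u u \<le> D * E u u" using poincare_E by blast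
  have C0: "0 \<le> C" using C[of 0] E.F_nonneg[of "u 0"] by linarith
  have "\<bar>avg (u n) (q k)\<bar> \<le> measure lebesgue \<Omega> + \<bar>D\<bar> * C" for n k
  proof -
    have "B (u n) (u n) \<le> D * E (u n) (u n)" by (rule D[OF u])
    also have "\<dots> \<le> \<bar>D\<bar> * C" using C E.F_nonneg by (intro mult_mono) auto
    finally show ?thesis using abs_avg_le[OF u[of n] qm[of k]] by linarith
  qed
  then obtain r l where r: "strict_mono (r :: nat \<Rightarrow> nat)" "\<And>k. (\<lambda>n. avg (u (r n)) (q k)) \<longlonglongrightarrow> l k"
    using diagonal_subsequence[of "\<lambda>n k. avg (u n) (q k)"] by metis
  have cau: "\<exists>N. \<forall>i\<ge>N. \<forall>j\<ge>N. (avg (u (r i) - u (r j)) Q)\<^sup>2 < e" if Q: "Q \<in> \<Q> m" and e: "0 < e" for Q m e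
  proof -
    have "Q \<in> range q" using q Q by (auto simp: \<A>_def)
    then obtain k where k: "q k = Q" by auto
    have "Cauchy (\<lambda>n. avg (u (r n)) (q k))" using r(2) by (rule LIMSEQ_imp_Cauchy)
    moreover have "0 < sqrt e" using e by simp
    ultimately obtain N where N: "\<And>i j. \<lbrakk>i \<ge> N; j \<ge> N\<rbrakk> \<Longrightarrow> \<bar>avg (u (r i)) Q - avg (u (r j)) Q\<bar> < sqrt e"
      unfolding Cauchy_def dist_real_def k by meson
    have "(avg (u (r i) - u (r j)) Q)\<^sup>2 < e" if "i \<ge> N" "j \<ge> N" for i j
    proof -
      have "avg (u (r i) - u (r j)) Q = avg (u (r i)) Q - avg (u (r j)) Q" using avg_diff u QM(2)[OF Q] by blast
      then have "\<bar>avg (u (r i) - u (r j)) Q\<bar> < sqrt e" using N[OF that] by simp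
      then have "\<bar>avg (u (r i) - u (r j)) Q\<bar>\<^sup>2 < (sqrt e)\<^sup>2" by (intro power_strict_mono) auto
      then show ?thesis using e by simp
    qed
    then show ?thesis by blast
  qed
  have "\<exists>N. \<forall>i\<ge>N. \<forall>j\<ge>N. B (u (r i) - u (r j)) (u (r i) - u (r j)) < e" if e: "0 < e" for e
  proof -
    have "0 < e / (2 * (4 * C + 1))" using e C0 by simp
    then obtain m where m: "inverse (real (Suc m)) < e / (2 * (4 * C + 1))" using reals_Archimedean by blast
    define d where "d = e / (2 * (M m + 1) * (real (card (\<Q> m)) + 1))"
    have d: "0 < d" using e QM(3)[of m] by (simp add: d_def add_nonneg_pos)
    have "\<exists>N. \<forall>Q\<in>\<Q> m. \<forall>i\<ge>N. \<forall>j\<ge>N. (avg (u (r i) - u (r j)) Q)\<^sup>2 < d"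
    proof -
      obtain f where f: "\<And>Q i j. \<lbrakk>Q \<in> \<Q> m; i \<ge> f Q; j \<ge> f Q\<rbrakk> \<Longrightarrow> (avg (u (r i) - u (r j)) Q)\<^sup>2 < d"
        using cau[OF _ d] by metis
      have "f Q \<le> Max (insert 0 (f ` \<Q> m))" if "Q \<in> \<Q> m" for Q using QM(1) that by simp
      then show ?thesis using f by (meson order_trans)
    qed
    then obtain N where N: "\<And>Q i j. \<lbrakk>Q \<in> \<Q> m; i \<ge> N; j \<ge> N\<rbrakk> \<Longrightarrow> (avg (u (r i) - u (r j)) Q)\<^sup>2 < d" by blast
    have "B (u (r i) - u (r j)) (u (r i) - u (r j)) < e" if ij: "i \<ge> N" "j \<ge> N" for i j
    proof -
      let ?w = "u (r i) - u (r j)"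
      have w: "?w \<in> H" using u by simp
      have "E (u (r i) + u (r j)) (u (r i) + u (r j)) \<ge> 0" by (rule E.F_nonneg)
      then have "E ?w ?w \<le> 2 * E (u (r i)) (u (r i)) + 2 * E (u (r j)) (u (r j))"
        using u by (simp add: E.F_lin)
      also have "\<dots> \<le> 4 * C" using C[of "r i"] C[of "r j"] by linarith
      finally have "inverse (real (Suc m)) * E ?w ?w \<le> inverse (real (Suc m)) * (4 * C + 1)" by (intro mult_left_mono) auto
      also have "\<dots> < e / (2 * (4 * C + 1)) * (4 * C + 1)" using m C0 by (intro mult_strict_right_mono) auto
      also have "\<dots> = e / 2" using C0 by (simp add: field_simps)
      finally have 1: "inverse (real (Suc m)) * E ?w ?w < e / 2" .
      have "(\<Sum>Q\<in>\<Q> m. (avg ?w Q)\<^sup>2) \<le> (\<Sum>Q\<in>\<Q> m. d)" using N ij by (intro sum_mono less_imp_le)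
      also have "\<dots> = real (card (\<Q> m)) * d" by simp
      also have "\<dots> \<le> (real (card (\<Q> m)) + 1) * d" using d by simp
      finally have "M m * (\<Sum>Q\<in>\<Q> m. (avg ?w Q)\<^sup>2) \<le> (M m + 1) * ((real (card (\<Q> m)) + 1) * d)"
        using QM(3)[of m] d by (intro mult_mono) (auto intro: sum_nonneg)
      also have "\<dots> = e / 2"
      proof -
        have "M m + 1 \<noteq> 0" "real (card (\<Q> m)) + 1 \<noteq> 0" using QM(3)[of m] by auto
        moreover have "a * (b * (e / (2 * a * b))) = e / 2" if "a \<noteq> 0" "b \<noteq> 0" for a b :: real using that by simp
        ultimately show ?thesis unfolding d_def by blast
      qed
      finally show ?thesis using QM(4)[OF w, of m] 1 by linarith
    qed
    then show ?thesis by blast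
  qed
  then show ?thesis using r(1) by blast
qed

section \<open>Finite energy of Lipschitz functions, and infinite dimension\<close>

lemma dyadic_upper:
  fixes v :: real assumes "0 < v" "v < 1"
  obtains j where "(1/2) ^ Suc j \<le> v" "v < (1/2) ^ j"
proof -
  obtain n where "(1/2::real) ^ n < v" using real_arch_pow_inv[OF assms(1), of "1/2"] by auto
  then have ex: "\<exists>j. (1/2::real) ^ Suc j \<le> v" using assms(1) by (intro exI[of _ n]) simp
  define j where "j = (LEAST j. (1/2::real) ^ Suc j \<le> v)"
  have "(1/2) ^ Suc j \<le> v" unfolding j_def by (rule LeastI_ex[OF ex])
  moreover have "v < (1/2) ^ j"
  proof (cases j)
    case (Suc k)
    then have "k < (LEAST j. (1/2::real) ^ Suc j \<le> v)" by (simp add: j_def)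
    from not_less_Least[OF this] show ?thesis using Suc by simp
  qed (use assms in simp)
  ultimately show ?thesis by (rule that)
qed

lemma dyadic_lower:
  fixes v :: real assumes "1 \<le> v"
  obtains j where "2 ^ j \<le> v" "v < 2 ^ Suc j"
proof -
  obtain n where "v < (2::real) ^ n" using real_arch_pow[of 2 v] by auto
  moreover have "(0::real) < 2 ^ n" by simp
  ultimately have "v < (2::real) ^ Suc n" unfolding power_Suc by linarith
  then have ex: "\<exists>j. v < (2::real) ^ Suc j" by blast
  define j where "j = (LEAST j. v < (2::real) ^ Suc j)"
  have "v < 2 ^ Suc j" unfolding j_def by (rule LeastI_ex[OF ex])
  moreover have "2 ^ j \<le> v"
  proof (cases j)
    case (Suc k)
    then have "k < (LEAST j. v < (2::real) ^ Suc j)" by (simp add: j_def)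
    from not_less_Least[OF this] show ?thesis using Suc by simp
  qed (use assms in simp)
  ultimately show ?thesis using that by blast
qed

text \<open>Majorant of the squared difference quotient of a 1-Lipschitz function with values in
  [0, 1].\<close>

definition kern :: "'a \<Rightarrow> 'a \<Rightarrow> real" where "kern x y = min 1 ((norm (x - y))\<^sup>2) / norm (x - y) powr \<alpha>"

text \<open>Dyadic shells replace polar coordinates. The shell of radius about
  \<open>(1/2) ^ j\<close> contributes a multiple of \<open>z1 ^ j\<close>, with
  \<open>z1 < 1\<close> because \<open>s < 1\<close>; the one of radius about \<open>2 ^ j\<close>
  contributes a multiple of \<open>z2 ^ j\<close>, with \<open>z2 < 1\<close> because
  \<open>s > 0\<close>.\<close>

lemma kern_bound:
  obtains C where "\<And>x. (\<integral>\<^sup>+ y. ennreal (kern x y) \<partial>lebesgue) \<le> ennreal C"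
proof -
  let ?n = "real DIM('a)"
  have \<alpha>: "0 < \<alpha>" using s by (simp add: \<alpha>_def)
  define \<omega> where "\<omega> = unit_ball_vol ?n"
  have \<omega>: "0 < \<omega>" by (simp add: \<omega>_def)
  have ball: "emeasure lborel (ball x r) = ennreal (\<omega> * r ^ DIM('a))" if "0 \<le> r" for x :: 'a and r
    using emeasure_ball[OF that, of x] by (simp add: \<omega>_def)
  have [measurable]: "ball x r \<in> sets lebesgue" for x :: 'a and r by simp
  define z1 z2 where "z1 = (2::real) powr (2 * s - 2)" and "z2 = (2::real) powr (- 2 * s)"
  have z: "0 < z1" "z1 < 1" "0 < z2" "z2 < 1"
    using s by (auto simp: z1_def z2_def powr_less_one)
  \<comment> \<open>Upper bounds for the kernel on the inner and outer shells. Each shell is then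
    enlarged to a ball, whose volume is explicit.\<close>
  define a b where "a j = ((1/2) ^ j)\<^sup>2 / ((1/2) ^ Suc j) powr \<alpha>" and "b j = 1 / (2 ^ j) powr \<alpha>" for j :: nat
  have ab: "0 \<le> a j" "0 \<le> b j" for j by (auto simp: a_def b_def)
  let ?f = "\<lambda>(x::'a) j y. ennreal (a j) * indicator (ball x ((1/2) ^ j)) y + ennreal (b j) * indicator (ball x (2 ^ Suc j)) y :: ennreal"
  have le: "ennreal (kern x y) \<le> (suminf (\<lambda>j. ?f x j y))" for x y
  proof (cases "x = y")
    case False
    define v where "v = norm (x - y)"
    have v: "0 < v" using False by (simp add: v_def)
    have "\<exists>j. ennreal (kern x y) \<le> ?f x j y"
    proof (cases "v < 1")
      case True
      obtain j where j: "(1/2) ^ Suc j \<le> v" "v < (1/2) ^ j" using dyadic_upper[OF v True] by blast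
      have "kern x y \<le> v\<^sup>2 / v powr \<alpha>" by (simp add: kern_def v_def[symmetric] divide_right_mono)
      also have "\<dots> \<le> a j" unfolding a_def
      proof (rule frac_le)
        show "v\<^sup>2 \<le> ((1 / 2) ^ j)\<^sup>2" using j v by (intro power_mono) auto
        show "((1 / 2) ^ Suc j) powr \<alpha> \<le> v powr \<alpha>" using j(1) \<alpha> by (intro powr_mono2) auto
      qed auto
      finally have "ennreal (kern x y) \<le> ennreal (a j)" by (rule ennreal_leI)
      moreover have "y \<in> ball x ((1/2) ^ j)" using j(2) by (simp add: v_def dist_norm)
      ultimately show ?thesis by (intro exI[of _ j]) (simp add: add_increasing2)
    next
      case False
      then have "1 \<le> v" by simp
      then obtain j where j: "2 ^ j \<le> v" "v < 2 ^ Suc j" by (rule dyadic_lower)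
      have "kern x y \<le> 1 / v powr \<alpha>" by (simp add: kern_def v_def[symmetric] divide_right_mono)
      also have "\<dots> \<le> b j" unfolding b_def using j(1) \<alpha> v by (intro divide_left_mono powr_mono2) auto
      finally have "ennreal (kern x y) \<le> ennreal (b j)" by (rule ennreal_leI)
      moreover have "y \<in> ball x (2 ^ Suc j)" using j(2) by (simp add: v_def dist_norm)
      ultimately show ?thesis by (intro exI[of _ j]) (simp add: add_increasing)
    qed
    then obtain j where "ennreal (kern x y) \<le> ?f x j y" by blast
    also have "\<dots> \<le> (suminf (\<lambda>j. ?f x j y))" using sum_le_suminf[of "\<lambda>j. ?f x j y" "{j}"] by simp
    finally show ?thesis .
  qed (simp add: kern_def)
  define c where "c j = 2 powr \<alpha> * \<omega> * z1 ^ j + 2 powr ?n * \<omega> * z2 ^ j" for j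
  have c0: "0 \<le> c j" for j using z \<omega> by (simp add: c_def)
  have p2: "(2::real) ^ j = 2 powr (real j)" "(1/2::real) ^ j = 2 powr (- real j)" for j :: nat
    by (simp_all add: powr_realpow powr_minus power_one_over inverse_eq_divide)
  have int: "(\<integral>\<^sup>+ y. ?f x j y \<partial>lebesgue) = ennreal (c j)" for x :: 'a and j
  proof -
    have "(\<integral>\<^sup>+ y. ?f x j y \<partial>lebesgue) = ennreal (a j * (\<omega> * ((1/2) ^ j) ^ DIM('a)) + b j * (\<omega> * (2 ^ Suc j) ^ DIM('a)))"
    proof (subst nn_integral_add)
      show "(\<integral>\<^sup>+ y. ennreal (a j) * indicator (ball x ((1/2) ^ j)) y \<partial>lebesgue) + (\<integral>\<^sup>+ y. ennreal (b j) * indicator (ball x (2 ^ Suc j)) y \<partial>lebesgue)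
        = ennreal (a j * (\<omega> * ((1/2) ^ j) ^ DIM('a)) + b j * (\<omega> * (2 ^ Suc j) ^ DIM('a)))"
        using ab \<omega> ball[of "(1/2) ^ j" x] ball[of "2 ^ Suc j" x]
        by (simp add: nn_integral_cmult_indicator ennreal_mult ennreal_plus del: power_Suc)
    qed measurable
    also have "a j * (\<omega> * ((1/2) ^ j) ^ DIM('a)) = 2 powr \<alpha> * \<omega> * z1 ^ j"
    proof -
      have "((1/2::real) ^ j)\<^sup>2 = 2 powr (- 2 * real j)" "((1/2::real) ^ j) ^ DIM('a) = 2 powr (- real j * ?n)"
        "((1/2) ^ Suc j) powr \<alpha> = 2 powr (- (real j + 1) * \<alpha>)" "z1 ^ j = 2 powr ((2 * s - 2) * real j)"
        unfolding p2 z1_def by (simp_all add: powr_powr powr_realpow[symmetric] powr_add[symmetric] power2_eq_square algebra_simps)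
      then have "a j * (\<omega> * ((1/2) ^ j) ^ DIM('a)) = \<omega> * (2 powr (- 2 * real j) / 2 powr (- (real j + 1) * \<alpha>) * 2 powr (- real j * ?n))"
        by (simp add: a_def)
      also have "2 powr (- 2 * real j) / 2 powr (- (real j + 1) * \<alpha>) * 2 powr (- real j * ?n) = (2::real) powr (\<alpha> + (2 * s - 2) * real j)"
        unfolding powr_diff[symmetric] powr_add[symmetric] by (rule arg_cong[where f = "(powr) 2"]) (simp add: \<alpha>_def algebra_simps)
      finally show ?thesis using \<open>z1 ^ j = _\<close> by (simp add: powr_add)
    qed
    also have "b j * (\<omega> * (2 ^ Suc j) ^ DIM('a)) = 2 powr ?n * \<omega> * z2 ^ j"
    proof -
      have "((2::real) ^ Suc j) ^ DIM('a) = 2 powr ((real j + 1) * ?n)"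
        "(2 ^ j) powr \<alpha> = 2 powr (real j * \<alpha>)" "z2 ^ j = 2 powr (- 2 * s * real j)"
        unfolding p2 z2_def by (simp_all add: powr_powr powr_realpow[symmetric] algebra_simps)
      then have "b j * (\<omega> * (2 ^ Suc j) ^ DIM('a)) = \<omega> * (1 / 2 powr (real j * \<alpha>) * 2 powr ((real j + 1) * ?n))"
        by (simp add: b_def del: power_Suc)
      also have "1 / 2 powr (real j * \<alpha>) * 2 powr ((real j + 1) * ?n) = (2::real) powr (?n + - 2 * s * real j)"
        unfolding powr_minus_divide[symmetric] powr_add[symmetric] by (rule arg_cong[where f = "(powr) 2"]) (simp add: \<alpha>_def algebra_simps)
      also have "(2::real) powr (?n + - 2 * s * real j) = 2 powr ?n * 2 powr (- 2 * s * real j)" by (rule powr_add)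
      finally show ?thesis using \<open>z2 ^ j = _\<close> by simp
    qed
    finally show ?thesis by (simp add: c_def)
  qed
  have "summable c" unfolding c_def using z by (intro summable_add summable_mult summable_geometric) auto
  then have sc: "(suminf (\<lambda>j. ennreal (c j))) = ennreal (suminf (\<lambda>j. c j))" using c0 by (intro suminf_ennreal2)
  show ?thesis
  proof (rule that[of "suminf (\<lambda>j. c j)"])
    fix x
    have "(\<integral>\<^sup>+ y. ennreal (kern x y) \<partial>lebesgue) \<le> (\<integral>\<^sup>+ y. (suminf (\<lambda>j. ?f x j y)) \<partial>lebesgue)" by (intro nn_integral_mono le)
    also have "\<dots> = (suminf (\<lambda>j. \<integral>\<^sup>+ y. ?f x j y \<partial>lebesgue))" by (rule nn_integral_suminf) measurable
    also have "\<dots> = ennreal (suminf (\<lambda>j. c j))" unfolding int sc ..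
    finally show "(\<integral>\<^sup>+ y. ennreal (kern x y) \<partial>lebesgue) \<le> ennreal (suminf (\<lambda>j. c j))" .
  qed
qed

text \<open>Only pairs with a point in \<open>\<Omega>\<close> contribute, and by symmetry of the
  kernel each of the two halves is at most \<open>C\<close> times the measure of
  \<open>\<Omega>\<close>.\<close>

lemma lipschitz_in_H:
  assumes wm: "w \<in> borel_measurable lebesgue" and supp: "\<And>x. x \<notin> \<Omega> \<Longrightarrow> w x = 0"
    and bd: "\<And>x. 0 \<le> w x \<and> w x \<le> 1" and lip: "\<And>x y. \<bar>w x - w y\<bar> \<le> norm (x - y)"
  shows "w \<in> H"
proof (rule H_I[OF wm])
  note [measurable] = measurable_fst_lebesgue measurable_snd_lebesgue
  obtain C where C: "\<And>x. (\<integral>\<^sup>+ y. ennreal (kern x y) \<partial>lebesgue) \<le> ennreal C" using kern_bound by blast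
  have km: "(\<lambda>z. ennreal (kern (fst z) (snd z))) \<in> borel_measurable LL" unfolding kern_def by measurable
  have i1: "(\<lambda>z. indicator \<Omega> (fst z) :: ennreal) \<in> borel_measurable LL" "(\<lambda>z. indicator \<Omega> (snd z) :: ennreal) \<in> borel_measurable LL"
    using measurable_compose[OF measurable_fst borel_measurable_indicator[OF sets_\<Omega>]] measurable_compose[OF measurable_snd borel_measurable_indicator[OF sets_\<Omega>]] by auto
  note [measurable] = km i1
  have "ennreal ((dq s w z)\<^sup>2) \<le> indicator \<Omega> (fst z) * ennreal (kern (fst z) (snd z)) + indicator \<Omega> (snd z) * ennreal (kern (fst z) (snd z))" for z
  proof (cases "fst z \<in> \<Omega> \<or> snd z \<in> \<Omega>")
    case True
    let ?d = "w (fst z) - w (snd z)"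
    have "\<bar>?d\<bar> \<le> 1" using bd[of "fst z"] bd[of "snd z"] by linarith
    then have "?d\<^sup>2 \<le> 1" "?d\<^sup>2 \<le> (norm (fst z - snd z))\<^sup>2"
      using power_mono[of "\<bar>?d\<bar>" 1 2] power_mono[OF lip[of "fst z" "snd z"], of 2] by auto
    then have "?d\<^sup>2 \<le> min 1 ((norm (fst z - snd z))\<^sup>2)" by simp
    then have "(dq s w z)\<^sup>2 \<le> kern (fst z) (snd z)"
      unfolding power2_eq_square dq_mult kern_def \<alpha>_def by (intro divide_right_mono) auto
    then have "ennreal ((dq s w z)\<^sup>2) \<le> ennreal (kern (fst z) (snd z))" by (rule ennreal_leI)
    then show ?thesis using True by (auto simp: indicator_def intro: add_increasing add_increasing2)
  qed (use supp in \<open>simp add: dq_def\<close>)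
  then have "(\<integral>\<^sup>+ z. ennreal ((dq s w z)\<^sup>2) \<partial>LL) \<le> (\<integral>\<^sup>+ z. indicator \<Omega> (fst z) * ennreal (kern (fst z) (snd z)) + indicator \<Omega> (snd z) * ennreal (kern (fst z) (snd z)) \<partial>LL)"
    by (intro nn_integral_mono)
  also have "\<dots> = (\<integral>\<^sup>+ z. indicator \<Omega> (fst z) * ennreal (kern (fst z) (snd z)) \<partial>LL) + (\<integral>\<^sup>+ z. indicator \<Omega> (snd z) * ennreal (kern (fst z) (snd z)) \<partial>LL)"
    by (rule nn_integral_add) measurable
  also have "(\<integral>\<^sup>+ z. indicator \<Omega> (fst z) * ennreal (kern (fst z) (snd z)) \<partial>LL) = (\<integral>\<^sup>+ x. \<integral>\<^sup>+ y. indicator \<Omega> x * ennreal (kern x y) \<partial>lebesgue \<partial>lebesgue)"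
    using lebesgue.nn_integral_fst[of "\<lambda>z. indicator \<Omega> (fst z) * ennreal (kern (fst z) (snd z))" lebesgue] by simp
  also have "(\<integral>\<^sup>+ z. indicator \<Omega> (snd z) * ennreal (kern (fst z) (snd z)) \<partial>LL) = (\<integral>\<^sup>+ y. \<integral>\<^sup>+ x. indicator \<Omega> y * ennreal (kern x y) \<partial>lebesgue \<partial>lebesgue)"
    using lebesgue_pair.nn_integral_snd[of "\<lambda>z. indicator \<Omega> (snd z) * ennreal (kern (fst z) (snd z))"] by simp
  also have "\<dots> = (\<integral>\<^sup>+ x. \<integral>\<^sup>+ y. indicator \<Omega> x * ennreal (kern x y) \<partial>lebesgue \<partial>lebesgue)"
    by (simp add: kern_def norm_minus_commute)
  also have "(\<integral>\<^sup>+ x. \<integral>\<^sup>+ y. indicator \<Omega> x * ennreal (kern x y) \<partial>lebesgue \<partial>lebesgue) \<le> (\<integral>\<^sup>+ x. ennreal C * indicator \<Omega> x \<partial>lebesgue)"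
    by (rule nn_integral_mono) (auto simp: indicator_def C)
  also have "(\<integral>\<^sup>+ x. ennreal C * indicator \<Omega> x \<partial>lebesgue) = ennreal C * emeasure lebesgue \<Omega>" by (simp add: nn_integral_cmult_indicator)
  finally show "(\<integral>\<^sup>+ z. ennreal ((dq s w z)\<^sup>2) \<partial>LL) < \<infinity>"
    using emeasure_\<Omega> by (auto simp: ennreal_mult_less_top add_mono intro: le_less_trans)
qed (use supp in auto)

text \<open>Infinitely many tent functions with disjoint supports fit into any ball; disjointness
  makes them orthogonal in \<open>L2\<close>.\<close>

lemma infinite_dim_H:
  assumes "\<Omega> \<noteq> {}"
  shows "\<exists>w. \<forall>i j::nat. w i \<in> H \<and> B (w i) (w j) = (if i = j then 1 else 0)"
proof -
  obtain x0 where x0: "x0 \<in> \<Omega>" using assms by blast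
  obtain \<rho>0 where \<rho>0: "\<rho>0 > 0" "ball x0 \<rho>0 \<subseteq> \<Omega>" using \<Omega>(1) x0 openE by blast
  define \<rho> where "\<rho> = min 1 \<rho>0"
  have \<rho>: "0 < \<rho>" "\<rho> \<le> 1" "ball x0 \<rho> \<subseteq> \<Omega>" using \<rho>0 by (auto simp: \<rho>_def)
  obtain b :: 'a where b: "b \<in> Basis" using nonempty_Basis by blast
  \<comment> \<open>The centres lie on a segment at distances \<open>t j\<close> from
    \<open>x0\<close>, with radii \<open>t j / 4\<close>. For \<open>i < j\<close> the centres are
    at least \<open>t i / 2\<close> apart, while the radii add up to at most
    \<open>3 / 8 * t i\<close>.\<close>
  define t where "t j = \<rho> * (1/2) ^ Suc j" for j :: nat
  define r where "r j = t j / 4" for j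
  define c where "c j = x0 + t j *\<^sub>R b" for j
  have t: "0 < t j" "t j \<le> \<rho> / 2" "t (Suc j) = t j / 2" for j
  proof -
    show "0 < t j" "t (Suc j) = t j / 2" using \<rho> by (auto simp: t_def)
    have "(1/2::real) ^ j \<le> 1" by (rule power_le_one) auto
    then have "\<rho> * (1/2) ^ j \<le> \<rho> * 1" using \<rho> by (intro mult_left_mono) auto
    then show "t j \<le> \<rho> / 2" by (simp add: t_def)
  qed
  have tmono: "t j \<le> t i / 2" if "i < j" for i j
    using that
  proof (induction j)
    case (Suc j)
    then show ?case using t(1,3)[of j] t(1)[of i] by (cases "i = j") auto
  qed simp
  define w where "w j x = max 0 (r j - dist x (c j))" for j x
  have r: "0 < r j" "r j \<le> 1" for j using t[of j] \<rho> by (auto simp: r_def)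
  have disj: "w i x = 0 \<or> w j x = 0" if "i \<noteq> j" for i j x
  proof -
    have *: "w i x = 0 \<or> w j x = 0" if ij: "i < j" for i j
    proof (rule ccontr)
      assume "\<not> ?thesis"
      then have "dist x (c i) < r i" "dist x (c j) < r j" by (auto simp: w_def max_def split: if_splits)
      then have "dist (c i) (c j) < r i + r j" using dist_triangle3[of "c i" "c j" x] by linarith
      moreover have "dist (c i) (c j) = t i - t j"
        using b tmono[OF ij] t(1)[of i] by (simp add: c_def dist_norm scaleR_diff_left[symmetric])
      ultimately show False using tmono[OF ij] t(1)[of i] by (simp add: r_def)
    qed
    show ?thesis using *[of i j] *[of j i] that by (meson nat_neq_iff)
  qed
  have supp: "w j x = 0" if "x \<notin> \<Omega>" for j x
  proof (rule ccontr)
    assume "w j x \<noteq> 0"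
    then have "dist x (c j) < r j" by (auto simp: w_def max_def split: if_splits)
    moreover have "dist (c j) x0 = t j" using b t(1)[of j] by (simp add: c_def dist_norm)
    ultimately have "dist x x0 < r j + t j" using dist_triangle[of x x0 "c j"] by linarith
    then have "x \<in> ball x0 \<rho>" using t[of j] \<rho>(1) by (simp add: r_def dist_commute)
    then show False using \<rho>(3) that by blast
  qed
  have wc: "continuous_on UNIV (w j)" for j unfolding w_def by (intro continuous_intros)
  have wm [measurable]: "w j \<in> borel_measurable lebesgue" for j
    by (intro measurable_completion) (use borel_measurable_continuous_onI[OF wc] in simp)
  have wH: "w j \<in> H" for j
  proof (rule lipschitz_in_H[OF wm supp])
    show "0 \<le> w j x \<and> w j x \<le> 1" for x using r[of j] zero_le_dist[of x "c j"] unfolding w_def by linarith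
    show "\<bar>w j x - w j y\<bar> \<le> norm (x - y)" for x y
    proof -
      have "dist x (c j) \<le> dist x y + dist y (c j)" "dist y (c j) \<le> dist x y + dist x (c j)"
        using dist_triangle[of x "c j" y] dist_triangle[of y "c j" x] by (auto simp: dist_commute)
      then show ?thesis unfolding w_def dist_norm[of x y, symmetric] by linarith
    qed
  qed auto
  have Bpos: "0 < B (w j) (w j)" for j
  proof -
    have "B (w j) (w j) \<noteq> 0"
    proof
      assume "B (w j) (w j) = 0"
      then have "AE x in lebesgue. w j x = 0" using B_zero_iff wH by blast
      moreover have ms: "{x. w j x \<noteq> 0} \<in> sets lebesgue"
      proof -
        have "{x \<in> space lebesgue. w j x \<noteq> 0} \<in> sets lebesgue" by measurable
        then show ?thesis by simp
      qed
      ultimately have "emeasure lebesgue {x. w j x \<noteq> 0} = 0"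
        using AE_iff_measurable[of "{x. w j x \<noteq> 0}" lebesgue "\<lambda>x. w j x = 0"] by simp
      moreover have "ball (c j) (r j) \<subseteq> {x. w j x \<noteq> 0}" by (auto simp: w_def dist_commute)
      ultimately have "emeasure lebesgue (ball (c j) (r j)) \<le> 0" using emeasure_mono[OF _ ms] by metis
      moreover have "0 < unit_ball_vol (real DIM('a)) * r j ^ DIM('a)" by (intro mult_pos_pos zero_less_power r) simp
      ultimately show False using emeasure_ball[of "r j" "c j"] r(1)[of j] by (simp add: ennreal_eq_0_iff)
    qed
    then show ?thesis using B.F_nonneg[of "w j"] by simp
  qed
  define v where "v j = (1 / sqrt (B (w j) (w j))) *\<^sub>R w j" for j
  have "B (v i) (v j) = (if i = j then 1 else 0)" for i j
  proof (cases "i = j")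
    case True
    then show ?thesis using Bpos[of j] wH by (simp add: v_def B.F_lin)
  next
    case False
    have eq: "(\<lambda>x. w i x * w j x) = (\<lambda>_. 0)" using disj[OF False] by (auto simp: fun_eq_iff)
    have "B (w i) (w j) = 0" unfolding B_def eq by simp
    then show ?thesis using False wH by (simp add: v_def B.F_lin)
  qed
  moreover have "v j \<in> H" for j using wH by (simp add: v_def)
  ultimately show ?thesis by blast
qed

lemma compact_embedding_H:
  assumes "\<Omega> \<noteq> {}" shows "compact_embedding H E B"
proof (intro compact_embedding.intro compact_embedding_axioms.intro)
  show "E u u = 0" if "u \<in> H" "B u u = 0" for u using that B_zero_iff E_zero_iff by blast
qed (use poincare_E complete_H compact_H infinite_dim_H[OF assms] E.semi_inner_axioms B.semi_inner_axioms in blast)+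

end

section \<open>Subcritical Sobolev inequality\<close>

context frac_domain
begin

text \<open>The \<open>L\<^sup>p\<close> bound prevents \<open>u\<close> from staying comparable to \<open>t = \<bar>u x\<bar>\<close> on a ball
  around \<open>x\<close> of volume a large multiple of \<open>K / t\<^sup>p\<close>, so there \<open>u x - u y\<close> is of order \<open>t\<close> on average.\<close>
lemma sobolev_pointwise:
  fixes p K :: real
  assumes u: "u \<in> H" and p: "2 \<le> p" and K: "0 < K" "(\<integral>\<^sup>+ x. ennreal (\<bar>u x\<bar> powr p) \<partial>lebesgue) \<le> ennreal K"
  defines "n \<equiv> real DIM('a)"
  defines "\<omega> \<equiv> unit_ball_vol n"
  defines "M \<equiv> 8 * 8 powr ((p - 2) / 2) / \<omega>"
  shows "ennreal (\<bar>u x\<bar> powr (2 + 2 * s / n * p)) \<le> ennreal (4 / \<omega> * (K * M) powr (2 * s / n)) * local_energy u x"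
proof (cases "u x = 0 \<or> local_energy u x = \<infinity>")
  case True
  have n: "0 < n" and \<omega>: "0 < \<omega>" by (simp_all add: n_def \<omega>_def)
  then have "0 < 4 / \<omega> * (K * M) powr (2 * s / n)" using K by (simp add: M_def)
  then show ?thesis using True by (auto simp: ennreal_mult_top ennreal_mult_eq_top_iff)
next
  case False
  note [measurable] = H_D(1)[OF u]
  have n: "0 < n" and \<omega>: "0 < \<omega>" by (simp_all add: n_def \<omega>_def)
  have M: "0 < M" using \<omega> by (simp add: M_def)
  define t where "t = \<bar>u x\<bar>"
  have t: "0 < t" using False by (simp add: t_def)
  obtain l where l: "0 \<le> l" "local_energy u x = ennreal l" using False by (cases "local_energy u x") auto
  \<comment> \<open>The ball will have volume \<open>\<omega> * \<rho>\<close>. The constant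
    \<open>M\<close> makes the \<open>L^p\<close> contribution \<open>c * K\<close> equal to
    \<open>1 / 4 * t\<^sup>2 * (\<omega> * \<rho>)\<close>, one third of the left side of the
    inequality integrated over the ball.\<close>
  define \<rho> where "\<rho> = K * M * t powr (- p)"
  have \<rho>: "0 < \<rho>" using K M t by (simp add: \<rho>_def)
  define r where "r = \<rho> powr (1 / n)"
  have r: "0 < r" using \<rho> by (simp add: r_def)
  have rn: "r ^ DIM('a) = \<rho>"
    using r \<rho> n by (simp add: powr_realpow[symmetric] n_def[symmetric]) (simp add: r_def powr_powr)
  have ra: "r powr \<alpha> = \<rho> * \<rho> powr (2 * s / n)"
  proof -
    have "r powr \<alpha> = \<rho> powr (1 + 2 * s / n)" using n by (simp add: r_def powr_powr \<alpha>_def n_def[symmetric] field_simps)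
    then show ?thesis using \<rho> by (simp add: powr_add)
  qed
  define e where "e = (2 - p) / 2"
  define c where "c = 2 * (t\<^sup>2 / 8) powr e"
  have c: "0 \<le> c" by (simp add: c_def)
  have pt: "3 / 4 * t\<^sup>2 \<le> 2 * r powr \<alpha> * (dq s u (x, y))\<^sup>2 + c * \<bar>u y\<bar> powr p" if y: "y \<in> ball x r" for y
  proof -
    have "(u x)\<^sup>2 \<le> 2 * (u x - u y)\<^sup>2 + 2 * (u y)\<^sup>2"
      using sum_squares_bound[of "u x - u y" "u y"] by (simp add: power2_eq_square algebra_simps)
    moreover have "(u x - u y)\<^sup>2 \<le> r powr \<alpha> * (dq s u (x, y))\<^sup>2"
      using y r by (intro diff_sq_le) (auto simp: dist_norm)
    \<comment> \<open>Where \<open>u y\<close> is not small compared with \<open>t\<close>, the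
      nonpositive power \<open>e = (2 - p) / 2\<close> of the square brings the exponent
      \<open>p\<close> back to 2.\<close>
    moreover have "(u y)\<^sup>2 \<le> t\<^sup>2 / 8 + (t\<^sup>2 / 8) powr e * \<bar>u y\<bar> powr p"
    proof (cases "(u y)\<^sup>2 \<le> t\<^sup>2 / 8")
      case True
      have "0 \<le> (t\<^sup>2 / 8) powr e * \<bar>u y\<bar> powr p" by simp
      then show ?thesis using True by linarith
    next
      case False
      have uy: "0 < (u y)\<^sup>2" "0 < \<bar>u y\<bar>" using False by auto
      have "((u y)\<^sup>2) powr e \<le> (t\<^sup>2 / 8) powr e" using False t p by (intro powr_mono2') (auto simp: e_def)
      then have "((u y)\<^sup>2) powr e * \<bar>u y\<bar> powr p \<le> (t\<^sup>2 / 8) powr e * \<bar>u y\<bar> powr p" by (intro mult_right_mono) auto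
      moreover have "((u y)\<^sup>2) powr e * \<bar>u y\<bar> powr p = (u y)\<^sup>2"
      proof -
        define a where "a = \<bar>u y\<bar>"
        have a: "0 < a" and sq: "(u y)\<^sup>2 = a powr 2" using uy by (simp_all add: a_def powr_numeral)
        have "(a powr 2) powr e * a powr p = a powr (2 * e + p)" by (simp add: powr_powr powr_add)
        also have "2 * e + p = 2" by (simp add: e_def field_simps)
        finally show ?thesis unfolding sq a_def .
      qed
      moreover have "0 \<le> t\<^sup>2 / 8" by simp
      ultimately show ?thesis by linarith
    qed
    moreover have "(u x)\<^sup>2 = t\<^sup>2" by (simp add: t_def)
    ultimately show ?thesis by (simp add: c_def algebra_simps)
  qed
  have [measurable]: "ball x r \<in> sets lebesgue" by simp
  have "ennreal (3 / 4 * t\<^sup>2 * (\<omega> * \<rho>)) = ennreal (3 / 4 * t\<^sup>2) * emeasure lebesgue (ball x r)"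
    using emeasure_ball[of r x] r \<omega> \<rho> by (simp add: ennreal_mult[symmetric] rn \<omega>_def n_def)
  also have "\<dots> = (\<integral>\<^sup>+ y. ennreal (3 / 4 * t\<^sup>2) * indicator (ball x r) y \<partial>lebesgue)" by (simp add: nn_integral_cmult_indicator)
  also have "\<dots> \<le> (\<integral>\<^sup>+ y. ennreal (2 * r powr \<alpha>) * ennreal ((dq s u (x, y))\<^sup>2) + ennreal c * ennreal (\<bar>u y\<bar> powr p) \<partial>lebesgue)"
  proof (rule nn_integral_mono)
    fix y
    show "ennreal (3 / 4 * t\<^sup>2) * indicator (ball x r) y \<le> ennreal (2 * r powr \<alpha>) * ennreal ((dq s u (x, y))\<^sup>2) + ennreal c * ennreal (\<bar>u y\<bar> powr p)"
    proof (cases "y \<in> ball x r")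
      case True
      have "ennreal (3 / 4 * t\<^sup>2) \<le> ennreal (2 * r powr \<alpha> * (dq s u (x, y))\<^sup>2 + c * \<bar>u y\<bar> powr p)" by (rule ennreal_leI[OF pt[OF True]])
      also have "\<dots> = ennreal (2 * r powr \<alpha>) * ennreal ((dq s u (x, y))\<^sup>2) + ennreal c * ennreal (\<bar>u y\<bar> powr p)"
        using c by (simp add: ennreal_plus ennreal_mult)
      finally show ?thesis using True by simp
    qed simp
  qed
  also have "\<dots> = ennreal (2 * r powr \<alpha>) * local_energy u x + ennreal c * (\<integral>\<^sup>+ y. ennreal (\<bar>u y\<bar> powr p) \<partial>lebesgue)"
    unfolding local_energy_def by (subst nn_integral_add) (simp_all add: nn_integral_cmult)
  also have "\<dots> \<le> ennreal (2 * r powr \<alpha>) * ennreal l + ennreal c * ennreal K"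
    unfolding l by (intro add_left_mono mult_left_mono K) simp
  also have "\<dots> = ennreal (2 * r powr \<alpha> * l + c * K)" using l c K by (simp add: ennreal_plus ennreal_mult)
  finally have "ennreal (3 / 4 * t\<^sup>2 * (\<omega> * \<rho>)) \<le> ennreal (2 * r powr \<alpha> * l + c * K)" .
  moreover have "0 \<le> 2 * r powr \<alpha> * l + c * K" using l c K by simp
  ultimately have main: "3 / 4 * t\<^sup>2 * (\<omega> * \<rho>) \<le> 2 * r powr \<alpha> * l + c * K" using ennreal_le_iff by blast
  have t2: "t\<^sup>2 = t powr 2" using t by (simp add: powr_numeral)
  have "c * K = 2 * K * (t powr (2 - p) * 8 powr ((p - 2) / 2))"
  proof -
    have "(t\<^sup>2 / 8) powr e = t powr (2 * e) / 8 powr e" unfolding t2 using t by (simp add: powr_divide powr_powr del: powr_numeral)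
    also have "2 * e = 2 - p" by (simp add: e_def)
    also have "t powr (2 - p) / 8 powr e = t powr (2 - p) * 8 powr (- e)" by (simp only: powr_minus divide_inverse)
    also have "- e = (p - 2) / 2" by (simp add: e_def minus_divide_left)
    finally show ?thesis unfolding c_def by (simp only: mult_ac)
  qed
  moreover have "1 / 4 * t\<^sup>2 * (\<omega> * \<rho>) = 2 * K * (t powr (2 - p) * 8 powr ((p - 2) / 2))"
  proof -
    have "t powr (2 - p) = t\<^sup>2 * t powr (- p)" unfolding t2 powr_add[symmetric] by simp
    then show ?thesis using \<omega> by (simp add: \<rho>_def M_def)
  qed
  ultimately have "c * K = 1 / 4 * t\<^sup>2 * (\<omega> * \<rho>)" by (simp only:)
  then have "1 / 2 * t\<^sup>2 * (\<omega> * \<rho>) \<le> 2 * r powr \<alpha> * l" using main by linarith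
  \<comment> \<open>\<open>r powr \<alpha>\<close> contains a factor \<open>\<rho>\<close>, which
    cancels the volume. The remaining power of \<open>\<rho>\<close> contributes
    \<open>t powr (- (2 * s / n * p))\<close>, and this is the gain in the exponent.\<close>
  then have "\<rho> * (t\<^sup>2) \<le> \<rho> * (4 / \<omega> * \<rho> powr (2 * s / n) * l)" using \<omega> unfolding ra by (simp add: field_simps)
  then have "t\<^sup>2 \<le> 4 / \<omega> * \<rho> powr (2 * s / n) * l" using \<rho> by (simp only: mult_le_cancel_left_pos)
  also have "\<rho> powr (2 * s / n) = (K * M) powr (2 * s / n) * t powr (- (2 * s / n * p))"
    using K M t unfolding \<rho>_def by (subst powr_mult) (simp add: powr_powr mult_ac)
  finally have "t\<^sup>2 * t powr (2 * s / n * p) \<le> 4 / \<omega> * ((K * M) powr (2 * s / n) * t powr (- (2 * s / n * p))) * l * t powr (2 * s / n * p)"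
    by (intro mult_right_mono) auto
  also have "\<dots> = 4 / \<omega> * (K * M) powr (2 * s / n) * l * (t powr (- (2 * s / n * p)) * t powr (2 * s / n * p))" by (simp only: mult_ac)
  also have "t powr (- (2 * s / n * p)) * t powr (2 * s / n * p) = 1" using t by (simp add: powr_add[symmetric])
  finally have "t powr (2 + 2 * s / n * p) \<le> 4 / \<omega> * (K * M) powr (2 * s / n) * l"
    unfolding powr_add t2 by simp
  then show ?thesis unfolding l(2) t_def[symmetric] using l(1) \<omega> by (simp add: ennreal_mult[symmetric] ennreal_leI)
qed

text \<open>Stated on the unit ball of the energy; \<open>Lp_bound\<close> restores homogeneity by
  scaling.\<close>

definition Lbound :: "real \<Rightarrow> real \<Rightarrow> bool" where
  "Lbound p K \<longleftrightarrow> 0 < K \<and> (\<forall>u\<in>H. E u u \<le> 1 \<longrightarrow> (\<integral>\<^sup>+ x. ennreal (\<bar>u x\<bar> powr p) \<partial>lebesgue) \<le> ennreal K)"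

lemma Lbound_2: "\<exists>K. Lbound 2 K"
proof -
  obtain C where C: "\<And>u. u \<in> H \<Longrightarrow> B u u \<le> C * E u u" using poincare_E by blast
  have "(\<integral>\<^sup>+ x. ennreal (\<bar>u x\<bar> powr 2) \<partial>lebesgue) \<le> ennreal (\<bar>C\<bar> + 1)" if u: "u \<in> H" "E u u \<le> 1" for u
  proof -
    have "\<bar>t\<bar> powr 2 = t\<^sup>2" for t :: real by (cases "t = 0") (simp_all add: powr_numeral)
    then have "(\<integral>\<^sup>+ x. ennreal (\<bar>u x\<bar> powr 2) \<partial>lebesgue) = ennreal (B u u)" by (simp add: nn_B[OF u(1)])
    moreover have "B u u \<le> \<bar>C\<bar> * 1"
      by (rule order_trans[OF C[OF u(1)] mult_mono]) (use u(2) E.F_nonneg in auto)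
    then have "ennreal (B u u) \<le> ennreal (\<bar>C\<bar> + 1)" by (intro ennreal_leI) simp
    ultimately show ?thesis by simp
  qed
  then show ?thesis unfolding Lbound_def by (intro exI[of _ "\<bar>C\<bar> + 1"]) auto
qed

text \<open>Integrating \<open>sobolev_pointwise\<close> over \<open>x\<close> turns the local
  energy into the full one.\<close>

lemma Lbound_step:
  assumes "Lbound p K" "2 \<le> p"
  shows "\<exists>K'. Lbound (2 + 2 * s / real DIM('a) * p) K'"
proof -
  define C where "C = 4 / unit_ball_vol (real DIM('a)) * (K * (8 * 8 powr ((p - 2) / 2) / unit_ball_vol (real DIM('a)))) powr (2 * s / real DIM('a))"
  have K: "0 < K" using assms by (simp add: Lbound_def)
  have C: "0 < C"
  proof -
    have "unit_ball_vol (real DIM('a)) \<noteq> 0" using unit_ball_vol_pos[of "real DIM('a)"] by linarith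
    then have "0 < (K * (8 * 8 powr ((p - 2) / 2) / unit_ball_vol (real DIM('a)))) powr (2 * s / real DIM('a))"
      using K by simp
    then show ?thesis unfolding C_def by (intro mult_pos_pos divide_pos_pos) auto
  qed
  have "(\<integral>\<^sup>+ x. ennreal (\<bar>u x\<bar> powr (2 + 2 * s / real DIM('a) * p)) \<partial>lebesgue) \<le> ennreal C" if u: "u \<in> H" "E u u \<le> 1" for u
  proof -
    note [measurable] = H_D(1)[OF u(1)]
    have "(\<integral>\<^sup>+ x. ennreal (\<bar>u x\<bar> powr (2 + 2 * s / real DIM('a) * p)) \<partial>lebesgue) \<le> (\<integral>\<^sup>+ x. ennreal C * local_energy u x \<partial>lebesgue)"
      unfolding C_def by (intro nn_integral_mono sobolev_pointwise[OF u(1) assms(2) K]) (use assms u in \<open>auto simp: Lbound_def\<close>)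
    also have "\<dots> = ennreal C * ennreal (E u u)" by (simp add: nn_integral_cmult nn_local_energy nn_E[OF u(1)])
    also have "\<dots> \<le> ennreal C * 1" using u(2) by (intro mult_left_mono) (auto simp: ennreal_le_1)
    finally show ?thesis by simp
  qed
  then show ?thesis using C unfolding Lbound_def by blast
qed

lemma Lbound_mono:
  assumes "Lbound p K" "2 \<le> p'" "p' \<le> p"
  shows "\<exists>K'. Lbound p' K'"
proof -
  obtain K2 where K2: "Lbound 2 K2" using Lbound_2 by blast
  have K: "0 < K" "0 < K2" using assms K2 by (auto simp: Lbound_def)
  have le: "\<bar>t\<bar> powr p' \<le> \<bar>t\<bar> powr 2 + \<bar>t\<bar> powr p" for t :: real
  proof (cases "\<bar>t\<bar> \<le> 1")
    case True
    then have "\<bar>t\<bar> powr p' \<le> \<bar>t\<bar> powr 2" using assms(2) by (intro powr_mono') auto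
    then show ?thesis by (simp add: add_increasing2)
  next
    case False
    then have "\<bar>t\<bar> powr p' \<le> \<bar>t\<bar> powr p" using assms(3) by (intro powr_mono) auto
    then show ?thesis by (simp add: add_increasing)
  qed
  have "(\<integral>\<^sup>+ x. ennreal (\<bar>u x\<bar> powr p') \<partial>lebesgue) \<le> ennreal (K2 + K)" if u: "u \<in> H" "E u u \<le> 1" for u
  proof -
    note [measurable] = H_D(1)[OF u(1)]
    have "(\<integral>\<^sup>+ x. ennreal (\<bar>u x\<bar> powr p') \<partial>lebesgue) \<le> (\<integral>\<^sup>+ x. ennreal (\<bar>u x\<bar> powr 2) + ennreal (\<bar>u x\<bar> powr p) \<partial>lebesgue)"
    proof (intro nn_integral_mono)
      show "ennreal (\<bar>u x\<bar> powr p') \<le> ennreal (\<bar>u x\<bar> powr 2) + ennreal (\<bar>u x\<bar> powr p)" for x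
        using ennreal_leI[OF le[of "u x"]] by (subst (asm) ennreal_plus) auto
    qed
    also have "\<dots> = (\<integral>\<^sup>+ x. ennreal (\<bar>u x\<bar> powr 2) \<partial>lebesgue) + (\<integral>\<^sup>+ x. ennreal (\<bar>u x\<bar> powr p) \<partial>lebesgue)"
      by (rule nn_integral_add) measurable
    also have "\<dots> \<le> ennreal K2 + ennreal K" using assms(1) K2 u by (intro add_mono) (auto simp: Lbound_def)
    finally show ?thesis using K by (simp add: ennreal_plus)
  qed
  then show ?thesis using K unfolding Lbound_def by (intro exI[of _ "K2 + K"]) auto
qed

text \<open>From the exponent 2 given by Poincare, \<open>k\<close> improvements lead to
  \<open>2 * (1 + \<theta> + ... + \<theta> ^ k)\<close>. The geometric series converges because
  \<open>2 * s\<close> is less than the dimension, and some partial sum exceeds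
  \<open>p\<close>.\<close>

lemma Lbound_subcritical:
  assumes dim: "2 * s < real DIM('a)" and p: "2 \<le> p" "p < crit_exp DIM('a) s"
  shows "\<exists>K. Lbound p K"
proof -
  define \<theta> where "\<theta> = 2 * s / real DIM('a)"
  have \<theta>: "0 < \<theta>" "\<theta> < 1" using s dim by (auto simp: \<theta>_def)
  define P where "P k = 2 * (\<Sum>i\<le>k. \<theta> ^ i)" for k
  have PS: "P (Suc k) = 2 + \<theta> * P k" for k
    unfolding P_def by (subst sum.atMost_Suc_shift) (simp add: sum_distrib_left algebra_simps)
  have P2: "2 \<le> P k" for k
  proof -
    have "(\<Sum>i\<in>{0}. \<theta> ^ i) \<le> (\<Sum>i\<le>k. \<theta> ^ i)" using \<theta> by (intro sum_mono2) auto
    then show ?thesis by (simp add: P_def)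
  qed
  have L: "\<exists>K. Lbound (P k) K" for k
  proof (induction k)
    case 0 then show ?case using Lbound_2 by (simp add: P_def)
  next
    case (Suc k)
    then show ?case using Lbound_step[OF _ P2] unfolding PS \<theta>_def by blast
  qed
  have "(\<lambda>k. \<Sum>i<k. \<theta> ^ i) \<longlonglongrightarrow> 1 / (1 - \<theta>)"
    using geometric_sums[of \<theta>] \<theta> unfolding sums_def by simp
  then have "(\<lambda>k. \<Sum>i<Suc k. \<theta> ^ i) \<longlonglongrightarrow> 1 / (1 - \<theta>)" by (rule LIMSEQ_Suc)
  then have "P \<longlonglongrightarrow> 2 * (1 / (1 - \<theta>))" unfolding P_def lessThan_Suc_atMost by (intro tendsto_mult_left)
  moreover have "2 * (1 / (1 - \<theta>)) = crit_exp DIM('a) s" using dim by (simp add: \<theta>_def crit_exp_def field_simps)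
  ultimately have "eventually (\<lambda>k. p < P k) sequentially" using p(2) by (auto intro: order_tendstoD)
  then obtain k where "p < P k" by (auto simp: eventually_sequentially)
  then show ?thesis using L[of k] Lbound_mono p(1) by (meson less_imp_le)
qed

lemma Lp_bound:
  assumes K: "Lbound p K" and u: "u \<in> H" and p: "0 < p"
  shows "integrable lebesgue (\<lambda>x. \<bar>u x\<bar> powr p)" "(\<integral>x. \<bar>u x\<bar> powr p \<partial>lebesgue) \<le> K * sqrt (E u u) powr p"
proof -
  note [measurable] = H_D(1)[OF u]
  have K0: "0 < K" using K by (simp add: Lbound_def)
  have "integrable lebesgue (\<lambda>x. \<bar>u x\<bar> powr p) \<and> (\<integral>x. \<bar>u x\<bar> powr p \<partial>lebesgue) \<le> K * sqrt (E u u) powr p"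
  proof (cases "E u u = 0")
    case True
    then have z: "AE x in lebesgue. \<bar>u x\<bar> powr p = 0" using E_zero_iff[OF u] p by auto
    have "integrable lebesgue (\<lambda>x. \<bar>u x\<bar> powr p)" using z by (subst integrable_cong_AE[of _ _ "\<lambda>_. 0"]) auto
    moreover have "(\<integral>x. \<bar>u x\<bar> powr p \<partial>lebesgue) = 0" using z by (rule integral_eq_zero_AE)
    ultimately show ?thesis using K0 by simp
  next
    case False
    define a where "a = sqrt (E u u)"
    have a: "0 < a" using False E.F_nonneg[of u] by (simp add: a_def)
    let ?v = "(1 / a) *\<^sub>R u"
    have v: "?v \<in> H" using u by simp
    have "a * a = E u u" using E.F_nonneg[of u] by (simp add: a_def)
    then have "E ?v ?v = 1" using u False by (simp add: E.F_lin)
    then have "(\<integral>\<^sup>+ x. ennreal (\<bar>?v x\<bar> powr p) \<partial>lebesgue) \<le> ennreal K" using K v by (auto simp: Lbound_def)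
    then have "ennreal (a powr p) * (\<integral>\<^sup>+ x. ennreal (\<bar>?v x\<bar> powr p) \<partial>lebesgue) \<le> ennreal (a powr p) * ennreal K"
      by (intro mult_left_mono) auto
    moreover have "ennreal (a powr p) * (\<integral>\<^sup>+ x. ennreal (\<bar>?v x\<bar> powr p) \<partial>lebesgue) = (\<integral>\<^sup>+ x. ennreal (\<bar>u x\<bar> powr p) \<partial>lebesgue)"
      using a by (subst nn_integral_cmult[symmetric]) (auto simp: ennreal_mult[symmetric] powr_mult[symmetric] abs_mult intro!: nn_integral_cong)
    ultimately have le: "(\<integral>\<^sup>+ x. ennreal (\<bar>u x\<bar> powr p) \<partial>lebesgue) \<le> ennreal (K * a powr p)"
      using K0 by (simp add: ennreal_mult mult.commute)
    then have i: "integrable lebesgue (\<lambda>x. \<bar>u x\<bar> powr p)"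
      unfolding integrable_iff_bounded by (auto intro: le_less_trans)
    then show ?thesis using le nn_integral_eq_integral[OF i] K0 by (simp add: a_def)
  qed
  then show "integrable lebesgue (\<lambda>x. \<bar>u x\<bar> powr p)" "(\<integral>x. \<bar>u x\<bar> powr p \<partial>lebesgue) \<le> K * sqrt (E u u) powr p" by auto
qed

end

section \<open>Nemytskii operators and power inequalities\<close>

text \<open>For a simple function in the second argument the composition is a finite sum of sections
  times indicators; continuity in that argument handles pointwise limits.\<close>

lemma caratheodory_measurable:
  fixes f :: "'z \<Rightarrow> real \<Rightarrow> real"
  assumes fm [measurable]: "\<And>t. (\<lambda>x. f x t) \<in> borel_measurable M" and fc: "\<And>x. continuous_on UNIV (f x)"
    and u: "u \<in> borel_measurable M"
  shows "(\<lambda>x. f x (u x)) \<in> borel_measurable M"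
proof -
  obtain v where v: "\<And>i. simple_function M (v i)" "\<And>x. x \<in> space M \<Longrightarrow> (\<lambda>i. v i x) \<longlonglongrightarrow> u x"
    using borel_measurable_implies_sequence_metric[OF u, of 0] by blast
  show ?thesis
  proof (rule borel_measurable_LIMSEQ_metric)
    fix i
    have fin: "finite (v i ` space M)" using v(1) by (rule simple_functionD)
    have [measurable]: "v i -` {y} \<inter> space M \<in> sets M" for y using v(1) by (rule simple_functionD)
    have "(\<lambda>x. \<Sum>y\<in>v i ` space M. indicator (v i -` {y} \<inter> space M) x * f x y) \<in> borel_measurable M"
      by measurable
    moreover have "(\<Sum>y\<in>v i ` space M. indicator (v i -` {y} \<inter> space M) x * f x y) = f x (v i x)" if x: "x \<in> space M" for x
    proof -
      have "(\<Sum>y\<in>v i ` space M. indicator (v i -` {y} \<inter> space M) x * f x y) = (\<Sum>y\<in>v i ` space M. if y = v i x then f x y else 0)"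
        using x by (intro sum.cong) (auto simp: indicator_def)
      then show ?thesis using fin x by simp
    qed
    ultimately show "(\<lambda>x. f x (v i x)) \<in> borel_measurable M" by (subst measurable_cong[where g = "\<lambda>x. \<Sum>y\<in>v i ` space M. indicator (v i -` {y} \<inter> space M) x * f x y"]) auto
  next
    fix x assume "x \<in> space M"
    then show "(\<lambda>i. f x (v i x)) \<longlonglongrightarrow> f x (u x)"
      using continuous_on_tendsto_compose[OF fc v(2)] by auto
  qed
qed

text \<open>\<open>prim\<close> is an oriented integral from 0, so it is first rewritten with the
  lower end \<open>-c\<close>, to the left of both 0 and \<open>t\<close>.\<close>

lemma prim_has_derivative:
  assumes fc: "continuous_on UNIV (f x)"
  shows "(prim f x has_real_derivative f x t) (at t)"
proof -
  define c where "c = \<bar>t\<bar> + 1"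
  have i: "interval_lebesgue_integrable lborel (ereal a) (ereal b) (f x)" for a b
    using fc by (intro interval_integrable_isCont) (auto simp: continuous_on_eq_continuous_at)
  have eq: "prim f x r = (LBINT y=-c..r. f x y) - (LBINT y=-c..0. f x y)" for r
    using interval_integral_sum[of "-c" 0 r "f x"] i by (simp add: prim_def zero_ereal_def flip: ereal_min ereal_max)
  have "((\<lambda>r. LBINT y=-c..r. f x y) has_vector_derivative f x t) (at t within {-c..c})"
    by (rule interval_integral_FTC2) (use fc in \<open>auto simp: c_def intro: continuous_on_subset\<close>)
  moreover have "at t within {-c..c} = at t" by (rule at_within_Icc_at) (auto simp: c_def)
  ultimately have "((\<lambda>r. LBINT y=-c..r. f x y) has_real_derivative f x t) (at t)"
    by (simp add: has_real_derivative_iff_has_vector_derivative)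
  then have "((\<lambda>r. (LBINT y=-c..r. f x y) - (LBINT y=-c..0. f x y)) has_real_derivative f x t - 0) (at t)"
    by (intro DERIV_diff DERIV_const)
  then show ?thesis unfolding eq[abs_def] by simp
qed

lemma prim_zero [simp]: "prim f x 0 = 0"
  by (simp add: prim_def zero_ereal_def)

text \<open>On the product with the line, \<open>f\<close> is jointly measurable by
  \<open>caratheodory_measurable\<close>, hence so is the parameter integral.\<close>

lemma prim_measurable:
  fixes f :: "'z \<Rightarrow> real \<Rightarrow> real"
  assumes fm: "\<And>t. (\<lambda>x. f x t) \<in> borel_measurable M" and fc: "\<And>x. continuous_on UNIV (f x)"
  shows "(\<lambda>x. prim f x t) \<in> borel_measurable M"
proof -
  have [measurable]: "(\<lambda>z. f (fst z) (snd z)) \<in> borel_measurable (M \<Otimes>\<^sub>M lborel)"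
    by (rule caratheodory_measurable[where f = "\<lambda>z. f (fst z)"])
      (use fm fc measurable_compose[OF measurable_fst fm] in auto)
  have "(\<lambda>x. \<integral>y. indicator S y *\<^sub>R f x y \<partial>lborel) \<in> borel_measurable M" if [measurable]: "S \<in> sets lborel" for S
  proof (rule lborel.borel_measurable_lebesgue_integral)
    have "(\<lambda>z. indicator S (snd z) *\<^sub>R f (fst z) (snd z)) \<in> borel_measurable (M \<Otimes>\<^sub>M lborel)" by measurable
    then show "(\<lambda>(x, y). indicator S y *\<^sub>R f x y) \<in> borel_measurable (M \<Otimes>\<^sub>M lborel)" by (simp add: case_prod_beta')
  qed
  then show ?thesis unfolding prim_def interval_lebesgue_integral_def set_lebesgue_integral_def
    by (intro measurable_If borel_measurable_uminus) auto
qed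

lemma prim_measurable_comp:
  fixes f :: "'z \<Rightarrow> real \<Rightarrow> real"
  assumes fm: "\<And>t. (\<lambda>x. f x t) \<in> borel_measurable M" and fc: "\<And>x. continuous_on UNIV (f x)"
    and u: "u \<in> borel_measurable M"
  shows "(\<lambda>x. prim f x (u x)) \<in> borel_measurable M"
  by (rule caratheodory_measurable[OF prim_measurable[OF fm fc] _ u])
    (use DERIV_continuous[OF prim_has_derivative[of f, OF fc]] in \<open>auto intro: continuous_at_imp_continuous_on\<close>)

text \<open>Young's inequality with crude constants: according to whether
  \<open>b \<le> \<eta> * a\<close>, one variable is replaced by a multiple of the other.\<close>

lemma young_left:
  fixes a b \<eta> q :: real
  assumes "0 \<le> a" "0 \<le> b" "0 < \<eta>" "1 < q"
  shows "a powr (q - 1) * b \<le> \<eta> * a powr q + \<eta> powr (1 - q) * b powr q"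
proof (cases "b \<le> \<eta> * a")
  case True
  have "a powr (q - 1) * b \<le> a powr (q - 1) * (\<eta> * a)" using True by (intro mult_left_mono) auto
  also have "\<dots> = \<eta> * (a powr (q - 1) * a powr 1)" using assms by simp
  also have "a powr (q - 1) * a powr 1 = a powr q" unfolding powr_add[symmetric] by simp
  finally show ?thesis by (simp add: add_increasing2)
next
  case False
  have b: "0 < b" using False assms by (smt (verit) mult_nonneg_nonneg)
  have "a powr (q - 1) \<le> (b / \<eta>) powr (q - 1)" using False assms by (intro powr_mono2) (auto simp: field_simps)
  then have "a powr (q - 1) * b \<le> (b / \<eta>) powr (q - 1) * b" using b by (intro mult_right_mono) auto
  also have "(b / \<eta>) powr (q - 1) = \<eta> powr (1 - q) * b powr (q - 1)"
    using assms b powr_minus_divide[of \<eta> "q - 1"] by (simp add: powr_divide)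
  also have "\<eta> powr (1 - q) * b powr (q - 1) * b = \<eta> powr (1 - q) * (b powr (q - 1) * b powr 1)" using b by simp
  also have "b powr (q - 1) * b powr 1 = b powr q" unfolding powr_add[symmetric] by simp
  finally show ?thesis using assms by (simp add: add_increasing)
qed

text \<open>This is \<open>young_left\<close> for \<open>a = d powr (1 / (q - 1))\<close>, with a
  parameter \<open>\<theta>\<close> such that \<open>\<theta> powr (1 - q) = \<eta>\<close>.\<close>

lemma young_right:
  fixes d b \<eta> q :: real
  assumes "0 \<le> d" "0 \<le> b" "0 < \<eta>" "1 < q"
  shows "d * b \<le> \<eta> powr (- (1 / (q - 1))) * d powr (q / (q - 1)) + \<eta> * b powr q"
proof -
  define a where "a = d powr (1 / (q - 1))"
  have aq: "a powr (q - 1) = d" using assms by (simp add: a_def powr_powr)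
  have "a powr q = d powr (q / (q - 1))" using assms by (simp add: a_def powr_powr)
  moreover define \<theta> where "\<theta> = \<eta> powr (- (1 / (q - 1)))"
  moreover have "\<theta> powr (1 - q) = \<eta>"
  proof -
    have "- (1 / (q - 1)) * (1 - q) = 1" using assms by (simp add: field_simps)
    then show ?thesis unfolding \<theta>_def powr_powr using assms by simp
  qed
  moreover have "0 < \<theta>" using assms by (simp add: \<theta>_def)
  ultimately show ?thesis using young_left[of a b \<theta> q] assms aq by (simp add: a_def)
qed

lemma powr_add_le:
  fixes a b p :: real
  assumes "0 \<le> a" "0 \<le> b" "0 \<le> p"
  shows "(a + b) powr p \<le> 2 powr p * (a powr p + b powr p)"
proof -
  have "(a + b) powr p \<le> (2 * max a b) powr p" using assms by (intro powr_mono2) auto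
  also have "\<dots> = 2 powr p * (max a b) powr p" using assms by (simp add: powr_mult)
  also have "(max a b) powr p \<le> a powr p + b powr p" by (simp add: max_def)
  finally show ?thesis by simp
qed

text \<open>The cases split at the solution of
  \<open>\<eta> * \<bar>t\<bar> powr (q - 2) = 1\<close>.\<close>

lemma square_le_powr:
  fixes \<eta> q t :: real
  assumes "0 < \<eta>" "2 < q"
  shows "t\<^sup>2 \<le> \<eta> * \<bar>t\<bar> powr q + (\<eta> powr (- (1 / (q - 2))))\<^sup>2"
proof (cases "\<bar>t\<bar> \<le> \<eta> powr (- (1 / (q - 2)))")
  case True
  then have "\<bar>t\<bar>\<^sup>2 \<le> (\<eta> powr (- (1 / (q - 2))))\<^sup>2" by (intro power_mono) auto
  then show ?thesis using assms by (simp add: add_increasing)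
next
  case False
  then have t: "0 < \<bar>t\<bar>" by (smt (verit) powr_ge_zero)
  have "(\<eta> powr (- (1 / (q - 2)))) powr (q - 2) \<le> \<bar>t\<bar> powr (q - 2)" using False assms by (intro powr_mono2) auto
  moreover have "(\<eta> powr (- (1 / (q - 2)))) powr (q - 2) = inverse \<eta>"
  proof -
    have "- (1 / (q - 2)) * (q - 2) = - 1" using assms by simp
    then show ?thesis unfolding powr_powr using assms by (simp add: powr_minus)
  qed
  ultimately have "1 \<le> \<eta> * \<bar>t\<bar> powr (q - 2)" using assms by (simp add: field_simps)
  then have "t\<^sup>2 * 1 \<le> t\<^sup>2 * (\<eta> * \<bar>t\<bar> powr (q - 2))" by (intro mult_left_mono) auto
  also have "\<dots> = \<eta> * (\<bar>t\<bar> powr 2 * \<bar>t\<bar> powr (q - 2))" using t by (simp add: powr_numeral)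
  also have "\<bar>t\<bar> powr 2 * \<bar>t\<bar> powr (q - 2) = \<bar>t\<bar> powr q" unfolding powr_add[symmetric] by simp
  finally show ?thesis by (simp add: add_increasing2)
qed

text \<open>Interpolation between the exponents 2 and \<open>p\<close>, split at
  \<open>\<epsilon> * \<bar>t\<bar> powr (p - q) = 1\<close>. It makes a null sequence of
  \<open>L2\<close> that is bounded in \<open>L^p\<close> a null sequence of
  \<open>L^q\<close>.\<close>

lemma powr_between:
  fixes \<epsilon> p q t :: real
  assumes "0 < \<epsilon>" "2 < q" "q < p"
  shows "\<bar>t\<bar> powr q \<le> \<epsilon> * \<bar>t\<bar> powr p + \<epsilon> powr (- ((q - 2) / (p - q))) * t\<^sup>2"
proof (cases "t = 0")
  case False
  then have t: "0 < \<bar>t\<bar>" by simp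
  define m where "m = \<epsilon> powr (- (1 / (p - q)))"
  have m: "0 < m" using assms by (simp add: m_def)
  show ?thesis
  proof (cases "\<bar>t\<bar> \<le> m")
    case True
    have "\<bar>t\<bar> powr q = \<bar>t\<bar> powr (q - 2) * \<bar>t\<bar> powr 2" unfolding powr_add[symmetric] by simp
    also have "\<dots> = \<bar>t\<bar> powr (q - 2) * t\<^sup>2" using t by (simp add: powr_numeral)
    also have "\<dots> \<le> m powr (q - 2) * t\<^sup>2" using True assms by (intro mult_right_mono powr_mono2) auto
    also have "m powr (q - 2) = \<epsilon> powr (- ((q - 2) / (p - q)))" by (simp add: m_def powr_powr)
    finally show ?thesis using assms by (simp add: add_increasing)
  next
    case False
    have "m powr (p - q) \<le> \<bar>t\<bar> powr (p - q)" using False m assms by (intro powr_mono2) auto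
    moreover have "m powr (p - q) = inverse \<epsilon>"
    proof -
      have "- (1 / (p - q)) * (p - q) = - 1" using assms by simp
      then show ?thesis unfolding m_def powr_powr using assms by (simp add: powr_minus)
    qed
    ultimately have "1 \<le> \<epsilon> * \<bar>t\<bar> powr (p - q)" using assms by (simp add: field_simps)
    then have "\<bar>t\<bar> powr q * 1 \<le> \<bar>t\<bar> powr q * (\<epsilon> * \<bar>t\<bar> powr (p - q))" by (intro mult_left_mono) auto
    also have "\<dots> = \<epsilon> * (\<bar>t\<bar> powr q * \<bar>t\<bar> powr (p - q))" by simp
    also have "\<bar>t\<bar> powr q * \<bar>t\<bar> powr (p - q) = \<bar>t\<bar> powr p" unfolding powr_add[symmetric] by simp
    finally show ?thesis using t by (simp add: add_increasing2)
  qed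
qed simp

section \<open>The nonlinear term in eigenbasis coordinates\<close>

text \<open>Here \<open>f\<close> has already been set to 0 outside a subset
  \<open>\<Omega>'\<close> of full measure on which the almost-everywhere conditions hold
  simultaneously. Thus continuity, growth and smallness can be stated for every point.\<close>

locale frac_problem = frac_domain \<Omega> s for \<Omega> :: "'a::euclidean_space set" and s :: real +
  fixes f :: "'a \<Rightarrow> real \<Rightarrow> real" and q a1 a2 a3 a4 :: real and \<Omega>' :: "'a set"
  assumes dim: "2 * s < real DIM('a)" and q: "2 < q" "q < crit_exp DIM('a) s"
    and f_meas: "\<And>t. (\<lambda>x. f x t) \<in> borel_measurable lebesgue" and f_cont: "\<And>x. continuous_on UNIV (f x)"
    and \<Omega>'_full: "\<Omega>' \<subseteq> \<Omega>" "AE x in lebesgue. x \<in> \<Omega> \<longrightarrow> x \<in> \<Omega>'"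
    and f_out: "\<And>x t. x \<notin> \<Omega>' \<Longrightarrow> f x t = 0"
    and a: "0 < a1" "0 < a2" "0 < a3" "0 < a4"
    and f_growth: "\<And>x t. \<bar>f x t\<bar> \<le> a1 + a2 * \<bar>t\<bar> powr (q - 1)"
    and F_lower: "\<And>x t. x \<in> \<Omega>' \<Longrightarrow> a3 * \<bar>t\<bar> powr q - a4 \<le> prim f x t"
    and f_small: "\<And>\<epsilon>. 0 < \<epsilon> \<Longrightarrow> \<exists>\<delta>>0. \<forall>x t. \<bar>t\<bar> < \<delta> \<longrightarrow> \<bar>f x t\<bar> \<le> \<epsilon> * \<bar>t\<bar>"
    and f_AR: "\<And>x t. \<lbrakk>x \<in> \<Omega>'; t \<noteq> 0\<rbrakk> \<Longrightarrow> 0 < prim f x t \<and> q * prim f x t \<le> t * f x t"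
begin

definition Kq :: real where "Kq = (SOME K. Lbound q K)"

lemma Kq: "Lbound q Kq" "0 < Kq"
proof -
  show 1: "Lbound q Kq" unfolding Kq_def by (rule someI_ex[OF Lbound_subcritical]) (use dim q in auto)
  then show "0 < Kq" by (simp add: Lbound_def)
qed

lemma Lq: 
  assumes "u \<in> H"
  shows "integrable lebesgue (\<lambda>x. \<bar>u x\<bar> powr q)" "(\<integral>x. \<bar>u x\<bar> powr q \<partial>lebesgue) \<le> Kq * sqrt (E u u) powr q"
  using Lp_bound[OF Kq(1) assms] q by auto

lemma Lq_unit:
  assumes "u \<in> H" "E u u \<le> 1" shows "(\<integral>x. \<bar>u x\<bar> powr q \<partial>lebesgue) \<le> Kq"
proof -
  have "sqrt (E u u) powr q \<le> 1 powr q" using assms q E.F_nonneg[of u] by (intro powr_mono2) auto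
  then have "Kq * sqrt (E u u) powr q \<le> Kq * 1" using Kq(2) by (intro mult_left_mono) auto
  then show ?thesis using Lq(2)[OF assms(1)] by linarith
qed

lemma f_comp [measurable]: "u \<in> borel_measurable lebesgue \<Longrightarrow> (\<lambda>x. f x (u x)) \<in> borel_measurable lebesgue"
  by (rule caratheodory_measurable[OF f_meas f_cont])

lemma F_comp [measurable]: "u \<in> borel_measurable lebesgue \<Longrightarrow> (\<lambda>x. prim f x (u x)) \<in> borel_measurable lebesgue"
  by (rule prim_measurable_comp[OF f_meas f_cont])

lemma F_mvt: "\<exists>\<xi>. \<bar>\<xi>\<bar> \<le> max \<bar>r\<bar> \<bar>t\<bar> \<and> prim f x t - prim f x r = f x \<xi> * (t - r)"
proof (cases r t rule: linorder_cases)
  case less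
  obtain z where "r < z" "z < t" "prim f x t - prim f x r = (t - r) * f x z"
    using MVT2[OF less, of "prim f x" "f x"] prim_has_derivative[of f x, OF f_cont] by metis
  then show ?thesis by (intro exI[of _ z]) auto
next
  case greater
  obtain z where "t < z" "z < r" "prim f x r - prim f x t = (r - t) * f x z"
    using MVT2[OF greater, of "prim f x" "f x"] prim_has_derivative[of f x, OF f_cont] by metis
  then show ?thesis by (intro exI[of _ z]) (auto simp: algebra_simps)
qed auto

lemma f_zero: "f x 0 = 0"
proof -
  obtain \<delta> where "0 < \<delta>" "\<And>t. \<bar>t\<bar> < \<delta> \<Longrightarrow> \<bar>f x t\<bar> \<le> 1 * \<bar>t\<bar>" using f_small[OF zero_less_one] by blast
  from this(2)[of 0] this(1) show ?thesis by simp
qed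

lemma F_out: "x \<notin> \<Omega>' \<Longrightarrow> prim f x t = 0"
  using F_mvt[of 0 t x] f_out by auto

lemma F_growth: "\<bar>prim f x t\<bar> \<le> a1 * \<bar>t\<bar> + a2 * \<bar>t\<bar> powr q"
proof -
  obtain z where z: "\<bar>z\<bar> \<le> \<bar>t\<bar>" "prim f x t = f x z * t" using F_mvt[of 0 t x] by auto
  have "\<bar>f x z\<bar> \<le> a1 + a2 * \<bar>z\<bar> powr (q - 1)" by (rule f_growth)
  also have "\<dots> \<le> a1 + a2 * \<bar>t\<bar> powr (q - 1)" using z a q by (intro add_left_mono mult_left_mono powr_mono2) auto
  finally have "\<bar>prim f x t\<bar> \<le> (a1 + a2 * \<bar>t\<bar> powr (q - 1)) * \<bar>t\<bar>"
    unfolding z(2) abs_mult by (rule mult_right_mono) simp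
  also have "\<dots> = a1 * \<bar>t\<bar> + a2 * (\<bar>t\<bar> powr (q - 1) * \<bar>t\<bar> powr 1)" by (simp add: algebra_simps)
  also have "\<bar>t\<bar> powr (q - 1) * \<bar>t\<bar> powr 1 = \<bar>t\<bar> powr q" unfolding powr_add[symmetric] by simp
  finally show ?thesis .
qed

lemma f_mult_le:
  assumes "0 < \<eta>"
  shows "\<bar>f x t * b\<bar> \<le> a1 * \<bar>b\<bar> + a2 * (\<eta> * \<bar>t\<bar> powr q + \<eta> powr (1 - q) * \<bar>b\<bar> powr q)"
proof -
  have "\<bar>f x t * b\<bar> \<le> (a1 + a2 * \<bar>t\<bar> powr (q - 1)) * \<bar>b\<bar>" unfolding abs_mult by (intro mult_right_mono f_growth) simp
  also have "\<dots> = a1 * \<bar>b\<bar> + a2 * (\<bar>t\<bar> powr (q - 1) * \<bar>b\<bar>)" by (simp add: algebra_simps)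
  also have "\<dots> \<le> a1 * \<bar>b\<bar> + a2 * (\<eta> * \<bar>t\<bar> powr q + \<eta> powr (1 - q) * \<bar>b\<bar> powr q)"
    using young_left[of "\<bar>t\<bar>" "\<bar>b\<bar>" \<eta> q] assms a q by (intro add_left_mono mult_left_mono) auto
  finally show ?thesis .
qed

text \<open>Beyond the \<open>\<delta>\<close> of \<open>f_small\<close> the constant
  \<open>a1\<close> is absorbed into a multiple of
  \<open>\<bar>t\<bar> powr (q - 1)\<close>.\<close>

lemma f_small_growth:
  assumes "0 < \<epsilon>"
  obtains C where "0 < C" "\<And>x t. \<bar>f x t\<bar> \<le> \<epsilon> * \<bar>t\<bar> + C * \<bar>t\<bar> powr (q - 1)"
proof -
  obtain \<delta> where \<delta>: "0 < \<delta>" "\<And>x t. \<bar>t\<bar> < \<delta> \<Longrightarrow> \<bar>f x t\<bar> \<le> \<epsilon> * \<bar>t\<bar>" using f_small[OF assms] by blast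
  define C where "C = a1 / \<delta> powr (q - 1) + a2"
  have C: "0 < C" "a2 \<le> C" using a \<delta> by (auto simp: C_def add_pos_pos)
  have "\<bar>f x t\<bar> \<le> \<epsilon> * \<bar>t\<bar> + C * \<bar>t\<bar> powr (q - 1)" for x t
  proof (cases "\<bar>t\<bar> < \<delta>")
    case True
    then show ?thesis using \<delta>(2)[OF True, of x] C by (simp add: add_increasing2)
  next
    case False
    have "\<delta> powr (q - 1) \<le> \<bar>t\<bar> powr (q - 1)" using False \<delta> q by (intro powr_mono2) auto
    then have "a1 / \<delta> powr (q - 1) * \<delta> powr (q - 1) \<le> a1 / \<delta> powr (q - 1) * \<bar>t\<bar> powr (q - 1)"
      using a \<delta> by (intro mult_left_mono) auto
    then have "a1 \<le> a1 / \<delta> powr (q - 1) * \<bar>t\<bar> powr (q - 1)" using \<delta> by simp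
    then have "a1 + a2 * \<bar>t\<bar> powr (q - 1) \<le> C * \<bar>t\<bar> powr (q - 1)" by (simp add: C_def algebra_simps)
    then show ?thesis using f_growth[of x t] assms by (simp add: add_increasing)
  qed
  with C that show ?thesis by blast
qed

text \<open>The derivative at \<open>u\<close>, in direction \<open>\<phi>\<close>, of the integral
  of the primitive.\<close>

definition N :: "('a \<Rightarrow> real) \<Rightarrow> ('a \<Rightarrow> real) \<Rightarrow> real" where "N u \<phi> = (\<integral>x. f x (u x) * \<phi> x \<partial>lebesgue)"

lemma integrable_abs: "u \<in> H \<Longrightarrow> integrable lebesgue (\<lambda>x. \<bar>u x\<bar>)"
  using integrable_H(1)[OF _ zero_less_one] by simp

lemma integrable_N:
  assumes u: "u \<in> H" and \<phi>: "\<phi> \<in> H" shows "integrable lebesgue (\<lambda>x. f x (u x) * \<phi> x)"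
proof (rule Bochner_Integration.integrable_bound)
  note [measurable] = H_D(1)[OF u] H_D(1)[OF \<phi>]
  show "integrable lebesgue (\<lambda>x. a1 * \<bar>\<phi> x\<bar> + a2 * (1 * \<bar>u x\<bar> powr q + 1 powr (1 - q) * \<bar>\<phi> x\<bar> powr q))"
    using Lq(1)[OF u] Lq(1)[OF \<phi>] integrable_abs[OF \<phi>] by simp
  show "(\<lambda>x. f x (u x) * \<phi> x) \<in> borel_measurable lebesgue" by measurable
  show "AE x in lebesgue. norm (f x (u x) * \<phi> x) \<le> norm (a1 * \<bar>\<phi> x\<bar> + a2 * (1 * \<bar>u x\<bar> powr q + 1 powr (1 - q) * \<bar>\<phi> x\<bar> powr q))"
    using f_mult_le[OF zero_less_one] by (intro always_eventually allI) (simp, meson abs_ge_self order_trans)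
qed

text \<open>Young's inequality with parameter \<open>\<eta> / a2\<close> puts an arbitrarily small
  factor before the \<open>L^q\<close> term of \<open>u\<close>; the price is a constant uniform
  over the unit ball of test functions.\<close>

lemma N_bound:
  assumes \<eta>: "0 < \<eta>"
  shows "\<exists>C. \<forall>u\<in>H. \<forall>\<phi>\<in>H. E \<phi> \<phi> \<le> 1 \<longrightarrow> \<bar>N u \<phi>\<bar> \<le> \<eta> * (\<integral>x. \<bar>u x\<bar> powr q \<partial>lebesgue) + C"
proof -
  obtain D where D: "\<And>u. u \<in> H \<Longrightarrow> B u u \<le> D * E u u" using poincare_E by blast
  define e where "e = \<eta> / a2"
  have e: "0 < e" using \<eta> a by (simp add: e_def)
  define C where "C = a1 * (measure lebesgue \<Omega> + \<bar>D\<bar>) + a2 * (e powr (1 - q) * Kq)"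
  have "\<bar>N u \<phi>\<bar> \<le> \<eta> * (\<integral>x. \<bar>u x\<bar> powr q \<partial>lebesgue) + C" if u: "u \<in> H" and \<phi>: "\<phi> \<in> H" "E \<phi> \<phi> \<le> 1" for u \<phi>
  proof -
    note i = Lq(1)[OF u] Lq(1)[OF \<phi>(1)] integrable_abs[OF \<phi>(1)]
    have "\<bar>N u \<phi>\<bar> \<le> (\<integral>x. \<bar>f x (u x) * \<phi> x\<bar> \<partial>lebesgue)" unfolding N_def by (rule integral_abs_bound)
    also have "\<dots> \<le> (\<integral>x. a1 * \<bar>\<phi> x\<bar> + a2 * (e * \<bar>u x\<bar> powr q + e powr (1 - q) * \<bar>\<phi> x\<bar> powr q) \<partial>lebesgue)"
      using i integrable_N[OF u \<phi>(1)] by (intro integral_mono f_mult_le[OF e]) auto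
    also have "\<dots> = a1 * (\<integral>x. \<bar>\<phi> x\<bar> \<partial>lebesgue) + a2 * (e * (\<integral>x. \<bar>u x\<bar> powr q \<partial>lebesgue) + e powr (1 - q) * (\<integral>x. \<bar>\<phi> x\<bar> powr q \<partial>lebesgue))"
      using i by simp
    also have "\<dots> \<le> a1 * (measure lebesgue \<Omega> + \<bar>D\<bar>) + a2 * (e * (\<integral>x. \<bar>u x\<bar> powr q \<partial>lebesgue) + e powr (1 - q) * Kq)"
    proof (intro add_mono mult_left_mono order_refl Lq_unit \<phi>)
      have "B \<phi> \<phi> \<le> \<bar>D\<bar> * 1" by (rule order_trans[OF D[OF \<phi>(1)] mult_mono]) (use \<phi>(2) E.F_nonneg in auto)
      then show "(\<integral>x. \<bar>\<phi> x\<bar> \<partial>lebesgue) \<le> measure lebesgue \<Omega> + \<bar>D\<bar>" using integrable_H(2)[OF \<phi>(1) zero_less_one] by simp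
    qed (use a e in auto)
    also have "\<dots> = \<eta> * (\<integral>x. \<bar>u x\<bar> powr q \<partial>lebesgue) + C" using a by (simp add: C_def e_def algebra_simps)
    finally show ?thesis .
  qed
  then show ?thesis by blast
qed

end

locale frac_coords = frac_problem +
  fixes \<mu> :: "nat \<Rightarrow> real" and J :: "ell2 \<Rightarrow> 'a \<Rightarrow> real"
  assumes \<mu>: "\<And>i. 0 < \<mu> i" "\<mu> \<longlonglongrightarrow> 0" and JH: "\<And>h. J h \<in> H"
    and EJ: "\<And>h k. E (J h) (J k) = h \<bullet> k" and BJ: "\<And>h k. B (J h) (J k) = diag \<mu> h \<bullet> k"
    and J_surj: "\<And>u. u \<in> H \<Longrightarrow> \<exists>h. E (u - J h) (u - J h) = 0"
begin

lemma Jm [measurable]: "J h \<in> borel_measurable lebesgue" by (rule H_D(1)[OF JH])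

text \<open>The energy of the defect is computed from \<open>EJ\<close> and vanishes, so the defect
  is a null function.\<close>

lemma J_linear: "AE x in lebesgue. J (c *\<^sub>R h + d *\<^sub>R k) x = c * J h x + d * J k x"
proof -
  let ?w = "J (c *\<^sub>R h + d *\<^sub>R k) - (c *\<^sub>R J h + d *\<^sub>R J k)"
  have "E ?w ?w = 0"
    by (simp add: E.F_lin JH EJ inner_add_left inner_add_right algebra_simps inner_commute)
  moreover have "?w \<in> H" using JH by simp
  ultimately have "AE x in lebesgue. ?w x = 0" using E_zero_iff by blast
  then show ?thesis by eventually_elim simp
qed

lemma J_diff: "AE x in lebesgue. J (h - k) x = J h x - J k x"
  using J_linear[of 1 h "-1" k] by simp

lemma N_linear: "u \<in> H \<Longrightarrow> N u (J (c *\<^sub>R h + d *\<^sub>R k)) = c * N u (J h) + d * N u (J k)"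
proof -
  assume u: "u \<in> H"
  note [measurable] = H_D(1)[OF u]
  have "N u (J (c *\<^sub>R h + d *\<^sub>R k)) = (\<integral>x. c * (f x (u x) * J h x) + d * (f x (u x) * J k x) \<partial>lebesgue)"
    unfolding N_def
    by (rule integral_cong_AE) (use J_linear[of c h d k] in \<open>auto simp: algebra_simps\<close>)
  also have "\<dots> = c * N u (J h) + d * N u (J k)"
    using integrable_N[OF u JH] by (simp add: N_def)
  finally show ?thesis .
qed

lemma norm_J: "sqrt (E (J h) (J h)) = norm h" by (simp add: EJ norm_eq_sqrt_inner)

lemma J_unit: "norm h \<le> 1 \<Longrightarrow> E (J h) (J h) \<le> 1"
  by (simp add: EJ power2_norm_eq_inner[symmetric] power_le_one)

lemma gradient_exists: "\<exists>z. \<forall>k. z \<bullet> k = N (J h) (J k)"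
proof -
  obtain C where C: "\<And>u \<phi>. \<lbrakk>u \<in> H; \<phi> \<in> H; E \<phi> \<phi> \<le> 1\<rbrakk> \<Longrightarrow> \<bar>N u \<phi>\<bar> \<le> 1 * (\<integral>x. \<bar>u x\<bar> powr q \<partial>lebesgue) + C"
    using N_bound[OF zero_less_one] by blast
  define M where "M = (\<integral>x. \<bar>J h x\<bar> powr q \<partial>lebesgue) + C"
  define L where "L k = N (J h) (J k)" for k
  have lin: "L (c *\<^sub>R k + d *\<^sub>R k') = c * L k + d * L k'" for c d k k' unfolding L_def by (rule N_linear[OF JH])
  have "\<bar>L k\<bar> \<le> M * norm k" for k
  proof (cases "k = 0")
    case True
    then show ?thesis using lin[of 0 0 0 0] by simp
  next
    case False
    have "\<bar>L ((1 / norm k) *\<^sub>R k)\<bar> \<le> M" unfolding L_def M_def using C[OF JH JH J_unit] False by simp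
    moreover have "L ((1 / norm k) *\<^sub>R k) = L k / norm k" using lin[of "1 / norm k" k 0 0] by simp
    ultimately show ?thesis using False by (simp add: field_simps abs_divide)
  qed
  note bound = this
  have add: "L (k + k') = L k + L k'" for k k' using lin[of 1 k 1 k'] by simp
  have scale: "L (c *\<^sub>R k) = c * L k" for c k using lin[of c k 0 0] by simp
  obtain z where "\<And>k. z \<bullet> k = L k" using ell2_riesz[of L M, OF add scale bound] by metis
  then show ?thesis by (auto simp: L_def)
qed

definition g :: "ell2 \<Rightarrow> ell2" where "g h = (SOME z. \<forall>k. z \<bullet> k = N (J h) (J k))"
definition \<Phi> :: "ell2 \<Rightarrow> real" where "\<Phi> h = (\<integral>x. prim f x (J h x) \<partial>lebesgue)"

lemma g_inner: "g h \<bullet> k = N (J h) (J k)"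
  using someI_ex[OF gradient_exists[of h]] unfolding g_def by blast

lemma integrable_F: 
  assumes u: "u \<in> H" shows "integrable lebesgue (\<lambda>x. prim f x (u x))"
proof (rule Bochner_Integration.integrable_bound)
  note [measurable] = H_D(1)[OF u]
  show "integrable lebesgue (\<lambda>x. a1 * \<bar>u x\<bar> + a2 * \<bar>u x\<bar> powr q)" using Lq(1)[OF u] integrable_abs[OF u] by simp
  show "AE x in lebesgue. norm (prim f x (u x)) \<le> norm (a1 * \<bar>u x\<bar> + a2 * \<bar>u x\<bar> powr q)"
    using F_growth by (intro always_eventually allI) (simp, meson abs_ge_self order_trans)
qed (rule F_comp[OF H_D(1)[OF u]])

text \<open>Dominated convergence along sequences. By the mean value theorem the difference
  quotients are \<open>f x z * J k x\<close>, with \<open>z\<close> bounded by the two arguments in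
  modulus.\<close>

lemma \<Phi>_derivative: "((\<lambda>t. \<Phi> (h + t *\<^sub>R k)) has_real_derivative (g h \<bullet> k)) (at 0)"
proof -
  let ?u = "J h" and ?v = "J k"
  have eq: "\<Phi> (h + t *\<^sub>R k) = (\<integral>x. prim f x (?u x + t * ?v x) \<partial>lebesgue)" for t
    unfolding \<Phi>_def by (rule integral_cong_AE) (use J_linear[of 1 h t k] in auto)
  have iF: "integrable lebesgue (\<lambda>x. prim f x (?u x + t * ?v x))" for t
    using integrable_F[of "?u + t *\<^sub>R ?v"] JH by simp
  have "((\<lambda>t. (\<Phi> (h + t *\<^sub>R k) - \<Phi> (h + 0 *\<^sub>R k)) / (t - 0)) \<longlongrightarrow> N ?u ?v) (at 0)"
    unfolding tendsto_at_iff_sequentially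
  proof (intro allI impI)
    fix X :: "nat \<Rightarrow> real" assume X: "\<forall>i. X i \<in> UNIV - {0}" "X \<longlonglongrightarrow> 0"
    obtain c where c: "\<And>i. \<bar>X i\<bar> \<le> c" using convergent_imp_bounded[OF X(2)] by (auto simp: bounded_iff)
    have c0: "0 \<le> c" using c[of 0] by linarith
    define D where "D i x = (prim f x (?u x + X i * ?v x) - prim f x (?u x)) / X i" for i x
    have "(\<lambda>i. \<integral>x. D i x \<partial>lebesgue) \<longlonglongrightarrow> (\<integral>x. f x (?u x) * ?v x \<partial>lebesgue)"
    proof (rule integral_dominated_convergence)
      \<comment> \<open>Young's inequality together with
        \<open>\<bar>z\<bar> \<le> \<bar>?u x\<bar> + c * \<bar>?v x\<bar>\<close>, where
        \<open>c\<close> bounds all increments \<open>X i\<close>.\<close>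
      let ?w = "\<lambda>x. a1 * \<bar>?v x\<bar> + a2 * (2 powr q * (\<bar>?u x\<bar> powr q + c powr q * \<bar>?v x\<bar> powr q) + \<bar>?v x\<bar> powr q)"
      show "integrable lebesgue ?w" using Lq(1)[OF JH] integrable_abs[OF JH] by simp
      show "D i \<in> borel_measurable lebesgue" for i unfolding D_def by measurable
      show "AE x in lebesgue. norm (D i x) \<le> ?w x" for i
      proof (intro always_eventually allI)
        fix x
        obtain z where z: "\<bar>z\<bar> \<le> max \<bar>?u x\<bar> \<bar>?u x + X i * ?v x\<bar>"
          "prim f x (?u x + X i * ?v x) - prim f x (?u x) = f x z * (X i * ?v x)"
          using F_mvt[of "?u x" "?u x + X i * ?v x" x] by auto
        have Xi: "X i \<noteq> 0" using X(1) by auto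
        have "D i x = f x z * ?v x" unfolding D_def z(2) using Xi by simp
        then have "norm (D i x) \<le> a1 * \<bar>?v x\<bar> + a2 * (1 * \<bar>z\<bar> powr q + 1 powr (1 - q) * \<bar>?v x\<bar> powr q)"
          using f_mult_le[OF zero_less_one, of x z "?v x"] by simp
        moreover have "\<bar>z\<bar> powr q \<le> 2 powr q * (\<bar>?u x\<bar> powr q + c powr q * \<bar>?v x\<bar> powr q)"
        proof -
          have "\<bar>X i * ?v x\<bar> \<le> c * \<bar>?v x\<bar>" unfolding abs_mult using c by (intro mult_right_mono) auto
          then have "\<bar>z\<bar> \<le> \<bar>?u x\<bar> + c * \<bar>?v x\<bar>" using z(1) by linarith
          then have "\<bar>z\<bar> powr q \<le> (\<bar>?u x\<bar> + c * \<bar>?v x\<bar>) powr q" using q by (intro powr_mono2) auto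
          also have "\<dots> \<le> 2 powr q * (\<bar>?u x\<bar> powr q + (c * \<bar>?v x\<bar>) powr q)" using c0 q by (intro powr_add_le) auto
          finally show ?thesis using c0 by (simp add: powr_mult)
        qed
        then have "a2 * (1 * \<bar>z\<bar> powr q + 1 powr (1 - q) * \<bar>?v x\<bar> powr q)
            \<le> a2 * (2 powr q * (\<bar>?u x\<bar> powr q + c powr q * \<bar>?v x\<bar> powr q) + \<bar>?v x\<bar> powr q)"
          using a by (intro mult_left_mono) auto
        ultimately show "norm (D i x) \<le> ?w x" by linarith
      qed
      show "AE x in lebesgue. (\<lambda>i. D i x) \<longlonglongrightarrow> f x (?u x) * ?v x"
      proof (intro always_eventually allI)
        fix x
        have "((\<lambda>t. prim f x (?u x + t * ?v x)) has_real_derivative f x (?u x + 0 * ?v x) * (0 + 1 * ?v x)) (at 0)"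
          by (rule DERIV_chain2[OF prim_has_derivative[OF f_cont]]) (auto intro!: derivative_eq_intros)
        then have "((\<lambda>t. (prim f x (?u x + t * ?v x) - prim f x (?u x)) / t) \<longlongrightarrow> f x (?u x) * ?v x) (at 0)"
          by (simp add: has_field_derivative_iff)
        then show "(\<lambda>i. D i x) \<longlonglongrightarrow> f x (?u x) * ?v x"
          using X unfolding tendsto_at_iff_sequentially D_def by (auto simp: o_def)
      qed
    qed measurable
    moreover have "(\<integral>x. D i x \<partial>lebesgue) = (\<Phi> (h + X i *\<^sub>R k) - \<Phi> (h + 0 *\<^sub>R k)) / (X i - 0)" for i
      unfolding D_def eq using iF[of "X i"] iF[of 0] by simp
    ultimately show "((\<lambda>t. (\<Phi> (h + t *\<^sub>R k) - \<Phi> (h + 0 *\<^sub>R k)) / (t - 0)) \<circ> X) \<longlonglongrightarrow> N ?u ?v"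
      by (simp add: o_def N_def)
  qed
  then show ?thesis unfolding g_inner by (simp add: has_field_derivative_iff)
qed

end

lemma inner_sgn: "z \<bullet> sgn z = norm z" for z :: "'b::real_inner"
  by (cases "z = 0") (auto simp: sgn_div_norm dot_square_norm power2_eq_square)

lemma norm_le_dual:
  fixes z :: "'b::real_inner" assumes "\<And>k. norm k \<le> 1 \<Longrightarrow> z \<bullet> k \<le> c" shows "norm z \<le> c"
  using assms[of "sgn z"] by (simp add: norm_sgn inner_sgn)

lemma weakly_diff: "weakly x l \<Longrightarrow> weakly (\<lambda>n. x n - l) 0"
proof -
  assume w: "weakly x l"
  have "bounded (range (\<lambda>n. x n - l))" using w by (intro bounded_minus_comp) (auto simp: weakly_def)
  moreover have "(\<lambda>n. coord (x n) i - coord l i) \<longlonglongrightarrow> coord l i - coord l i" for i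
    using w by (intro tendsto_intros) (simp add: weakly_def)
  ultimately show ?thesis by (simp add: weakly_def)
qed

context frac_coords
begin

section \<open>Compactness of the gradient\<close>

lemma J_Lq: "integrable lebesgue (\<lambda>y. \<bar>J h y\<bar> powr q)" "(\<integral>y. \<bar>J h y\<bar> powr q \<partial>lebesgue) \<le> Kq * norm h powr q"
  using Lq[OF JH, of h] by (auto simp: norm_J)

text \<open>In \<open>L2\<close> this is compactness of \<open>diag \<mu>\<close>. For
  \<open>L^q\<close> choose \<open>p\<close> strictly between \<open>q\<close> and the critical
  exponent: the \<open>L^p\<close> norms are bounded, and \<open>powr_between\<close>
  interpolates.\<close>

lemma weakly_null:
  assumes w: "weakly w 0"
  shows "(\<lambda>n. \<integral>y. (J (w n) y)\<^sup>2 \<partial>lebesgue) \<longlonglongrightarrow> 0" "(\<lambda>n. \<integral>y. \<bar>J (w n) y\<bar> powr q \<partial>lebesgue) \<longlonglongrightarrow> 0"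
proof -
  obtain M where M: "0 < M" "\<And>n. norm (w n) \<le> M" using w by (auto simp: weakly_def bounded_pos)
  have "(\<lambda>n. diag \<mu> (w n)) \<longlonglongrightarrow> diag \<mu> 0" by (rule weakly_diag_tendsto[OF w \<mu>(2)])
  also have "diag \<mu> 0 = 0" using BJ[of 0 "diag \<mu> 0"] convergent_imp_bounded[OF \<mu>(2)]
    by (intro ell2_eqI) (simp add: coord_diag)
  finally have lim: "(\<lambda>n. norm (diag \<mu> (w n)) * M) \<longlonglongrightarrow> 0" by (intro tendsto_mult_left_zero) (rule tendsto_norm_zero)
  have "norm (B (J (w n)) (J (w n))) \<le> norm (diag \<mu> (w n)) * M" for n
    unfolding BJ real_norm_def by (rule order_trans[OF Cauchy_Schwarz_ineq2 mult_left_mono]) (use M in auto)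
  then have B0: "(\<lambda>n. B (J (w n)) (J (w n))) \<longlonglongrightarrow> 0"
    by (intro Lim_null_comparison[OF _ lim] always_eventually allI)
  then show sq: "(\<lambda>n. \<integral>y. (J (w n) y)\<^sup>2 \<partial>lebesgue) \<longlonglongrightarrow> 0" by (simp add: B_def power2_eq_square)
  obtain p where p: "q < p" "p < crit_exp DIM('a) s" using dense[OF q(2)] by blast
  obtain K where K: "Lbound p K" "0 < K" using Lbound_subcritical[of p] dim p q by (auto simp: Lbound_def)
  have iq: "integrable lebesgue (\<lambda>y. \<bar>J (w n) y\<bar> powr q)" for n using J_Lq by blast
  show "(\<lambda>n. \<integral>y. \<bar>J (w n) y\<bar> powr q \<partial>lebesgue) \<longlonglongrightarrow> 0"
  proof (rule LIMSEQ_I)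
    fix e :: real assume e: "0 < e"
    define \<epsilon> where "\<epsilon> = e / (2 * K * M powr p)"
    have \<epsilon>: "0 < \<epsilon>" using e K M by (simp add: \<epsilon>_def)
    define C where "C = \<epsilon> powr (- ((q - 2) / (p - q)))"
    have "(\<lambda>n. C * (\<integral>y. (J (w n) y)\<^sup>2 \<partial>lebesgue)) \<longlonglongrightarrow> 0" using sq by (rule tendsto_mult_right_zero)
    then have "\<forall>\<^sub>F n in sequentially. C * (\<integral>y. (J (w n) y)\<^sup>2 \<partial>lebesgue) < e / 2" by (rule order_tendstoD(2)) (use e in simp)
    then obtain n0 where n0: "\<And>n. n \<ge> n0 \<Longrightarrow> C * (\<integral>y. (J (w n) y)\<^sup>2 \<partial>lebesgue) < e / 2" by (auto simp: eventually_sequentially)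
    have "(\<integral>y. \<bar>J (w n) y\<bar> powr q \<partial>lebesgue) < e" if "n \<ge> n0" for n
    proof -
      have ip: "integrable lebesgue (\<lambda>y. \<bar>J (w n) y\<bar> powr p)"
        and bp: "(\<integral>y. \<bar>J (w n) y\<bar> powr p \<partial>lebesgue) \<le> K * norm (w n) powr p"
        using Lp_bound[OF K(1) JH, of "w n"] p q by (auto simp: norm_J)
      have "(\<integral>y. \<bar>J (w n) y\<bar> powr q \<partial>lebesgue) \<le> (\<integral>y. \<epsilon> * \<bar>J (w n) y\<bar> powr p + C * (J (w n) y)\<^sup>2 \<partial>lebesgue)"
        unfolding C_def using ip iq H_D(3)[OF JH] powr_between[OF \<epsilon> q(1) p(1)] by (intro integral_mono) auto
      also have "\<dots> = \<epsilon> * (\<integral>y. \<bar>J (w n) y\<bar> powr p \<partial>lebesgue) + C * (\<integral>y. (J (w n) y)\<^sup>2 \<partial>lebesgue)"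
        using ip H_D(3)[OF JH] by simp
      also have "\<epsilon> * (\<integral>y. \<bar>J (w n) y\<bar> powr p \<partial>lebesgue) \<le> \<epsilon> * (K * M powr p)"
      proof -
        have "norm (w n) powr p \<le> M powr p" using M(2) p q by (intro powr_mono2) auto
        then show ?thesis using bp K(2) \<epsilon> by (intro mult_left_mono) (auto intro: order_trans)
      qed
      also have "\<epsilon> * (K * M powr p) = e / 2" using K M by (simp add: \<epsilon>_def)
      finally show ?thesis using n0[OF that] by linarith
    qed
    moreover have "0 \<le> (\<integral>y. \<bar>J (w n) y\<bar> powr q \<partial>lebesgue)" for n by simp
    ultimately show "\<exists>n0. \<forall>n\<ge>n0. norm ((\<integral>y. \<bar>J (w n) y\<bar> powr q \<partial>lebesgue) - 0) < e" by auto
  qed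
qed

text \<open>The conjugate exponent \<open>q / (q - 1)\<close> converts growth of order
  \<open>q - 1\<close> into order \<open>q\<close>, which the energy controls.\<close>

lemma difference_growth:
  obtains A C where "0 \<le> A" "0 \<le> C"
    "\<And>x t r. \<bar>f x (t + r) - f x t\<bar> powr (q / (q - 1)) \<le> A * indicator \<Omega> x + C * \<bar>t\<bar> powr q + C * \<bar>r\<bar> powr q"
proof -
  define q' where "q' = q / (q - 1)"
  have q': "0 < q'" "(q - 1) * q' = q" using q by (auto simp: q'_def)
  define A where "A = 2 powr q' * (2 powr q' * a1 powr q')"
  define C where "C = 2 powr q' * (2 powr q' * (a2 powr q' * 2 powr q))"
  have "\<bar>f x (t + r) - f x t\<bar> powr q' \<le> A * indicator \<Omega> x + C * \<bar>t\<bar> powr q + C * \<bar>r\<bar> powr q" for x t r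
  proof (cases "x \<in> \<Omega>'")
    case False
    then show ?thesis using f_out[of x] by (simp add: A_def C_def)
  next
    case True
    then have x: "x \<in> \<Omega>" using \<Omega>'_full by blast
    define m where "m = \<bar>t\<bar> + \<bar>r\<bar>"
    have "\<bar>t + r\<bar> powr (q - 1) \<le> m powr (q - 1)" "\<bar>t\<bar> powr (q - 1) \<le> m powr (q - 1)"
      using q by (auto intro!: powr_mono2 simp: m_def)
    then have "a2 * \<bar>t + r\<bar> powr (q - 1) \<le> a2 * m powr (q - 1)" "a2 * \<bar>t\<bar> powr (q - 1) \<le> a2 * m powr (q - 1)"
      using a by auto
    then have "\<bar>f x (t + r) - f x t\<bar> \<le> 2 * (a1 + a2 * m powr (q - 1))"
      using f_growth[of x t] f_growth[of x "t + r"] abs_triangle_ineq4[of "f x (t + r)" "f x t"]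
      unfolding distrib_left by argo
    then have "\<bar>f x (t + r) - f x t\<bar> powr q' \<le> (2 * (a1 + a2 * m powr (q - 1))) powr q'"
      using q' by (intro powr_mono2) auto
    also have "\<dots> = 2 powr q' * (a1 + a2 * m powr (q - 1)) powr q'" using a by (subst powr_mult) auto
    also have "\<dots> \<le> 2 powr q' * (2 powr q' * (a1 powr q' + (a2 * m powr (q - 1)) powr q'))"
      using a q' by (intro mult_left_mono powr_add_le) auto
    also have "(a2 * m powr (q - 1)) powr q' = a2 powr q' * m powr q"
      using a q' by (simp add: powr_mult powr_powr)
    also have "2 powr q' * (2 powr q' * (a1 powr q' + a2 powr q' * m powr q))
       \<le> 2 powr q' * (2 powr q' * (a1 powr q' + a2 powr q' * (2 powr q * (\<bar>t\<bar> powr q + \<bar>r\<bar> powr q))))"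
      unfolding m_def using q by (intro mult_left_mono add_left_mono powr_add_le) auto
    also have "\<dots> = A * indicator \<Omega> x + C * \<bar>t\<bar> powr q + C * \<bar>r\<bar> powr q"
      using x by (simp add: A_def C_def algebra_simps)
    finally show ?thesis .
  qed
  moreover have "0 \<le> A" "0 \<le> C" by (auto simp: A_def C_def)
  ultimately show ?thesis using that unfolding q'_def by blast
qed

text \<open>Along a subsequence the functions converge almost everywhere and in \<open>L^q\<close>,
  so their images under \<open>f\<close> converge in the conjugate exponent. Testing against the
  unit ball gives norm convergence of the gradients.\<close>

lemma g_compact:
  assumes x: "weakly x l"
  shows "\<exists>r. strict_mono r \<and> (\<lambda>n. g (x (r n))) \<longlonglongrightarrow> g l"
proof -
  define q' where "q' = q / (q - 1)"
  have q': "0 < q'" using q by (auto simp: q'_def)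
  let ?u = "J l"
  have w: "weakly (\<lambda>n. x n - l) 0" by (rule weakly_diff[OF x])
  have "\<exists>r::nat\<Rightarrow>nat. strict_mono r \<and> (AE y in lebesgue. (\<lambda>n. (J (x (r n) - l) y)\<^sup>2) \<longlonglongrightarrow> 0)"
    using weakly_null(1)[OF w] H_D(3)[OF JH] by (intro tendsto_L1_AE_subseq) auto
  then obtain r :: "nat \<Rightarrow> nat" where r: "strict_mono r" "AE y in lebesgue. (\<lambda>n. (J (x (r n) - l) y)\<^sup>2) \<longlonglongrightarrow> 0" by blast
  define D where "D n = J (x (r n) - l)" for n
  have [measurable]: "D n \<in> borel_measurable lebesgue" for n unfolding D_def by (rule Jm)
  have D0: "AE y in lebesgue. (\<lambda>n. D n y) \<longlonglongrightarrow> 0"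
    using r(2) unfolding D_def by eventually_elim (simp add: tendsto_null_power)
  have iD: "integrable lebesgue (\<lambda>y. \<bar>D n y\<bar> powr q)" for n unfolding D_def by (rule J_Lq)
  have Dq: "(\<lambda>n. \<integral>y. \<bar>D n y\<bar> powr q \<partial>lebesgue) \<longlonglongrightarrow> 0"
    using LIMSEQ_subseq_LIMSEQ[OF weakly_null(2)[OF w] r(1)] by (simp add: D_def o_def)
  obtain A C where AC: "0 \<le> A" "0 \<le> C"
    "\<And>x t r. \<bar>f x (t + r) - f x t\<bar> powr q' \<le> A * indicator \<Omega> x + C * \<bar>t\<bar> powr q + C * \<bar>r\<bar> powr q"
    unfolding q'_def by (rule difference_growth) blast
  define d where "d n y = \<bar>f y (?u y + D n y) - f y (?u y)\<bar>" for n y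
  have [measurable]: "d n \<in> borel_measurable lebesgue" for n unfolding d_def by measurable
  have iw: "integrable lebesgue (\<lambda>y. A * indicator \<Omega> y + C * \<bar>?u y\<bar> powr q)"
    using emeasure_\<Omega> J_Lq(1)[of l] by (intro Bochner_Integration.integrable_add) auto
  have dle: "d n y powr q' \<le> A * indicator \<Omega> y + C * \<bar>?u y\<bar> powr q + C * \<bar>D n y\<bar> powr q" for n y
    unfolding d_def by (rule AC(3))
  have id: "integrable lebesgue (\<lambda>y. d n y powr q')" for n
  proof (rule Bochner_Integration.integrable_bound)
    show "integrable lebesgue (\<lambda>y. A * indicator \<Omega> y + C * \<bar>?u y\<bar> powr q + C * \<bar>D n y\<bar> powr q)"
      using iw iD[of n] by (intro Bochner_Integration.integrable_add[OF iw]) auto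
    show "AE y in lebesgue. norm (d n y powr q') \<le> norm (A * indicator \<Omega> y + C * \<bar>?u y\<bar> powr q + C * \<bar>D n y\<bar> powr q)"
      using dle[of n] by (intro always_eventually allI) (simp, meson abs_ge_self order_trans)
  qed measurable
  \<comment> \<open>The term in \<open>D n\<close> spoils a common majorant. Once it is subtracted,
    and its integral tends to 0 anyway, the rest is dominated by a fixed integrable
    function.\<close>
  define S where "S n y = max 0 (d n y powr q' - C * \<bar>D n y\<bar> powr q)" for n y
  have "(\<lambda>n. \<integral>y. S n y \<partial>lebesgue) \<longlonglongrightarrow> (\<integral>y. 0 \<partial>(lebesgue :: 'a measure))"
  proof (rule integral_dominated_convergence[OF _ _ iw])
    show "S n \<in> borel_measurable lebesgue" for n unfolding S_def by measurable
    show "AE y in lebesgue. (\<lambda>n. S n y) \<longlonglongrightarrow> 0"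
      using D0
    proof eventually_elim
      fix y assume y: "(\<lambda>n. D n y) \<longlonglongrightarrow> 0"
      have "(\<lambda>n. f y (?u y + D n y)) \<longlonglongrightarrow> f y (?u y + 0)"
        by (rule continuous_on_tendsto_compose[OF f_cont tendsto_add[OF tendsto_const y]]) auto
      then have "(\<lambda>n. d n y) \<longlonglongrightarrow> 0" unfolding d_def by (intro tendsto_rabs_zero) (simp add: LIM_zero)
      then have "(\<lambda>n. d n y powr q') \<longlonglongrightarrow> 0" by (rule tendsto_zero_powrI) (auto simp: q' d_def)
      moreover have "(\<lambda>n. \<bar>D n y\<bar> powr q) \<longlonglongrightarrow> 0"
        by (rule tendsto_zero_powrI[OF tendsto_rabs_zero[OF y] tendsto_const]) (use q in auto)
      ultimately have "(\<lambda>n. max 0 (d n y powr q' - C * \<bar>D n y\<bar> powr q)) \<longlonglongrightarrow> max 0 (0 - C * 0)"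
        by (intro tendsto_intros)
      then show "(\<lambda>n. S n y) \<longlonglongrightarrow> 0" by (simp add: S_def)
    qed
    show "AE y in lebesgue. norm (S n y) \<le> A * indicator \<Omega> y + C * \<bar>?u y\<bar> powr q" for n
      using dle[of n] AC(1,2) by (intro always_eventually allI) (simp add: S_def algebra_simps)
  qed simp
  then have S0: "(\<lambda>n. \<integral>y. S n y \<partial>lebesgue) \<longlonglongrightarrow> 0" by simp
  have iS: "integrable lebesgue (S n)" for n
    unfolding S_def using id[of n] iD[of n] by auto
  have lim: "(\<lambda>n. (\<integral>y. S n y \<partial>lebesgue) + C * (\<integral>y. \<bar>D n y\<bar> powr q \<partial>lebesgue)) \<longlonglongrightarrow> 0"
    by (rule tendsto_add_zero[OF S0 tendsto_mult_right_zero[OF Dq]])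
  have le: "(\<integral>y. d n y powr q' \<partial>lebesgue) \<le> (\<integral>y. S n y \<partial>lebesgue) + C * (\<integral>y. \<bar>D n y\<bar> powr q \<partial>lebesgue)" for n
  proof -
    have "(\<integral>y. d n y powr q' \<partial>lebesgue) \<le> (\<integral>y. S n y + C * \<bar>D n y\<bar> powr q \<partial>lebesgue)"
      using id[of n] iS[of n] iD[of n] by (intro integral_mono) (auto simp: S_def)
    then show ?thesis using iS[of n] iD[of n] by simp
  qed
  have d0: "(\<lambda>n. \<integral>y. d n y powr q' \<partial>lebesgue) \<longlonglongrightarrow> 0"
    by (rule Lim_null_comparison[OF always_eventually[OF allI] lim]) (use le in simp)
  \<comment> \<open>Young's inequality serves instead of Hoelder's: first \<open>\<eta> * Kq\<close>
    is made small, then \<open>n\<close> large.\<close>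
  have est: "norm (g (x (r n)) - g l) \<le> \<eta> powr (- (1 / (q - 1))) * (\<integral>y. d n y powr q' \<partial>lebesgue) + \<eta> * Kq"
    if \<eta>: "0 < \<eta>" for \<eta> n
  proof (rule norm_le_dual)
    fix k :: ell2 assume k: "norm k \<le> 1"
    let ?c = "\<eta> powr (- (1 / (q - 1)))"
    have "(g (x (r n)) - g l) \<bullet> k = (\<integral>y. f y (J (x (r n)) y) * J k y - f y (?u y) * J k y \<partial>lebesgue)"
      unfolding inner_diff_left g_inner N_def
      by (rule Bochner_Integration.integral_diff[symmetric]) (rule integrable_N[OF JH JH])+
    also have "\<dots> \<le> (\<integral>y. ?c * d n y powr q' + \<eta> * \<bar>J k y\<bar> powr q \<partial>lebesgue)"
    proof (rule integral_mono_AE)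
      show "integrable lebesgue (\<lambda>y. f y (J (x (r n)) y) * J k y - f y (?u y) * J k y)"
        using integrable_N[OF JH JH] by simp
      show "integrable lebesgue (\<lambda>y. ?c * d n y powr q' + \<eta> * \<bar>J k y\<bar> powr q)" using id[of n] J_Lq(1)[of k] by simp
      show "AE y in lebesgue. f y (J (x (r n)) y) * J k y - f y (?u y) * J k y \<le> ?c * d n y powr q' + \<eta> * \<bar>J k y\<bar> powr q"
        using J_diff[of "x (r n)" l]
      proof eventually_elim
        fix y assume "J (x (r n) - l) y = J (x (r n)) y - J l y"
        then have "J (x (r n)) y = ?u y + D n y" by (simp add: D_def)
        then have "f y (J (x (r n)) y) * J k y - f y (?u y) * J k y = (f y (?u y + D n y) - f y (?u y)) * J k y"
          by (simp add: algebra_simps)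
        also have "\<dots> \<le> d n y * \<bar>J k y\<bar>" unfolding d_def abs_mult[symmetric] by (rule abs_ge_self)
        also have "\<dots> \<le> ?c * d n y powr q' + \<eta> * \<bar>J k y\<bar> powr q"
          unfolding q'_def using \<eta> q by (intro young_right) (auto simp: d_def)
        finally show "f y (J (x (r n)) y) * J k y - f y (?u y) * J k y \<le> ?c * d n y powr q' + \<eta> * \<bar>J k y\<bar> powr q" .
      qed
    qed
    also have "\<dots> = ?c * (\<integral>y. d n y powr q' \<partial>lebesgue) + \<eta> * (\<integral>y. \<bar>J k y\<bar> powr q \<partial>lebesgue)" using id[of n] J_Lq(1)[of k] by simp
    also have "\<dots> \<le> ?c * (\<integral>y. d n y powr q' \<partial>lebesgue) + \<eta> * Kq"
      using Lq_unit[OF JH J_unit[OF k]] \<eta> by (intro add_left_mono mult_left_mono) auto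
    finally show "(g (x (r n)) - g l) \<bullet> k \<le> ?c * (\<integral>y. d n y powr q' \<partial>lebesgue) + \<eta> * Kq" .
  qed
  have "(\<lambda>n. g (x (r n))) \<longlonglongrightarrow> g l"
  proof (rule LIMSEQ_I)
    fix e :: real assume e: "0 < e"
    define \<eta> where "\<eta> = e / (2 * Kq)"
    have \<eta>: "0 < \<eta>" "\<eta> * Kq = e / 2" using e Kq(2) by (auto simp: \<eta>_def)
    have "(\<lambda>n. \<eta> powr (- (1 / (q - 1))) * (\<integral>y. d n y powr q' \<partial>lebesgue)) \<longlonglongrightarrow> 0" using d0 by (rule tendsto_mult_right_zero)
    then have "\<forall>\<^sub>F n in sequentially. \<eta> powr (- (1 / (q - 1))) * (\<integral>y. d n y powr q' \<partial>lebesgue) < e / 2"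
      by (rule order_tendstoD(2)) (use e in simp)
    then have "\<forall>\<^sub>F n in sequentially. norm (g (x (r n)) - g l) < e"
    proof eventually_elim
      case (elim n)
      then show ?case using est[OF \<eta>(1), of n] \<eta>(2) by linarith
    qed
    then show "\<exists>n0. \<forall>n\<ge>n0. norm (g (x (r n)) - g l) < e" by (simp add: eventually_sequentially)
  qed
  with r(1) show ?thesis by blast
qed

section \<open>The hypotheses of the abstract theorem\<close>

lemma \<Phi>_zero: "\<Phi> 0 = 0"
proof -
  have "AE y in lebesgue. J 0 y = 0" using E_zero_iff[OF JH, of 0] by (simp add: EJ)
  then have "\<Phi> 0 = (\<integral>y. 0 \<partial>(lebesgue :: 'a measure))" unfolding \<Phi>_def by (intro integral_cong_AE) auto
  then show ?thesis by simp
qed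

lemma \<Phi>_le: "q * \<Phi> h \<le> g h \<bullet> h"
proof -
  have "q * prim f x t \<le> f x t * t" for x t
    using f_AR[of x t] F_out[of x t] f_out[of x t] by (cases "x \<in> \<Omega>'"; cases "t = 0") (auto simp: mult.commute)
  then have "(\<integral>x. q * prim f x (J h x) \<partial>lebesgue) \<le> (\<integral>x. f x (J h x) * J h x \<partial>lebesgue)"
    using integrable_F[OF JH] integrable_N[OF JH JH] by (intro integral_mono) auto
  then show ?thesis by (simp add: \<Phi>_def g_inner N_def)
qed

lemma F_nonneg: "0 \<le> prim f x t"
  using f_AR[of x t] F_out[of x t] by (cases "x \<in> \<Omega>'"; cases "t = 0") auto

text \<open>If the integral of the nonnegative primitive is zero, the primitive vanishes almost
  everywhere, which (F5) permits only where \<open>J h\<close> vanishes.\<close>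

lemma \<Phi>_pos: "h \<noteq> 0 \<Longrightarrow> 0 < \<Phi> h"
proof (rule ccontr)
  assume h: "h \<noteq> 0" and "\<not> 0 < \<Phi> h"
  moreover have "0 \<le> \<Phi> h" unfolding \<Phi>_def by (simp add: F_nonneg)
  ultimately have "\<Phi> h = 0" by simp
  then have "AE x in lebesgue. prim f x (J h x) = 0"
    unfolding \<Phi>_def using integral_nonneg_eq_0_iff_AE[OF integrable_F[OF JH, of h]] F_nonneg by auto
  then have "AE x in lebesgue. J h x = 0" using H_D(2)[OF JH, of h] \<Omega>'_full(2)
  proof eventually_elim
    case (elim x)
    then show ?case using f_AR[of x "J h x"] by (cases "x \<in> \<Omega>") auto
  qed
  then have "E (J h) (J h) = 0" using E_zero_iff[OF JH] by blast
  with h show False by (simp add: EJ)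
qed

text \<open>For \<open>k\<close> of the same norm as \<open>h\<close>, \<open>N (J h) (J k)\<close>
  is at most \<open>\<epsilon> / 2 * (norm h)\<^sup>2\<close> plus a term of order
  \<open>q > 2\<close>. The choice \<open>k = h\<close> bounds \<open>\<Phi>\<close> through
  \<open>\<Phi>_le\<close>, and \<open>k\<close> in the direction of \<open>g h\<close> bounds the
  gradient.\<close>

lemma small:
  assumes \<epsilon>: "0 < \<epsilon>"
  shows "\<exists>\<delta>>0. \<forall>h. norm h \<le> \<delta> \<longrightarrow> \<Phi> h \<le> \<epsilon> * (norm h)\<^sup>2 \<and> norm (g h) \<le> \<epsilon> * norm h"
proof -
  obtain D where D: "\<And>u. u \<in> H \<Longrightarrow> B u u \<le> D * E u u" using poincare_E by blast
  define D' where "D' = \<bar>D\<bar> + 1"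
  have D': "0 < D'" "\<And>h. (\<integral>x. (J h x)\<^sup>2 \<partial>lebesgue) \<le> D' * (norm h)\<^sup>2"
  proof -
    fix h
    have "(\<integral>x. (J h x)\<^sup>2 \<partial>lebesgue) \<le> D * (norm h)\<^sup>2" using D[OF JH, of h] by (simp add: EJ B_def power2_eq_square[symmetric] power2_norm_eq_inner)
    also have "\<dots> \<le> D' * (norm h)\<^sup>2" by (intro mult_right_mono) (auto simp: D'_def)
    finally show "(\<integral>x. (J h x)\<^sup>2 \<partial>lebesgue) \<le> D' * (norm h)\<^sup>2" .
  qed (simp add: D'_def)
  define e where "e = \<epsilon> / (4 * D')"
  have e: "0 < e" using \<epsilon> D' by (simp add: e_def)
  obtain C where C: "0 < C" "\<And>x t. \<bar>f x t\<bar> \<le> e * \<bar>t\<bar> + C * \<bar>t\<bar> powr (q - 1)" using f_small_growth[OF e] by blast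
  have N_le: "N (J h) (J k) \<le> \<epsilon> / 2 * (norm h)\<^sup>2 + 2 * C * Kq * norm h powr q" if k: "norm k = norm h" for h k
  proof -
    have pw: "f x t * b \<le> e * (t\<^sup>2 + b\<^sup>2) + C * (\<bar>t\<bar> powr q + \<bar>b\<bar> powr q)" for x t b
    proof -
      have "f x t * b \<le> \<bar>f x t\<bar> * \<bar>b\<bar>" unfolding abs_mult[symmetric] by (rule abs_ge_self)
      also have "\<dots> \<le> (e * \<bar>t\<bar> + C * \<bar>t\<bar> powr (q - 1)) * \<bar>b\<bar>" by (intro mult_right_mono C) simp
      also have "\<dots> = e * (\<bar>t\<bar> * \<bar>b\<bar>) + C * (\<bar>t\<bar> powr (q - 1) * \<bar>b\<bar>)" by (simp add: algebra_simps)
      also have "\<dots> \<le> e * (t\<^sup>2 + b\<^sup>2) + C * (\<bar>t\<bar> powr q + \<bar>b\<bar> powr q)"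
      proof (intro add_mono mult_left_mono)
        show "\<bar>t\<bar> * \<bar>b\<bar> \<le> t\<^sup>2 + b\<^sup>2" using sum_squares_bound[of "\<bar>t\<bar>" "\<bar>b\<bar>"] mult_nonneg_nonneg[of "\<bar>t\<bar>" "\<bar>b\<bar>"]
          by (simp del: mult_nonneg_nonneg)
        show "\<bar>t\<bar> powr (q - 1) * \<bar>b\<bar> \<le> \<bar>t\<bar> powr q + \<bar>b\<bar> powr q" using young_left[of "\<bar>t\<bar>" "\<bar>b\<bar>" 1 q] q by simp
      qed (use e C in auto)
      finally show ?thesis .
    qed
    note i = H_D(3)[OF JH, of h] H_D(3)[OF JH, of k] J_Lq(1)[of h] J_Lq(1)[of k]
    have "N (J h) (J k) \<le> (\<integral>x. e * ((J h x)\<^sup>2 + (J k x)\<^sup>2) + C * (\<bar>J h x\<bar> powr q + \<bar>J k x\<bar> powr q) \<partial>lebesgue)"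
      unfolding N_def using i integrable_N[OF JH JH, of h k] pw by (intro integral_mono) auto
    also have "\<dots> = e * ((\<integral>x. (J h x)\<^sup>2 \<partial>lebesgue) + (\<integral>x. (J k x)\<^sup>2 \<partial>lebesgue))
        + C * ((\<integral>x. \<bar>J h x\<bar> powr q \<partial>lebesgue) + (\<integral>x. \<bar>J k x\<bar> powr q \<partial>lebesgue))"
      using i by simp
    also have "\<dots> \<le> e * (D' * (norm h)\<^sup>2 + D' * (norm h)\<^sup>2) + C * (Kq * norm h powr q + Kq * norm h powr q)"
      using D'(2)[of h] D'(2)[of k] J_Lq(2)[of h] J_Lq(2)[of k] e C k by (intro add_mono mult_left_mono) auto
    also have "\<dots> = \<epsilon> / 2 * (norm h)\<^sup>2 + 2 * C * Kq * norm h powr q" using D' by (simp add: e_def field_simps)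
    finally show ?thesis .
  qed
  \<comment> \<open>Solves
    \<open>2 * C * Kq * \<delta> powr (q - 2) = \<epsilon> / 2\<close>.\<close>
  define \<delta> where "\<delta> = (\<epsilon> / (4 * C * Kq)) powr (1 / (q - 2))"
  have \<delta>: "0 < \<delta>" using \<epsilon> C Kq by (simp add: \<delta>_def)
  have small_term: "2 * C * Kq * norm h powr q \<le> \<epsilon> / 2 * (norm h)\<^sup>2" if "norm h \<le> \<delta>" for h :: ell2
  proof -
    have "norm h powr (q - 2) \<le> \<delta> powr (q - 2)" using that q by (intro powr_mono2) auto
    also have "\<delta> powr (q - 2) = \<epsilon> / (4 * C * Kq)" using \<epsilon> C Kq q by (simp add: \<delta>_def powr_powr)
    finally have "2 * C * Kq * norm h powr (q - 2) * (norm h)\<^sup>2 \<le> 2 * C * Kq * (\<epsilon> / (4 * C * Kq)) * (norm h)\<^sup>2"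
      using C Kq by (intro mult_right_mono mult_left_mono) auto
    also have "\<dots> = \<epsilon> / 2 * (norm h)\<^sup>2" using C Kq by simp
    also have "norm h powr q = norm h powr (q - 2) * norm h powr 2" unfolding powr_add[symmetric] by simp
    then have "2 * C * Kq * norm h powr (q - 2) * (norm h)\<^sup>2 = 2 * C * Kq * norm h powr q" by simp
    finally show ?thesis .
  qed
  have N_small: "N (J h) (J k) \<le> \<epsilon> * (norm h)\<^sup>2" if "norm h \<le> \<delta>" "norm k = norm h" for h k
    using N_le[OF that(2)] small_term[OF that(1)] by linarith
  have g_small: "norm (g h) \<le> \<epsilon> * norm h" if h: "norm h \<le> \<delta>" for h
  proof (cases "g h = 0 \<or> h = 0")
    case True
    moreover have "g 0 = 0"
    proof -
      have "AE y in lebesgue. J 0 y = 0" using E_zero_iff[OF JH, of 0] by (simp add: EJ)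
      then have "N (J 0) (J k) = (\<integral>y. 0 \<partial>(lebesgue :: 'a measure))" for k
        unfolding N_def by (intro integral_cong_AE) (auto simp: f_zero)
      then have "g 0 \<bullet> g 0 = 0" unfolding g_inner by simp
      then show ?thesis by simp
    qed
    ultimately show ?thesis using \<epsilon> by auto
  next
    case False
    define k where "k = norm h *\<^sub>R sgn (g h)"
    have "norm h * norm (g h) = N (J h) (J k)" unfolding g_inner[symmetric] k_def by (simp add: inner_sgn)
    also have "\<dots> \<le> \<epsilon> * (norm h)\<^sup>2" by (rule N_small[OF h]) (use False in \<open>simp add: k_def norm_sgn\<close>)
    also have "\<dots> = norm h * (\<epsilon> * norm h)" by (simp add: power2_eq_square)
    finally show ?thesis using False by simp
  qed
  have "\<Phi> h \<le> \<epsilon> * (norm h)\<^sup>2" if h: "norm h \<le> \<delta>" for h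
  proof -
    have "0 \<le> \<Phi> h" unfolding \<Phi>_def by (simp add: F_nonneg)
    then have "\<Phi> h \<le> q * \<Phi> h" using q mult_right_mono[of 1 q "\<Phi> h"] by simp
    also have "\<dots> \<le> N (J h) (J h)" using \<Phi>_le[of h] by (simp add: g_inner)
    also have "\<dots> \<le> \<epsilon> * (norm h)\<^sup>2" by (rule N_small[OF h]) simp
    finally show ?thesis .
  qed
  with g_small \<delta> show ?thesis by blast
qed

lemma \<Phi>_lower: "a3 * (\<integral>x. \<bar>J h x\<bar> powr q \<partial>lebesgue) \<le> \<Phi> h + a4 * measure lebesgue \<Omega>"
proof -
  have i: "integrable lebesgue (\<lambda>x. a4 * indicator \<Omega> x :: real)" using emeasure_\<Omega> by auto
  have "(\<integral>x. a3 * \<bar>J h x\<bar> powr q \<partial>lebesgue) \<le> (\<integral>x. prim f x (J h x) + a4 * indicator \<Omega> x \<partial>lebesgue)"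
  proof (rule integral_mono_AE)
    show "AE x in lebesgue. a3 * \<bar>J h x\<bar> powr q \<le> prim f x (J h x) + a4 * indicator \<Omega> x"
      using H_D(2)[OF JH, of h] \<Omega>'_full(2)
    proof eventually_elim
      case (elim x)
      then show ?case using F_lower[of x "J h x"] F_nonneg[of x "J h x"] by (cases "x \<in> \<Omega>") auto
    qed
  qed (use J_Lq(1)[of h] integrable_F[OF JH, of h] i in auto)
  also have "\<dots> = \<Phi> h + a4 * measure lebesgue \<Omega>" using i integrable_F[OF JH, of h] by (simp add: \<Phi>_def)
  finally show ?thesis by simp
qed

text \<open>\<open>N_bound\<close> is used with the factor \<open>\<eta> * a3\<close>, so that
  \<open>\<Phi>_lower\<close> trades its \<open>L^q\<close> term for
  \<open>\<eta> * \<Phi> u\<close> plus a constant.\<close>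

lemma growth:
  assumes \<eta>: "0 < \<eta>" shows "\<exists>C. \<forall>u v. norm v \<le> 1 \<longrightarrow> \<bar>g u \<bullet> v\<bar> \<le> \<eta> * \<Phi> u + C"
proof -
  obtain C where C: "\<And>u \<phi>. \<lbrakk>u \<in> H; \<phi> \<in> H; E \<phi> \<phi> \<le> 1\<rbrakk> \<Longrightarrow> \<bar>N u \<phi>\<bar> \<le> \<eta> * a3 * (\<integral>x. \<bar>u x\<bar> powr q \<partial>lebesgue) + C"
    using N_bound[of "\<eta> * a3"] \<eta> a by auto
  have "\<bar>g u \<bullet> v\<bar> \<le> \<eta> * \<Phi> u + (\<eta> * (a4 * measure lebesgue \<Omega>) + C)" if "norm v \<le> 1" for u v
    using C[OF JH JH J_unit[OF that], of u] mult_left_mono[OF \<Phi>_lower[of u], of \<eta>] \<eta> by (simp add: g_inner algebra_simps)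
  then show ?thesis by blast
qed

lemma superquadratic_growth:
  assumes \<eta>: "0 < \<eta>" shows "\<exists>C. \<forall>u. diag \<mu> u \<bullet> u \<le> \<eta> * \<Phi> u + C"
proof -
  define c where "c = ((\<eta> * a3) powr (- (1 / (q - 2))))\<^sup>2"
  have "diag \<mu> u \<bullet> u \<le> \<eta> * \<Phi> u + (\<eta> * (a4 * measure lebesgue \<Omega>) + c * measure lebesgue \<Omega>)" for u
  proof -
    have i: "integrable lebesgue (\<lambda>x. c * indicator \<Omega> x :: real)" using emeasure_\<Omega> by auto
    have "diag \<mu> u \<bullet> u = (\<integral>x. (J u x)\<^sup>2 \<partial>lebesgue)" by (simp add: BJ[symmetric] B_def power2_eq_square)
    also have "\<dots> \<le> (\<integral>x. \<eta> * a3 * \<bar>J u x\<bar> powr q + c * indicator \<Omega> x \<partial>lebesgue)"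
    proof (rule integral_mono_AE)
      show "AE x in lebesgue. (J u x)\<^sup>2 \<le> \<eta> * a3 * \<bar>J u x\<bar> powr q + c * indicator \<Omega> x"
        using H_D(2)[OF JH, of u]
      proof eventually_elim
        case (elim x)
        then show ?case using square_le_powr[of "\<eta> * a3" q "J u x"] \<eta> a q by (cases "x \<in> \<Omega>") (auto simp: c_def)
      qed
    qed (use J_Lq(1)[of u] H_D(3)[OF JH, of u] i in auto)
    also have "\<dots> = \<eta> * (a3 * (\<integral>x. \<bar>J u x\<bar> powr q \<partial>lebesgue)) + c * measure lebesgue \<Omega>" using J_Lq(1)[of u] i by simp
    finally show ?thesis using mult_left_mono[OF \<Phi>_lower[of u], of \<eta>] \<eta> by (simp add: algebra_simps)
  qed
  then show ?thesis by blast
qed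

sublocale superquadratic \<mu> \<Phi> g q
proof
  show "\<exists>r. strict_mono r \<and> (\<lambda>n. g (x (r n))) \<longlonglongrightarrow> g l" if "weakly x l" for x l using g_compact that .
qed (fact \<mu> \<Phi>_derivative \<Phi>_zero small q \<Phi>_le \<Phi>_pos growth superquadratic_growth)+

end

section \<open>Weak solutions as critical points\<close>

context frac_coords
begin

text \<open>\<open>\<phi>\<close> and \<open>J k\<close> differ by a vector of zero energy, which is
  \<open>E\<close>-orthogonal to all of \<open>H\<close> by Cauchy-Schwarz.\<close>

lemma J_represents:
  assumes "\<phi> \<in> H" obtains k where "AE x in lebesgue. \<phi> x = J k x" "\<And>h. E (J h) \<phi> = h \<bullet> k"
proof -
  obtain k where k: "E (\<phi> - J k) (\<phi> - J k) = 0" using J_surj[OF assms] by blast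
  have d: "\<phi> - J k \<in> H" using assms JH by simp
  have "AE x in lebesgue. (\<phi> - J k) x = 0" using E_zero_iff[OF d] k by blast
  then have ae: "AE x in lebesgue. \<phi> x = J k x" by eventually_elim simp
  have E: "E (J h) \<phi> = h \<bullet> k" for h
  proof -
    have "(E (J h) (\<phi> - J k))\<^sup>2 \<le> 0" using E.cauchy_schwarz[OF JH d, of h] k by simp
    then have "E (J h) (\<phi> - J k) = 0" by simp
    then show ?thesis using E.F_lin assms JH by (simp add: EJ)
  qed
  show ?thesis by (rule that[OF ae E])
qed

lemma J_distinct: "h \<noteq> k \<Longrightarrow> \<not> (AE x in lebesgue. J h x = J k x)"
proof
  assume "h \<noteq> k" and ae: "AE x in lebesgue. J h x = J k x"
  have "AE x in lebesgue. (J h - J k) x = 0" using ae by eventually_elim simp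
  moreover have "J h - J k \<in> H" using JH by simp
  ultimately have "E (J h - J k) (J h - J k) = 0" using E_zero_iff by blast
  then have "(h - k) \<bullet> (h - k) = 0" using E.F_lin JH by (simp add: EJ inner_diff_left inner_diff_right)
  with \<open>h \<noteq> k\<close> show False by simp
qed

lemma J_nonzero: "h \<noteq> 0 \<Longrightarrow> \<not> (AE x in lebesgue. J h x = 0)"
  using E_zero_iff[OF JH, of h] by (simp add: EJ)

lemma J_Hs: "J h \<in> Hs s"
  using JH[of h] H_D[OF JH, of h] by (simp add: Hs_def H_def X0_def)

text \<open>Tested with \<open>J (unit i)\<close>, for a nonzero coordinate \<open>i\<close> of the
  eigenfunction, the equation reads \<open>coord h i = lam * (\<mu> i * coord h i)\<close>.\<close>

lemma eigenvalue_iff: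
  assumes "frac_dirichlet_eigenvalue \<Omega> s lam" obtains i where "lam = 1 / \<mu> i"
proof -
  obtain u where u: "u \<in> H" "\<not> (AE x in lebesgue. u x = 0)"
    and eig: "\<And>\<phi>. \<phi> \<in> H \<Longrightarrow> E u \<phi> = lam * (\<integral>x\<in>\<Omega>. u x * \<phi> x \<partial>lebesgue)"
    using assms by (auto simp: frac_dirichlet_eigenvalue_def H_def E_def)
  note [measurable] = H_D(1)[OF u(1)]
  obtain h where h: "AE x in lebesgue. u x = J h x" "\<And>k. E (J k) u = k \<bullet> h" by (rule J_represents[OF u(1)]) blast
  have "h \<noteq> 0"
  proof
    assume "h = 0"
    then have "AE x in lebesgue. J h x = 0" using E_zero_iff[OF JH, of h] by (simp add: EJ)
    with h(1) have "AE x in lebesgue. u x = 0" by eventually_elim simp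
    with u(2) show False by blast
  qed
  then obtain i where i: "coord h i \<noteq> 0" using ell2_eqI[of h 0] by auto
  have "(\<integral>x\<in>\<Omega>. u x * J (unit i) x \<partial>lebesgue) = (\<integral>x. J h x * J (unit i) x \<partial>lebesgue)"
    unfolding set_integral_mult[OF u(1) Jm] by (rule integral_cong_AE) (use h(1) in auto)
  also have "\<dots> = B (J h) (J (unit i))" by (simp add: B_def)
  also have "\<dots> = \<mu> i * coord h i" using convergent_imp_bounded[OF \<mu>(2)] by (simp add: BJ inner_unit coord_diag)
  finally have "E u (J (unit i)) = lam * (\<mu> i * coord h i)" using eig[OF JH] by simp
  moreover have "E u (J (unit i)) = coord h i" using h(2)[of "unit i"] by (simp add: E.F_sym[of u] inner_commute[of _ h] inner_unit)
  ultimately have "lam * \<mu> i = 1" using i by (simp add: field_simps)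
  then show ?thesis using \<mu>(1)[of i] by (intro that[of i]) (simp add: field_simps)
qed

text \<open>Each test function is some \<open>J k\<close> up to a null set, and the three integrals
  become \<open>w \<bullet> k\<close>, \<open>diag \<mu> w \<bullet> k\<close> and
  \<open>g w \<bullet> k\<close>. The weak equation is then
  \<open>G lam w \<bullet> k = 0\<close>.\<close>

lemma critical_weak_solution:
  assumes "G lam w = 0" shows "weak_solution \<Omega> s lam f (J w)"
  unfolding weak_solution_def
proof (intro conjI ballI)
  show "J w \<in> X0 \<Omega> s" using JH by (simp add: H_def)
  fix \<phi> assume "\<phi> \<in> X0 \<Omega> s"
  then have \<phi>: "\<phi> \<in> H" by (simp add: H_def)
  note [measurable] = H_D(1)[OF \<phi>]
  obtain k where k: "AE x in lebesgue. \<phi> x = J k x" "\<And>h. E (J h) \<phi> = h \<bullet> k" by (rule J_represents[OF \<phi>]) blast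
  have 1: "X0_inner s (J w) \<phi> = w \<bullet> k" using k(2) by (simp add: E_def)
  have "(\<integral>x\<in>\<Omega>. J w x * \<phi> x \<partial>lebesgue) = (\<integral>x. J w x * J k x \<partial>lebesgue)"
    unfolding set_integral_mult[OF JH H_D(1)[OF \<phi>]] by (rule integral_cong_AE) (use k(1) in auto)
  then have 2: "(\<integral>x\<in>\<Omega>. J w x * \<phi> x \<partial>lebesgue) = diag \<mu> w \<bullet> k" by (simp add: BJ[symmetric] B_def)
  have "(\<integral>x\<in>\<Omega>. f x (J w x) * \<phi> x \<partial>lebesgue) = (\<integral>x. f x (J w x) * J k x \<partial>lebesgue)"
    unfolding set_lebesgue_integral_def
  proof (rule integral_cong_AE)
    show "AE x in lebesgue. indicator \<Omega> x *\<^sub>R (f x (J w x) * \<phi> x) = f x (J w x) * J k x"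
      using k(1)
    proof eventually_elim
      case (elim x)
      then show ?case using f_out[of x] \<Omega>'_full(1) by (cases "x \<in> \<Omega>") auto
    qed
  qed measurable
  then have 3: "(\<integral>x\<in>\<Omega>. f x (J w x) * \<phi> x \<partial>lebesgue) = g w \<bullet> k" by (simp add: g_inner N_def)
  have "(w - lam *\<^sub>R diag \<mu> w - g w) \<bullet> k = 0" using assms by (simp add: G_def T_def)
  then show "X0_inner s (J w) \<phi> - lam * (\<integral>x\<in>\<Omega>. J w x * \<phi> x \<partial>lebesgue) = (\<integral>x\<in>\<Omega>. f x (J w x) * \<phi> x \<partial>lebesgue)"
    unfolding 1 2 3 by (simp add: inner_diff_left)
qed

theorem three_weak_solutions:
  assumes "frac_dirichlet_eigenvalue \<Omega> s lamk"
  shows "\<exists>\<delta>>0. \<forall>lam\<in>{lamk - \<delta><..<lamk}.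
              \<exists>u1 u2 u3. weak_solution \<Omega> s lam f u1 \<and> weak_solution \<Omega> s lam f u2 \<and>
                weak_solution \<Omega> s lam f u3 \<and>
                u1 \<in> Hs s \<and> u2 \<in> Hs s \<and> u3 \<in> Hs s \<and>
                \<not> (AE x in lebesgue. u1 x = 0) \<and> \<not> (AE x in lebesgue. u2 x = 0) \<and>
                \<not> (AE x in lebesgue. u3 x = 0) \<and>
                \<not> (AE x in lebesgue. u1 x = u2 x) \<and> \<not> (AE x in lebesgue. u1 x = u3 x) \<and>
                \<not> (AE x in lebesgue. u2 x = u3 x)"
proof -
  obtain i where i: "lamk = 1 / \<mu> i" by (rule eigenvalue_iff[OF assms])
  obtain \<delta> where \<delta>: "\<delta> > 0" "\<forall>\<nu>. lamk - \<delta> < \<nu> \<and> \<nu> < lamk \<longrightarrow>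
     (\<exists>w1 w2 w3. G \<nu> w1 = 0 \<and> G \<nu> w2 = 0 \<and> G \<nu> w3 = 0 \<and> w1 \<noteq> 0 \<and> w2 \<noteq> 0 \<and> w3 \<noteq> 0
        \<and> w1 \<noteq> w2 \<and> w1 \<noteq> w3 \<and> w2 \<noteq> w3)"
    using three_critical_points[of i, unfolded \<nu>k_def, folded i] by (elim exE conjE) (rule that)
  show ?thesis
  proof (intro exI[of _ \<delta>] conjI ballI)
    fix lam assume "lam \<in> {lamk - \<delta><..<lamk}"
    then have "lamk - \<delta> < lam \<and> lam < lamk" by simp
    with \<delta>(2) obtain w1 w2 w3 where "G lam w1 = 0" "G lam w2 = 0" "G lam w3 = 0" "w1 \<noteq> 0" "w2 \<noteq> 0" "w3 \<noteq> 0"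
      "w1 \<noteq> w2" "w1 \<noteq> w3" "w2 \<noteq> w3" by blast
    then show "\<exists>u1 u2 u3. weak_solution \<Omega> s lam f u1 \<and> weak_solution \<Omega> s lam f u2 \<and>
                weak_solution \<Omega> s lam f u3 \<and>
                u1 \<in> Hs s \<and> u2 \<in> Hs s \<and> u3 \<in> Hs s \<and>
                \<not> (AE x in lebesgue. u1 x = 0) \<and> \<not> (AE x in lebesgue. u2 x = 0) \<and>
                \<not> (AE x in lebesgue. u3 x = 0) \<and>
                \<not> (AE x in lebesgue. u1 x = u2 x) \<and> \<not> (AE x in lebesgue. u1 x = u3 x) \<and>
                \<not> (AE x in lebesgue. u2 x = u3 x)"
      by (intro exI[of _ "J w1"] exI[of _ "J w2"] exI[of _ "J w3"] conjI critical_weak_solution J_Hs J_nonzero J_distinct)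
  qed (fact \<delta>)
qed

end

text \<open>(F4) restricts only \<open>t \<noteq> 0\<close>; the value at 0 has to come from
  continuity.\<close>

lemma vanishes_at_zero:
  fixes h :: "real \<Rightarrow> real"
  assumes "continuous_on UNIV h" "0 < \<delta>" "\<And>t. \<lbrakk>t \<noteq> 0; \<bar>t\<bar> < \<delta>\<rbrakk> \<Longrightarrow> \<bar>h t\<bar> \<le> \<bar>t\<bar>"
  shows "h 0 = 0"
proof -
  have "(h \<longlongrightarrow> h 0) (at 0)" using assms(1) by (simp add: continuous_on_eq_continuous_at isCont_def)
  moreover have "(h \<longlongrightarrow> 0) (at 0)"
  proof (rule Lim_null_comparison)
    show "\<forall>\<^sub>F t in at 0. norm (h t) \<le> \<bar>t\<bar>" unfolding eventually_at by (intro exI[of _ \<delta>]) (use assms in auto)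
    show "((\<lambda>t. \<bar>t\<bar>) \<longlongrightarrow> (0::real)) (at 0)" by (rule tendsto_rabs_zero) (rule tendsto_ident_at)
  qed
  ultimately show ?thesis using tendsto_unique[OF trivial_limit_at] by blast
qed

text \<open>The proof passes to a modification \<open>h\<close> of \<open>f\<close> that satisfies
  the almost-everywhere conditions pointwise and has the same weak solutions.\<close>

theorem theorem1p2:
  fixes \<Omega> :: "'a::euclidean_space set" and s q a1 a2 a3 a4 :: real
    and f :: "'a \<Rightarrow> real \<Rightarrow> real"
  assumes s: "0 < s" "s < 1"
    and dim: "real DIM('a) > 2 * s"
    and dom: "continuous_boundary_domain \<Omega>"
    and F1_meas: "\<And>t. (\<lambda>x. f x t) \<in> borel_measurable (restrict_space lebesgue \<Omega>)"
    and F1_cont: "AE x in lebesgue. x \<in> \<Omega> \<longrightarrow> continuous_on UNIV (f x)"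
    and q: "2 < q" "q < crit_exp DIM('a) s"
    and F2: "a1 > 0" "a2 > 0"
        "AE x in lebesgue. x \<in> \<Omega> \<longrightarrow> (\<forall>t. \<bar>f x t\<bar> \<le> a1 + a2 * \<bar>t\<bar> powr (q - 1))"
    and F3: "a3 > 0" "a4 > 0"
        "AE x in lebesgue. x \<in> \<Omega> \<longrightarrow> (\<forall>t. prim f x t \<ge> a3 * \<bar>t\<bar> powr q - a4)"
    and F4: "\<forall>\<epsilon>>0. \<exists>\<delta>>0. \<forall>x\<in>\<Omega>. \<forall>t. t \<noteq> 0 \<and> \<bar>t\<bar> < \<delta> \<longrightarrow> \<bar>f x t / \<bar>t\<bar>\<bar> < \<epsilon>"
    and F5: "AE x in lebesgue. x \<in> \<Omega> \<longrightarrow>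
               (\<forall>t. t \<noteq> 0 \<longrightarrow> 0 < q * prim f x t \<and> q * prim f x t \<le> t * f x t)"
  shows "\<forall>lamk. frac_dirichlet_eigenvalue \<Omega> s lamk \<longrightarrow>
           (\<exists>\<delta>>0. \<forall>lam\<in>{lamk - \<delta><..<lamk}.
              \<exists>u1 u2 u3. weak_solution \<Omega> s lam f u1 \<and> weak_solution \<Omega> s lam f u2 \<and>
                weak_solution \<Omega> s lam f u3 \<and>
                u1 \<in> Hs s \<and> u2 \<in> Hs s \<and> u3 \<in> Hs s \<and>
                \<not> (AE x in lebesgue. u1 x = 0) \<and> \<not> (AE x in lebesgue. u2 x = 0) \<and>
                \<not> (AE x in lebesgue. u3 x = 0) \<and>
                \<not> (AE x in lebesgue. u1 x = u2 x) \<and> \<not> (AE x in lebesgue. u1 x = u3 x) \<and>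
                \<not> (AE x in lebesgue. u2 x = u3 x))"
proof (intro allI impI)
  fix lamk assume lamk: "frac_dirichlet_eigenvalue \<Omega> s lamk"
  have \<Omega>: "open \<Omega>" "bounded \<Omega>" using dom by (auto simp: continuous_boundary_domain_def)
  interpret frac_domain \<Omega> s by unfold_locales (fact s \<Omega>)+
  define \<Omega>' where "\<Omega>' = {x \<in> \<Omega>. continuous_on UNIV (f x) \<and> (\<forall>t. \<bar>f x t\<bar> \<le> a1 + a2 * \<bar>t\<bar> powr (q - 1))
     \<and> (\<forall>t. prim f x t \<ge> a3 * \<bar>t\<bar> powr q - a4)
     \<and> (\<forall>t. t \<noteq> 0 \<longrightarrow> 0 < q * prim f x t \<and> q * prim f x t \<le> t * f x t)}"
  have full: "AE x in lebesgue. x \<in> \<Omega> \<longrightarrow> x \<in> \<Omega>'"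
    using F1_cont F2(3) F3(3) F5 by eventually_elim (simp add: \<Omega>'_def)
  have "\<Omega> - \<Omega>' = {x \<in> space lebesgue. \<not> (x \<in> \<Omega> \<longrightarrow> x \<in> \<Omega>')}" by auto
  \<comment> \<open>Completeness of \<open>lebesgue\<close> makes the exceptional set
    measurable.\<close>
  then have "\<Omega> - \<Omega>' \<in> null_sets lebesgue" using full completion.AE_iff_null_sets by metis
  then have "\<Omega> - (\<Omega> - \<Omega>') \<in> sets lebesgue" by (intro sets.Diff sets_\<Omega> null_setsD2)
  moreover have "\<Omega> - (\<Omega> - \<Omega>') = \<Omega>'" by (auto simp: \<Omega>'_def)
  ultimately have [measurable]: "\<Omega>' \<in> sets lebesgue" by simp
  define h where "h x t = (if x \<in> \<Omega>' then f x t else 0)" for x t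
  have prim_h: "prim h x t = prim f x t" if "x \<in> \<Omega>'" for x t using that by (simp add: prim_def h_def)
  have h_small: "\<exists>\<delta>>0. \<forall>x t. \<bar>t\<bar> < \<delta> \<longrightarrow> \<bar>h x t\<bar> \<le> \<epsilon> * \<bar>t\<bar>" if \<epsilon>: "0 < \<epsilon>" for \<epsilon>
  proof -
    have div: "\<bar>f x t\<bar> \<le> e * \<bar>t\<bar>" if "t \<noteq> 0" "\<bar>f x t / \<bar>t\<bar>\<bar> < e" for x t e
      using that by (simp add: abs_divide divide_less_eq less_imp_le)
    have h0: "h x 0 = 0" for x
    proof (cases "x \<in> \<Omega>'")
      case True
      obtain \<delta> where \<delta>: "0 < \<delta>" "\<forall>x\<in>\<Omega>. \<forall>t. t \<noteq> 0 \<and> \<bar>t\<bar> < \<delta> \<longrightarrow> \<bar>f x t / \<bar>t\<bar>\<bar> < 1" using F4 zero_less_one by blast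
      have "f x 0 = 0"
      proof (rule vanishes_at_zero[OF _ \<delta>(1)])
        show "\<bar>f x t\<bar> \<le> \<bar>t\<bar>" if "t \<noteq> 0" "\<bar>t\<bar> < \<delta>" for t
        proof -
          have "\<bar>f x t / \<bar>t\<bar>\<bar> < 1" using \<delta>(2) that True \<Omega>'_def by blast
          then show ?thesis using div[OF that(1)] by fastforce
        qed
      qed (use True in \<open>simp add: \<Omega>'_def\<close>)
      then show ?thesis by (simp add: h_def)
    qed (simp add: h_def)
    obtain \<delta> where \<delta>: "0 < \<delta>" "\<forall>x\<in>\<Omega>. \<forall>t. t \<noteq> 0 \<and> \<bar>t\<bar> < \<delta> \<longrightarrow> \<bar>f x t / \<bar>t\<bar>\<bar> < \<epsilon>" using F4 \<epsilon> by blast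
    have "\<bar>h x t\<bar> \<le> \<epsilon> * \<bar>t\<bar>" if "\<bar>t\<bar> < \<delta>" for x t
      using h0[of x] div[of t x \<epsilon>] \<delta>(2) that \<epsilon> by (cases "t = 0"; cases "x \<in> \<Omega>'") (auto simp: h_def \<Omega>'_def)
    with \<delta>(1) show ?thesis by blast
  qed
  interpret frac_problem \<Omega> s h q a1 a2 a3 a4 \<Omega>'
  proof
    show "2 * s < real DIM('a)" "2 < q" "q < crit_exp DIM('a) s" "0 < a1" "0 < a2" "0 < a3" "0 < a4" by fact+
    show "\<Omega>' \<subseteq> \<Omega>" by (auto simp: \<Omega>'_def)
    show "(\<lambda>x. h x t) \<in> borel_measurable lebesgue" for t
    proof -
      have [measurable]: "(\<lambda>x. indicator \<Omega> x *\<^sub>R f x t) \<in> borel_measurable lebesgue"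
        using F1_meas[of t] by (subst (asm) borel_measurable_restrict_space_iff) auto
      have "(\<lambda>x. h x t) = (\<lambda>x. indicator \<Omega>' x * (indicator \<Omega> x *\<^sub>R f x t))"
        by (auto simp: h_def \<Omega>'_def indicator_def)
      also have "\<dots> \<in> borel_measurable lebesgue" by measurable
      finally show ?thesis .
    qed
    show "continuous_on UNIV (h x)" for x
    proof (cases "x \<in> \<Omega>'")
      case True
      then have "h x = f x" by (auto simp: h_def)
      then show ?thesis using True by (simp add: \<Omega>'_def)
    next
      case False
      then have "h x = (\<lambda>_. 0)" by (auto simp: h_def)
      then show ?thesis by simp
    qed
    show "\<bar>h x t\<bar> \<le> a1 + a2 * \<bar>t\<bar> powr (q - 1)" for x t
      using F2 by (cases "x \<in> \<Omega>'") (auto simp: h_def \<Omega>'_def)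
    show "a3 * \<bar>t\<bar> powr q - a4 \<le> prim h x t" if "x \<in> \<Omega>'" for x t
      using that prim_h[OF that] by (simp add: \<Omega>'_def)
    show "0 < prim h x t \<and> q * prim h x t \<le> t * h x t" if "x \<in> \<Omega>'" "t \<noteq> 0" for x t
      using that prim_h[OF that(1)] q(1) by (simp add: \<Omega>'_def h_def zero_less_mult_iff)
  qed (use full h_small in \<open>auto simp: h_def\<close>)
  \<comment> \<open>Over the empty set every function in \<open>X0\<close> is null, so there would
    be no eigenvalue.\<close>
  have "\<Omega> \<noteq> {}"
  proof
    assume "\<Omega> = {}"
    then show False using lamk by (auto simp: frac_dirichlet_eigenvalue_def X0_def)
  qed
  then interpret compact_embedding H E B by (rule compact_embedding_H)
  obtain \<mu> J where \<mu>J: "\<And>i. 0 < \<mu> i" "\<mu> \<longlonglongrightarrow> 0" "\<And>h. J h \<in> H" "\<And>h k. E (J h) (J k) = h \<bullet> k"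
    "\<And>h k. B (J h) (J k) = diag \<mu> h \<bullet> k" "\<And>u. u \<in> H \<Longrightarrow> \<exists>h. E (u - J h) (u - J h) = 0"
    using ell2_coordinates by blast
  interpret frac_coords \<Omega> s h q a1 a2 a3 a4 \<Omega>' \<mu> J by unfold_locales (fact \<mu>J)+
  have weak: "weak_solution \<Omega> s lam h u \<longleftrightarrow> weak_solution \<Omega> s lam f u" for lam u
  proof -
    have "(\<integral>x\<in>\<Omega>. h x (u x) * \<phi> x \<partial>lebesgue) = (\<integral>x\<in>\<Omega>. f x (u x) * \<phi> x \<partial>lebesgue)"
      if "u \<in> X0 \<Omega> s" "\<phi> \<in> X0 \<Omega> s" for \<phi>
    proof -
      have [measurable]: "u \<in> borel_measurable lebesgue" "\<phi> \<in> borel_measurable lebesgue" using that by (auto simp: X0_def)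
      have m: "(\<lambda>x. indicator \<Omega> x *\<^sub>R (h x (u x) * \<phi> x)) \<in> borel_measurable lebesgue" by measurable
      have ae: "AE x in lebesgue. indicator \<Omega> x *\<^sub>R (h x (u x) * \<phi> x) = indicator \<Omega> x *\<^sub>R (f x (u x) * \<phi> x)"
        using full by eventually_elim (auto simp: h_def indicator_def)
      \<comment> \<open>Measurability of the integrand with \<open>f\<close> is inherited from the
        one with \<open>h\<close>, again by completeness.\<close>
      show ?thesis unfolding set_lebesgue_integral_def
        by (rule integral_cong_AE[OF m borel_measurable_AE[OF m ae] ae])
    qed
    then show ?thesis by (auto simp: weak_solution_def)
  qed
  show "\<exists>\<delta>>0. \<forall>lam\<in>{lamk - \<delta><..<lamk}.
              \<exists>u1 u2 u3. weak_solution \<Omega> s lam f u1 \<and> weak_solution \<Omega> s lam f u2 \<and>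
                weak_solution \<Omega> s lam f u3 \<and>
                u1 \<in> Hs s \<and> u2 \<in> Hs s \<and> u3 \<in> Hs s \<and>
                \<not> (AE x in lebesgue. u1 x = 0) \<and> \<not> (AE x in lebesgue. u2 x = 0) \<and>
                \<not> (AE x in lebesgue. u3 x = 0) \<and>
                \<not> (AE x in lebesgue. u1 x = u2 x) \<and> \<not> (AE x in lebesgue. u1 x = u3 x) \<and>
                \<not> (AE x in lebesgue. u2 x = u3 x)"
    using three_weak_solutions[OF lamk] unfolding weak .
qed

end
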